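(* Let $(K,\mathsf R)$ be a triangular Hopf algebra, $\mathsf F$ a twist for $K$, $H$ a Hopf algebra and $B=A^{coH}\subseteq A$ a $K$-equivariant $H$-Hopf--Galois extension. The twist $\mathcal U(\mathrm{aut}^{\mathsf R}_B(A))_{\mathsf F}$ of the $(K,\mathsf R)$-braided Hopf algebra $\mathcal U(\mathrm{aut}^{\mathsf R}_B(A))$ of the Hopf--Galois extension $B=A^{coH}\subseteq A$ is isomorphic to the $(K_{\mathsf F},\mathsf R_{\mathsf F})$-braided Hopf algebra $\mathcal U(\mathrm{aut}^{\mathsf R_{\mathsf F}}_{B_{\mathsf F}}(A_{\mathsf F}))$ of the Hopf--Galois extension $B_{\mathsf F}=A_{\mathsf F}^{coH}\subseteq A_{\mathsf F}$.
   Context: $\Bbbk$ is a field, or the ring of formal power series in a variable over a field; $\otimes$ is over $\Bbbk$; sums understood. Triangular Hopf algebra $(K,\mathsf R)$: $\mathsf R=\mathsf R^\alpha\otimes\mathsf R_\alpha\in K\otimes K$ invertible, $\Delta^{cop}(k)=\mathsf R\Delta(k)\mathsf R^{-1}$, $(\Delta\otimes\mathrm{id})\mathsf R=\mathsf R_{13}\mathsf R_{23}$, $(\mathrm{id}\otimes\Delta)\mathsf R=\mathsf R_{13}\mathsf R_{12}$, $\mathsf R^{-1}=\mathsf R_{21}$. Twist: an invertible $\mathsf F=\mathsf F^\alpha\otimes\mathsf F_\alpha\in K\otimes K$, inverse $\bar{\mathsf F}=\bar{\mathsf F}^\alpha\otimes\bar{\mathsf F}_\alpha$, with $(\varepsilon\otimes\mathrm{id})\mathsf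 F=1=(\mathrm{id}\otimes\varepsilon)\mathsf F$ and $(\mathsf F\otimes1)(\Delta\otimes\mathrm{id})\mathsf F=(1\otimes\mathsf F)(\mathrm{id}\otimes\Delta)\mathsf F$. $K_{\mathsf F}$ is the algebra $K$ with same counit, coproduct $\Delta_{\mathsf F}(k)=\mathsf F\Delta(k)\bar{\mathsf F}$, antipode $S_{\mathsf F}(k)=\mathsf uS(k)\mathsf u^{-1}$, $\mathsf u=\mathsf F^\alpha S(\mathsf F_\alpha)$; it is triangular with $\mathsf R_{\mathsf F}=\mathsf F_{21}\mathsf R\bar{\mathsf F}$. A $K$-equivariant $H$-Hopf--Galois extension $B=A^{coH}\subseteq A$: $A$ is a right $H$-comodule algebra, coaction $\delta(a)=a_{(0)}\otimes a_{(1)}$, $B$ its coinvariants, $A\otimes_BA\to A\otimes H$, $a'\otimes_Ba\mapsto a'a_{(0)}\otimes a_{(1)}$ bijective; $A$ is a $K$-module algebra with $\delta(k\triangleright a)=(k\triangleright a_{(0)})\otimes a_{(1)}$, and $B$ is a $K$-submodule. $A_{\mathsf F}$ (and likewise $B_{\mathsf F}$) is the vector space $A$ with same coaction and action and product $a\bullet_{\mathsf F}a'=(\bar{\mathsf F}^\alpha\triangleright a)(\bar{\mathsf F}_\alpha\triangleright a')$; $B_{\mathsf F}\subseteq A_{\mathsf F}$ is a $K_{\mathsf F}$-equivariant $H$-Hopf--Galois extension. A $K$-braided Lie algebra is a $K$-module $\mathfrak g$ with a $K$-equivariant bracket satisfying $[u,v]=-[\mathsf R_\alpha\triangleright v,\mathsf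 R^\alpha\triangleright u]$ and $[u,[v,w]]=[[u,v],w]+[\mathsf R_\alpha\triangleright v,[\mathsf R^\alpha\triangleright u,w]]$. With $\mathrm{Hom}(A,A)$ a $K$-module by $(k\triangleright\psi)(a)=k_{(1)}\triangleright\psi(S(k_{(2)})\triangleright a)$, the $K$-braided Lie algebra $\mathrm{aut}^{\mathsf R}_B(A)$ consists of the $u\in\mathrm{Hom}(A,A)$ with $\delta(u(a))=u(a_{(0)})\otimes a_{(1)}$, $u(aa')=u(a)a'+(\mathsf R_\alpha\triangleright a)(\mathsf R^\alpha\triangleright u)(a')$, $u(b)=0$ for $a,a'\in A$, $b\in B$, with bracket $[u,u']=u\circ u'-(\mathsf R_\alpha\triangleright u')\circ(\mathsf R^\alpha\triangleright u)$. $\mathrm{aut}^{\mathsf R_{\mathsf F}}_{B_{\mathsf F}}(A_{\mathsf F})$ is defined in the same way from $(K_{\mathsf F},\mathsf R_{\mathsf F})$, $A_{\mathsf F}$, $B_{\mathsf F}$. A $(K,\mathsf R)$-braided Hopf algebra $L$ is a $K$-module algebra and $K$-module coalgebra such that $\varepsilon_L:L\to\Bbbk$ and $\Delta_L:L\to L\boxtimes L$ are algebra maps, where $L\boxtimes L$ is $L\otimes L$ with product $(a\boxtimes c)(a'\boxtimes c')=a(\mathsf R_\alpha\triangleright a')\boxtimes(\mathsf R^\alpha\triangleright c)c'$, and with a $K$-equivariant convolution inverse $S_L$ of $\mathrm{id}_L$. The universal enveloping algebra $\mathcal U(\mathfrak g)$ of a $K$-braided Lie algebra is the quotient of the tensor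 algebra $T(\mathfrak g)$ by the ideal generated by $u\otimes v-\mathsf R_\alpha\triangleright v\otimes\mathsf R^\alpha\triangleright u-[u,v]$, $u,v\in\mathfrak g$; it is a $(K,\mathsf R)$-braided Hopf algebra with $\Delta(u)=u\boxtimes1+1\boxtimes u$, $\varepsilon(u)=0$, $S(u)=-u$ on $u\in\mathfrak g$. The twist $L_{\mathsf F}$ of a $(K,\mathsf R)$-braided Hopf algebra $L$ is the $(K_{\mathsf F},\mathsf R_{\mathsf F})$-braided Hopf algebra with the same vector space, action, unit, counit and antipode, product $\xi\bullet_{\mathsf F}\xi'=(\bar{\mathsf F}^\alpha\triangleright\xi)(\bar{\mathsf F}_\alpha\triangleright\xi')$ and coproduct $\Delta_{L_{\mathsf F}}(\xi)=(\mathsf F^\alpha\triangleright\xi_{(1)})\otimes(\mathsf F_\alpha\triangleright\xi_{(2)})$. Isomorphisms of braided Hopf algebras are module isomorphisms that are algebra and coalgebra maps. *)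

theory Defs
  imports "HOL-Algebra.Module" "HOL-Algebra.QuotRing"
begin

section \<open>Ground rings\<close>

definition power_series_ring :: "'f ring \<Rightarrow> (nat \<Rightarrow> 'f) ring" where
  "power_series_ring F =
    \<lparr>carrier = UNIV \<rightarrow> carrier F,
     mult = (\<lambda>p q n. \<Oplus>\<^bsub>F\<^esub>i\<in>{..n}. p i \<otimes>\<^bsub>F\<^esub> q (n - i)),
     one = (\<lambda>n. if n = 0 then \<one>\<^bsub>F\<^esub> else \<zero>\<^bsub>F\<^esub>),
     zero = (\<lambda>n. \<zero>\<^bsub>F\<^esub>),
     add = (\<lambda>p q n. p n \<oplus>\<^bsub>F\<^esub> q n)\<rparr>"

text \<open>Taking the coefficient field on the type of the ground ring loses no generality: a power
  series ring contains a copy of its coefficient field.\<close>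

definition ground_ring :: "'k ring \<Rightarrow> bool" where
  "ground_ring k \<longleftrightarrow> field k \<or> (cring k \<and> (\<exists>F :: 'k ring. field F \<and> k \<simeq> power_series_ring F))"


section \<open>Modules and algebras over the ground ring\<close>

text \<open>As in HOL-Algebra, a module is a record that also has fields \<open>mult\<close> and \<open>one\<close>; they carry no
  meaning unless the module is an algebra.\<close>

definition self_module :: "'k ring \<Rightarrow> ('k, 'k) module" where
  "self_module k =
    \<lparr>carrier = carrier k, mult = mult k, one = \<one>\<^bsub>k\<^esub>, zero = \<zero>\<^bsub>k\<^esub>, add = add k, smult = mult k\<rparr>"

definition linear_map ::
    "'k ring \<Rightarrow> ('k, 'v, 'm) module_scheme \<Rightarrow> ('k, 'w, 'n) module_scheme \<Rightarrow> ('v \<Rightarrow> 'w) \<Rightarrow> bool" where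
  "linear_map k V W f \<longleftrightarrow>
     f \<in> carrier V \<rightarrow> carrier W \<and>
     (\<forall>x\<in>carrier V. \<forall>y\<in>carrier V. f (x \<oplus>\<^bsub>V\<^esub> y) = f x \<oplus>\<^bsub>W\<^esub> f y) \<and>
     (\<forall>c\<in>carrier k. \<forall>x\<in>carrier V. f (c \<odot>\<^bsub>V\<^esub> x) = c \<odot>\<^bsub>W\<^esub> f x)"

text \<open>The locale \<open>algebra\<close> of HOL-Algebra is restricted to commutative algebras.\<close>

definition k_algebra :: "'k ring \<Rightarrow> ('k, 'v, 'm) module_scheme \<Rightarrow> bool" where
  "k_algebra k A \<longleftrightarrow> module k A \<and> ring A \<and>
     (\<forall>c\<in>carrier k. \<forall>x\<in>carrier A. \<forall>y\<in>carrier A.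
        (c \<odot>\<^bsub>A\<^esub> x) \<otimes>\<^bsub>A\<^esub> y = c \<odot>\<^bsub>A\<^esub> (x \<otimes>\<^bsub>A\<^esub> y) \<and>
        x \<otimes>\<^bsub>A\<^esub> (c \<odot>\<^bsub>A\<^esub> y) = c \<odot>\<^bsub>A\<^esub> (x \<otimes>\<^bsub>A\<^esub> y))"

definition algebra_map ::
    "'k ring \<Rightarrow> ('k, 'v, 'm) module_scheme \<Rightarrow> ('k, 'w, 'n) module_scheme \<Rightarrow> ('v \<Rightarrow> 'w) \<Rightarrow> bool" where
  "algebra_map k A A' f \<longleftrightarrow> linear_map k A A' f \<and> f \<in> ring_hom A A'"

definition submodule_span :: "'k ring \<Rightarrow> ('k, 'v, 'm) module_scheme \<Rightarrow> 'v set \<Rightarrow> 'v set" where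
  "submodule_span k M S = \<Inter>{N. submodule N k M \<and> S \<subseteq> N}"

definition quot_module :: "('k, 'v, 'm) module_scheme \<Rightarrow> 'v set \<Rightarrow> ('k, 'v set) module" where
  "quot_module M N =
    \<lparr>carrier = a_rcosets\<^bsub>M\<^esub> N, mult = rcoset_mult M N, one = N +>\<^bsub>M\<^esub> \<one>\<^bsub>M\<^esub>, zero = N,
     add = set_add M, smult = (\<lambda>c X. \<Union>x\<in>X. N +>\<^bsub>M\<^esub> (c \<odot>\<^bsub>M\<^esub> x))\<rparr>"

definition free_module :: "'k ring \<Rightarrow> 'x set \<Rightarrow> ('k, 'x \<Rightarrow> 'k) module" where
  "free_module k X =
    \<lparr>carrier = {p. p \<in> UNIV \<rightarrow> carrier k \<and> finite {x. p x \<noteq> \<zero>\<^bsub>k\<^esub>} \<and> {x. p x \<noteq> \<zero>\<^bsub>k\<^esub>} \<subseteq> X},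
     mult = undefined, one = undefined,
     zero = (\<lambda>x. \<zero>\<^bsub>k\<^esub>), add = (\<lambda>p q x. p x \<oplus>\<^bsub>k\<^esub> q x), smult = (\<lambda>c p x. c \<otimes>\<^bsub>k\<^esub> p x)\<rparr>"

definition basis_vec :: "'k ring \<Rightarrow> 'x \<Rightarrow> 'x \<Rightarrow> 'k" where
  "basis_vec k x = (\<lambda>y. if y = x then \<one>\<^bsub>k\<^esub> else \<zero>\<^bsub>k\<^esub>)"

definition linear_ext ::
    "'k ring \<Rightarrow> ('k, 'v, 'm) module_scheme \<Rightarrow> ('x \<Rightarrow> 'v) \<Rightarrow> ('x \<Rightarrow> 'k) \<Rightarrow> 'v" where
  "linear_ext k V f p = (\<Oplus>\<^bsub>V\<^esub>x\<in>{x. p x \<noteq> \<zero>\<^bsub>k\<^esub>}. p x \<odot>\<^bsub>V\<^esub> f x)"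


section \<open>Tensor products\<close>

type_synonym ('k, 'v, 'w) tensor = "('v \<times> 'w \<Rightarrow> 'k) set"

definition bilinear_relations ::
    "'k ring \<Rightarrow> ('k, 'v, 'm) module_scheme \<Rightarrow> ('k, 'w, 'n) module_scheme \<Rightarrow> ('v \<times> 'w \<Rightarrow> 'k) set" where
  "bilinear_relations k V W = (let M = free_module k (carrier V \<times> carrier W); e = basis_vec k in
     {e (v \<oplus>\<^bsub>V\<^esub> v', w) \<ominus>\<^bsub>M\<^esub> (e (v, w) \<oplus>\<^bsub>M\<^esub> e (v', w)) | v v' w.
        v \<in> carrier V \<and> v' \<in> carrier V \<and> w \<in> carrier W} \<union>
     {e (v, w \<oplus>\<^bsub>W\<^esub> w') \<ominus>\<^bsub>M\<^esub> (e (v, w) \<oplus>\<^bsub>M\<^esub> e (v, w')) | v w w'.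
        v \<in> carrier V \<and> w \<in> carrier W \<and> w' \<in> carrier W} \<union>
     {e (c \<odot>\<^bsub>V\<^esub> v, w) \<ominus>\<^bsub>M\<^esub> c \<odot>\<^bsub>M\<^esub> e (v, w) | c v w.
        c \<in> carrier k \<and> v \<in> carrier V \<and> w \<in> carrier W} \<union>
     {e (v, c \<odot>\<^bsub>W\<^esub> w) \<ominus>\<^bsub>M\<^esub> c \<odot>\<^bsub>M\<^esub> e (v, w) | c v w.
        c \<in> carrier k \<and> v \<in> carrier V \<and> w \<in> carrier W})"

definition tensor_null ::
    "'k ring \<Rightarrow> ('k, 'v, 'm) module_scheme \<Rightarrow> ('k, 'w, 'n) module_scheme \<Rightarrow> ('v \<times> 'w \<Rightarrow> 'k) set" where
  "tensor_null k V W =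
     submodule_span k (free_module k (carrier V \<times> carrier W)) (bilinear_relations k V W)"

definition tensor_module ::
    "'k ring \<Rightarrow> ('k, 'v, 'm) module_scheme \<Rightarrow> ('k, 'w, 'n) module_scheme \<Rightarrow>
     ('k, ('k, 'v, 'w) tensor) module" where
  "tensor_module k V W = quot_module (free_module k (carrier V \<times> carrier W)) (tensor_null k V W)"

definition tens ::
    "'k ring \<Rightarrow> ('k, 'v, 'm) module_scheme \<Rightarrow> ('k, 'w, 'n) module_scheme \<Rightarrow>
     'v \<Rightarrow> 'w \<Rightarrow> ('k, 'v, 'w) tensor" where
  "tens k V W v w =
     tensor_null k V W +>\<^bsub>free_module k (carrier V \<times> carrier W)\<^esub> basis_vec k (v, w)"

text \<open>For a tensor \<open>t = \<Sum>\<^sub>i v\<^sub>i \<otimes> w\<^sub>i\<close> and a map \<open>f\<close> with values in \<open>X\<close>, \<open>tsum k X t f\<close> is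
  \<open>\<Sum>\<^sub>i f v\<^sub>i w\<^sub>i\<close>. All maps \<open>f\<close> used below are bilinear, so that the choice of the representative of
  \<open>t\<close> is immaterial; this renders the Sweedler notation and the notation
  \<open>\<R> = \<R>\<^sup>\<alpha> \<otimes> \<R>\<^sub>\<alpha>\<close>.\<close>

definition tsum ::
    "'k ring \<Rightarrow> ('k, 'x, 'm) module_scheme \<Rightarrow> ('k, 'v, 'w) tensor \<Rightarrow> ('v \<Rightarrow> 'w \<Rightarrow> 'x) \<Rightarrow> 'x" where
  "tsum k X t f = linear_ext k X (\<lambda>(v, w). f v w) (SOME p. p \<in> t)"

definition tensor_product_algebra ::
    "'k ring \<Rightarrow> ('k, 'v, 'm) module_scheme \<Rightarrow> ('k, 'w, 'n) module_scheme \<Rightarrow>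
     ('k, ('k, 'v, 'w) tensor) module" where
  "tensor_product_algebra k A C = (let T = tensor_module k A C in
     T\<lparr>mult := (\<lambda>s t. tsum k T s (\<lambda>a c. tsum k T t (\<lambda>a' c'. tens k A C (a \<otimes>\<^bsub>A\<^esub> a') (c \<otimes>\<^bsub>C\<^esub> c')))),
       one := tens k A C \<one>\<^bsub>A\<^esub> \<one>\<^bsub>C\<^esub>\<rparr>)"

definition tmap ::
    "'k ring \<Rightarrow> ('k, 'v, 'm) module_scheme \<Rightarrow> ('k, 'w, 'n) module_scheme \<Rightarrow>
     ('x \<Rightarrow> 'v) \<Rightarrow> ('y \<Rightarrow> 'w) \<Rightarrow> ('k, 'x, 'y) tensor \<Rightarrow> ('k, 'v, 'w) tensor" where
  "tmap k V W f g t = tsum k (tensor_module k V W) t (\<lambda>x y. tens k V W (f x) (g y))"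

definition tflip ::
    "'k ring \<Rightarrow> ('k, 'v, 'm) module_scheme \<Rightarrow> ('k, 'w, 'n) module_scheme \<Rightarrow>
     ('k, 'v, 'w) tensor \<Rightarrow> ('k, 'w, 'v) tensor" where
  "tflip k V W t = tsum k (tensor_module k W V) t (\<lambda>v w. tens k W V w v)"

definition tassoc ::
    "'k ring \<Rightarrow> ('k, 'v, 'm) module_scheme \<Rightarrow> ('k, 'w, 'n) module_scheme \<Rightarrow>
     ('k, 'x, 'l) module_scheme \<Rightarrow>
     ('k, ('k, 'v, 'w) tensor, 'x) tensor \<Rightarrow> ('k, 'v, ('k, 'w, 'x) tensor) tensor" where
  "tassoc k V W X t = (let WX = tensor_module k W X; Y = tensor_module k V WX in
     tsum k Y t (\<lambda>s x. tsum k Y s (\<lambda>v w. tens k V WX v (tens k W X w x))))"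


section \<open>Hopf algebras\<close>

record ('k, 'h) hopf = "('k, 'h) module" +
  comult :: "'h \<Rightarrow> ('k, 'h, 'h) tensor"
  counit :: "'h \<Rightarrow> 'k"
  antipode :: "'h \<Rightarrow> 'h"

definition coalgebra ::
    "'k ring \<Rightarrow> ('k, 'v, 'm) module_scheme \<Rightarrow> ('v \<Rightarrow> ('k, 'v, 'v) tensor) \<Rightarrow> ('v \<Rightarrow> 'k) \<Rightarrow> bool" where
  "coalgebra k C \<Delta> \<epsilon> \<longleftrightarrow> (let CC = tensor_module k C C in
     linear_map k C CC \<Delta> \<and> linear_map k C (self_module k) \<epsilon> \<and>
     (\<forall>x\<in>carrier C.
        tassoc k C C C (tmap k CC C \<Delta> id (\<Delta> x)) = tmap k C CC id \<Delta> (\<Delta> x) \<and>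
        tsum k C (\<Delta> x) (\<lambda>y z. \<epsilon> y \<odot>\<^bsub>C\<^esub> z) = x \<and>
        tsum k C (\<Delta> x) (\<lambda>y z. \<epsilon> z \<odot>\<^bsub>C\<^esub> y) = x))"

definition convolution_inverse_of_id ::
    "'k ring \<Rightarrow> ('k, 'v, 'm) module_scheme \<Rightarrow> ('v \<Rightarrow> ('k, 'v, 'v) tensor) \<Rightarrow> ('v \<Rightarrow> 'k) \<Rightarrow>
     ('v \<Rightarrow> 'v) \<Rightarrow> bool" where
  "convolution_inverse_of_id k L \<Delta> \<epsilon> S \<longleftrightarrow> linear_map k L L S \<and>
     (\<forall>x\<in>carrier L.
        tsum k L (\<Delta> x) (\<lambda>y z. S y \<otimes>\<^bsub>L\<^esub> z) = \<epsilon> x \<odot>\<^bsub>L\<^esub> \<one>\<^bsub>L\<^esub> \<and>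
        tsum k L (\<Delta> x) (\<lambda>y z. y \<otimes>\<^bsub>L\<^esub> S z) = \<epsilon> x \<odot>\<^bsub>L\<^esub> \<one>\<^bsub>L\<^esub>)"

definition hopf_algebra :: "'k ring \<Rightarrow> ('k, 'h) hopf \<Rightarrow> bool" where
  "hopf_algebra k H \<longleftrightarrow>
     k_algebra k H \<and> coalgebra k H (comult H) (counit H) \<and>
     algebra_map k H (tensor_product_algebra k H H) (comult H) \<and>
     algebra_map k H (self_module k) (counit H) \<and>
     convolution_inverse_of_id k H (comult H) (counit H) (antipode H)"

text \<open>The hexagon identities for \<open>\<R>\<close> are stated in \<open>(K \<otimes> K) \<otimes> K\<close> and in \<open>K \<otimes> (K \<otimes> K)\<close>
  respectively, where the legs of \<open>\<R>\<close> are embedded accordingly.\<close>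

definition triangular_hopf_algebra :: "'k ring \<Rightarrow> ('k, 'h) hopf \<Rightarrow> ('k, 'h, 'h) tensor \<Rightarrow> bool" where
  "triangular_hopf_algebra k K \<R> \<longleftrightarrow>
     (let KK = tensor_product_algebra k K K;
          KK_K = tensor_product_algebra k KK K;
          K_KK = tensor_product_algebra k K KK
      in hopf_algebra k K \<and> \<R> \<in> Units KK \<and>
         (\<forall>h\<in>carrier K. tflip k K K (comult K h) = \<R> \<otimes>\<^bsub>KK\<^esub> comult K h \<otimes>\<^bsub>KK\<^esub> inv\<^bsub>KK\<^esub> \<R>) \<and>
         tmap k KK K (comult K) id \<R> =
           tmap k KK K (\<lambda>x. tens k K K x \<one>\<^bsub>K\<^esub>) id \<R> \<otimes>\<^bsub>KK_K\<^esub> tmap k KK K (tens k K K \<one>\<^bsub>K\<^esub>) id \<R> \<and>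
         tmap k K KK id (comult K) \<R> =
           tmap k K KK id (tens k K K \<one>\<^bsub>K\<^esub>) \<R> \<otimes>\<^bsub>K_KK\<^esub> tmap k K KK id (\<lambda>y. tens k K K y \<one>\<^bsub>K\<^esub>) \<R> \<and>
         inv\<^bsub>KK\<^esub> \<R> = tflip k K K \<R>)"


section \<open>Twists\<close>

definition hopf_twist_element :: "'k ring \<Rightarrow> ('k, 'h) hopf \<Rightarrow> ('k, 'h, 'h) tensor \<Rightarrow> bool" where
  "hopf_twist_element k K \<F> \<longleftrightarrow>
     (let KK = tensor_product_algebra k K K;
          KK_K = tensor_product_algebra k KK K;
          K_KK = tensor_product_algebra k K KK
      in \<F> \<in> Units KK \<and>
         tsum k K \<F> (\<lambda>x y. counit K x \<odot>\<^bsub>K\<^esub> y) = \<one>\<^bsub>K\<^esub> \<and>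
         tsum k K \<F> (\<lambda>x y. counit K y \<odot>\<^bsub>K\<^esub> x) = \<one>\<^bsub>K\<^esub> \<and>
         tassoc k K K K (tens k KK K \<F> \<one>\<^bsub>K\<^esub> \<otimes>\<^bsub>KK_K\<^esub> tmap k KK K (comult K) id \<F>) =
           tens k K KK \<one>\<^bsub>K\<^esub> \<F> \<otimes>\<^bsub>K_KK\<^esub> tmap k K KK id (comult K) \<F>)"

definition inv_twist :: "'k ring \<Rightarrow> ('k, 'h) hopf \<Rightarrow> ('k, 'h, 'h) tensor \<Rightarrow> ('k, 'h, 'h) tensor" where
  "inv_twist k K \<F> = inv\<^bsub>tensor_product_algebra k K K\<^esub> \<F>"

definition twisted_hopf :: "'k ring \<Rightarrow> ('k, 'h) hopf \<Rightarrow> ('k, 'h, 'h) tensor \<Rightarrow> ('k, 'h) hopf" where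
  "twisted_hopf k K \<F> =
     (let KK = tensor_product_algebra k K K;
          \<u> = tsum k K \<F> (\<lambda>x y. x \<otimes>\<^bsub>K\<^esub> antipode K y)
      in K\<lparr>comult := (\<lambda>h. \<F> \<otimes>\<^bsub>KK\<^esub> comult K h \<otimes>\<^bsub>KK\<^esub> inv_twist k K \<F>),
           antipode := (\<lambda>h. \<u> \<otimes>\<^bsub>K\<^esub> antipode K h \<otimes>\<^bsub>K\<^esub> inv\<^bsub>K\<^esub> \<u>)\<rparr>)"

definition twisted_R ::
    "'k ring \<Rightarrow> ('k, 'h) hopf \<Rightarrow> ('k, 'h, 'h) tensor \<Rightarrow> ('k, 'h, 'h) tensor \<Rightarrow> ('k, 'h, 'h) tensor" where
  "twisted_R k K \<R> \<F> =
     (let KK = tensor_product_algebra k K K in tflip k K K \<F> \<otimes>\<^bsub>KK\<^esub> \<R> \<otimes>\<^bsub>KK\<^esub> inv_twist k K \<F>)"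


section \<open>Equivariant Hopf--Galois extensions\<close>

record ('k, 'h, 'v) kmod = "('k, 'v) module" +
  act :: "'h \<Rightarrow> 'v \<Rightarrow> 'v"

definition K_module :: "'k ring \<Rightarrow> ('k, 'h) hopf \<Rightarrow> ('k, 'h, 'v, 'm) kmod_scheme \<Rightarrow> bool" where
  "K_module k K V \<longleftrightarrow> module k V \<and>
     (\<forall>h\<in>carrier K. linear_map k V V (act V h)) \<and>
     (\<forall>v\<in>carrier V. linear_map k K V (\<lambda>h. act V h v) \<and> act V \<one>\<^bsub>K\<^esub> v = v \<and>
        (\<forall>h\<in>carrier K. \<forall>h'\<in>carrier K. act V (h \<otimes>\<^bsub>K\<^esub> h') v = act V h (act V h' v)))"

definition K_module_algebra :: "'k ring \<Rightarrow> ('k, 'h) hopf \<Rightarrow> ('k, 'h, 'v, 'm) kmod_scheme \<Rightarrow> bool" where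
  "K_module_algebra k K A \<longleftrightarrow> k_algebra k A \<and> K_module k K A \<and>
     (\<forall>h\<in>carrier K. act A h \<one>\<^bsub>A\<^esub> = counit K h \<odot>\<^bsub>A\<^esub> \<one>\<^bsub>A\<^esub> \<and>
        (\<forall>a\<in>carrier A. \<forall>a'\<in>carrier A.
           act A h (a \<otimes>\<^bsub>A\<^esub> a') = tsum k A (comult K h) (\<lambda>x y. act A x a \<otimes>\<^bsub>A\<^esub> act A y a')))"

record ('k, 'h, 'c, 'a) comod_kmod = "('k, 'h, 'a) kmod" +
  coact :: "'a \<Rightarrow> ('k, 'a, 'c) tensor"

definition comodule_algebra ::
    "'k ring \<Rightarrow> ('k, 'c) hopf \<Rightarrow> ('k, 'h, 'c, 'a) comod_kmod \<Rightarrow> bool" where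
  "comodule_algebra k H A \<longleftrightarrow> k_algebra k A \<and>
     algebra_map k A (tensor_product_algebra k A H) (coact A) \<and>
     (\<forall>a\<in>carrier A.
        tassoc k A H H (tmap k (tensor_module k A H) H (coact A) id (coact A a)) =
          tmap k A (tensor_module k H H) id (comult H) (coact A a) \<and>
        tsum k A (coact A a) (\<lambda>x c. counit H c \<odot>\<^bsub>A\<^esub> x) = a)"

definition coinvariants :: "'k ring \<Rightarrow> ('k, 'c) hopf \<Rightarrow> ('k, 'h, 'c, 'a) comod_kmod \<Rightarrow> 'a set" where
  "coinvariants k H A = {b \<in> carrier A. coact A b = tens k A H b \<one>\<^bsub>H\<^esub>}"

text \<open>\<open>A \<otimes>\<^sub>B A\<close> as a quotient of \<open>A \<otimes> A\<close>.\<close>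

definition tensor_over :: "'k ring \<Rightarrow> ('k, 'a, 'm) module_scheme \<Rightarrow> 'a set \<Rightarrow> ('k, ('k, 'a, 'a) tensor set) module" where
  "tensor_over k A B = (let T = tensor_module k A A in
     quot_module T (submodule_span k T
       {tens k A A (a \<otimes>\<^bsub>A\<^esub> b) a' \<ominus>\<^bsub>T\<^esub> tens k A A a (b \<otimes>\<^bsub>A\<^esub> a') | a b a'.
          a \<in> carrier A \<and> b \<in> B \<and> a' \<in> carrier A}))"

definition canonical_map ::
    "'k ring \<Rightarrow> ('k, 'c) hopf \<Rightarrow> ('k, 'h, 'c, 'a) comod_kmod \<Rightarrow>
     ('k, 'a, 'a) tensor set \<Rightarrow> ('k, 'a, 'c) tensor" where
  "canonical_map k H A X = (let T = tensor_module k A H in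
     tsum k T (SOME t. t \<in> X)
       (\<lambda>a' a. tsum k T (coact A a) (\<lambda>x c. tens k A H (a' \<otimes>\<^bsub>A\<^esub> x) c)))"

definition hopf_galois :: "'k ring \<Rightarrow> ('k, 'c) hopf \<Rightarrow> ('k, 'h, 'c, 'a) comod_kmod \<Rightarrow> bool" where
  "hopf_galois k H A \<longleftrightarrow> comodule_algebra k H A \<and>
     bij_betw (canonical_map k H A)
       (carrier (tensor_over k A (coinvariants k H A))) (carrier (tensor_module k A H))"

definition equivariant_hopf_galois ::
    "'k ring \<Rightarrow> ('k, 'h) hopf \<Rightarrow> ('k, 'c) hopf \<Rightarrow> ('k, 'h, 'c, 'a) comod_kmod \<Rightarrow> bool" where
  "equivariant_hopf_galois k K H A \<longleftrightarrow>
     hopf_galois k H A \<and> K_module_algebra k K A \<and>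
     (\<forall>h\<in>carrier K. \<forall>a\<in>carrier A. coact A (act A h a) = tmap k A H (act A h) id (coact A a)) \<and>
     (\<forall>h\<in>carrier K. \<forall>b\<in>coinvariants k H A. act A h b \<in> coinvariants k H A)"

definition twisted_algebra ::
    "'k ring \<Rightarrow> ('k, 'h) hopf \<Rightarrow> ('k, 'h, 'h) tensor \<Rightarrow>
     ('k, 'h, 'v, 'm) kmod_scheme \<Rightarrow> ('k, 'h, 'v, 'm) kmod_scheme" where
  "twisted_algebra k K \<F> A =
     A\<lparr>mult := (\<lambda>a a'. tsum k A (inv_twist k K \<F>) (\<lambda>x y. act A x a \<otimes>\<^bsub>A\<^esub> act A y a'))\<rparr>"


section \<open>The braided Lie algebra of infinitesimal gauge transformations\<close>

record ('k, 'h, 'g) braided_lie = "('k, 'h, 'g) kmod" +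
  bracket :: "'g \<Rightarrow> 'g \<Rightarrow> 'g"

text \<open>\<open>Hom(A, A)\<close> with the adjoint action. Linear maps are extensional outside \<open>carrier A\<close>, so that
  equality in the record is equality of maps on \<open>A\<close>.\<close>

definition hom_module ::
    "'k ring \<Rightarrow> ('k, 'h) hopf \<Rightarrow> ('k, 'h, 'a, 'm) kmod_scheme \<Rightarrow> ('k, 'h, 'a \<Rightarrow> 'a) kmod" where
  "hom_module k K A =
    \<lparr>carrier = {\<psi> \<in> carrier A \<rightarrow>\<^sub>E carrier A. linear_map k A A \<psi>},
     mult = compose (carrier A),
     one = (\<lambda>a\<in>carrier A. a),
     zero = (\<lambda>a\<in>carrier A. \<zero>\<^bsub>A\<^esub>),
     add = (\<lambda>\<psi> \<psi>'. \<lambda>a\<in>carrier A. \<psi> a \<oplus>\<^bsub>A\<^esub> \<psi>' a),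
     smult = (\<lambda>c \<psi>. \<lambda>a\<in>carrier A. c \<odot>\<^bsub>A\<^esub> \<psi> a),
     act = (\<lambda>h \<psi>. \<lambda>a\<in>carrier A.
       tsum k A (comult K h) (\<lambda>x y. act A x (\<psi> (act A (antipode K y) a))))\<rparr>"

text \<open>In \<open>tsum k X \<R> (\<lambda>r s. \<dots>)\<close> the variables \<open>r\<close> and \<open>s\<close> stand for
  \<open>\<R>\<^sup>\<alpha>\<close> (first leg) and \<open>\<R>\<^sub>\<alpha>\<close> (second leg).\<close>

definition aut_carrier ::
    "'k ring \<Rightarrow> ('k, 'h) hopf \<Rightarrow> ('k, 'c) hopf \<Rightarrow> ('k, 'h, 'h) tensor \<Rightarrow>
     ('k, 'h, 'c, 'a) comod_kmod \<Rightarrow> ('a \<Rightarrow> 'a) set" where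
  "aut_carrier k K H \<R> A = {u \<in> carrier (hom_module k K A).
     (\<forall>a\<in>carrier A. coact A (u a) = tmap k A H u id (coact A a)) \<and>
     (\<forall>a\<in>carrier A. \<forall>a'\<in>carrier A. u (a \<otimes>\<^bsub>A\<^esub> a') =
        u a \<otimes>\<^bsub>A\<^esub> a' \<oplus>\<^bsub>A\<^esub> tsum k A \<R> (\<lambda>r s. act A s a \<otimes>\<^bsub>A\<^esub> act (hom_module k K A) r u a')) \<and>
     (\<forall>b\<in>coinvariants k H A. u b = \<zero>\<^bsub>A\<^esub>)}"

definition aut_lie ::
    "'k ring \<Rightarrow> ('k, 'h) hopf \<Rightarrow> ('k, 'c) hopf \<Rightarrow> ('k, 'h, 'h) tensor \<Rightarrow>
     ('k, 'h, 'c, 'a) comod_kmod \<Rightarrow> ('k, 'h, 'a \<Rightarrow> 'a) braided_lie" where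
  "aut_lie k K H \<R> A = (let E = hom_module k K A in
     kmod.extend (E\<lparr>carrier := aut_carrier k K H \<R> A\<rparr>)
       (braided_lie.fields
          (\<lambda>u u'. u \<otimes>\<^bsub>E\<^esub> u' \<ominus>\<^bsub>E\<^esub> tsum k E \<R> (\<lambda>r s. act E s u' \<otimes>\<^bsub>E\<^esub> act E r u))))"


section \<open>Braided Hopf algebras\<close>

record ('k, 'h, 'l) braided_hopf = "('k, 'h, 'l) kmod" +
  bcomult :: "'l \<Rightarrow> ('k, 'l, 'l) tensor"
  bcounit :: "'l \<Rightarrow> 'k"
  bantipode :: "'l \<Rightarrow> 'l"

definition braided_tensor ::
    "'k ring \<Rightarrow> ('k, 'h, 'h) tensor \<Rightarrow> ('k, 'h, 'l, 'm) kmod_scheme \<Rightarrow> ('k, ('k, 'l, 'l) tensor) module" where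
  "braided_tensor k \<R> L = (let T = tensor_module k L L in
     T\<lparr>mult := (\<lambda>s t. tsum k T s (\<lambda>a c. tsum k T t (\<lambda>a' c'.
                 tsum k T \<R> (\<lambda>x y. tens k L L (a \<otimes>\<^bsub>L\<^esub> act L y a') (act L x c \<otimes>\<^bsub>L\<^esub> c'))))),
       one := tens k L L \<one>\<^bsub>L\<^esub> \<one>\<^bsub>L\<^esub>\<rparr>)"

definition braided_hopf_algebra ::
    "'k ring \<Rightarrow> ('k, 'h) hopf \<Rightarrow> ('k, 'h, 'h) tensor \<Rightarrow> ('k, 'h, 'l) braided_hopf \<Rightarrow> bool" where
  "braided_hopf_algebra k K \<R> L \<longleftrightarrow>
     K_module_algebra k K L \<and>
     coalgebra k L (bcomult L) (bcounit L) \<and>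
     (\<forall>h\<in>carrier K. \<forall>\<xi>\<in>carrier L.
        bcomult L (act L h \<xi>) =
          tsum k (tensor_module k L L) (comult K h) (\<lambda>x y. tmap k L L (act L x) (act L y) (bcomult L \<xi>)) \<and>
        bcounit L (act L h \<xi>) = counit K h \<otimes>\<^bsub>k\<^esub> bcounit L \<xi> \<and>
        bantipode L (act L h \<xi>) = act L h (bantipode L \<xi>)) \<and>
     algebra_map k L (braided_tensor k \<R> L) (bcomult L) \<and>
     algebra_map k L (self_module k) (bcounit L) \<and>
     convolution_inverse_of_id k L (bcomult L) (bcounit L) (bantipode L)"

definition twisted_braided_hopf ::
    "'k ring \<Rightarrow> ('k, 'h) hopf \<Rightarrow> ('k, 'h, 'h) tensor \<Rightarrow>
     ('k, 'h, 'l) braided_hopf \<Rightarrow> ('k, 'h, 'l) braided_hopf" where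
  "twisted_braided_hopf k K \<F> L =
     (twisted_algebra k K \<F> L)\<lparr>bcomult := (\<lambda>\<xi>.
        tsum k (tensor_module k L L) \<F> (\<lambda>x y. tmap k L L (act L x) (act L y) (bcomult L \<xi>)))\<rparr>"

definition braided_hopf_iso ::
    "'k ring \<Rightarrow> ('k, 'h) hopf \<Rightarrow> ('k, 'h, 'l) braided_hopf \<Rightarrow> ('k, 'h, 'n) braided_hopf \<Rightarrow>
     ('l \<Rightarrow> 'n) \<Rightarrow> bool" where
  "braided_hopf_iso k K L L' \<phi> \<longleftrightarrow>
     bij_betw \<phi> (carrier L) (carrier L') \<and> algebra_map k L L' \<phi> \<and>
     (\<forall>h\<in>carrier K. \<forall>\<xi>\<in>carrier L. \<phi> (act L h \<xi>) = act L' h (\<phi> \<xi>)) \<and>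
     (\<forall>\<xi>\<in>carrier L. bcomult L' (\<phi> \<xi>) = tmap k L' L' \<phi> \<phi> (bcomult L \<xi>) \<and> bcounit L' (\<phi> \<xi>) = bcounit L \<xi>)"

definition braided_hopf_isomorphic ::
    "'k ring \<Rightarrow> ('k, 'h) hopf \<Rightarrow> ('k, 'h, 'h) tensor \<Rightarrow>
     ('k, 'h, 'l) braided_hopf \<Rightarrow> ('k, 'h, 'n) braided_hopf \<Rightarrow> bool" where
  "braided_hopf_isomorphic k K \<R> L L' \<longleftrightarrow>
     braided_hopf_algebra k K \<R> L \<and> braided_hopf_algebra k K \<R> L' \<and>
     (\<exists>\<phi>. braided_hopf_iso k K L L' \<phi>)"


section \<open>Universal enveloping algebras\<close>

text \<open>The free algebra on a set of letters has the words as basis and concatenation as product.\<close>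

definition free_algebra :: "'k ring \<Rightarrow> 'g set \<Rightarrow> ('k, 'g list \<Rightarrow> 'k) module" where
  "free_algebra k X = (free_module k (lists X))
     \<lparr>mult := (\<lambda>p q w. \<Oplus>\<^bsub>k\<^esub>i\<in>{..length w}. p (take i w) \<otimes>\<^bsub>k\<^esub> q (drop i w)),
      one := basis_vec k []\<rparr>"

text \<open>\<open>T(\<gg>)\<close> is the free algebra on the set \<open>\<gg>\<close> modulo linearity of the inclusion of letters;
  in degree \<open>n\<close> this is the span of \<open>n\<close>-tuples modulo multilinearity.\<close>

definition letter_relations :: "'k ring \<Rightarrow> ('k, 'g, 'm) module_scheme \<Rightarrow> ('g list \<Rightarrow> 'k) set" where
  "letter_relations k \<gg> = (let M = free_algebra k (carrier \<gg>); e = basis_vec k in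
     {e [u \<oplus>\<^bsub>\<gg>\<^esub> v] \<ominus>\<^bsub>M\<^esub> (e [u] \<oplus>\<^bsub>M\<^esub> e [v]) | u v. u \<in> carrier \<gg> \<and> v \<in> carrier \<gg>} \<union>
     {e [c \<odot>\<^bsub>\<gg>\<^esub> u] \<ominus>\<^bsub>M\<^esub> c \<odot>\<^bsub>M\<^esub> e [u] | c u. c \<in> carrier k \<and> u \<in> carrier \<gg>})"

definition letter_ideal :: "'k ring \<Rightarrow> ('k, 'g, 'm) module_scheme \<Rightarrow> ('g list \<Rightarrow> 'k) set" where
  "letter_ideal k \<gg> = Idl\<^bsub>free_algebra k (carrier \<gg>)\<^esub> (letter_relations k \<gg>)"

definition tensor_algebra ::
    "'k ring \<Rightarrow> ('k, 'g, 'm) module_scheme \<Rightarrow> ('k, ('g list \<Rightarrow> 'k) set) module" where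
  "tensor_algebra k \<gg> = quot_module (free_algebra k (carrier \<gg>)) (letter_ideal k \<gg>)"

definition tensor_algebra_incl ::
    "'k ring \<Rightarrow> ('k, 'g, 'm) module_scheme \<Rightarrow> 'g \<Rightarrow> ('g list \<Rightarrow> 'k) set" where
  "tensor_algebra_incl k \<gg> u = letter_ideal k \<gg> +>\<^bsub>free_algebra k (carrier \<gg>)\<^esub> basis_vec k [u]"

type_synonym ('k, 'g) env = "('g list \<Rightarrow> 'k) set set"

definition env_ideal ::
    "'k ring \<Rightarrow> ('k, 'h, 'h) tensor \<Rightarrow> ('k, 'h, 'g) braided_lie \<Rightarrow> ('k, 'g) env" where
  "env_ideal k \<R> \<gg> = (let T = tensor_algebra k \<gg>; \<iota> = tensor_algebra_incl k \<gg> in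
     Idl\<^bsub>T\<^esub> {\<iota> u \<otimes>\<^bsub>T\<^esub> \<iota> v \<ominus>\<^bsub>T\<^esub> tsum k T \<R> (\<lambda>r s. \<iota> (act \<gg> s v) \<otimes>\<^bsub>T\<^esub> \<iota> (act \<gg> r u)) \<ominus>\<^bsub>T\<^esub> \<iota> (bracket \<gg> u v)
       | u v. u \<in> carrier \<gg> \<and> v \<in> carrier \<gg>})"

definition env_algebra ::
    "'k ring \<Rightarrow> ('k, 'h, 'h) tensor \<Rightarrow> ('k, 'h, 'g) braided_lie \<Rightarrow> ('k, ('k, 'g) env) module" where
  "env_algebra k \<R> \<gg> = quot_module (tensor_algebra k \<gg>) (env_ideal k \<R> \<gg>)"

definition env_incl ::
    "'k ring \<Rightarrow> ('k, 'h, 'h) tensor \<Rightarrow> ('k, 'h, 'g) braided_lie \<Rightarrow> 'g \<Rightarrow> ('k, 'g) env" where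
  "env_incl k \<R> \<gg> u = env_ideal k \<R> \<gg> +>\<^bsub>tensor_algebra k \<gg>\<^esub> tensor_algebra_incl k \<gg> u"

text \<open>The linear map on \<open>\<U>(\<gg>)\<close> with prescribed values \<open>f w\<close> on the (classes of) words \<open>w\<close> in
  elements of \<open>\<gg>\<close>, evaluated on a representative in the free algebra. The structure maps of \<open>\<U>(\<gg>)\<close>
  are given in this way, by the values on words that their values on generators force.\<close>

definition env_ext ::
    "'k ring \<Rightarrow> ('k, 'x, 'm) module_scheme \<Rightarrow> ('g list \<Rightarrow> 'x) \<Rightarrow> ('k, 'g) env \<Rightarrow> 'x" where
  "env_ext k X f \<xi> = linear_ext k X f (SOME p. p \<in> (SOME t. t \<in> \<xi>))"

text \<open>The multiplicative extension of a map given on generators.\<close>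

definition word_prod :: "('x, 'm) monoid_scheme \<Rightarrow> ('g \<Rightarrow> 'x) \<Rightarrow> 'g list \<Rightarrow> 'x" where
  "word_prod X f w = foldr (\<lambda>u z. f u \<otimes>\<^bsub>X\<^esub> z) w \<one>\<^bsub>X\<^esub>"

text \<open>The action makes \<open>\<U>(\<gg>)\<close> a module algebra:
  \<open>h \<rhd> (u w) = (h\<^sub>1 \<rhd> u) (h\<^sub>2 \<rhd> w)\<close>.\<close>

primrec word_act ::
    "'k ring \<Rightarrow> ('k, 'h) hopf \<Rightarrow> ('k, 'h, 'h) tensor \<Rightarrow> ('k, 'h, 'g) braided_lie \<Rightarrow>
     'g list \<Rightarrow> 'h \<Rightarrow> ('k, 'g) env" where
  "word_act k K \<R> \<gg> [] = (\<lambda>h. counit K h \<odot>\<^bsub>env_algebra k \<R> \<gg>\<^esub> \<one>\<^bsub>env_algebra k \<R> \<gg>\<^esub>)"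
| "word_act k K \<R> \<gg> (u # w) = (\<lambda>h. tsum k (env_algebra k \<R> \<gg>) (comult K h)
     (\<lambda>x y. env_incl k \<R> \<gg> (act \<gg> x u) \<otimes>\<^bsub>env_algebra k \<R> \<gg>\<^esub> word_act k K \<R> \<gg> w y))"

definition env_kmod ::
    "'k ring \<Rightarrow> ('k, 'h) hopf \<Rightarrow> ('k, 'h, 'h) tensor \<Rightarrow> ('k, 'h, 'g) braided_lie \<Rightarrow>
     ('k, 'h, ('k, 'g) env) kmod" where
  "env_kmod k K \<R> \<gg> = (let U = env_algebra k \<R> \<gg> in
     module.extend U (kmod.fields (\<lambda>h. env_ext k U (\<lambda>w. word_act k K \<R> \<gg> w h))))"

text \<open>The antipode is braided antimultiplicative:
  \<open>S(u w) = S(\<R>\<^sub>\<alpha> \<rhd> w) S(\<R>\<^sup>\<alpha> \<rhd> u) = - (\<R>\<^sub>\<alpha> \<rhd> S(w)) (\<R>\<^sup>\<alpha> \<rhd> u)\<close>.\<close>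

primrec word_antipode ::
    "'k ring \<Rightarrow> ('k, 'h) hopf \<Rightarrow> ('k, 'h, 'h) tensor \<Rightarrow> ('k, 'h, 'g) braided_lie \<Rightarrow>
     'g list \<Rightarrow> ('k, 'g) env" where
  "word_antipode k K \<R> \<gg> [] = \<one>\<^bsub>env_kmod k K \<R> \<gg>\<^esub>"
| "word_antipode k K \<R> \<gg> (u # w) = \<ominus>\<^bsub>env_kmod k K \<R> \<gg>\<^esub> tsum k (env_kmod k K \<R> \<gg>) \<R>
     (\<lambda>r s. act (env_kmod k K \<R> \<gg>) s (word_antipode k K \<R> \<gg> w)
              \<otimes>\<^bsub>env_kmod k K \<R> \<gg>\<^esub> env_incl k \<R> \<gg> (act \<gg> r u))"

definition universal_enveloping ::
    "'k ring \<Rightarrow> ('k, 'h) hopf \<Rightarrow> ('k, 'h, 'h) tensor \<Rightarrow> ('k, 'h, 'g) braided_lie \<Rightarrow>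
     ('k, 'h, ('k, 'g) env) braided_hopf" where
  "universal_enveloping k K \<R> \<gg> =
     (let U = env_kmod k K \<R> \<gg>; \<iota> = env_incl k \<R> \<gg>; UU = braided_tensor k \<R> U
      in kmod.extend U (braided_hopf.fields
           (env_ext k UU (word_prod UU (\<lambda>u. tens k U U (\<iota> u) \<one>\<^bsub>U\<^esub> \<oplus>\<^bsub>UU\<^esub> tens k U U \<one>\<^bsub>U\<^esub> (\<iota> u))))
           (env_ext k (self_module k) (word_prod (self_module k) (\<lambda>u. \<zero>\<^bsub>k\<^esub>)))
           (env_ext k U (word_antipode k K \<R> \<gg>))))"

end

theory Submission
  imports Defs
begin

text \<open>Write \<open>\<gg>\<close> for the braided Lie algebra of the extension \<open>B \<subseteq> A\<close>, \<open>\<gg>'\<close> for that of the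
  twisted extension, and \<open>G\<close> for the inverse of the twist \<open>F\<close>. There are two ideas.

  First, \<open>\<gg>'\<close> is a twist of \<open>\<gg>\<close>. The map \<open>D(\<psi>)(a) = (G\<^sup>\<alpha> \<rhd> \<psi>)(G\<^sub>\<alpha> \<rhd> a)\<close> on \<open>Hom(A, A)\<close>
  is equivariant for the adjoint actions of \<open>K\<close> and \<open>K\<^sub>F\<close> and turns the product
  \<open>(G\<^sup>\<alpha> \<rhd> \<psi>) \<circ> (G\<^sub>\<alpha> \<rhd> \<phi>)\<close> into \<open>D(\<psi>) \<circ> D(\<phi>)\<close> by the cocycle condition. Since
  \<open>R G = G\<^sub>2\<^sub>1 R\<^sub>F\<close>, it takes braided derivations of \<open>A\<close> to braided derivations of \<open>A\<^sub>F\<close>, and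
  \<open>D [G\<^sup>\<alpha> \<rhd> u, G\<^sub>\<alpha> \<rhd> v] = [D(u), D(v)]\<close> (lemmas \<open>D_act\<close>, \<open>D_mult\<close>, \<open>D_aut\<close>, \<open>D_br\<close>). The set-up is
  symmetric, because \<open>G\<close> is a twist of \<open>K\<^sub>F\<close> that leads back to \<open>K\<close> (\<open>twist_inverse\<close>); the inverse of \<open>D\<close> is the
  same construction for \<open>K\<^sub>F\<close> and \<open>G\<close> (\<open>D_D\<close>).

  Second, enveloping algebras turn twists of brackets into twists of braided Hopf algebras. In the algebra
  \<open>\<U>(\<gg>)\<^sub>F\<close> the letters \<open>D\<^sup>-\<^sup>1(u)\<close>, \<open>u \<in> \<gg>'\<close>, satisfy the defining relations of \<open>\<U>(\<gg>')\<close>, once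
  more because \<open>R G = G\<^sub>2\<^sub>1 R\<^sub>F\<close> (\<open>UF_relation\<close>), so they define an algebra map
  \<open>\<Phi> : \<U>(\<gg>') \<rightarrow> \<U>(\<gg>)\<^sub>F\<close>. The map obtained in the same way from \<open>D\<close> and \<open>G\<close> is its inverse
  (\<open>\<Phi>_left_inverse\<close>). For the coproducts it suffices to compare how they behave on the product of a letter
  with an arbitrary element. This comparison (\<open>DF_step\<close>) comes down to two identities in \<open>K \<otimes> K \<otimes> K\<close>: a form of
  the cocycle condition, and \<open>leg_identity_step\<close>, which moves \<open>F\<close> past \<open>R\<close>. As \<open>\<Phi>\<close> is surjective, the same
  comparison shows that the twisted coproduct is multiplicative, so that \<open>\<U>(\<gg>)\<^sub>F\<close> is a braided Hopf algebra.

  Along the way the objects themselves have to be constructed: the twisted triangular Hopf algebra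
  (\<open>hopf_algebra_K'\<close>, \<open>triangular_K'\<close>), the bracket of braided derivations (\<open>aut_bracket\<close>), and the braided
  Hopf algebra structure of an enveloping algebra (\<open>universal_enveloping_braided_hopf\<close>).

  Elements of a tensor product are used only through sums over their legs. These sums are linear in the
  tensor and in the summand, and every structural identity (coassociativity, cocycle, hexagon) is an equation
  between nested sums of a multilinear function; a computation is a chain of such equations and of exchanges
  of sums. Sums over the legs of an element of \<open>K \<otimes> K\<close> and of a coproduct \<open>\<Delta>(h)\<close> are written
  \<open>ks X t (%x y. \<dots>)\<close> and \<open>sw X h (%x y. \<dots>)\<close>, where \<open>X\<close> is the module in which the sum is taken.\<close>

abbreviation in_carrier :: "'a \<Rightarrow> ('a, 'm) partial_object_scheme \<Rightarrow> bool" (infix "<:" 50) where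
  "x <: V \<equiv> x \<in> carrier V"

section \<open>Linear maps\<close>

lemma module_cring: "module k V ==> cring k"
  unfolding module_def by blast

lemma module_abelian_group: "module k V ==> abelian_group V"
  unfolding module_def by blast

lemma module_ops_closed:
  assumes "module k V"
  shows "\<zero>\<^bsub>V\<^esub> <: V"
    and "[|x <: V; y <: V|] ==> x \<oplus>\<^bsub>V\<^esub> y <: V"
    and "[|x <: V; y <: V|] ==> x \<ominus>\<^bsub>V\<^esub> y <: V"
    and "x <: V ==> \<ominus>\<^bsub>V\<^esub> x <: V"
    and "[|c <: k; x <: V|] ==> c \<odot>\<^bsub>V\<^esub> x <: V"
proof -
  interpret module k V by fact
  show "\<zero>\<^bsub>V\<^esub> <: V" by simp
  show "[|x <: V; y <: V|] ==> x \<oplus>\<^bsub>V\<^esub> y <: V" by simp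
  show "[|x <: V; y <: V|] ==> x \<ominus>\<^bsub>V\<^esub> y <: V" by simp
  show "x <: V ==> \<ominus>\<^bsub>V\<^esub> x <: V" by simp
  show "[|c <: k; x <: V|] ==> c \<odot>\<^bsub>V\<^esub> x <: V" by simp
qed

lemma module_minus_eq_zero:
  assumes "module k V" "x <: V" "y <: V"
  shows "x \<ominus>\<^bsub>V\<^esub> y = \<zero>\<^bsub>V\<^esub> \<longleftrightarrow> x = y"
proof -
  interpret module k V by fact
  show ?thesis
    using assms(2,3) M.minus_equality[of x "\<ominus>\<^bsub>V\<^esub> y"] by (auto simp: a_minus_def M.r_neg)
qed

lemma linear_mapI:
  assumes "!!x. x <: V ==> f x <: W"
    and "!!x y. [|x <: V; y <: V|] ==> f (x \<oplus>\<^bsub>V\<^esub> y) = f x \<oplus>\<^bsub>W\<^esub> f y"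
    and "!!c x. [|c <: k; x <: V|] ==> f (c \<odot>\<^bsub>V\<^esub> x) = c \<odot>\<^bsub>W\<^esub> f x"
  shows "linear_map k V W f"
  using assms unfolding linear_map_def by auto

lemma lin_closed: "[|linear_map k V W f; x <: V|] ==> f x <: W"
  unfolding linear_map_def by auto

lemma lin_add:
  "[|linear_map k V W f; x <: V; y <: V|] ==> f (x \<oplus>\<^bsub>V\<^esub> y) = f x \<oplus>\<^bsub>W\<^esub> f y"
  unfolding linear_map_def by auto

lemma lin_smult:
  "[|linear_map k V W f; c <: k; x <: V|] ==> f (c \<odot>\<^bsub>V\<^esub> x) = c \<odot>\<^bsub>W\<^esub> f x"
  unfolding linear_map_def by auto

lemma lin_zero:
  assumes "module k V" "module k W" "linear_map k V W f"
  shows "f \<zero>\<^bsub>V\<^esub> = \<zero>\<^bsub>W\<^esub>"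
proof -
  interpret V: module k V by fact
  interpret W: module k W by fact
  have "f \<zero>\<^bsub>V\<^esub> = f (\<zero>\<^bsub>k\<^esub> \<odot>\<^bsub>V\<^esub> \<zero>\<^bsub>V\<^esub>)" by simp
  also have "... = \<zero>\<^bsub>k\<^esub> \<odot>\<^bsub>W\<^esub> f \<zero>\<^bsub>V\<^esub>" using assms(3) by (intro lin_smult) auto
  also have "... = \<zero>\<^bsub>W\<^esub>" using lin_closed[OF assms(3)] by simp
  finally show ?thesis .
qed

lemma lin_uminus:
  assumes "module k V" "module k W" "linear_map k V W f" "x <: V"
  shows "f (\<ominus>\<^bsub>V\<^esub> x) = \<ominus>\<^bsub>W\<^esub> f x"
proof -
  interpret V: module k V by fact
  interpret W: module k W by fact
  have "f (\<ominus>\<^bsub>V\<^esub> x) \<oplus>\<^bsub>W\<^esub> f x = f (\<ominus>\<^bsub>V\<^esub> x \<oplus>\<^bsub>V\<^esub> x)"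
    using assms(4) by (simp add: lin_add[OF assms(3)])
  also have "... = \<zero>\<^bsub>W\<^esub>" using assms(4) by (simp add: V.M.l_neg lin_zero[OF assms(1-3)])
  finally show ?thesis
    using W.M.minus_equality[of "f (\<ominus>\<^bsub>V\<^esub> x)" "f x"] lin_closed[OF assms(3)] assms(4) by simp
qed

lemma lin_minus:
  assumes "module k V" "module k W" "linear_map k V W f" "x <: V" "y <: V"
  shows "f (x \<ominus>\<^bsub>V\<^esub> y) = f x \<ominus>\<^bsub>W\<^esub> f y"
proof -
  interpret V: module k V by fact
  show ?thesis
    using assms(4,5) lin_add[OF assms(3,4) V.M.a_inv_closed[OF assms(5)]]
      lin_uminus[OF assms(1-3,5)] by (simp add: a_minus_def)
qed

lemma lin_cong:
  assumes "module k V" "!!x. x <: V ==> f x = g x"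
  shows "linear_map k V W f = linear_map k V W g"
proof -
  interpret module k V by fact
  show ?thesis using assms(2) unfolding linear_map_def Pi_def by auto
qed

lemma lin_ident [simp]: "linear_map k V V (%x. x)"
  unfolding linear_map_def by auto

lemma lin_id [simp]: "linear_map k V V id"
  unfolding linear_map_def by auto

lemma lin_const_zero [simp]:
  assumes "module k W" shows "linear_map k V W (%x. \<zero>\<^bsub>W\<^esub>)"
proof -
  interpret module k W by fact
  show ?thesis unfolding linear_map_def by auto
qed

lemma lin_comp:
  "[|linear_map k W X g; linear_map k V W f|] ==> linear_map k V X (%x. g (f x))"
  unfolding linear_map_def Pi_def by auto

lemma lin_addf [simp]:
  assumes "module k W" "linear_map k V W f" "linear_map k V W g"
  shows "linear_map k V W (%x. f x \<oplus>\<^bsub>W\<^esub> g x)"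
proof -
  interpret module k W by fact
  note c = lin_closed[OF assms(2)] lin_closed[OF assms(3)]
  show ?thesis
    by (rule linear_mapI)
      (simp_all add: c lin_add[OF assms(2)] lin_add[OF assms(3)]
        lin_smult[OF assms(2)] lin_smult[OF assms(3)] smult_r_distr M.a_ac)
qed

lemma lin_smultf [simp]:
  assumes "module k W" "linear_map k V W f" "c <: k"
  shows "linear_map k V W (%x. c \<odot>\<^bsub>W\<^esub> f x)"
proof -
  interpret module k W by fact
  note c = lin_closed[OF assms(2)]
  show ?thesis
    by (rule linear_mapI)
      (simp_all add: c assms(3) lin_add[OF assms(2)] lin_smult[OF assms(2)]
        smult_r_distr smult_assoc1[symmetric] m_comm)
qed

lemma lin_uminusf [simp]:
  assumes "module k W" "linear_map k V W f"
  shows "linear_map k V W (%x. \<ominus>\<^bsub>W\<^esub> f x)"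
proof -
  interpret module k W by fact
  note c = lin_closed[OF assms(2)]
  show ?thesis
    by (rule linear_mapI)
      (simp_all add: c lin_add[OF assms(2)] lin_smult[OF assms(2)]
        smult_r_minus M.minus_add)
qed

lemma lin_minusf [simp]:
  assumes "module k W" "linear_map k V W f" "linear_map k V W g"
  shows "linear_map k V W (%x. f x \<ominus>\<^bsub>W\<^esub> g x)"
  unfolding a_minus_def using assms by simp

lemma lin_smult_left [simp]:
  assumes "module k W" "linear_map k V (self_module k) f" "w <: W"
  shows "linear_map k V W (%x. f x \<odot>\<^bsub>W\<^esub> w)"
proof -
  interpret module k W by fact
  have c: "f x <: k" if "x <: V" for x
    using lin_closed[OF assms(2) that] by (simp add: self_module_def)
  show ?thesis
    by (rule linear_mapI)
      (simp_all add: c assms lin_add[OF assms(2)] lin_smult[OF assms(2)] self_module_def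
         smult_l_distr smult_assoc1)
qed

lemma module_self: "cring k ==> module k (self_module k)"
proof -
  assume "cring k"
  then interpret cring k .
  show ?thesis
    by (rule moduleI, fact, rule abelian_groupI)
      (auto simp: self_module_def l_distr r_distr m_assoc a_ac intro: bexI[of _ "a_inv k x" for x] l_neg)
qed

lemma self_module_simps [simp]:
  "carrier (self_module k) = carrier k" "mult (self_module k) = mult k" "one (self_module k) = one k"
  "zero (self_module k) = zero k" "add (self_module k) = add k" "smult (self_module k) = mult k"
  by (simp_all add: self_module_def)

lemma equalizer_submodule:
  assumes "module k V" "module k W" "linear_map k V W f" "linear_map k V W g"
  shows "submodule {x \<in> carrier V. f x = g x} k V"
proof -
  interpret V: module k V by fact
  show ?thesis
    by (intro V.submoduleI)
      (auto simp: lin_zero[OF assms(1,2,3)] lin_zero[OF assms(1,2,4)]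
        lin_uminus[OF assms(1,2,3)] lin_uminus[OF assms(1,2,4)]
        lin_add[OF assms(3)] lin_add[OF assms(4)]
        lin_smult[OF assms(3)] lin_smult[OF assms(4)])
qed

section \<open>Quotient modules\<close>

lemma submodule_abelian_subgroup:
  assumes "module k M" "submodule N k M"
  shows "abelian_subgroup N M"
proof -
  interpret M: module k M by fact
  show ?thesis
    using assms(2) by (intro abelian_subgroupI3 additive_subgroup.intro)
      (auto simp: submodule_def M.abelian_group_axioms)
qed

lemma quot_module_simps:
  "carrier (quot_module M N) = (%x. N +>\<^bsub>M\<^esub> x) ` carrier M"
  "zero (quot_module M N) = N" "one (quot_module M N) = N +>\<^bsub>M\<^esub> \<one>\<^bsub>M\<^esub>"
  "add (quot_module M N) = set_add M" "mult (quot_module M N) = rcoset_mult M N"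
  by (auto simp: quot_module_def A_RCOSETS_def RCOSETS_def a_r_coset_def)

text \<open>The basic fact about quotients, in the form in which relations are verified below.\<close>

lemma coset_eq_iff:
  assumes "module k M" "submodule N k M" "x <: M" "y <: M"
  shows "N +>\<^bsub>M\<^esub> x = N +>\<^bsub>M\<^esub> y \<longleftrightarrow> x \<ominus>\<^bsub>M\<^esub> y \<in> N"
proof -
  interpret M: module k M by fact
  interpret N: abelian_subgroup N M by (rule submodule_abelian_subgroup) fact+
  show ?thesis
    using N.a_repr_independence'[of y x] N.a_repr_independence'[of x y] N.a_rcos_self[OF assms(3)]
      N.a_rcos_module[OF assms(4,3)] assms(3,4) unfolding a_minus_def by blast
qed

lemma quot_module_add:
  assumes "module k M" "submodule N k M" "x <: M" "y <: M"
  shows "(N +>\<^bsub>M\<^esub> x) \<oplus>\<^bsub>quot_module M N\<^esub> (N +>\<^bsub>M\<^esub> y) = N +>\<^bsub>M\<^esub> (x \<oplus>\<^bsub>M\<^esub> y)"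
proof -
  interpret N: abelian_subgroup N M by (rule submodule_abelian_subgroup) fact+
  show ?thesis using assms by (simp add: quot_module_simps N.a_rcos_sum)
qed

lemma quot_module_smult:
  assumes "module k M" "submodule N k M" "c <: k" "x <: M"
  shows "c \<odot>\<^bsub>quot_module M N\<^esub> (N +>\<^bsub>M\<^esub> x) = N +>\<^bsub>M\<^esub> (c \<odot>\<^bsub>M\<^esub> x)"
proof -
  interpret M: module k M by fact
  interpret N: abelian_subgroup N M by (rule submodule_abelian_subgroup) fact+
  have "N +>\<^bsub>M\<^esub> (c \<odot>\<^bsub>M\<^esub> y) = N +>\<^bsub>M\<^esub> (c \<odot>\<^bsub>M\<^esub> x)" if "y \<in> N +>\<^bsub>M\<^esub> x" for y
  proof -
    have y: "y <: M" using that assms(4) N.a_elemrcos_carrier by blast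
    then have "y \<ominus>\<^bsub>M\<^esub> x \<in> N" using that assms(4) N.a_rcos_module[of x y]
      by (simp add: a_minus_def)
    then have "c \<odot>\<^bsub>M\<^esub> (y \<ominus>\<^bsub>M\<^esub> x) \<in> N" using assms by (simp add: submodule.smult_closed)
    then have "c \<odot>\<^bsub>M\<^esub> y \<ominus>\<^bsub>M\<^esub> c \<odot>\<^bsub>M\<^esub> x \<in> N"
      using assms y by (simp add: a_minus_def M.smult_r_distr M.smult_r_minus)
    then show ?thesis using assms y by (simp add: coset_eq_iff)
  qed
  then have "(\<Union>y\<in>N +>\<^bsub>M\<^esub> x. N +>\<^bsub>M\<^esub> (c \<odot>\<^bsub>M\<^esub> y)) = N +>\<^bsub>M\<^esub> (c \<odot>\<^bsub>M\<^esub> x)"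
    by (intro UN_constant_eq[OF N.a_rcos_self[OF assms(4)]]) blast
  then show ?thesis by (simp add: quot_module_def)
qed

lemma module_quot:
  assumes "module k M" "submodule N k M"
  shows "module k (quot_module M N)"
proof -
  interpret M: module k M by fact
  interpret N: abelian_subgroup N M by (rule submodule_abelian_subgroup) fact+
  have zero: "\<zero>\<^bsub>quot_module M N\<^esub> = N +>\<^bsub>M\<^esub> \<zero>\<^bsub>M\<^esub>"
    using N.a_subset by (simp add: quot_module_simps M.a_coset_add_zero)
  have "abelian_group (quot_module M N)"
  proof (rule abelian_groupI)
    fix X assume "X <: (quot_module M N)"
    then obtain x where x: "x <: M" "X = N +>\<^bsub>M\<^esub> x" by (auto simp: quot_module_simps)
    show "\<exists>Y\<in>carrier (quot_module M N). Y \<oplus>\<^bsub>quot_module M N\<^esub> X = \<zero>\<^bsub>quot_module M N\<^esub>"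
      using x by (intro bexI[of _ "N +>\<^bsub>M\<^esub> (\<ominus>\<^bsub>M\<^esub> x)"])
        (auto simp: zero quot_module_add[OF assms] M.l_neg quot_module_simps(1))
  qed (auto simp: zero quot_module_add[OF assms] quot_module_simps(1) M.a_ac)
  then show ?thesis
    using assms by (intro moduleI M.is_cring)
      (auto simp: quot_module_simps(1) quot_module_smult quot_module_add M.smult_l_distr
         M.smult_r_distr M.smult_assoc1)
qed

lemma lin_coset:
  assumes "module k M" "submodule N k M"
  shows "linear_map k M (quot_module M N) (%x. N +>\<^bsub>M\<^esub> x)"
  using assms by (intro linear_mapI) (auto simp: quot_module_simps(1) quot_module_smult quot_module_add)

lemma coset_repr:
  assumes "module k M" "submodule N k M" "X <: (quot_module M N)"
  shows "(SOME x. x \<in> X) <: M" "X = N +>\<^bsub>M\<^esub> (SOME x. x \<in> X)"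
proof -
  interpret M: module k M by fact
  interpret N: abelian_subgroup N M by (rule submodule_abelian_subgroup) fact+
  obtain x where x: "x <: M" "X = N +>\<^bsub>M\<^esub> x" using assms(3) by (auto simp: quot_module_simps)
  have "(SOME x. x \<in> X) \<in> X" using N.a_rcos_self[OF x(1)] x(2) by (metis someI)
  then show "(SOME x. x \<in> X) <: M" "X = N +>\<^bsub>M\<^esub> (SOME x. x \<in> X)"
    using x N.a_elemrcos_carrier N.a_repr_independence' by (blast, metis)
qed

lemma submodule_span_least: "[|submodule N k M; S \<subseteq> N|] ==> submodule_span k M S \<subseteq> N"
  unfolding submodule_span_def by blast

lemma submodule_span_subset: "S \<subseteq> submodule_span k M S"
  unfolding submodule_span_def by blast

lemma submodule_span_submodule:
  assumes "module k M" "S \<subseteq> carrier M"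
  shows "submodule (submodule_span k M S) k M"
proof -
  interpret M: module k M by fact
  have "carrier M \<in> {N. submodule N k M \<and> S \<subseteq> N}" using assms M.carrier_is_submodule by simp
  then have sub: "submodule_span k M S \<subseteq> carrier M" unfolding submodule_span_def by blast
  show ?thesis
  proof (rule M.submoduleI[OF sub])
    show "\<zero>\<^bsub>M\<^esub> \<in> submodule_span k M S"
      unfolding submodule_span_def
      using additive_subgroup.zero_closed[OF abelian_subgroup.axioms(1)[OF submodule_abelian_subgroup[OF assms(1)]]]
      by blast
  qed (unfold submodule_span_def, auto dest: M.submoduleE)
qed

section \<open>Free modules\<close>

lemma free_module_simps:
  "zero (free_module k X) = (%x. \<zero>\<^bsub>k\<^esub>)" "add (free_module k X) = (%p q x. p x \<oplus>\<^bsub>k\<^esub> q x)"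
  "smult (free_module k X) = (%c p x. c \<otimes>\<^bsub>k\<^esub> p x)"
  by (simp_all add: free_module_def)

lemma free_module_carrier:
  "p <: (free_module k X) \<longleftrightarrow>
    (\<forall>x. p x <: k) \<and> finite {x. p x \<noteq> \<zero>\<^bsub>k\<^esub>} \<and> {x. p x \<noteq> \<zero>\<^bsub>k\<^esub>} \<subseteq> X"
  by (auto simp: free_module_def)

lemma module_free:
  assumes "cring k" shows "module k (free_module k X)"
proof -
  interpret cring k by fact
  show ?thesis
  proof (rule moduleI, fact)
    show "abelian_group (free_module k X)"
    proof (rule abelian_groupI)
      fix p q assume pq: "p <: (free_module k X)" "q <: (free_module k X)"
      then have "{x. p x \<oplus>\<^bsub>k\<^esub> q x \<noteq> \<zero>\<^bsub>k\<^esub>} \<subseteq> {x. p x \<noteq> \<zero>\<^bsub>k\<^esub>} \<union> {x. q x \<noteq> \<zero>\<^bsub>k\<^esub>}" by auto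
      then show "p \<oplus>\<^bsub>free_module k X\<^esub> q <: (free_module k X)"
        using pq by (auto intro: finite_subset simp: Pi_def free_module_carrier free_module_simps)
    next
      fix p assume p: "p <: (free_module k X)"
      then have "{x. \<ominus>\<^bsub>k\<^esub> p x \<noteq> \<zero>\<^bsub>k\<^esub>} \<subseteq> {x. p x \<noteq> \<zero>\<^bsub>k\<^esub>}" by auto
      then have "(%x. \<ominus>\<^bsub>k\<^esub> p x) <: (free_module k X)"
        using p by (auto intro: finite_subset simp: Pi_def free_module_carrier free_module_simps)
      moreover have "(%x. \<ominus>\<^bsub>k\<^esub> p x) \<oplus>\<^bsub>free_module k X\<^esub> p = \<zero>\<^bsub>free_module k X\<^esub>"
        using p by (auto simp: free_module_simps Pi_def free_module_carrier free_module_simps l_neg)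
      ultimately show "\<exists>y\<in>carrier (free_module k X). y \<oplus>\<^bsub>free_module k X\<^esub> p = \<zero>\<^bsub>free_module k X\<^esub>"
        by blast
    qed (auto simp: Pi_def free_module_carrier free_module_simps a_ac)
  next
    fix c p assume p: "c <: k" "p <: (free_module k X)"
    then have "{x. c \<otimes>\<^bsub>k\<^esub> p x \<noteq> \<zero>\<^bsub>k\<^esub>} \<subseteq> {x. p x \<noteq> \<zero>\<^bsub>k\<^esub>}" by auto
    then show "c \<odot>\<^bsub>free_module k X\<^esub> p <: (free_module k X)"
      using p by (auto intro: finite_subset simp: Pi_def free_module_carrier free_module_simps)
  qed (auto simp: Pi_def free_module_carrier free_module_simps l_distr r_distr m_assoc)
qed

lemma basis_vec_in [simp]: "cring k ==> x \<in> X ==> basis_vec k x <: (free_module k X)"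
proof -
  assume "cring k" "x \<in> X"
  interpret cring k by fact
  have "{y. basis_vec k x y \<noteq> \<zero>\<^bsub>k\<^esub>} \<subseteq> {x}" by (auto simp: basis_vec_def)
  then show ?thesis using \<open>x \<in> X\<close> by (auto simp: basis_vec_def free_module_carrier intro: finite_subset)
qed

text \<open>Induction on the size of the support: an element is built up by adding multiples of basis vectors.\<close>

lemma free_module_induct:
  assumes "cring k" "p <: (free_module k X)"
    and zero: "P (\<zero>\<^bsub>free_module k X\<^esub>)"
    and step: "!!p c x. [|p <: (free_module k X); c <: k; x \<in> X; P p|]
      ==> P (p \<oplus>\<^bsub>free_module k X\<^esub> (c \<odot>\<^bsub>free_module k X\<^esub> basis_vec k x))"
  shows "P p"
proof -
  interpret cring k by fact
  have "finite S ==> p <: (free_module k X) ==> {x. p x \<noteq> \<zero>\<^bsub>k\<^esub>} = S ==> P p" for S p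
  proof (induction S arbitrary: p rule: finite_induct)
    case empty
    then have "p = \<zero>\<^bsub>free_module k X\<^esub>" by (auto simp: free_module_simps)
    then show ?case using zero by simp
  next
    case (insert x S)
    define q where "q = p(x := \<zero>\<^bsub>k\<^esub>)"
    have q: "q <: (free_module k X)" "{x. q x \<noteq> \<zero>\<^bsub>k\<^esub>} = S"
      using insert.prems insert.hyps
      by (auto simp: q_def free_module_carrier intro: finite_subset[of _ "insert x S"])
    have pq: "p = q \<oplus>\<^bsub>free_module k X\<^esub> (p x \<odot>\<^bsub>free_module k X\<^esub> basis_vec k x)"
    proof
      fix y
      show "p y = (q \<oplus>\<^bsub>free_module k X\<^esub> (p x \<odot>\<^bsub>free_module k X\<^esub> basis_vec k x)) y"
        using insert.prems(1) by (auto simp: q_def basis_vec_def free_module_carrier free_module_simps)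
    qed
    have "x \<in> X" "p x <: k" using insert.prems by (auto simp: free_module_carrier)
    then have "P (q \<oplus>\<^bsub>free_module k X\<^esub> (p x \<odot>\<^bsub>free_module k X\<^esub> basis_vec k x))"
      by (intro step[OF q(1) _ _ insert.IH[OF q]])
    then show ?case by (simp only: pq[symmetric])
  qed
  then show ?thesis using assms(2) by (auto simp: free_module_carrier)
qed

lemma linear_ext_superset:
  assumes "module k V" "p <: (free_module k X)" "f \<in> X \<rightarrow> carrier V"
    and "finite S" "S \<subseteq> X" "{x. p x \<noteq> \<zero>\<^bsub>k\<^esub>} \<subseteq> S"
  shows "linear_ext k V f p = (\<Oplus>\<^bsub>V\<^esub>x\<in>S. p x \<odot>\<^bsub>V\<^esub> f x)"
proof -
  interpret module k V by fact
  show ?thesis unfolding linear_ext_def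
    using assms by (intro M.add.finprod_mono_neutral_cong_left) (auto simp: Pi_def free_module_carrier free_module_simps)
qed

lemma lin_linear_ext:
  assumes "module k V" "f \<in> X \<rightarrow> carrier V"
  shows "linear_map k (free_module k X) V (linear_ext k V f)"
proof -
  interpret module k V by fact
  interpret F: module k "free_module k X" by (rule module_free) (rule is_cring)
  show ?thesis
  proof (rule linear_mapI)
    fix p assume p: "p <: (free_module k X)"
    then show "linear_ext k V f p <: V"
      unfolding linear_ext_def using assms(2) by (intro M.finsum_closed) (auto simp: Pi_def free_module_carrier)
    fix c assume c: "c <: k"
    have S: "finite {x. p x \<noteq> \<zero>\<^bsub>k\<^esub>}" "{x. p x \<noteq> \<zero>\<^bsub>k\<^esub>} \<subseteq> X" using p by (auto simp: free_module_carrier)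
    have fp: "(%x. p x \<odot>\<^bsub>V\<^esub> f x) \<in> {x. p x \<noteq> \<zero>\<^bsub>k\<^esub>} \<rightarrow> carrier V" using p assms(2) by (auto simp: Pi_def free_module_carrier)
    have "linear_ext k V f (c \<odot>\<^bsub>free_module k X\<^esub> p) =
        (\<Oplus>\<^bsub>V\<^esub>x\<in>{x. p x \<noteq> \<zero>\<^bsub>k\<^esub>}. (c \<odot>\<^bsub>free_module k X\<^esub> p) x \<odot>\<^bsub>V\<^esub> f x)"
      by (rule linear_ext_superset[OF assms(1) F.smult_closed[OF c p] assms(2) S]) (use c in \<open>auto simp: free_module_simps\<close>)
    also have "... = (\<Oplus>\<^bsub>V\<^esub>x\<in>{x. p x \<noteq> \<zero>\<^bsub>k\<^esub>}. c \<odot>\<^bsub>V\<^esub> (p x \<odot>\<^bsub>V\<^esub> f x))"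
      using p c assms(2) by (intro M.finsum_cong') (auto simp: free_module_simps smult_assoc1 Pi_def free_module_carrier subset_iff)
    also have "... = c \<odot>\<^bsub>V\<^esub> linear_ext k V f p"
      unfolding linear_ext_def by (rule finsum_smult_ldistr[symmetric, OF S(1) c fp])
    finally show "linear_ext k V f (c \<odot>\<^bsub>free_module k X\<^esub> p) = c \<odot>\<^bsub>V\<^esub> linear_ext k V f p" .
  next
    fix p q assume pq: "p <: (free_module k X)" "q <: (free_module k X)"
    define S where "S = {x. p x \<noteq> \<zero>\<^bsub>k\<^esub>} \<union> {x. q x \<noteq> \<zero>\<^bsub>k\<^esub>}"
    have S: "finite S" "S \<subseteq> X" using pq by (auto simp: S_def free_module_carrier)
    have "linear_ext k V f (p \<oplus>\<^bsub>free_module k X\<^esub> q) = (\<Oplus>\<^bsub>V\<^esub>x\<in>S. (p \<oplus>\<^bsub>free_module k X\<^esub> q) x \<odot>\<^bsub>V\<^esub> f x)"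
      by (rule linear_ext_superset[OF assms(1) F.a_closed[OF pq] assms(2) S]) (auto simp: S_def free_module_simps)
    also have "... = (\<Oplus>\<^bsub>V\<^esub>x\<in>S. p x \<odot>\<^bsub>V\<^esub> f x \<oplus>\<^bsub>V\<^esub> q x \<odot>\<^bsub>V\<^esub> f x)"
      using pq S assms(2) by (intro M.finsum_cong') (auto simp: free_module_simps smult_l_distr Pi_def free_module_carrier subset_iff)
    also have "... = (\<Oplus>\<^bsub>V\<^esub>x\<in>S. p x \<odot>\<^bsub>V\<^esub> f x) \<oplus>\<^bsub>V\<^esub> (\<Oplus>\<^bsub>V\<^esub>x\<in>S. q x \<odot>\<^bsub>V\<^esub> f x)"
      using pq S assms(2) by (intro M.finsum_addf) (auto simp: Pi_def free_module_carrier)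
    also have "(\<Oplus>\<^bsub>V\<^esub>x\<in>S. p x \<odot>\<^bsub>V\<^esub> f x) = linear_ext k V f p"
      by (rule linear_ext_superset[symmetric, OF assms(1) pq(1) assms(2) S]) (auto simp: S_def)
    also have "(\<Oplus>\<^bsub>V\<^esub>x\<in>S. q x \<odot>\<^bsub>V\<^esub> f x) = linear_ext k V f q"
      by (rule linear_ext_superset[symmetric, OF assms(1) pq(2) assms(2) S]) (auto simp: S_def)
    finally show "linear_ext k V f (p \<oplus>\<^bsub>free_module k X\<^esub> q) = linear_ext k V f p \<oplus>\<^bsub>V\<^esub> linear_ext k V f q" .
  qed
qed

lemma linear_ext_basis [simp]:
  assumes "module k V" "x \<in> X" "f \<in> X \<rightarrow> carrier V"
  shows "linear_ext k V f (basis_vec k x) = f x"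
proof -
  interpret module k V by fact
  have fx: "f x <: V" using assms by auto
  have "linear_ext k V f (basis_vec k x) = (\<Oplus>\<^bsub>V\<^esub>y\<in>{x}. basis_vec k x y \<odot>\<^bsub>V\<^esub> f y)"
    by (rule linear_ext_superset[OF assms(1) _ assms(3)]) (use assms(2) basis_vec_in[OF module_cring[OF assms(1)] assms(2)] in \<open>auto, auto simp: basis_vec_def split: if_splits\<close>)
  also have "... = f x" using fx by (simp add: basis_vec_def)
  finally show ?thesis .
qed

lemma free_module_linear_eq:
  assumes "module k V" "linear_map k (free_module k X) V f" "linear_map k (free_module k X) V g"
    and "!!x. x \<in> X ==> f (basis_vec k x) = g (basis_vec k x)" "p <: (free_module k X)"
  shows "f p = g p"
proof -
  note cr = module_cring[OF assms(1)]
  note F = module_free[OF cr, of X]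
  show ?thesis
  proof (rule free_module_induct[OF cr assms(5)])
    show "f \<zero>\<^bsub>free_module k X\<^esub> = g \<zero>\<^bsub>free_module k X\<^esub>"
      by (simp only: lin_zero[OF F assms(1,2)] lin_zero[OF F assms(1,3)])
  next
    fix p c x
    assume a: "p <: (free_module k X)" "c <: k" "x \<in> X" and IH: "f p = g p"
    have b: "basis_vec k x <: (free_module k X)" using cr a by simp
    show "f (p \<oplus>\<^bsub>free_module k X\<^esub> (c \<odot>\<^bsub>free_module k X\<^esub> basis_vec k x)) =
          g (p \<oplus>\<^bsub>free_module k X\<^esub> (c \<odot>\<^bsub>free_module k X\<^esub> basis_vec k x))"
      by (simp only: lin_add[OF assms(2) a(1) module_ops_closed(5)[OF F a(2) b]]
          lin_add[OF assms(3) a(1) module_ops_closed(5)[OF F a(2) b]]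
          lin_smult[OF assms(2) a(2) b] lin_smult[OF assms(3) a(2) b] IH assms(4)[OF a(3)])
  qed
qed


lemma linear_ext_cong:
  assumes "module k V" "p <: (free_module k X)" "g \<in> X \<rightarrow> carrier V" "!!x. x \<in> X ==> f x = g x"
  shows "linear_ext k V f p = linear_ext k V g p"
proof -
  interpret module k V by fact
  show ?thesis
    unfolding linear_ext_def using assms(2-4)
    by (intro M.finsum_cong') (auto simp: free_module_carrier subset_iff Pi_def)
qed

lemma linear_ext_linear:
  assumes "module k V" "module k W" "linear_map k V W g" "f \<in> X \<rightarrow> carrier V"
    and "p <: (free_module k X)"
  shows "g (linear_ext k V f p) = linear_ext k W (%x. g (f x)) p"
proof -
  have c: "(%x. g (f x)) \<in> X \<rightarrow> carrier W" using assms(4) lin_closed[OF assms(3)] by auto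
  show ?thesis
    by (rule free_module_linear_eq[OF assms(2) lin_comp[OF assms(3) lin_linear_ext[OF assms(1,4)]]
        lin_linear_ext[OF assms(2) c] _ assms(5)])
      (simp only: linear_ext_basis[OF assms(1) _ assms(4)] linear_ext_basis[OF assms(2) _ c])
qed

lemma linear_ext_addf:
  assumes "module k V" "f \<in> X \<rightarrow> carrier V" "g \<in> X \<rightarrow> carrier V" "p <: (free_module k X)"
  shows "linear_ext k V (%x. f x \<oplus>\<^bsub>V\<^esub> g x) p = linear_ext k V f p \<oplus>\<^bsub>V\<^esub> linear_ext k V g p"
proof -
  have c: "(%x. f x \<oplus>\<^bsub>V\<^esub> g x) \<in> X \<rightarrow> carrier V" using assms(2,3) module_ops_closed(2)[OF assms(1)] by auto
  show ?thesis
    by (rule free_module_linear_eq[OF assms(1) lin_linear_ext[OF assms(1) c]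
        lin_addf[OF assms(1) lin_linear_ext[OF assms(1,2)] lin_linear_ext[OF assms(1,3)]] _ assms(4)])
      (simp only: linear_ext_basis[OF assms(1) _ c] linear_ext_basis[OF assms(1) _ assms(2)] linear_ext_basis[OF assms(1) _ assms(3)])
qed

lemma linear_ext_smultf:
  assumes "module k V" "f \<in> X \<rightarrow> carrier V" "c <: k" "p <: (free_module k X)"
  shows "linear_ext k V (%x. c \<odot>\<^bsub>V\<^esub> f x) p = c \<odot>\<^bsub>V\<^esub> linear_ext k V f p"
  using linear_ext_linear[OF assms(1,1) lin_smultf[OF assms(1) lin_ident assms(3)] assms(2,4)]
  by simp

text \<open>Both sides are the same finite double sum; this is the source of all exchanges of sums over tensors.\<close>

lemma linear_ext_swap:
  assumes "module k V" "!!x y. [|x \<in> X; y \<in> Y|] ==> f x y <: V"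
    and p: "p <: (free_module k X)" and q: "q <: (free_module k Y)"
  shows "linear_ext k V (%x. linear_ext k V (f x) q) p = linear_ext k V (%y. linear_ext k V (%x. f x y) p) q"
proof (rule free_module_linear_eq[OF assms(1) _ _ _ p])
  have c: "f x \<in> Y \<rightarrow> carrier V" "linear_ext k V (f x) q <: V" if "x \<in> X" for x
    using assms(2)[OF that] lin_closed[OF lin_linear_ext[OF assms(1)] q] by auto
  have d: "(%x. f x y) \<in> X \<rightarrow> carrier V" if "y \<in> Y" for y using assms(2) that by auto
  note lin = lin_linear_ext[OF assms(1) d]
  show "linear_map k (free_module k X) V (linear_ext k V (%x. linear_ext k V (f x) q))"
    using c by (intro lin_linear_ext assms(1)) auto
  show "linear_map k (free_module k X) V (%p. linear_ext k V (%y. linear_ext k V (%x. f x y) p) q)"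
  proof (rule linear_mapI)
    fix p assume p: "p <: (free_module k X)"
    have e: "(%y. linear_ext k V (%x. f x y) p) \<in> Y \<rightarrow> carrier V"
      using lin_closed[OF lin p] by auto
    show "linear_ext k V (%y. linear_ext k V (%x. f x y) p) q <: V"
      by (rule lin_closed[OF lin_linear_ext[OF assms(1) e] q])
    { fix c assume c: "c <: k"
      show "linear_ext k V (%y. linear_ext k V (%x. f x y) (c \<odot>\<^bsub>free_module k X\<^esub> p)) q =
            c \<odot>\<^bsub>V\<^esub> linear_ext k V (%y. linear_ext k V (%x. f x y) p) q"
        unfolding linear_ext_smultf[OF assms(1) e c q, symmetric]
        using e by (intro linear_ext_cong[OF assms(1) q])
          (auto simp: lin_smult[OF lin c p] intro!: module_ops_closed[OF assms(1)] c) }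
    { fix p' assume p': "p' <: (free_module k X)"
      have e': "(%y. linear_ext k V (%x. f x y) p') \<in> Y \<rightarrow> carrier V"
        using lin_closed[OF lin p'] by auto
      show "linear_ext k V (%y. linear_ext k V (%x. f x y) (p \<oplus>\<^bsub>free_module k X\<^esub> p')) q =
            linear_ext k V (%y. linear_ext k V (%x. f x y) p) q \<oplus>\<^bsub>V\<^esub> linear_ext k V (%y. linear_ext k V (%x. f x y) p') q"
        unfolding linear_ext_addf[OF assms(1) e e' q, symmetric]
        using e e' by (intro linear_ext_cong[OF assms(1) q])
          (auto simp: lin_add[OF lin p p'] intro!: module_ops_closed[OF assms(1)]) }
  qed
next
  fix x assume x: "x \<in> X"
  have c: "linear_ext k V (f x) q <: V" if "x \<in> X" for x
    using assms(2)[OF that] by (intro lin_closed[OF lin_linear_ext[OF assms(1)] q]) auto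
  have "linear_ext k V (%y. linear_ext k V (%x. f x y) (basis_vec k x)) q = linear_ext k V (f x) q"
    using assms(2) x by (intro linear_ext_cong[OF assms(1) q])
      (auto intro!: linear_ext_basis[OF assms(1), of x X])
  then show "linear_ext k V (%x. linear_ext k V (f x) q) (basis_vec k x) =
      linear_ext k V (%y. linear_ext k V (%x. f x y) (basis_vec k x)) q"
    using linear_ext_basis[OF assms(1) x, of "%x. linear_ext k V (f x) q"] c by auto
qed

section \<open>Tensor products\<close>

text \<open>A sum over a tensor that remembers the two factors. It vanishes outside its intended domain, so
  that its value lies in \<open>X\<close> without further conditions and depends on \<open>f\<close> only through the
  values of \<open>f\<close> on the carriers.\<close>

definition tsumc ::
    "'k ring \<Rightarrow> ('k, 'v, 'm) module_scheme \<Rightarrow> ('k, 'w, 'n) module_scheme \<Rightarrow> ('k, 'x, 'l) module_scheme \<Rightarrow>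
     ('k, 'v, 'w) tensor \<Rightarrow> ('v \<Rightarrow> 'w \<Rightarrow> 'x) \<Rightarrow> 'x" where
  "tsumc k V W X t f =
     (if module k V \<and> module k W \<and> module k X \<and> t <: (tensor_module k V W) \<and> (\<forall>v\<in>carrier V. \<forall>w\<in>carrier W. f v w <: X)
      then tsum k X t f else \<zero>\<^bsub>X\<^esub>)"

definition bilinear_map ::
    "'k ring \<Rightarrow> ('k, 'v, 'm) module_scheme \<Rightarrow> ('k, 'w, 'n) module_scheme \<Rightarrow> ('k, 'x, 'l) module_scheme \<Rightarrow>
     ('v \<Rightarrow> 'w \<Rightarrow> 'x) \<Rightarrow> bool" where
  "bilinear_map k V W X f \<longleftrightarrow>
     (\<forall>v\<in>carrier V. linear_map k W X (%w. f v w)) \<and> (\<forall>w\<in>carrier W. linear_map k V X (%v. f v w))"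

lemma bilinear_mapI [intro?]:
  "[|!!v. v <: V ==> linear_map k W X (%w. f v w); !!w. w <: W ==> linear_map k V X (%v. f v w)|]
   ==> bilinear_map k V W X f"
  unfolding bilinear_map_def by blast

lemma tsum_eq_tsumc:
  "[|module k V; module k W; module k X; t <: (tensor_module k V W); !!v w. [|v <: V; w <: W|] ==> f v w <: X|]
   ==> tsum k X t f = tsumc k V W X t f"
  unfolding tsumc_def by auto

locale tensor_factors =
  fixes k :: "'k ring" and V :: "('k, 'v, 'm) module_scheme" and W :: "('k, 'w, 'n) module_scheme"
  assumes V: "module k V" and W: "module k W"
begin

abbreviation "Fr \<equiv> free_module k (carrier V \<times> carrier W)"
abbreviation "N \<equiv> tensor_null k V W"
abbreviation "T \<equiv> tensor_module k V W"

lemma cring_k: "cring k" using V by (rule module_cring)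

lemma module_Fr: "module k Fr" by (rule module_free[OF cring_k])

lemma basis_in: "[|v <: V; w <: W|] ==> basis_vec k (v, w) <: Fr"
  by (rule basis_vec_in[OF cring_k]) auto

lemma relations_subset: "bilinear_relations k V W \<subseteq> carrier Fr"
  unfolding bilinear_relations_def Let_def
  by (auto intro!: module_ops_closed[OF module_Fr] basis_in module_ops_closed[OF V] module_ops_closed[OF W])

lemma submodule_N: "submodule N k Fr"
  unfolding tensor_null_def by (rule submodule_span_submodule[OF module_Fr relations_subset])

lemma module_T: "module k T"
  unfolding tensor_module_def by (rule module_quot[OF module_Fr submodule_N])

lemma tens_closed: "[|v <: V; w <: W|] ==> tens k V W v w <: T"
  unfolding tens_def tensor_module_def quot_module_simps using basis_in by blast

text \<open>The representatives on which the linear extension of a bilinear map vanishes form a submodule that contains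
  the bilinear relations. This is the universal property of the tensor product.\<close>

lemma linear_ext_relation:
  assumes X: "module k X" and f: "bilinear_map k V W X f" and "p \<in> N"
  shows "linear_ext k X (%(v, w). f v w) p = \<zero>\<^bsub>X\<^esub>"
proof -
  interpret X: module k X by fact
  have l1: "linear_map k W X (%w. f v w)" if "v <: V" for v using f that by (simp add: bilinear_map_def)
  have l2: "linear_map k V X (%v. f v w)" if "w <: W" for w using f that by (simp add: bilinear_map_def)
  have c: "(%(v, w). f v w) \<in> carrier V \<times> carrier W \<rightarrow> carrier X" using lin_closed[OF l1] by auto
  note L = lin_linear_ext[OF X c]
  note b = linear_ext_basis[OF X _ c]
  note cl = basis_in module_ops_closed[OF V] module_ops_closed[OF W] module_ops_closed[OF module_Fr]
  have "submodule {p \<in> carrier Fr. linear_ext k X (%(v, w). f v w) p = \<zero>\<^bsub>X\<^esub>} k Fr"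
    by (rule equalizer_submodule[OF module_Fr X L lin_const_zero[OF X]])
  moreover have "bilinear_relations k V W \<subseteq> {p \<in> carrier Fr. linear_ext k X (%(v, w). f v w) p = \<zero>\<^bsub>X\<^esub>}"
  proof
    fix r assume r: "r \<in> bilinear_relations k V W"
    note m = lin_minus[OF module_Fr X L] lin_add[OF L] lin_smult[OF L]
    have "linear_ext k X (%(v, w). f v w) r = \<zero>\<^bsub>X\<^esub>"
      using r unfolding bilinear_relations_def Let_def
      by (auto simp only: Un_iff mem_Collect_eq)
        (simp_all add: m cl b lin_add[OF l1] lin_add[OF l2] lin_smult[OF l1]
          lin_smult[OF l2] lin_closed[OF l1] module_minus_eq_zero[OF X] module_ops_closed[OF X])
    then show "r \<in> {p \<in> carrier Fr. linear_ext k X (%(v, w). f v w) p = \<zero>\<^bsub>X\<^esub>}"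
      using r relations_subset by blast
  qed
  ultimately show ?thesis
    using assms(3) submodule_span_least unfolding tensor_null_def by blast
qed

lemma tsum_rep:
  assumes "t <: T"
  shows "(SOME p. p \<in> t) <: Fr" "t = N +>\<^bsub>Fr\<^esub> (SOME p. p \<in> t)"
  using coset_repr[OF module_Fr submodule_N assms[unfolded tensor_module_def]] by auto

lemma tsumc_rep:
  assumes "module k X" "!!v w. [|v <: V; w <: W|] ==> f v w <: X" "t <: T"
  shows "tsumc k V W X t f = linear_ext k X (%(v, w). f v w) (SOME p. p \<in> t)"
  using assms V W by (auto simp: tsumc_def tsum_def)

lemma tsumc_coset:
  assumes X: "module k X" and f: "bilinear_map k V W X f" and p: "p <: Fr"
  shows "tsumc k V W X (N +>\<^bsub>Fr\<^esub> p) f = linear_ext k X (%(v, w). f v w) p"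
proof -
  interpret X: module k X by fact
  have t: "N +>\<^bsub>Fr\<^esub> p <: T" unfolding tensor_module_def quot_module_simps using p by blast
  have l1: "linear_map k W X (%w. f v w)" if "v <: V" for v using f that by (simp add: bilinear_map_def)
  have c: "(%(v, w). f v w) \<in> carrier V \<times> carrier W \<rightarrow> carrier X" using lin_closed[OF l1] by auto
  note L = lin_linear_ext[OF X c]
  define q where "q = (SOME q. q \<in> N +>\<^bsub>Fr\<^esub> p)"
  have q: "q <: Fr" "N +>\<^bsub>Fr\<^esub> p = N +>\<^bsub>Fr\<^esub> q" unfolding q_def using tsum_rep[OF t] by auto
  have "q \<ominus>\<^bsub>Fr\<^esub> p \<in> N" using q coset_eq_iff[OF module_Fr submodule_N q(1) p] by simp
  then have "linear_ext k X (%(v, w). f v w) (q \<ominus>\<^bsub>Fr\<^esub> p) = \<zero>\<^bsub>X\<^esub>" by (rule linear_ext_relation[OF X f])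
  then have "linear_ext k X (%(v, w). f v w) q = linear_ext k X (%(v, w). f v w) p"
    using lin_minus[OF module_Fr X L q(1) p] lin_closed[OF L] q(1) p
    by (simp add: module_minus_eq_zero[OF X])
  then show ?thesis using tsumc_rep[OF X _ t, of f] lin_closed[OF l1] by (simp add: q_def)
qed

lemma lin_tens: "bilinear_map k V W T (tens k V W)"
proof -
  note b = basis_in module_ops_closed[OF V] module_ops_closed[OF W] module_ops_closed[OF module_Fr]
  have eq: "N +>\<^bsub>Fr\<^esub> p = N +>\<^bsub>Fr\<^esub> q" if "p <: Fr" "q <: Fr" "p \<ominus>\<^bsub>Fr\<^esub> q \<in> bilinear_relations k V W" for p q
    using coset_eq_iff[OF module_Fr submodule_N that(1,2)] subsetD[OF submodule_span_subset[of _ k Fr] that(3)]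
    unfolding tensor_null_def by simp
  note q = quot_module_add[OF module_Fr submodule_N] quot_module_smult[OF module_Fr submodule_N]
  show ?thesis
  proof
    fix v assume v: "v <: V"
    show "linear_map k W T (%w. tens k V W v w)"
    proof (rule linear_mapI)
      fix w w' assume w: "w <: W" "w' <: W"
      have "N +>\<^bsub>Fr\<^esub> basis_vec k (v, w \<oplus>\<^bsub>W\<^esub> w') = N +>\<^bsub>Fr\<^esub> (basis_vec k (v, w) \<oplus>\<^bsub>Fr\<^esub> basis_vec k (v, w'))"
        by (rule eq) (use v w in \<open>auto intro!: b simp: bilinear_relations_def Let_def\<close>)
      then show "tens k V W v (w \<oplus>\<^bsub>W\<^esub> w') = tens k V W v w \<oplus>\<^bsub>T\<^esub> tens k V W v w'"
        using v w by (simp add: tens_def tensor_module_def q b)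
    next
      fix c w assume w: "c <: k" "w <: W"
      have "N +>\<^bsub>Fr\<^esub> basis_vec k (v, c \<odot>\<^bsub>W\<^esub> w) = N +>\<^bsub>Fr\<^esub> (c \<odot>\<^bsub>Fr\<^esub> basis_vec k (v, w))"
        by (rule eq) (use v w in \<open>auto intro!: b simp: bilinear_relations_def Let_def\<close>)
      then show "tens k V W v (c \<odot>\<^bsub>W\<^esub> w) = c \<odot>\<^bsub>T\<^esub> tens k V W v w"
        using v w by (simp add: tens_def tensor_module_def q b)
    qed (rule tens_closed[OF v])
  next
    fix w assume w: "w <: W"
    show "linear_map k V T (%v. tens k V W v w)"
    proof (rule linear_mapI)
      fix v v' assume v: "v <: V" "v' <: V"
      have "N +>\<^bsub>Fr\<^esub> basis_vec k (v \<oplus>\<^bsub>V\<^esub> v', w) = N +>\<^bsub>Fr\<^esub> (basis_vec k (v, w) \<oplus>\<^bsub>Fr\<^esub> basis_vec k (v', w))"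
        by (rule eq) (use v w in \<open>auto intro!: b simp: bilinear_relations_def Let_def\<close>)
      then show "tens k V W (v \<oplus>\<^bsub>V\<^esub> v') w = tens k V W v w \<oplus>\<^bsub>T\<^esub> tens k V W v' w"
        using v w by (simp add: tens_def tensor_module_def q b)
    next
      fix c v assume v: "c <: k" "v <: V"
      have "N +>\<^bsub>Fr\<^esub> basis_vec k (c \<odot>\<^bsub>V\<^esub> v, w) = N +>\<^bsub>Fr\<^esub> (c \<odot>\<^bsub>Fr\<^esub> basis_vec k (v, w))"
        by (rule eq) (use v w in \<open>auto intro!: b simp: bilinear_relations_def Let_def\<close>)
      then show "tens k V W (c \<odot>\<^bsub>V\<^esub> v) w = c \<odot>\<^bsub>T\<^esub> tens k V W v w"
        using v w by (simp add: tens_def tensor_module_def q b)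
    qed (rule tens_closed[OF _ w])
  qed
qed

lemma lin_tsumc:
  assumes X: "module k X" and f: "bilinear_map k V W X f"
  shows "linear_map k T X (%t. tsumc k V W X t f)"
proof -
  have l1: "linear_map k W X (%w. f v w)" if "v <: V" for v using f that by (simp add: bilinear_map_def)
  have c: "(%(v, w). f v w) \<in> carrier V \<times> carrier W \<rightarrow> carrier X" using lin_closed[OF l1] by auto
  note L = lin_linear_ext[OF X c]
  note s = tsumc_coset[OF X f]
  note Fc = module_ops_closed[OF module_Fr]
  show ?thesis
    unfolding tensor_module_def
    by (rule linear_mapI; unfold quot_module_simps(1), elim imageE)
      (simp_all only: quot_module_add[OF module_Fr submodule_N] quot_module_smult[OF module_Fr submodule_N]
        s Fc lin_add[OF L] lin_smult[OF L] lin_closed[OF L])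
qed

lemma tsumc_tens:
  assumes X: "module k X" and f: "bilinear_map k V W X f" and "v <: V" "w <: W"
  shows "tsumc k V W X (tens k V W v w) f = f v w"
proof -
  have l1: "linear_map k W X (%w. f v w)" if "v <: V" for v using f that by (simp add: bilinear_map_def)
  have c: "(%(v, w). f v w) \<in> carrier V \<times> carrier W \<rightarrow> carrier X" using lin_closed[OF l1] by auto
  show ?thesis using tsumc_coset[OF X f basis_in[OF assms(3,4)]] linear_ext_basis[OF X _ c, of "(v, w)"] assms(3,4)
    by (simp add: tens_def)
qed

lemma tsumc_closed:
  assumes X: "module k X" shows "tsumc k V W X t f <: X"
proof (cases "t <: T \<and> (\<forall>v\<in>carrier V. \<forall>w\<in>carrier W. f v w <: X)")
  case True
  then have "linear_ext k X (%(v, w). f v w) (SOME p. p \<in> t) <: X"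
    by (intro lin_closed[OF lin_linear_ext[OF X] tsum_rep(1)]) auto
  then show ?thesis using True tsumc_rep[OF X, of f t] by simp
qed (use module_ops_closed(1)[OF X] in \<open>auto simp: tsumc_def\<close>)

lemma tsumc_linear:
  assumes X: "module k X" and Y: "module k Y" and g: "linear_map k X Y g"
    and f: "!!v w. [|v <: V; w <: W|] ==> f v w <: X"
  shows "g (tsumc k V W X t f) = tsumc k V W Y t (%v w. g (f v w))"
proof (cases "t <: T")
  case True
  have c: "(%(v, w). f v w) \<in> carrier V \<times> carrier W \<rightarrow> carrier X" using f by auto
  have "g (tsumc k V W X t f) = g (linear_ext k X (%(v, w). f v w) (SOME p. p \<in> t))"
    using tsumc_rep[OF X f True] by simp
  also have "... = linear_ext k Y (%x. g (case x of (v, w) \<Rightarrow> f v w)) (SOME p. p \<in> t)"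
    by (rule linear_ext_linear[OF X Y g c tsum_rep(1)[OF True]])
  also have "(%x. g (case x of (v, w) \<Rightarrow> f v w)) = (%(v, w). g (f v w))" by auto
  also have "linear_ext k Y ... (SOME p. p \<in> t) = tsumc k V W Y t (%v w. g (f v w))"
    using tsumc_rep[OF Y, of "%v w. g (f v w)" t] True f lin_closed[OF g] by simp
  finally show ?thesis .
qed (simp add: tsumc_def lin_zero[OF X Y g])

lemma tsumc_self: "t <: T ==> tsumc k V W T t (tens k V W) = t"
proof -
  assume t: "t <: T"
  define p where "p = (SOME p. p \<in> t)"
  have p: "p <: Fr" "t = N +>\<^bsub>Fr\<^esub> p" unfolding p_def using tsum_rep[OF t] by auto
  have c: "(%(v, w). tens k V W v w) \<in> carrier V \<times> carrier W \<rightarrow> carrier T" using tens_closed by auto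
  have q: "linear_map k Fr T (%x. N +>\<^bsub>Fr\<^esub> x)"
    unfolding tensor_module_def by (rule lin_coset[OF module_Fr submodule_N])
  have "tsumc k V W T t (tens k V W) = linear_ext k T (%(v, w). tens k V W v w) p"
    using tsumc_rep[OF module_T tens_closed t] by (simp add: p_def)
  also have "... = N +>\<^bsub>Fr\<^esub> p"
    by (rule free_module_linear_eq[OF module_T lin_linear_ext[OF module_T c] q _ p(1)])
      (subst linear_ext_basis[OF module_T _ c], assumption, auto simp: tens_def)
  finally show ?thesis using p(2) by simp
qed

end

lemma tsumc_cong:
  assumes eq: "!!v w. [|v <: V; w <: W|] ==> f v w = g v w"
  shows "tsumc k V W X t f = tsumc k V W X t g"
proof (cases "module k V \<and> module k W \<and> module k X \<and> t <: (tensor_module k V W) \<and>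
    (\<forall>v\<in>carrier V. \<forall>w\<in>carrier W. g v w <: X)")
  case True
  then interpret tensor_factors k V W by (simp add: tensor_factors_def)
  have "tsum k X t f = tsum k X t g"
    unfolding tsum_def using eq True by (intro linear_ext_cong[OF _ tsum_rep(1)]) auto
  then show ?thesis using eq by (simp add: tsumc_def)
qed (use eq in \<open>auto simp: tsumc_def\<close>)

text \<open>As a congruence rule this lets rewriting inside a sum use that the legs lie in their modules.\<close>

lemma tsumc_cong_simp [cong]:
  assumes "V = V'" "W = W'" "X = X'" "t = t'" "!!v w. [|v <: V'; w <: W'|] ==> f v w = g v w"
  shows "tsumc k V W X t f = tsumc k V' W' X' t' g"
  using tsumc_cong[of V' W' f g k X' t'] assms by simp

context tensor_factors
begin

lemma tensor_linear_eq:
  assumes X: "module k X" and f: "linear_map k T X f" and g: "linear_map k T X g"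
    and eq: "!!v w. [|v <: V; w <: W|] ==> f (tens k V W v w) = g (tens k V W v w)"
    and t: "t <: T"
  shows "f t = g t"
proof -
  have "f t = tsumc k V W X t (%v w. f (tens k V W v w))"
    using tsumc_linear[of T X f "tens k V W" t, OF module_T X f tens_closed] tsumc_self[OF t] by simp
  also have "... = tsumc k V W X t (%v w. g (tens k V W v w))"
    by (rule tsumc_cong[OF eq])
  also have "... = g t"
    using tsumc_linear[of T X g "tens k V W" t, OF module_T X g tens_closed] tsumc_self[OF t] by simp
  finally show ?thesis .
qed

lemma tsumc_add:
  assumes X: "module k X" and f: "!!v w. [|v <: V; w <: W|] ==> f v w <: X"
    and g: "!!v w. [|v <: V; w <: W|] ==> g v w <: X"
  shows "tsumc k V W X t (%v w. f v w \<oplus>\<^bsub>X\<^esub> g v w) = tsumc k V W X t f \<oplus>\<^bsub>X\<^esub> tsumc k V W X t g"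
proof (cases "t <: T")
  case True
  have c: "(%(v, w). f v w) \<in> carrier V \<times> carrier W \<rightarrow> carrier X" "(%(v, w). g v w) \<in> carrier V \<times> carrier W \<rightarrow> carrier X"
    using f g by auto
  have "(%(v, w). f v w \<oplus>\<^bsub>X\<^esub> g v w) = (%x. (case x of (v, w) \<Rightarrow> f v w) \<oplus>\<^bsub>X\<^esub> (case x of (v, w) \<Rightarrow> g v w))" by auto
  then show ?thesis
    using linear_ext_addf[OF X c tsum_rep(1)[OF True]] tsumc_rep[OF X f True] tsumc_rep[OF X g True]
      tsumc_rep[OF X, of "%v w. f v w \<oplus>\<^bsub>X\<^esub> g v w" t] f g True module_ops_closed(2)[OF X] by simp
next
  case False
  interpret X: module k X by fact
  show ?thesis using False by (simp add: tsumc_def)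
qed

lemma lin_tsumc_arg:
  assumes X: "module k X" and U: "module k U"
    and f: "!!v w. [|v <: V; w <: W|] ==> linear_map k U X (%u. f u v w)"
  shows "linear_map k U X (%u. tsumc k V W X t (f u))"
proof (rule linear_mapI)
  fix u assume u: "u <: U"
  note c = lin_closed[OF f]
  show "tsumc k V W X t (f u) <: X" by (rule tsumc_closed[OF X])
  { fix u' assume u': "u' <: U"
    show "tsumc k V W X t (f (u \<oplus>\<^bsub>U\<^esub> u')) = tsumc k V W X t (f u) \<oplus>\<^bsub>X\<^esub> tsumc k V W X t (f u')"
      by (subst tsumc_add[OF X c[OF _ _ u] c[OF _ _ u'], symmetric])
        (assumption | rule tsumc_cong[OF lin_add[OF f u u']])+ }
  { fix a assume a: "a <: k"
    show "tsumc k V W X t (f (a \<odot>\<^bsub>U\<^esub> u)) = a \<odot>\<^bsub>X\<^esub> tsumc k V W X t (f u)"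
      by (subst tsumc_linear[OF X X lin_smultf[OF X lin_ident a] c[OF _ _ u]])
        (assumption | rule tsumc_cong[OF lin_smult[OF f a u]])+ }
qed

end

text \<open>Independent sums commute, by the corresponding fact on representatives.\<close>

lemma tsumc_exchange:
  assumes V: "module k V" and W: "module k W" and V': "module k V'" and W': "module k W'" and X: "module k X"
    and f: "!!v w v' w'. [|v <: V; w <: W; v' <: V'; w' <: W'|] ==> f v w v' w' <: X"
  shows "tsumc k V W X s (%v w. tsumc k V' W' X t (f v w)) = tsumc k V' W' X t (%v' w'. tsumc k V W X s (%v w. f v w v' w'))"
proof (cases "s <: (tensor_module k V W) \<and> t <: (tensor_module k V' W')")
  interpret A: tensor_factors k V W using V W by (rule tensor_factors.intro)
  interpret B: tensor_factors k V' W' using V' W' by (rule tensor_factors.intro)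
  interpret X: module k X by fact
  case True
  define p q where "p = (SOME p. p \<in> s)" and "q = (SOME q. q \<in> t)"
  have p: "p <: A.Fr" and q: "q <: B.Fr" unfolding p_def q_def
    using A.tsum_rep B.tsum_rep True by auto
  have cl: "linear_ext k X (%y. f v w (fst y) (snd y)) q <: X" if "v <: V" "w <: W" for v w
    by (rule lin_closed[OF lin_linear_ext[OF X] q]) (use that f in auto)
  have "tsumc k V W X s (%v w. tsumc k V' W' X t (f v w)) =
      linear_ext k X (%x. tsumc k V' W' X t (f (fst x) (snd x))) p"
    using A.tsumc_rep[OF X, of "%v w. tsumc k V' W' X t (f v w)" s] B.tsumc_closed[OF X] True
    by (simp add: p_def case_prod_unfold)
  also have "... = linear_ext k X (%x. linear_ext k X (%y. f (fst x) (snd x) (fst y) (snd y)) q) p"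
    using f True cl by (intro linear_ext_cong[OF X p])
      (auto simp: B.tsumc_rep[OF X] q_def[symmetric] case_prod_unfold)
  also have "... = linear_ext k X (%y. linear_ext k X (%x. f (fst x) (snd x) (fst y) (snd y)) p) q"
    by (rule linear_ext_swap[OF X _ p q]) (use f in auto)
  also have "... = linear_ext k X (%y. tsumc k V W X s (%v w. f v w (fst y) (snd y))) q"
    using f True A.tsumc_closed[OF X] by (intro linear_ext_cong[OF X q])
      (auto simp: A.tsumc_rep[OF X] p_def case_prod_unfold)
  also have "... = tsumc k V' W' X t (%v' w'. tsumc k V W X s (%v w. f v w v' w'))"
    using B.tsumc_rep[OF X, of "%v' w'. tsumc k V W X s (%v w. f v w v' w')" t] A.tsumc_closed[OF X] True
    by (simp add: q_def case_prod_unfold)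
  finally show ?thesis .
next
  interpret A: tensor_factors k V W using V W by (rule tensor_factors.intro)
  interpret B: tensor_factors k V' W' using V' W' by (rule tensor_factors.intro)
  case False
  have z: "tsumc k V W X u (%v w. \<zero>\<^bsub>X\<^esub>) = \<zero>\<^bsub>X\<^esub>" for u
    using A.tsumc_linear[OF X X lin_const_zero[OF X], of "%v w. \<zero>\<^bsub>X\<^esub>" u] module_ops_closed(1)[OF X] by simp
  have z': "tsumc k V' W' X u (%v w. \<zero>\<^bsub>X\<^esub>) = \<zero>\<^bsub>X\<^esub>" for u
    using B.tsumc_linear[OF X X lin_const_zero[OF X], of "%v w. \<zero>\<^bsub>X\<^esub>" u] module_ops_closed(1)[OF X] by simp
  consider "s \<notin> carrier (tensor_module k V W)" | "t \<notin> carrier (tensor_module k V' W')" using False by blast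
  then show ?thesis
  proof cases
    case 1
    then have "tsumc k V W X s g = \<zero>\<^bsub>X\<^esub>" for g by (simp add: tsumc_def)
    then show ?thesis by (simp add: z')
  next
    case 2
    then have "tsumc k V' W' X t g = \<zero>\<^bsub>X\<^esub>" for g by (simp add: tsumc_def)
    then show ?thesis by (simp add: z)
  qed
qed

section \<open>Calculus of sums over tensors\<close>

definition same_module ::
    "('k, 'v, 'm) module_scheme \<Rightarrow> ('k, 'v, 'n) module_scheme \<Rightarrow> bool" where
  "same_module V V' \<longleftrightarrow>
     carrier V = carrier V' \<and> add V = add V' \<and> zero V = zero V' \<and> smult V = smult V'"

text \<open>The constructions on modules depend only on four record fields. Algebras, twisted algebras and modules with
  action built on the same module therefore share their tensor products, and rewriting can bring all of them to
  one form.\<close>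

lemma same_module_module:
  assumes "same_module V V'" "module k V" shows "module k V'"
proof -
  interpret module k V by fact
  have e: "carrier V' = carrier V" "add V' = add V" "zero V' = zero V" "smult V' = smult V"
    using assms(1) by (simp_all add: same_module_def)
  show ?thesis
    by (rule moduleI[OF is_cring abelian_groupI])
      (auto simp: e M.a_ac smult_l_distr smult_r_distr smult_assoc1 intro: bexI[of _ "\<ominus>\<^bsub>V\<^esub> x" for x] M.l_neg)
qed

lemma same_module_sym: "same_module V V' ==> same_module V' V"
  by (simp add: same_module_def)

lemma same_module_a_inv: "same_module V V' ==> a_inv V = a_inv V'"
  by (simp add: same_module_def a_inv_def m_inv_def fun_eq_iff)

lemma same_module_a_minus: "same_module V V' ==> a_minus V = a_minus V'"
  by (simp add: same_module_a_inv[of V V'] a_minus_def fun_eq_iff) (simp add: same_module_def)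

lemma same_module_linear_map:
  "same_module V V' ==> linear_map k V W f = linear_map k V' W f"
  "same_module V V' ==> linear_map k U V g = linear_map k U V' g"
  by (simp_all add: linear_map_def same_module_def)

lemma same_module_tensor_module:
  assumes "same_module V V'"
  shows "tensor_module k V W = tensor_module k V' W" "tensor_module k U V = tensor_module k U V'"
    "tens k V W = tens k V' W" "tens k U V = tens k U V'"
  using assms unfolding tensor_module_def tens_def tensor_null_def bilinear_relations_def same_module_def Let_def
  by (simp_all add: fun_eq_iff)

lemma finprod_mult_cong:
  "[|carrier G = carrier G'; mult G = mult G'; one G = one G'|] ==> finprod G f S = finprod G' f S"
  by (simp add: finprod_def)

lemma same_module_finsum: "same_module V V' ==> finsum V f S = finsum V' f S"
  unfolding finsum_def by (intro finprod_mult_cong) (auto simp: same_module_def)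

lemma same_module_tsum:
  assumes "same_module V V'" shows "tsum k V = tsum k V'"
proof -
  have "smult V = smult V'" using assms by (simp add: same_module_def)
  then show ?thesis
    by (simp add: fun_eq_iff tsum_def linear_ext_def same_module_finsum[OF assms])
qed

lemma same_module_tsumc:
  assumes "same_module V V'"
  shows "tsumc k V W X t f = tsumc k V' W X t f" "tsumc k U V Y s g = tsumc k U V' Y s g"
    "tsumc k Z Z' V r h = tsumc k Z Z' V' r h"
proof -
  have m: "module k V = module k V'" using same_module_module[OF assms] same_module_module[OF same_module_sym[OF assms]] by blast
  have c: "carrier V = carrier V'" "zero V = zero V'" using assms by (simp_all add: same_module_def)
  show "tsumc k V W X t f = tsumc k V' W X t f" "tsumc k U V Y s g = tsumc k U V' Y s g"
    "tsumc k Z Z' V r h = tsumc k Z Z' V' r h"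
    unfolding tsumc_def same_module_tensor_module[OF assms] same_module_tsum[OF assms] m c by rule+
qed

lemmas same_module_cong = same_module_tensor_module same_module_tsum same_module_tsumc
  same_module_linear_map

locale ground =
  fixes k :: "'k ring"
  assumes cring_k: "cring k"
begin

lemmas ops_closed [simp] = module_ops_closed[of k]

lemma module_self_module [simp]: "module k (self_module k)"
  by (rule module_self[OF cring_k])

lemma ground_closed [simp]:
  "\<one>\<^bsub>k\<^esub> <: k" "\<zero>\<^bsub>k\<^esub> <: k"
  "[|a <: k; b <: k|] ==> a \<otimes>\<^bsub>k\<^esub> b <: k"
  "[|a <: k; b <: k|] ==> a \<oplus>\<^bsub>k\<^esub> b <: k"
  using cring_k by (simp_all add: cring_def ring.ring_simprules)

lemma smult_rules:
  assumes "module k V"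
  shows "x <: V ==> \<one>\<^bsub>k\<^esub> \<odot>\<^bsub>V\<^esub> x = x"
    and "[|a <: k; b <: k; x <: V|] ==> a \<odot>\<^bsub>V\<^esub> (b \<odot>\<^bsub>V\<^esub> x) = (a \<otimes>\<^bsub>k\<^esub> b) \<odot>\<^bsub>V\<^esub> x"
    and "x <: V ==> \<zero>\<^bsub>k\<^esub> \<odot>\<^bsub>V\<^esub> x = \<zero>\<^bsub>V\<^esub>"
    and "a <: k ==> a \<odot>\<^bsub>V\<^esub> \<zero>\<^bsub>V\<^esub> = \<zero>\<^bsub>V\<^esub>"
proof -
  interpret module k V by fact
  show "x <: V ==> \<one>\<^bsub>k\<^esub> \<odot>\<^bsub>V\<^esub> x = x" by simp
  show "[|a <: k; b <: k; x <: V|] ==> a \<odot>\<^bsub>V\<^esub> (b \<odot>\<^bsub>V\<^esub> x) = (a \<otimes>\<^bsub>k\<^esub> b) \<odot>\<^bsub>V\<^esub> x"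
    by (simp add: smult_assoc1)
  show "x <: V ==> \<zero>\<^bsub>k\<^esub> \<odot>\<^bsub>V\<^esub> x = \<zero>\<^bsub>V\<^esub>" by simp
  show "a <: k ==> a \<odot>\<^bsub>V\<^esub> \<zero>\<^bsub>V\<^esub> = \<zero>\<^bsub>V\<^esub>" by simp
qed

lemmas smult_one_zero [simp] = smult_rules(1,3,4)

lemma tensor_factorsI: "[|module k V; module k W|] ==> tensor_factors k V W"
  by (rule tensor_factors.intro)

lemma module_tensor [simp]: "[|module k V; module k W|] ==> module k (tensor_module k V W)"
  by (rule tensor_factors.module_T[OF tensor_factorsI])

lemma tens_closed [simp]:
  "[|module k V; module k W; v <: V; w <: W|] ==> tens k V W v w <: (tensor_module k V W)"
  by (rule tensor_factors.tens_closed[OF tensor_factorsI])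

lemma lin_tens_left:
  assumes "module k V" "module k W" "w <: W"
  shows "linear_map k V (tensor_module k V W) (%v. tens k V W v w)"
  using tensor_factors.lin_tens[OF tensor_factorsI[OF assms(1,2)]] assms(3)
  by (simp add: bilinear_map_def)

lemma lin_tens_right:
  assumes "module k V" "module k W" "v <: V"
  shows "linear_map k W (tensor_module k V W) (%w. tens k V W v w)"
  using tensor_factors.lin_tens[OF tensor_factorsI[OF assms(1,2)]] assms(3)
  by (simp add: bilinear_map_def)

lemma lin_tens1 [simp]:
  "[|module k V; module k W; linear_map k U V g; w <: W|]
   ==> linear_map k U (tensor_module k V W) (%u. tens k V W (g u) w)"
  by (rule lin_comp[OF lin_tens_left])

lemma lin_tens2 [simp]:
  "[|module k V; module k W; linear_map k U W g; v <: V|]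
   ==> linear_map k U (tensor_module k V W) (%u. tens k V W v (g u))"
  by (rule lin_comp[OF lin_tens_right])

lemma tsumc_closed [simp]:
  "[|module k V; module k W; module k X|] ==> tsumc k V W X t f <: X"
  by (rule tensor_factors.tsumc_closed[OF tensor_factorsI])

lemma lin_tsumc_arg [simp]:
  "[|module k V; module k W; module k X; module k U;
    !!v w. [|v <: V; w <: W|] ==> linear_map k U X (%u. f u v w)|]
   ==> linear_map k U X (%u. tsumc k V W X t (%v w. f u v w))"
  by (rule tensor_factors.lin_tsumc_arg[OF tensor_factorsI])

lemma lin_tsumc_tensor [simp]:
  assumes "module k V" "module k W" "module k X" "linear_map k U (tensor_module k V W) g"
    and "!!v. v <: V ==> linear_map k W X (%w. f v w)" "!!w. w <: W ==> linear_map k V X (%v. f v w)"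
  shows "linear_map k U X (%u. tsumc k V W X (g u) f)"
  by (rule lin_comp[OF tensor_factors.lin_tsumc[OF tensor_factorsI[OF assms(1,2)] assms(3)] assms(4)])
    (rule bilinear_mapI; rule assms(5,6))

lemma tsumc_tens [simp]:
  assumes "module k V" "module k W" "module k X" "v <: V" "w <: W"
    and "!!v. v <: V ==> linear_map k W X (%w. f v w)" "!!w. w <: W ==> linear_map k V X (%v. f v w)"
  shows "tsumc k V W X (tens k V W v w) f = f v w"
  by (rule tensor_factors.tsumc_tens[OF tensor_factorsI[OF assms(1,2)] assms(3) _ assms(4,5)])
    (rule bilinear_mapI; rule assms(6,7))

lemma linear_tsumc:
  "[|linear_map k X Y g; module k V; module k W; module k X; module k Y;
    !!v w. [|v <: V; w <: W|] ==> f v w <: X|]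
   ==> g (tsumc k V W X t f) = tsumc k V W Y t (%v w. g (f v w))"
  by (rule tensor_factors.tsumc_linear[OF tensor_factorsI])

lemma tsumc_self [simp]:
  "[|module k V; module k W; t <: (tensor_module k V W)|]
   ==> tsumc k V W (tensor_module k V W) t (%v w. tens k V W v w) = t"
  using tensor_factors.tsumc_self[OF tensor_factorsI] by fastforce

lemma bilinear_comp:
  assumes "!!v. v <: V ==> linear_map k W X (%w. f v w)" "!!w. w <: W ==> linear_map k V X (%v. f v w)"
  shows "[|w <: W; linear_map k U V g|] ==> linear_map k U X (%u. f (g u) w)"
    and "[|v <: V; linear_map k U W h|] ==> linear_map k U X (%u. f v (h u))"
  by (rule lin_comp[OF assms(2)]; assumption) (rule lin_comp[OF assms(1)]; assumption)

lemma tensor_linear_eq: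
  assumes "t <: (tensor_module k V W)" "module k V" "module k W" "module k X"
    and "linear_map k (tensor_module k V W) X f" "linear_map k (tensor_module k V W) X g"
    and "!!v w. [|v <: V; w <: W|] ==> f (tens k V W v w) = g (tens k V W v w)"
  shows "f t = g t"
  by (rule tensor_factors.tensor_linear_eq[OF tensor_factorsI[OF assms(2,3)] assms(4-7,1)])

text \<open>Linear operations are moved inside sums; this direction gives every expression a normal form with the sums
  outermost.\<close>

lemma tsumc_push [simp]:
  assumes "module k V" "module k W" "module k X"
    and "!!v w. [|v <: V; w <: W|] ==> f v w <: X"
  shows "c <: k ==> c \<odot>\<^bsub>X\<^esub> tsumc k V W X t f = tsumc k V W X t (%v w. c \<odot>\<^bsub>X\<^esub> f v w)"
    and "[|module k Z; z <: Z|] ==> tens k Z X z (tsumc k V W X t f) =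
        tsumc k V W (tensor_module k Z X) t (%v w. tens k Z X z (f v w))"
    and "[|module k Y; y <: Y|] ==> tens k X Y (tsumc k V W X t f) y =
        tsumc k V W (tensor_module k X Y) t (%v w. tens k X Y (f v w) y)"
    and "\<ominus>\<^bsub>X\<^esub> (tsumc k V W X t f) = tsumc k V W X t (%v w. \<ominus>\<^bsub>X\<^esub> f v w)"
proof -
  note a = linear_tsumc[OF _ assms(1-3) _ assms(4)]
  show "c <: k ==> c \<odot>\<^bsub>X\<^esub> tsumc k V W X t f = tsumc k V W X t (%v w. c \<odot>\<^bsub>X\<^esub> f v w)"
    by (rule a) (use assms in simp_all)
  show "[|module k Z; z <: Z|] ==> tens k Z X z (tsumc k V W X t f) =
        tsumc k V W (tensor_module k Z X) t (%v w. tens k Z X z (f v w))"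
    by (rule a) (use assms in simp_all)
  show "[|module k Y; y <: Y|] ==> tens k X Y (tsumc k V W X t f) y =
        tsumc k V W (tensor_module k X Y) t (%v w. tens k X Y (f v w) y)"
    by (rule a) (use assms in simp_all)
  show "\<ominus>\<^bsub>X\<^esub> (tsumc k V W X t f) = tsumc k V W X t (%v w. \<ominus>\<^bsub>X\<^esub> f v w)"
    by (rule a) (use assms in simp_all)
qed

lemma tsumc_tsumc [simp]:
  assumes "module k A" "module k B" "module k V" "module k W" "module k X"
    and "!!v. v <: V ==> linear_map k W X (%w. f v w)" "!!w. w <: W ==> linear_map k V X (%v. f v w)"
    and "!!a b. [|a <: A; b <: B|] ==> F a b <: (tensor_module k V W)"
  shows "tsumc k V W X (tsumc k A B (tensor_module k V W) s F) f = tsumc k A B X s (%a b. tsumc k V W X (F a b) f)"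
  by (rule linear_tsumc) (use assms in simp_all)

lemma tsumc_addf:
  "[|module k V; module k W; module k X;
    !!v w. [|v <: V; w <: W|] ==> f v w <: X; !!v w. [|v <: V; w <: W|] ==> g v w <: X|]
   ==> tsumc k V W X t (%v w. f v w \<oplus>\<^bsub>X\<^esub> g v w) = tsumc k V W X t f \<oplus>\<^bsub>X\<^esub> tsumc k V W X t g"
  by (rule tensor_factors.tsumc_add[OF tensor_factorsI])

lemma tsumc_add_tensor:
  assumes "module k V" "module k W" "module k X" "s <: (tensor_module k V W)" "t <: (tensor_module k V W)"
    and "!!v. v <: V ==> linear_map k W X (%w. f v w)" "!!w. w <: W ==> linear_map k V X (%v. f v w)"
  shows "tsumc k V W X (s \<oplus>\<^bsub>tensor_module k V W\<^esub> t) f = tsumc k V W X s f \<oplus>\<^bsub>X\<^esub> tsumc k V W X t f"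
  by (rule lin_add[of k "tensor_module k V W" X "%t. tsumc k V W X t f"]) (use assms in simp_all)

lemma tsumc_zero [simp]:
  "[|module k V; module k W; module k X|] ==> tsumc k V W X t (%v w. \<zero>\<^bsub>X\<^esub>) = \<zero>\<^bsub>X\<^esub>"
  using tensor_factors.tsumc_linear[OF tensor_factorsI, of V W X X "%x. \<zero>\<^bsub>X\<^esub>" "%v w. \<zero>\<^bsub>X\<^esub>" t] by simp

lemma tsumc_swap:
  assumes "module k V" "module k W" "module k V'" "module k W'" "module k X"
    and "!!v w v' w'. [|v <: V; w <: W; v' <: V'; w' <: W'|] ==> f v w v' w' <: X"
  shows "tsumc k V W X s (%v w. tsumc k V' W' X t (f v w)) = tsumc k V' W' X t (%v' w'. tsumc k V W X s (%v w. f v w v' w'))"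
  by (rule tsumc_exchange) (use assms in auto)

section \<open>Algebras and their tensor products\<close>

lemma k_algebraD:
  assumes "k_algebra k A"
  shows k_algebra_module: "module k A" and k_algebra_ring: "ring A"
  using assms by (simp_all add: k_algebra_def)

lemma alg_simps [simp]:
  assumes "k_algebra k A"
  shows "module k A" "\<one>\<^bsub>A\<^esub> <: A" "[|x <: A; y <: A|] ==> x \<otimes>\<^bsub>A\<^esub> y <: A"
    "x <: A ==> \<one>\<^bsub>A\<^esub> \<otimes>\<^bsub>A\<^esub> x = x" "x <: A ==> x \<otimes>\<^bsub>A\<^esub> \<one>\<^bsub>A\<^esub> = x"
    "[|c <: k; x <: A; y <: A|] ==> (c \<odot>\<^bsub>A\<^esub> x) \<otimes>\<^bsub>A\<^esub> y = c \<odot>\<^bsub>A\<^esub> (x \<otimes>\<^bsub>A\<^esub> y)"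
    "[|c <: k; x <: A; y <: A|] ==> x \<otimes>\<^bsub>A\<^esub> (c \<odot>\<^bsub>A\<^esub> y) = c \<odot>\<^bsub>A\<^esub> (x \<otimes>\<^bsub>A\<^esub> y)"
    "x <: A ==> \<zero>\<^bsub>A\<^esub> \<otimes>\<^bsub>A\<^esub> x = \<zero>\<^bsub>A\<^esub>" "x <: A ==> x \<otimes>\<^bsub>A\<^esub> \<zero>\<^bsub>A\<^esub> = \<zero>\<^bsub>A\<^esub>"
proof -
  interpret ring A using assms by (rule k_algebra_ring)
  show "module k A" "\<one>\<^bsub>A\<^esub> <: A" "[|x <: A; y <: A|] ==> x \<otimes>\<^bsub>A\<^esub> y <: A"
    "x <: A ==> \<one>\<^bsub>A\<^esub> \<otimes>\<^bsub>A\<^esub> x = x" "x <: A ==> x \<otimes>\<^bsub>A\<^esub> \<one>\<^bsub>A\<^esub> = x"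
    "[|c <: k; x <: A; y <: A|] ==> (c \<odot>\<^bsub>A\<^esub> x) \<otimes>\<^bsub>A\<^esub> y = c \<odot>\<^bsub>A\<^esub> (x \<otimes>\<^bsub>A\<^esub> y)"
    "[|c <: k; x <: A; y <: A|] ==> x \<otimes>\<^bsub>A\<^esub> (c \<odot>\<^bsub>A\<^esub> y) = c \<odot>\<^bsub>A\<^esub> (x \<otimes>\<^bsub>A\<^esub> y)"
    "x <: A ==> \<zero>\<^bsub>A\<^esub> \<otimes>\<^bsub>A\<^esub> x = \<zero>\<^bsub>A\<^esub>" "x <: A ==> x \<otimes>\<^bsub>A\<^esub> \<zero>\<^bsub>A\<^esub> = \<zero>\<^bsub>A\<^esub>"
    using assms by (auto simp: k_algebra_def)
qed

lemma alg_rules: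
  assumes "k_algebra k A"
  shows alg_assoc: "[|x <: A; y <: A; z <: A|] ==> x \<otimes>\<^bsub>A\<^esub> y \<otimes>\<^bsub>A\<^esub> z = x \<otimes>\<^bsub>A\<^esub> (y \<otimes>\<^bsub>A\<^esub> z)"
    and alg_l_distr: "[|x <: A; y <: A; z <: A|] ==> (x \<oplus>\<^bsub>A\<^esub> y) \<otimes>\<^bsub>A\<^esub> z = x \<otimes>\<^bsub>A\<^esub> z \<oplus>\<^bsub>A\<^esub> y \<otimes>\<^bsub>A\<^esub> z"
    and alg_r_distr: "[|x <: A; y <: A; z <: A|] ==> z \<otimes>\<^bsub>A\<^esub> (x \<oplus>\<^bsub>A\<^esub> y) = z \<otimes>\<^bsub>A\<^esub> x \<oplus>\<^bsub>A\<^esub> z \<otimes>\<^bsub>A\<^esub> y"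
  using k_algebra_ring[OF assms] by (simp_all add: ring.ring_simprules)

lemma alg_minus_mult:
  assumes "k_algebra k A" "x <: A" "y <: A"
  shows "(\<ominus>\<^bsub>A\<^esub> x) \<otimes>\<^bsub>A\<^esub> y = \<ominus>\<^bsub>A\<^esub> (x \<otimes>\<^bsub>A\<^esub> y)" "x \<otimes>\<^bsub>A\<^esub> (\<ominus>\<^bsub>A\<^esub> y) = \<ominus>\<^bsub>A\<^esub> (x \<otimes>\<^bsub>A\<^esub> y)"
  using k_algebra_ring[OF assms(1)] assms(2,3) by (simp_all add: ring.l_minus ring.r_minus)

lemma lin_mult1 [simp]:
  assumes "k_algebra k A" "linear_map k U A g" "a <: A"
  shows "linear_map k U A (%u. g u \<otimes>\<^bsub>A\<^esub> a)"
  by (rule lin_comp[OF _ assms(2)], rule linear_mapI)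
    (use assms(1,3) in \<open>auto simp: alg_l_distr\<close>)

lemma lin_mult2 [simp]:
  assumes "k_algebra k A" "linear_map k U A g" "a <: A"
  shows "linear_map k U A (%u. a \<otimes>\<^bsub>A\<^esub> g u)"
  by (rule lin_comp[OF _ assms(2)], rule linear_mapI)
    (use assms(1,3) in \<open>auto simp: alg_r_distr\<close>)

lemma tsumc_mult [simp]:
  assumes "k_algebra k A" "module k V" "module k W"
    and "!!v w. [|v <: V; w <: W|] ==> f v w <: A" "a <: A"
  shows "a \<otimes>\<^bsub>A\<^esub> tsumc k V W A t f = tsumc k V W A t (%v w. a \<otimes>\<^bsub>A\<^esub> f v w)"
    and "tsumc k V W A t f \<otimes>\<^bsub>A\<^esub> a = tsumc k V W A t (%v w. f v w \<otimes>\<^bsub>A\<^esub> a)"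
  by (rule linear_tsumc; use assms in simp)+

lemma k_algebraI:
  assumes "module k A" "\<one>\<^bsub>A\<^esub> <: A"
    and "!!x. x <: A ==> linear_map k A A (%y. x \<otimes>\<^bsub>A\<^esub> y)"
    and "!!y. y <: A ==> linear_map k A A (%x. x \<otimes>\<^bsub>A\<^esub> y)"
    and "!!x y z. [|x <: A; y <: A; z <: A|] ==> x \<otimes>\<^bsub>A\<^esub> y \<otimes>\<^bsub>A\<^esub> z = x \<otimes>\<^bsub>A\<^esub> (y \<otimes>\<^bsub>A\<^esub> z)"
    and "!!x. x <: A ==> \<one>\<^bsub>A\<^esub> \<otimes>\<^bsub>A\<^esub> x = x" "!!x. x <: A ==> x \<otimes>\<^bsub>A\<^esub> \<one>\<^bsub>A\<^esub> = x"
  shows "k_algebra k A"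
proof -
  have "ring A"
    by (rule ringI[OF module_abelian_group[OF assms(1)] monoidI])
      (simp_all only: assms(2,5,6,7) lin_closed[OF assms(3)] lin_add[OF assms(3)] lin_add[OF assms(4)])
  then show ?thesis
    unfolding k_algebra_def using assms(1) lin_smult[OF assms(3)] lin_smult[OF assms(4)] by blast
qed

abbreviation tpa where "tpa A C \<equiv> tensor_product_algebra k A C"

lemma tpa_simps [simp]:
  "carrier (tpa A C) = carrier (tensor_module k A C)" "zero (tpa A C) = zero (tensor_module k A C)"
  "add (tpa A C) = add (tensor_module k A C)" "smult (tpa A C) = smult (tensor_module k A C)"
  "one (tpa A C) = tens k A C \<one>\<^bsub>A\<^esub> \<one>\<^bsub>C\<^esub>"
  by (simp_all add: tensor_product_algebra_def Let_def)

lemma same_tpa: "same_module (tpa A C) (tensor_module k A C)"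
  by (simp add: same_module_def)

lemmas tpa_cong [simp] = same_module_cong[OF same_tpa]

lemma module_tpa [simp]: "[|module k A; module k C|] ==> module k (tpa A C)"
  by (rule same_module_module[OF same_module_sym[OF same_tpa]]) simp

lemma tpa_mult:
  assumes "k_algebra k A" "k_algebra k C" "s <: (tensor_module k A C)" "t <: (tensor_module k A C)"
  shows "s \<otimes>\<^bsub>tpa A C\<^esub> t = tsumc k A C (tensor_module k A C) s (%a c.
    tsumc k A C (tensor_module k A C) t (%a' c'. tens k A C (a \<otimes>\<^bsub>A\<^esub> a') (c \<otimes>\<^bsub>C\<^esub> c')))"
proof -
  have "tsum k (tensor_module k A C) t (%a' c'. tens k A C (a \<otimes>\<^bsub>A\<^esub> a') (c \<otimes>\<^bsub>C\<^esub> c')) =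
    tsumc k A C (tensor_module k A C) t (%a' c'. tens k A C (a \<otimes>\<^bsub>A\<^esub> a') (c \<otimes>\<^bsub>C\<^esub> c'))" 
    if "a <: A" "c <: C" for a c
    using assms that by (intro tsum_eq_tsumc) auto
  then show ?thesis using assms
    by (simp add: tensor_product_algebra_def Let_def) (subst tsum_eq_tsumc[of k A C], auto intro!: tsumc_cong)
qed

lemma tpa_mult_tens:
  assumes "k_algebra k A" "k_algebra k C" "a <: A" "a' <: A" "c <: C" "c' <: C"
  shows "tens k A C a c \<otimes>\<^bsub>tpa A C\<^esub> tens k A C a' c' = tens k A C (a \<otimes>\<^bsub>A\<^esub> a') (c \<otimes>\<^bsub>C\<^esub> c')"
  using assms by (simp add: tpa_mult)

lemma tpa_linear:
  assumes "k_algebra k A" "k_algebra k C" "s <: (tensor_module k A C)"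
  shows "linear_map k (tensor_module k A C) (tensor_module k A C) (%t. s \<otimes>\<^bsub>tpa A C\<^esub> t)"
    and "linear_map k (tensor_module k A C) (tensor_module k A C) (%t. t \<otimes>\<^bsub>tpa A C\<^esub> s)"
proof -
  have m: "module k (tensor_module k A C)" using assms by simp
  show "linear_map k (tensor_module k A C) (tensor_module k A C) (%t. s \<otimes>\<^bsub>tpa A C\<^esub> t)"
    by (subst lin_cong[OF m, OF tpa_mult[OF assms]]) (use assms in simp_all)
  show "linear_map k (tensor_module k A C) (tensor_module k A C) (%t. t \<otimes>\<^bsub>tpa A C\<^esub> s)"
    by (subst lin_cong[OF m, OF tpa_mult[OF assms(1,2) _ assms(3)]]) (use assms in simp_all)
qed

lemma tpa_closed:
  "[|k_algebra k A; k_algebra k C; s <: (tensor_module k A C); t <: (tensor_module k A C)|]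
   ==> s \<otimes>\<^bsub>tpa A C\<^esub> t <: (tensor_module k A C)"
  using lin_closed[OF tpa_linear(1)] by blast

text \<open>Associativity is linear in each of the three factors, hence checked on pure tensors.\<close>

lemma k_algebra_tpa [simp]:
  assumes A: "k_algebra k A" and C: "k_algebra k C"
  shows "k_algebra k (tpa A C)"
proof (rule k_algebraI)
  let ?T = "tensor_module k A C"
  note [simp] = A C
  have l1: "linear_map k U ?T (%u. g u \<otimes>\<^bsub>tpa A C\<^esub> t)" if "linear_map k U ?T g" "t <: ?T" for U :: "('k, 'u, 'z) module_scheme" and g t
    by (rule lin_comp[OF tpa_linear(2)[OF A C that(2)] that(1)])
  have l2: "linear_map k U ?T (%u. t \<otimes>\<^bsub>tpa A C\<^esub> g u)" if "linear_map k U ?T g" "t <: ?T" for U :: "('k, 'u, 'z) module_scheme" and g t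
    by (rule lin_comp[OF tpa_linear(1)[OF A C that(2)] that(1)])
  note [simp] = tpa_mult_tens tpa_closed
  fix x y z assume "x <: (tpa A C)" "y <: (tpa A C)" "z <: (tpa A C)"
  then have x: "x <: ?T" "y <: ?T" "z <: ?T" by simp_all
  have 1: "tens k A C (a \<otimes>\<^bsub>A\<^esub> b) (c \<otimes>\<^bsub>C\<^esub> d) \<otimes>\<^bsub>tpa A C\<^esub> t = tens k A C a c \<otimes>\<^bsub>tpa A C\<^esub> (tens k A C b d \<otimes>\<^bsub>tpa A C\<^esub> t)"
    if "a <: A" "c <: C" "b <: A" "d <: C" "t <: ?T" for a b c d t
    by (rule tensor_linear_eq[OF that(5), where X = ?T]) (use that in \<open>simp_all add: l2 tpa_linear alg_assoc\<close>)
  have 2: "tens k A C a c \<otimes>\<^bsub>tpa A C\<^esub> s \<otimes>\<^bsub>tpa A C\<^esub> t = tens k A C a c \<otimes>\<^bsub>tpa A C\<^esub> (s \<otimes>\<^bsub>tpa A C\<^esub> t)"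
    if "a <: A" "c <: C" "s <: ?T" "t <: ?T" for a c s t
    by (rule tensor_linear_eq[OF that(3), where X = ?T]) (use that in \<open>simp_all add: l2 l1 tpa_linear 1\<close>)
  show "x \<otimes>\<^bsub>tpa A C\<^esub> y \<otimes>\<^bsub>tpa A C\<^esub> z = x \<otimes>\<^bsub>tpa A C\<^esub> (y \<otimes>\<^bsub>tpa A C\<^esub> z)"
    by (rule tensor_linear_eq[OF x(1), where X = ?T]) (use x in \<open>simp_all add: l2 l1 tpa_linear 2\<close>)
next
  note [simp] = A C
  fix x assume x: "x <: (tpa A C)"
  then show "\<one>\<^bsub>tpa A C\<^esub> \<otimes>\<^bsub>tpa A C\<^esub> x = x" "x \<otimes>\<^bsub>tpa A C\<^esub> \<one>\<^bsub>tpa A C\<^esub> = x"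
    by (simp_all add: tpa_mult)
  show "linear_map k (tpa A C) (tpa A C) (%y. x \<otimes>\<^bsub>tpa A C\<^esub> y)" "linear_map k (tpa A C) (tpa A C) (%y. y \<otimes>\<^bsub>tpa A C\<^esub> x)"
    using x by (simp_all add: tpa_linear)
qed (use A C in simp_all)

text \<open>A sum over a product of tensors is a nested sum over the factors. Through this rule an identity in \<open>A
  \<otimes> C\<close> becomes an identity of sums.\<close>

lemma tsumc_tpa_mult [simp]:
  assumes "k_algebra k A" "k_algebra k C" "module k X" "s <: (tensor_module k A C)" "t <: (tensor_module k A C)"
    and "!!v. v <: A ==> linear_map k C X (%w. f v w)" "!!w. w <: C ==> linear_map k A X (%v. f v w)"
  shows "tsumc k A C X (s \<otimes>\<^bsub>tpa A C\<^esub> t) f =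
    tsumc k A C X s (%a c. tsumc k A C X t (%a' c'. f (a \<otimes>\<^bsub>A\<^esub> a') (c \<otimes>\<^bsub>C\<^esub> c')))"
proof -
  have c: "f v w <: X" if "v <: A" "w <: C" for v w
    using lin_closed[OF assms(6)[OF that(1)] that(2)] .
  show ?thesis using assms by (simp add: tpa_mult c bilinear_comp[OF assms(6,7)])
qed

end

section \<open>Coalgebras in Sweedler notation\<close>

definition trilinear_map ::
    "'k ring \<Rightarrow> ('k, 'u, 'p) module_scheme \<Rightarrow> ('k, 'v, 'm) module_scheme \<Rightarrow> ('k, 'w, 'n) module_scheme \<Rightarrow>
     ('k, 'x, 'l) module_scheme \<Rightarrow> ('u \<Rightarrow> 'v \<Rightarrow> 'w \<Rightarrow> 'x) \<Rightarrow> bool" where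
  "trilinear_map k U V W X f \<longleftrightarrow>
     (\<forall>v\<in>carrier V. \<forall>w\<in>carrier W. linear_map k U X (%u. f u v w)) \<and>
     (\<forall>u\<in>carrier U. \<forall>w\<in>carrier W. linear_map k V X (%v. f u v w)) \<and>
     (\<forall>u\<in>carrier U. \<forall>v\<in>carrier V. linear_map k W X (%w. f u v w))"

text \<open>Substitution of linear maps into a multilinear one; supplied to the simplifier whenever a generic summand
  occurs.\<close>

lemma trilinear_comp:
  assumes "trilinear_map k U V W X f"
  shows "[|linear_map k Y U g; v <: V; w <: W|] ==> linear_map k Y X (%y. f (g y) v w)"
    and "[|linear_map k Y V h; u <: U; w <: W|] ==> linear_map k Y X (%y. f u (h y) w)"
    and "[|linear_map k Y W i; u <: U; v <: V|] ==> linear_map k Y X (%y. f u v (i y))"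
    and "[|u <: U; v <: V; w <: W|] ==> f u v w <: X"
proof -
  have 1: "linear_map k U X (%u. f u v w)" if "v <: V" "w <: W" for v w
    using assms that by (simp add: trilinear_map_def)
  have 2: "linear_map k V X (%v. f u v w)" if "u <: U" "w <: W" for u w
    using assms that by (simp add: trilinear_map_def)
  have 3: "linear_map k W X (%w. f u v w)" if "u <: U" "v <: V" for u v
    using assms that by (simp add: trilinear_map_def)
  show "[|linear_map k Y U g; v <: V; w <: W|] ==> linear_map k Y X (%y. f (g y) v w)"
    by (rule lin_comp[OF 1])
  show "[|linear_map k Y V h; u <: U; w <: W|] ==> linear_map k Y X (%y. f u (h y) w)"
    by (rule lin_comp[OF 2])
  show "[|linear_map k Y W i; u <: U; v <: V|] ==> linear_map k Y X (%y. f u v (i y))"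
    by (rule lin_comp[OF 3])
  show "[|u <: U; v <: V; w <: W|] ==> f u v w <: X"
    by (rule lin_closed[OF 1])
qed

context ground begin

lemma tmap_eq:
  assumes "t <: (tensor_module k V' W')" "linear_map k V' V f" "linear_map k W' W g"
    "module k V" "module k W" "module k V'" "module k W'"
  shows "tmap k V W f g t = tsumc k V' W' (tensor_module k V W) t (%x y. tens k V W (f x) (g y))"
  unfolding tmap_def using assms
  by (intro tsum_eq_tsumc) (auto simp: lin_closed[OF assms(2)] lin_closed[OF assms(3)])

lemma tassoc_eq:
  assumes "t <: (tensor_module k (tensor_module k V W) X)" "module k V" "module k W" "module k X"
  shows "tassoc k V W X t = tsumc k (tensor_module k V W) X (tensor_module k V (tensor_module k W X)) t
    (%s x. tsumc k V W (tensor_module k V (tensor_module k W X)) s (%v w. tens k V (tensor_module k W X) v (tens k W X w x)))"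
proof -
  have "tsum k (tensor_module k V (tensor_module k W X)) s (%v w. tens k V (tensor_module k W X) v (tens k W X w x)) =
    tsumc k V W (tensor_module k V (tensor_module k W X)) s (%v w. tens k V (tensor_module k W X) v (tens k W X w x))"
    if "s <: (tensor_module k V W)" "x <: X" for s x
    using assms that by (intro tsum_eq_tsumc) auto
  then show ?thesis unfolding tassoc_def Let_def using assms
    by (subst tsum_eq_tsumc[of k "tensor_module k V W" X]) (auto intro!: tsumc_cong)
qed

lemma tflip_eq:
  assumes "t <: (tensor_module k V W)" "module k V" "module k W"
  shows "tflip k V W t = tsumc k V W (tensor_module k W V) t (%v w. tens k W V w v)"
  unfolding tflip_def using assms by (intro tsum_eq_tsumc) auto

text \<open>Coassociativity for an arbitrary trilinear summand follows from the tensor identity by applying the induced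
  linear map to both sides.\<close>

lemma coalgebra_sweedler:
  assumes "coalgebra k C \<Delta> \<epsilon>" and C [simp]: "module k C"
  shows coalgebra_linear: "linear_map k C (tensor_module k C C) \<Delta>" "linear_map k C (self_module k) \<epsilon>"
    and coalgebra_coassoc: "[|x <: C; trilinear_map k C C C X f; module k X|] ==>
      tsumc k C C X (\<Delta> x) (%x y. tsumc k C C X (\<Delta> x) (%a b. f a b y)) =
      tsumc k C C X (\<Delta> x) (%x y. tsumc k C C X (\<Delta> y) (%a b. f x a b))"
    and coalgebra_counit1: "[|x <: C; linear_map k C X g; module k X|] ==>
      tsumc k C C X (\<Delta> x) (%x y. \<epsilon> x \<odot>\<^bsub>X\<^esub> g y) = g x"
    and coalgebra_counit2: "[|x <: C; linear_map k C X g; module k X|] ==>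
      tsumc k C C X (\<Delta> x) (%x y. \<epsilon> y \<odot>\<^bsub>X\<^esub> g x) = g x"
proof -
  let ?CC = "tensor_module k C C"
  show l: "linear_map k C ?CC \<Delta>" "linear_map k C (self_module k) \<epsilon>"
    using assms by (simp_all add: coalgebra_def Let_def)
  note [simp] = l lin_closed[OF l(1)] lin_closed[OF l(2), simplified] lin_comp[OF l(1)] lin_comp[OF l(2)]
  { fix x g and X :: "('k, 'x, 'l) module_scheme"
    assume x: "x <: C" and g: "linear_map k C X g" and X: "module k X"
    note [simp] = x g X lin_closed[OF g] lin_smult[OF g]
    have "tsumc k C C X (\<Delta> x) (%x y. \<epsilon> x \<odot>\<^bsub>X\<^esub> g y) = g (tsumc k C C C (\<Delta> x) (%x y. \<epsilon> x \<odot>\<^bsub>C\<^esub> y))"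
      by (subst linear_tsumc[OF g]) auto
    also have "tsumc k C C C (\<Delta> x) (%x y. \<epsilon> x \<odot>\<^bsub>C\<^esub> y) = x"
      using assms(1) by (subst tsum_eq_tsumc[symmetric]) (auto simp: coalgebra_def Let_def)
    finally show "tsumc k C C X (\<Delta> x) (%x y. \<epsilon> x \<odot>\<^bsub>X\<^esub> g y) = g x" .
    have "tsumc k C C X (\<Delta> x) (%x y. \<epsilon> y \<odot>\<^bsub>X\<^esub> g x) = g (tsumc k C C C (\<Delta> x) (%x y. \<epsilon> y \<odot>\<^bsub>C\<^esub> x))"
      by (subst linear_tsumc[OF g]) auto
    also have "tsumc k C C C (\<Delta> x) (%x y. \<epsilon> y \<odot>\<^bsub>C\<^esub> x) = x"
      using assms(1) by (subst tsum_eq_tsumc[symmetric]) (auto simp: coalgebra_def Let_def)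
    finally show "tsumc k C C X (\<Delta> x) (%x y. \<epsilon> y \<odot>\<^bsub>X\<^esub> g x) = g x" . }
  { fix x f and X :: "('k, 'x, 'l) module_scheme"
    assume x: "x <: C" and f: "trilinear_map k C C C X f" and X: "module k X"
    note [simp] = x X trilinear_comp[OF f]
    have "tassoc k C C C (tmap k ?CC C \<Delta> id (\<Delta> x)) = tmap k C ?CC id \<Delta> (\<Delta> x)"
      using assms(1) x by (simp add: coalgebra_def Let_def)
    then have "tsumc k C ?CC X (tassoc k C C C (tmap k ?CC C \<Delta> id (\<Delta> x))) (%a s. tsumc k C C X s (%b c. f a b c)) =
       tsumc k C ?CC X (tmap k C ?CC id \<Delta> (\<Delta> x)) (%a s. tsumc k C C X s (%b c. f a b c))" by simp
    then show "tsumc k C C X (\<Delta> x) (%x y. tsumc k C C X (\<Delta> x) (%a b. f a b y)) =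
      tsumc k C C X (\<Delta> x) (%x y. tsumc k C C X (\<Delta> y) (%a b. f x a b))"
      by (simp add: tassoc_eq tmap_eq[of _ C C]) }
qed

lemma coalgebraI:
  assumes C [simp]: "module k C" and l: "linear_map k C (tensor_module k C C) \<Delta>" "linear_map k C (self_module k) \<epsilon>"
    and coassoc: "!!x. x <: C ==>
      tsumc k C C (tensor_module k C (tensor_module k C C)) (\<Delta> x) (%x y. tsumc k C C (tensor_module k C (tensor_module k C C)) (\<Delta> x)
        (%a b. tens k C (tensor_module k C C) a (tens k C C b y))) =
      tsumc k C C (tensor_module k C (tensor_module k C C)) (\<Delta> x) (%x y. tsumc k C C (tensor_module k C (tensor_module k C C)) (\<Delta> y)
        (%a b. tens k C (tensor_module k C C) x (tens k C C a b)))"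
    and counit: "!!x. x <: C ==> tsumc k C C C (\<Delta> x) (%x y. \<epsilon> x \<odot>\<^bsub>C\<^esub> y) = x"
      "!!x. x <: C ==> tsumc k C C C (\<Delta> x) (%x y. \<epsilon> y \<odot>\<^bsub>C\<^esub> x) = x"
  shows "coalgebra k C \<Delta> \<epsilon>"
proof -
  let ?CC = "tensor_module k C C"
  note [simp] = l lin_closed[OF l(1)] lin_closed[OF l(2), simplified] lin_comp[OF l(1)] lin_comp[OF l(2)]
  have "tassoc k C C C (tmap k ?CC C \<Delta> id (\<Delta> x)) = tmap k C ?CC id \<Delta> (\<Delta> x)" if [simp]: "x <: C" for x
  proof -
    have "tmap k C ?CC id \<Delta> (\<Delta> x) = tsumc k C C (tensor_module k C ?CC) (\<Delta> x) (%x y. tsumc k C C (tensor_module k C ?CC) (\<Delta> y)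
        (%a b. tens k C (tensor_module k C C) x (tens k C C a b)))"
      by (simp add: tmap_eq[of _ C C] flip: tsumc_push(2))
    then show ?thesis by (simp add: tassoc_eq tmap_eq[of _ C C] coassoc)
  qed
  moreover have "tsum k C (\<Delta> x) (%x y. \<epsilon> x \<odot>\<^bsub>C\<^esub> y) = x" "tsum k C (\<Delta> x) (%x y. \<epsilon> y \<odot>\<^bsub>C\<^esub> x) = x" if "x <: C" for x
    using counit[OF that] that by (subst tsum_eq_tsumc[of k C C]; simp)+
  ultimately show ?thesis using l by (simp add: coalgebra_def Let_def)
qed

end

section \<open>Hopf algebras\<close>

locale hopf = ground k for k :: "'k ring" +
  fixes K :: "('k, 'h) hopf"
  assumes hopf: "hopf_algebra k K"
begin

abbreviation "KK \<equiv> tensor_module k K K"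
abbreviation kk_mult (infixl "**" 70) where "s ** t \<equiv> s \<otimes>\<^bsub>tensor_product_algebra k K K\<^esub> t"
abbreviation "ks X t f \<equiv> tsumc k K K X t f"
abbreviation "sw X h f \<equiv> tsumc k K K X (comult K h) f"
abbreviation kmult (infixl "\<cdot>" 70) where "x \<cdot> y \<equiv> x \<otimes>\<^bsub>K\<^esub> y"
abbreviation "S \<equiv> antipode K"
abbreviation "eps \<equiv> counit K"

lemma K_alg [simp]: "k_algebra k K"
  using hopf by (simp add: hopf_algebra_def)

lemma K_mod [simp]: "module k K" by (rule alg_simps(1)) simp

lemmas K_simps [simp] = alg_simps[OF K_alg]
lemmas K_assoc = alg_assoc[OF K_alg]

lemma K_coalg: "coalgebra k K (comult K) (counit K)"
  using hopf by (simp add: hopf_algebra_def)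

lemmas comult_linear = coalgebra_linear(1)[OF K_coalg K_mod]
lemmas counit_linear = coalgebra_linear(2)[OF K_coalg K_mod]

lemma antipode_linear: "linear_map k K K S"
  using hopf by (simp add: hopf_algebra_def convolution_inverse_of_id_def)

lemma hopf_maps [simp]:
  "h <: K ==> comult K h <: KK" "h <: K ==> eps h <: k"
  "h <: K ==> S h <: K"
  "linear_map k U K g ==> linear_map k U KK (%u. comult K (g u))"
  "linear_map k U K g ==> linear_map k U (self_module k) (%u. eps (g u))"
  "linear_map k U K g ==> linear_map k U K (%u. S (g u))"
  using lin_closed[OF comult_linear] lin_closed[OF counit_linear] lin_closed[OF antipode_linear]
    lin_comp[OF comult_linear] lin_comp[OF counit_linear] lin_comp[OF antipode_linear] by auto

lemma hopf_hom [simp]: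
  "[|g <: K; h <: K|] ==> comult K (g \<cdot> h) = comult K g ** comult K h"
  "comult K \<one>\<^bsub>K\<^esub> = tens k K K \<one>\<^bsub>K\<^esub> \<one>\<^bsub>K\<^esub>"
  "[|g <: K; h <: K|] ==> eps (g \<cdot> h) = eps g \<otimes>\<^bsub>k\<^esub> eps h"
  "eps \<one>\<^bsub>K\<^esub> = \<one>\<^bsub>k\<^esub>"
  using hopf by (auto simp: hopf_algebra_def algebra_map_def ring_hom_def)

lemmas sw_coassoc = coalgebra_coassoc[OF K_coalg K_mod]
lemmas sw_counit [simp] = coalgebra_counit1[OF K_coalg K_mod] coalgebra_counit2[OF K_coalg K_mod]

lemma sw_antipode:
  assumes "h <: K" "linear_map k K X g" "module k X"
  shows "sw X h (%x y. g (S x \<cdot> y)) = eps h \<odot>\<^bsub>X\<^esub> g \<one>\<^bsub>K\<^esub>" "sw X h (%x y. g (x \<cdot> S y)) = eps h \<odot>\<^bsub>X\<^esub> g \<one>\<^bsub>K\<^esub>"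
proof -
  note c = convolution_inverse_of_id_def
  have 1: "sw K h (%x y. S x \<cdot> y) = eps h \<odot>\<^bsub>K\<^esub> \<one>\<^bsub>K\<^esub>"
    using hopf assms(1) by (subst tsum_eq_tsumc[symmetric]) (auto simp: hopf_algebra_def c)
  have 2: "sw K h (%x y. x \<cdot> S y) = eps h \<odot>\<^bsub>K\<^esub> \<one>\<^bsub>K\<^esub>"
    using hopf assms(1) by (subst tsum_eq_tsumc[symmetric]) (auto simp: hopf_algebra_def c)
  note [simp] = assms
  have "sw X h (%x y. g (S x \<cdot> y)) = g (sw K h (%x y. S x \<cdot> y))"
    by (rule linear_tsumc[symmetric]) simp_all
  then show "sw X h (%x y. g (S x \<cdot> y)) = eps h \<odot>\<^bsub>X\<^esub> g \<one>\<^bsub>K\<^esub>" unfolding 1 by (simp add: lin_smult[OF assms(2)])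
  have "sw X h (%x y. g (x \<cdot> S y)) = g (sw K h (%x y. x \<cdot> S y))"
    by (rule linear_tsumc[symmetric]) simp_all
  then show "sw X h (%x y. g (x \<cdot> S y)) = eps h \<odot>\<^bsub>X\<^esub> g \<one>\<^bsub>K\<^esub>" unfolding 2 by (simp add: lin_smult[OF assms(2)])
qed

lemma antipode_one [simp]: "S \<one>\<^bsub>K\<^esub> = \<one>\<^bsub>K\<^esub>"
  using sw_antipode(1)[of "\<one>\<^bsub>K\<^esub>" K "%x. x"] by simp

text \<open>Both sides are convolution inverse to the product: in \<open>S(y) S(x) = S(x\<^sub>1 y\<^sub>1) x\<^sub>2
  y\<^sub>2 S(y\<^sub>3) S(x\<^sub>3)\<close> either the left or the right half collapses to counits.\<close>

lemma antipode_mult: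
  assumes [simp]: "x <: K" "y <: K"
  shows "S (x \<cdot> y) = S y \<cdot> S x"
proof -
  let ?F = "%a1 a2 c b1 b2 d. S (a1 \<cdot> b1) \<cdot> (a2 \<cdot> b2) \<cdot> (S d \<cdot> S c)"
  have "S y \<cdot> S x = sw K x (%a c. eps a \<odot>\<^bsub>K\<^esub> sw K y (%b d. eps b \<odot>\<^bsub>K\<^esub> (S d \<cdot> S c)))"
    by (simp del: tsumc_push)
  also have "... = sw K x (%a c. sw K y (%b d. (eps a \<otimes>\<^bsub>k\<^esub> eps b) \<odot>\<^bsub>K\<^esub> (S d \<cdot> S c)))"
    by (simp add: smult_rules(2) del: sw_counit)
  also have "... = sw K x (%a c. sw K y (%b d. sw K a (%a1 a2. sw K b (%b1 b2. ?F a1 a2 c b1 b2 d))))"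
  proof (intro tsumc_cong)
    fix a c b d assume [simp]: "a <: K" "c <: K" "b <: K" "d <: K"
    show "(eps a \<otimes>\<^bsub>k\<^esub> eps b) \<odot>\<^bsub>K\<^esub> (S d \<cdot> S c) = sw K a (%a1 a2. sw K b (%b1 b2. ?F a1 a2 c b1 b2 d))"
      using sw_antipode(1)[of "a \<cdot> b" K "%z. z \<cdot> (S d \<cdot> S c)"] by (simp del: tsumc_mult)
  qed
  also have "... = sw K x (%a c. sw K a (%a1 a2. sw K y (%b d. sw K b (%b1 b2. ?F a1 a2 c b1 b2 d))))"
    by (intro tsumc_cong tsumc_swap) simp_all
  also have "... = sw K x (%a c. sw K c (%c1 c2. sw K y (%b d. sw K d (%d1 d2. ?F a c1 c2 b d1 d2))))"
    by (subst sw_coassoc[where f = "%a1 a2 c. sw K y (%b d. sw K b (%b1 b2. ?F a1 a2 c b1 b2 d))"], simp, simp add: trilinear_map_def, simp)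
      (intro tsumc_cong sw_coassoc, simp_all add: trilinear_map_def)
  also have "... = sw K x (%a c. sw K c (%c1 c2. S (a \<cdot> y) \<cdot> (c1 \<cdot> S c2)))"
  proof (intro tsumc_cong)
    fix a c c1 c2 assume [simp]: "a <: K" "c <: K" "c1 <: K" "c2 <: K"
    have "sw K d (%d1 d2. ?F a c1 c2 b d1 d2) = eps d \<odot>\<^bsub>K\<^esub> (S (a \<cdot> b) \<cdot> (c1 \<cdot> S c2))"
      if [simp]: "b <: K" "d <: K" for b d
      using sw_antipode(2)[of d K "%z. S (a \<cdot> b) \<cdot> c1 \<cdot> z \<cdot> S c2"] by (simp add: K_assoc)
    then show "sw K y (%b d. sw K d (%d1 d2. ?F a c1 c2 b d1 d2)) = S (a \<cdot> y) \<cdot> (c1 \<cdot> S c2)" by simp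
  qed
  also have "... = sw K x (%a c. eps c \<odot>\<^bsub>K\<^esub> S (a \<cdot> y))"
    by (intro tsumc_cong) (use sw_antipode(2)[of _ K "%z. S (_ \<cdot> y) \<cdot> z"] in simp)
  also have "... = S (x \<cdot> y)" by simp
  finally show ?thesis by simp
qed

end

section \<open>Identities in the third tensor power of a Hopf algebra\<close>

context ground begin

lemmas [simp] = tpa_mult_tens tpa_closed

lemma tpa_mult_tens_nested [simp]:
  assumes "k_algebra k A" "k_algebra k C" "k_algebra k D"
  shows "[|a <: A; a' <: A; c <: (tensor_module k C D); c' <: (tensor_module k C D)|] ==>
      tens k A (tensor_module k C D) a c \<otimes>\<^bsub>tpa A (tpa C D)\<^esub> tens k A (tensor_module k C D) a' c' =
      tens k A (tensor_module k C D) (a \<otimes>\<^bsub>A\<^esub> a') (c \<otimes>\<^bsub>tpa C D\<^esub> c')"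
    and "[|s <: (tensor_module k A C); s' <: (tensor_module k A C); d <: D; d' <: D|] ==>
      tens k (tensor_module k A C) D s d \<otimes>\<^bsub>tpa (tpa A C) D\<^esub> tens k (tensor_module k A C) D s' d' =
      tens k (tensor_module k A C) D (s \<otimes>\<^bsub>tpa A C\<^esub> s') (d \<otimes>\<^bsub>D\<^esub> d')"
  using tpa_mult_tens[of A "tpa C D" a a' c c'] tpa_mult_tens[of "tpa A C" D s s' d d'] assms by simp_all

lemma tpa_closed_nested [simp]:
  assumes "k_algebra k A" "k_algebra k C" "k_algebra k D"
  shows "[|s <: (tensor_module k A (tensor_module k C D)); t <: (tensor_module k A (tensor_module k C D))|]
     ==> s \<otimes>\<^bsub>tpa A (tpa C D)\<^esub> t <: (tensor_module k A (tensor_module k C D))"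
    and "[|u <: (tensor_module k (tensor_module k A C) D); v <: (tensor_module k (tensor_module k A C) D)|]
     ==> u \<otimes>\<^bsub>tpa (tpa A C) D\<^esub> v <: (tensor_module k (tensor_module k A C) D)"
  using tpa_closed[of A "tpa C D" s t] tpa_closed[of "tpa A C" D u v] assms by simp_all

lemma tpa_push [simp]:
  assumes "k_algebra k A" "k_algebra k C" "module k V" "module k W"
    and "!!v w. [|v <: V; w <: W|] ==> f v w <: (tensor_module k A C)" "z <: (tensor_module k A C)"
  shows "z \<otimes>\<^bsub>tpa A C\<^esub> tsumc k V W (tensor_module k A C) t f = tsumc k V W (tensor_module k A C) t (%v w. z \<otimes>\<^bsub>tpa A C\<^esub> f v w)"
    and "tsumc k V W (tensor_module k A C) t f \<otimes>\<^bsub>tpa A C\<^esub> z = tsumc k V W (tensor_module k A C) t (%v w. f v w \<otimes>\<^bsub>tpa A C\<^esub> z)"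
  using tsumc_mult[of "tpa A C" V W f z t] assms by simp_all

lemma tpa_push_nested [simp]:
  assumes "k_algebra k A" "k_algebra k C" "k_algebra k D" "module k V" "module k W"
    and "!!v w. [|v <: V; w <: W|] ==> f v w <: (tensor_module k A (tensor_module k C D))"
    and "z <: (tensor_module k A (tensor_module k C D))"
  shows "z \<otimes>\<^bsub>tpa A (tpa C D)\<^esub> tsumc k V W (tensor_module k A (tensor_module k C D)) t f =
      tsumc k V W (tensor_module k A (tensor_module k C D)) t (%v w. z \<otimes>\<^bsub>tpa A (tpa C D)\<^esub> f v w)"
    and "tsumc k V W (tensor_module k A (tensor_module k C D)) t f \<otimes>\<^bsub>tpa A (tpa C D)\<^esub> z =
      tsumc k V W (tensor_module k A (tensor_module k C D)) t (%v w. f v w \<otimes>\<^bsub>tpa A (tpa C D)\<^esub> z)"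
  using tpa_push[of A "tpa C D" V W f z t] assms by simp_all

lemma tpa_push_nested' [simp]:
  assumes "k_algebra k A" "k_algebra k C" "k_algebra k D" "module k V" "module k W"
    and "!!v w. [|v <: V; w <: W|] ==> f v w <: (tensor_module k (tensor_module k A C) D)"
    and "z <: (tensor_module k (tensor_module k A C) D)"
  shows "z \<otimes>\<^bsub>tpa (tpa A C) D\<^esub> tsumc k V W (tensor_module k (tensor_module k A C) D) t f =
      tsumc k V W (tensor_module k (tensor_module k A C) D) t (%v w. z \<otimes>\<^bsub>tpa (tpa A C) D\<^esub> f v w)"
    and "tsumc k V W (tensor_module k (tensor_module k A C) D) t f \<otimes>\<^bsub>tpa (tpa A C) D\<^esub> z =
      tsumc k V W (tensor_module k (tensor_module k A C) D) t (%v w. f v w \<otimes>\<^bsub>tpa (tpa A C) D\<^esub> z)"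
  using tpa_push[of "tpa A C" D V W f z t] assms by simp_all
lemma ring_tpa: "[|k_algebra k A; k_algebra k C|] ==> ring (tpa A C)"
  by (rule k_algebra_ring) simp

lemma tsumc_multiplicative:
  assumes "k_algebra k A" "k_algebra k C" "k_algebra k B"
    and "!!v. v <: A ==> linear_map k C B (%w. P v w)" "!!w. w <: C ==> linear_map k A B (%v. P v w)"
    and "!!a c a' c'. [|a <: A; a' <: A; c <: C; c' <: C|] ==>
      P (a \<otimes>\<^bsub>A\<^esub> a') (c \<otimes>\<^bsub>C\<^esub> c') = P a c \<otimes>\<^bsub>B\<^esub> P a' c'"
    and "s <: (tensor_module k A C)" "t <: (tensor_module k A C)"
  shows "tsumc k A C B (s \<otimes>\<^bsub>tpa A C\<^esub> t) P = tsumc k A C B s P \<otimes>\<^bsub>B\<^esub> tsumc k A C B t P"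
proof -
  have [simp]: "P v w <: B" if "v <: A" "w <: C" for v w
    using lin_closed[OF assms(4)[OF that(1)] that(2)] .
  note [simp] = assms(1-3,7,8)
  have "tsumc k A C B (s \<otimes>\<^bsub>tpa A C\<^esub> t) P = tsumc k A C B s (%a c. tsumc k A C B t (%a' c'. P a c \<otimes>\<^bsub>B\<^esub> P a' c'))"
    by (subst tsumc_tpa_mult) (use assms in \<open>simp_all cong del: tsumc_cong_simp cong: tsumc_cong\<close>)
  also have "... = tsumc k A C B s (%a c. P a c \<otimes>\<^bsub>B\<^esub> tsumc k A C B t P)"
    by (intro tsumc_cong) simp
  also have "... = tsumc k A C B s P \<otimes>\<^bsub>B\<^esub> tsumc k A C B t P"
    by (rule tsumc_mult(2)[symmetric]) simp_all
  finally show ?thesis .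
qed

end

context hopf begin

abbreviation "K3 \<equiv> tpa K (tpa K K)"
abbreviation k3_mult (infixl "***" 70) where "s *** t \<equiv> s \<otimes>\<^bsub>K3\<^esub> t"
abbreviation "T3 \<equiv> tensor_module k K KK"
abbreviation "t3 a b c \<equiv> tens k K KK a (tens k K K b c)"
abbreviation "ev3 X z f \<equiv> tsumc k K KK X z (%a s. ks X s (%b c. f a b c))"

lemma swap_comult:
  assumes "!!p q x y a b. [|p <: K; q <: K; x <: K; y <: K; a <: K; b <: K|]
    ==> f p q x y a b <: X" "module k X"
  shows "ks X t (%p q. ks X s (%x y. sw X (u x y) (%a b. f p q x y a b))) =
    ks X s (%x y. sw X (u x y) (%a b. ks X t (%p q. f p q x y a b)))"
proof -
  note [simp] = assms
  have "ks X t (%p q. ks X s (%x y. sw X (u x y) (%a b. f p q x y a b))) = ks X s (%x y. ks X t (%p q. sw X (u x y) (%a b. f p q x y a b)))"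
    by (rule tsumc_swap) simp_all
  also have "... = ks X s (%x y. sw X (u x y) (%a b. ks X t (%p q. f p q x y a b)))"
    by (intro tsumc_cong tsumc_swap) simp_all
  finally show ?thesis .
qed

lemma swap_comult2:
  assumes "!!p q c d x y a b. [|p <: K; q <: K; c <: K; d <: K;
      x <: K; y <: K; a <: K; b <: K|] ==> f p q c d x y a b <: X" "module k X"
  shows "ks X t (%p q. sw X (v p q) (%c d. ks X s (%x y. sw X (u x y) (%a b. f p q c d x y a b)))) =
    ks X s (%x y. sw X (u x y) (%a b. ks X t (%p q. sw X (v p q) (%c d. f p q c d x y a b))))"
proof -
  note [simp] = assms
  have "ks X t (%p q. sw X (v p q) (%c d. ks X s (%x y. sw X (u x y) (%a b. f p q c d x y a b)))) =
      ks X t (%p q. ks X s (%x y. sw X (u x y) (%a b. sw X (v p q) (%c d. f p q c d x y a b))))"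
    by (intro tsumc_cong swap_comult) simp_all
  also have "... = ks X s (%x y. sw X (u x y) (%a b. ks X t (%p q. sw X (v p q) (%c d. f p q c d x y a b))))"
    by (rule swap_comult) simp_all
  finally show ?thesis .
qed

lemma K3_alg [simp]: "k_algebra k K3" by simp

lemma lift_mult:
  assumes "!!v. v <: K ==> linear_map k K T3 (%w. P v w)" "!!w. w <: K ==> linear_map k K T3 (%v. P v w)"
    and "!!a c a' c'. [|a <: K; a' <: K; c <: K; c' <: K|] ==> P (a \<cdot> a') (c \<cdot> c') = P a c *** P a' c'"
    and "s <: KK" "t <: KK"
  shows "ks T3 (s ** t) P = ks T3 s P *** ks T3 t P"
  by (rule tsumc_multiplicative[of K K K3 P s t, unfolded tpa_cong tpa_simps, OF K_alg K_alg K3_alg assms])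

end

text \<open>The cocycle condition \<open>a b = c d\<close> between invertible elements, solved for the other pairs of
  factors.\<close>

lemma monoid_cocycle:
  assumes "monoid M" and c: "a <: M" "a' <: M" "b <: M" "b' <: M"
      "c <: M" "c' <: M" "d <: M" "d' <: M"
    and inv: "a' \<otimes>\<^bsub>M\<^esub> a = \<one>\<^bsub>M\<^esub>" "b \<otimes>\<^bsub>M\<^esub> b' = \<one>\<^bsub>M\<^esub>" "c' \<otimes>\<^bsub>M\<^esub> c = \<one>\<^bsub>M\<^esub>" "d \<otimes>\<^bsub>M\<^esub> d' = \<one>\<^bsub>M\<^esub>"
    and eq: "a \<otimes>\<^bsub>M\<^esub> b = c \<otimes>\<^bsub>M\<^esub> d"
  shows "a' \<otimes>\<^bsub>M\<^esub> c = b \<otimes>\<^bsub>M\<^esub> d'" "c' \<otimes>\<^bsub>M\<^esub> a = d \<otimes>\<^bsub>M\<^esub> b'" 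
    and "[|b' \<otimes>\<^bsub>M\<^esub> b = \<one>\<^bsub>M\<^esub>; c \<otimes>\<^bsub>M\<^esub> c' = \<one>\<^bsub>M\<^esub>|] ==> b' \<otimes>\<^bsub>M\<^esub> a' = d' \<otimes>\<^bsub>M\<^esub> c'"
proof -
  interpret monoid M by fact
  have "b \<otimes>\<^bsub>M\<^esub> d' = (a' \<otimes>\<^bsub>M\<^esub> a) \<otimes>\<^bsub>M\<^esub> b \<otimes>\<^bsub>M\<^esub> d'" using c inv(1) by simp
  also have "... = a' \<otimes>\<^bsub>M\<^esub> (a \<otimes>\<^bsub>M\<^esub> b) \<otimes>\<^bsub>M\<^esub> d'" using c by (simp add: m_assoc)
  also have "... = a' \<otimes>\<^bsub>M\<^esub> c \<otimes>\<^bsub>M\<^esub> (d \<otimes>\<^bsub>M\<^esub> d')" unfolding eq using c by (simp add: m_assoc)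
  also have "... = a' \<otimes>\<^bsub>M\<^esub> c" using c inv(4) by simp
  finally show 1: "a' \<otimes>\<^bsub>M\<^esub> c = b \<otimes>\<^bsub>M\<^esub> d'" by simp
  have "d \<otimes>\<^bsub>M\<^esub> b' = (c' \<otimes>\<^bsub>M\<^esub> c) \<otimes>\<^bsub>M\<^esub> d \<otimes>\<^bsub>M\<^esub> b'" using c inv(3) by simp
  also have "... = c' \<otimes>\<^bsub>M\<^esub> (c \<otimes>\<^bsub>M\<^esub> d) \<otimes>\<^bsub>M\<^esub> b'" using c by (simp add: m_assoc)
  also have "... = c' \<otimes>\<^bsub>M\<^esub> a \<otimes>\<^bsub>M\<^esub> (b \<otimes>\<^bsub>M\<^esub> b')" unfolding eq[symmetric] using c by (simp add: m_assoc)
  also have "... = c' \<otimes>\<^bsub>M\<^esub> a" using c inv(2) by simp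
  finally show "c' \<otimes>\<^bsub>M\<^esub> a = d \<otimes>\<^bsub>M\<^esub> b'" by simp
  assume i: "b' \<otimes>\<^bsub>M\<^esub> b = \<one>\<^bsub>M\<^esub>" "c \<otimes>\<^bsub>M\<^esub> c' = \<one>\<^bsub>M\<^esub>"
  have "b' \<otimes>\<^bsub>M\<^esub> a' = b' \<otimes>\<^bsub>M\<^esub> a' \<otimes>\<^bsub>M\<^esub> (c \<otimes>\<^bsub>M\<^esub> c')" using c i by simp
  also have "... = b' \<otimes>\<^bsub>M\<^esub> (a' \<otimes>\<^bsub>M\<^esub> c) \<otimes>\<^bsub>M\<^esub> c'" using c by (simp add: m_assoc)
  also have "... = (b' \<otimes>\<^bsub>M\<^esub> b) \<otimes>\<^bsub>M\<^esub> d' \<otimes>\<^bsub>M\<^esub> c'" unfolding 1 using c by (simp add: m_assoc)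
  also have "... = d' \<otimes>\<^bsub>M\<^esub> c'" using c i by simp
  finally show "b' \<otimes>\<^bsub>M\<^esub> a' = d' \<otimes>\<^bsub>M\<^esub> c'" .
qed

section \<open>Twists\<close>

locale twist = hopf k K for k :: "'k ring" and K :: "('k, 'h) hopf" +
  fixes F G :: "('k, 'h, 'h) tensor"
  assumes F_in [simp]: "F <: KK" and G_in [simp]: "G <: KK"
    and FG: "F ** G = tens k K K \<one>\<^bsub>K\<^esub> \<one>\<^bsub>K\<^esub>" and GF: "G ** F = tens k K K \<one>\<^bsub>K\<^esub> \<one>\<^bsub>K\<^esub>"
    and F_counit1: "ks K F (%x y. eps x \<odot>\<^bsub>K\<^esub> y) = \<one>\<^bsub>K\<^esub>" and F_counit2: "ks K F (%x y. eps y \<odot>\<^bsub>K\<^esub> x) = \<one>\<^bsub>K\<^esub>"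
    and F_cocycle: "ks T3 F (%x y. sw T3 x (%a b. ks T3 F (%p q. t3 (p \<cdot> a) (q \<cdot> b) y))) =
      ks T3 F (%x y. sw T3 y (%a b. ks T3 F (%p q. t3 x (p \<cdot> a) (q \<cdot> b))))"
begin

lemma FG_cancel:
  assumes "!!v. v <: K ==> linear_map k K X (%w. f v w)" "!!w. w <: K ==> linear_map k K X (%v. f v w)" "module k X"
  shows "ks X F (%x y. ks X G (%p q. f (x \<cdot> p) (y \<cdot> q))) = f \<one>\<^bsub>K\<^esub> \<one>\<^bsub>K\<^esub>"
    and "ks X G (%x y. ks X F (%p q. f (x \<cdot> p) (y \<cdot> q))) = f \<one>\<^bsub>K\<^esub> \<one>\<^bsub>K\<^esub>"
proof -
  have "ks X (F ** G) f = f \<one>\<^bsub>K\<^esub> \<one>\<^bsub>K\<^esub>" "ks X (G ** F) f = f \<one>\<^bsub>K\<^esub> \<one>\<^bsub>K\<^esub>"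
    unfolding FG GF using assms by simp_all
  then show "ks X F (%x y. ks X G (%p q. f (x \<cdot> p) (y \<cdot> q))) = f \<one>\<^bsub>K\<^esub> \<one>\<^bsub>K\<^esub>"
    "ks X G (%x y. ks X F (%p q. f (x \<cdot> p) (y \<cdot> q))) = f \<one>\<^bsub>K\<^esub> \<one>\<^bsub>K\<^esub>" using assms by simp_all
qed

lemma F_counit [simp]:
  assumes "linear_map k K X g" "module k X"
  shows "ks X F (%x y. eps x \<odot>\<^bsub>X\<^esub> g y) = g \<one>\<^bsub>K\<^esub>" "ks X F (%x y. eps y \<odot>\<^bsub>X\<^esub> g x) = g \<one>\<^bsub>K\<^esub>"
proof -
  note [simp] = assms lin_smult[OF assms(1)]
  show "ks X F (%x y. eps x \<odot>\<^bsub>X\<^esub> g y) = g \<one>\<^bsub>K\<^esub>"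
    using linear_tsumc[OF assms(1) K_mod K_mod K_mod assms(2), of "%x y. eps x \<odot>\<^bsub>K\<^esub> y" F] by (simp add: F_counit1)
  show "ks X F (%x y. eps y \<odot>\<^bsub>X\<^esub> g x) = g \<one>\<^bsub>K\<^esub>"
    using linear_tsumc[OF assms(1) K_mod K_mod K_mod assms(2), of "%x y. eps y \<odot>\<^bsub>K\<^esub> x" F] by (simp add: F_counit2)
qed

text \<open>Multiply with \<open>F\<close> and use that \<open>F\<close> is normalised.\<close>

lemma G_counit [simp]:
  assumes "linear_map k K X g" "module k X"
  shows "ks X G (%x y. eps x \<odot>\<^bsub>X\<^esub> g y) = g \<one>\<^bsub>K\<^esub>" "ks X G (%x y. eps y \<odot>\<^bsub>X\<^esub> g x) = g \<one>\<^bsub>K\<^esub>"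
proof -
  have lc: "linear_map k K X (%u. g (x \<cdot> u))" if "x <: K" for x
    by (rule lin_comp[OF assms(1)]) (simp add: that)
  have cl: "g x <: X" if "x <: K" for x using lin_closed[OF assms(1) that] .
  note [simp] = assms lin_smult[OF assms(1)] lc lin_comp[OF assms(1)] cl smult_rules(2)
  have "ks X G (%x y. eps x \<odot>\<^bsub>X\<^esub> g y) = ks X F (%p q. eps p \<odot>\<^bsub>X\<^esub> ks X G (%x y. eps x \<odot>\<^bsub>X\<^esub> g (q \<cdot> y)))"
    by (subst F_counit(1)) simp_all
  also have "... = ks X F (%p q. ks X G (%x y. eps (p \<cdot> x) \<odot>\<^bsub>X\<^esub> g (q \<cdot> y)))" by (simp del: F_counit)
  also have "... = g \<one>\<^bsub>K\<^esub>" by (subst FG_cancel(1)) simp_all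
  finally show "ks X G (%x y. eps x \<odot>\<^bsub>X\<^esub> g y) = g \<one>\<^bsub>K\<^esub>" .
  have "ks X G (%x y. eps y \<odot>\<^bsub>X\<^esub> g x) = ks X F (%p q. eps q \<odot>\<^bsub>X\<^esub> ks X G (%x y. eps y \<odot>\<^bsub>X\<^esub> g (p \<cdot> x)))"
    by (subst F_counit(2)) simp_all
  also have "... = ks X F (%p q. ks X G (%x y. eps (q \<cdot> y) \<odot>\<^bsub>X\<^esub> g (p \<cdot> x)))" by (simp del: F_counit)
  also have "... = g \<one>\<^bsub>K\<^esub>" by (subst FG_cancel(1)) simp_all
  finally show "ks X G (%x y. eps y \<odot>\<^bsub>X\<^esub> g x) = g \<one>\<^bsub>K\<^esub>" .
qed

abbreviation "L12 t \<equiv> ks T3 t (%x y. t3 x y \<one>\<^bsub>K\<^esub>)"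
abbreviation "L23 t \<equiv> ks T3 t (%x y. t3 \<one>\<^bsub>K\<^esub> x y)"
abbreviation "D12 t \<equiv> ks T3 t (%x y. sw T3 x (%a b. t3 a b y))"
abbreviation "D23 t \<equiv> ks T3 t (%x y. sw T3 y (%a b. t3 x a b))"

lemma cocycle_K3: "L12 F *** D12 F = L23 F *** D23 F"
  using F_cocycle by (simp add: swap_comult)

lemma
  assumes [simp]: "s <: KK" "t <: KK"
  shows L12_mult: "L12 (s ** t) = L12 s *** L12 t"
    and L23_mult: "L23 (s ** t) = L23 s *** L23 t"
    and D12_mult: "D12 (s ** t) = D12 s *** D12 t"
    and D23_mult: "D23 (s ** t) = D23 s *** D23 t"
  by (rule lift_mult; simp; rule tsumc_swap; simp)+

lemma leg_inverse:
  "L12 G *** L12 F = \<one>\<^bsub>K3\<^esub>" "L23 G *** L23 F = \<one>\<^bsub>K3\<^esub>" "L23 F *** L23 G = \<one>\<^bsub>K3\<^esub>"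
  "D12 G *** D12 F = \<one>\<^bsub>K3\<^esub>" "D12 F *** D12 G = \<one>\<^bsub>K3\<^esub>" "D23 F *** D23 G = \<one>\<^bsub>K3\<^esub>"
  by (subst L12_mult[symmetric] L23_mult[symmetric] D12_mult[symmetric] D23_mult[symmetric]; simp add: FG GF)+

lemma cocycle_variants_K3:
  "L12 G *** L23 F = D12 F *** D23 G"
  "L23 G *** L12 F = D23 F *** D12 G"
  "D12 G *** L12 G = D23 G *** L23 G"
proof -
  have m: "monoid K3" using ring_tpa[of K "tpa K K"] by (simp add: ring_def)
  note i = leg_inverse
  show "L12 G *** L23 F = D12 F *** D23 G"
    by (rule monoid_cocycle(1)[OF m _ _ _ _ _ _ _ _ i(1,5,2,6) cocycle_K3]) simp_all
  show "L23 G *** L12 F = D23 F *** D12 G"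
    by (rule monoid_cocycle(2)[OF m _ _ _ _ _ _ _ _ i(1,5,2,6) cocycle_K3]) simp_all
  show "D12 G *** L12 G = D23 G *** L23 G"
    by (rule monoid_cocycle(3)[OF m _ _ _ _ _ _ _ _ i(1,5,2,6) cocycle_K3 i(4,3)]) simp_all
qed

text \<open>The cocycle condition and its consequences as identities between sums.\<close>

lemma cocycle:
  assumes f: "trilinear_map k K K K X f" and X [simp]: "module k X"
  shows "ks X F (%x y. sw X x (%a b. ks X F (%p q. f (p \<cdot> a) (q \<cdot> b) y))) =
      ks X F (%x y. sw X y (%a b. ks X F (%p q. f x (p \<cdot> a) (q \<cdot> b))))"
    and "ks X G (%x y. sw X x (%a b. ks X G (%p q. f (a \<cdot> p) (b \<cdot> q) y))) =
      ks X G (%x y. sw X y (%a b. ks X G (%p q. f x (a \<cdot> p) (b \<cdot> q))))"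
    and "ks X G (%p q. ks X F (%x y. f p (q \<cdot> x) y)) =
      ks X F (%x y. sw X x (%a b. ks X G (%p q. sw X q (%c d. f (a \<cdot> p) (b \<cdot> c) (y \<cdot> d)))))"
    and "ks X G (%p q. ks X F (%x y. f x (p \<cdot> y) q)) =
      ks X F (%x y. sw X y (%a b. ks X G (%p q. sw X p (%c d. f (x \<cdot> c) (a \<cdot> d) (b \<cdot> q)))))"
proof -
  note [simp] = trilinear_comp[OF f]
  show "ks X F (%x y. sw X x (%a b. ks X F (%p q. f (p \<cdot> a) (q \<cdot> b) y))) =
      ks X F (%x y. sw X y (%a b. ks X F (%p q. f x (p \<cdot> a) (q \<cdot> b))))"
    using arg_cong[OF cocycle_K3, of "%z. ev3 X z f"] by (simp add: swap_comult)
  show "ks X G (%x y. sw X x (%a b. ks X G (%p q. f (a \<cdot> p) (b \<cdot> q) y))) =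
      ks X G (%x y. sw X y (%a b. ks X G (%p q. f x (a \<cdot> p) (b \<cdot> q))))"
    using arg_cong[OF cocycle_variants_K3(3), of "%z. ev3 X z f"] by (simp add: swap_comult)
  show "ks X G (%p q. ks X F (%x y. f p (q \<cdot> x) y)) =
      ks X F (%x y. sw X x (%a b. ks X G (%p q. sw X q (%c d. f (a \<cdot> p) (b \<cdot> c) (y \<cdot> d)))))"
    using arg_cong[OF cocycle_variants_K3(1), of "%z. ev3 X z f"]
    by (subst swap_comult2) (simp_all add: tsumc_swap[of K K K K X _ F G])
  show "ks X G (%p q. ks X F (%x y. f x (p \<cdot> y) q)) =
      ks X F (%x y. sw X y (%a b. ks X G (%p q. sw X p (%c d. f (x \<cdot> c) (a \<cdot> d) (b \<cdot> q)))))"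
    using arg_cong[OF cocycle_variants_K3(2), of "%z. ev3 X z f"]
    by (subst swap_comult2) (simp_all add: tsumc_swap[of K K K K X _ F G])
qed

end

section \<open>The twisted Hopf algebra\<close>

context hopf begin

lemma tensor_alg_monoid: "monoid (tpa K K)" "monoid K3"
  using ring_tpa[of K K] ring_tpa[of K "tpa K K"] by (simp_all add: ring_def)

lemmas KK_assoc = alg_assoc[OF k_algebra_tpa[OF K_alg K_alg], simplified tpa_simps]
lemmas K3_assoc = alg_assoc[OF k_algebra_tpa[OF K_alg k_algebra_tpa[OF K_alg K_alg]], simplified tpa_simps tpa_cong]

lemma KK_one [simp]:
  "t <: KK ==> tens k K K \<one>\<^bsub>K\<^esub> \<one>\<^bsub>K\<^esub> ** t = t"
  "t <: KK ==> t ** tens k K K \<one>\<^bsub>K\<^esub> \<one>\<^bsub>K\<^esub> = t"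
  using alg_simps(4,5)[OF k_algebra_tpa[OF K_alg K_alg]] by simp_all

lemma KK_linear [simp]:
  assumes "linear_map k U KK g" "t <: KK"
  shows "linear_map k U KK (%u. t ** g u)" "linear_map k U KK (%u. g u ** t)"
  using lin_comp[OF tpa_linear(1)[OF K_alg K_alg assms(2)] assms(1)]
    lin_comp[OF tpa_linear(2)[OF K_alg K_alg assms(2)] assms(1)] by simp_all

lemma K3_linear [simp]:
  assumes "linear_map k U T3 g" "t <: T3"
  shows "linear_map k U T3 (%u. t *** g u)" "linear_map k U T3 (%u. g u *** t)"
  using lin_comp[OF tpa_linear(1)[OF K_alg k_algebra_tpa[OF K_alg K_alg], unfolded tpa_cong, OF assms(2)] assms(1)]
    lin_comp[OF tpa_linear(2)[OF K_alg k_algebra_tpa[OF K_alg K_alg], unfolded tpa_cong, OF assms(2)] assms(1)] by simp_all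

end

lemma (in hopf) tsumc_rev3:
  assumes "!!x y a b p q. [|x <: K; y <: K; a <: K; b <: K; p <: K; q <: K|]
    ==> f x y a b p q <: X" "module k X"
  shows "ks X r (%x y. ks X s (%a b. ks X t (%p q. f x y a b p q))) = ks X t (%p q. ks X s (%a b. ks X r (%x y. f x y a b p q)))"
proof -
  note [simp] = assms
  have "ks X r (%x y. ks X s (%a b. ks X t (%p q. f x y a b p q))) = ks X r (%x y. ks X t (%p q. ks X s (%a b. f x y a b p q)))"
    by (intro tsumc_cong tsumc_swap) simp_all
  also have "... = ks X t (%p q. ks X r (%x y. ks X s (%a b. f x y a b p q)))"
    by (intro tsumc_swap) simp_all
  also have "... = ks X t (%p q. ks X s (%a b. ks X r (%x y. f x y a b p q)))"
    by (intro tsumc_cong tsumc_swap) simp_all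
  finally show ?thesis .
qed

context twist begin

text \<open>The element \<open>u = F\<^sup>\<alpha> S(F\<^sub>\<alpha>)\<close> that conjugates the antipode, and its inverse, formed from \<open>G\<close>.\<close>

definition "uF = ks K F (%x y. x \<cdot> S y)"
definition "vF = ks K G (%x y. S x \<cdot> y)"

lemma uv_closed [simp]: "uF <: K" "vF <: K"
  by (simp_all add: uF_def vF_def)

text \<open>This is the cocycle condition multiplied out with \<open>a \<otimes> b \<otimes> c \<mapsto> S(a) b
  S(c)\<close>; all coproducts collapse by the antipode axiom.\<close>

lemma vu: "vF \<cdot> uF = \<one>\<^bsub>K\<^esub>"
proof -
  let ?f = "%a b c. S a \<cdot> b \<cdot> S c"
  have "vF \<cdot> uF = ks K G (%p q. ks K F (%x y. ?f p (q \<cdot> x) y))"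
    unfolding uF_def vF_def by (simp add: K_assoc tsumc_swap[of K K K K K _ F G])
  also have "... = ks K F (%x y. sw K x (%a b. ks K G (%p q. sw K q (%c d. ?f (a \<cdot> p) (b \<cdot> c) (y \<cdot> d)))))"
    by (rule cocycle(3)) (simp_all add: trilinear_map_def)
  also have "... = ks K F (%x y. sw K x (%a b. ks K G (%p q. eps q \<odot>\<^bsub>K\<^esub> (S (a \<cdot> p) \<cdot> b \<cdot> S y))))"
  proof (intro tsumc_cong)
    fix x y a b p q assume [simp]: "x <: K" "y <: K" "a <: K" "b <: K" "p <: K" "q <: K"
    show "sw K q (%c d. ?f (a \<cdot> p) (b \<cdot> c) (y \<cdot> d)) = eps q \<odot>\<^bsub>K\<^esub> (S (a \<cdot> p) \<cdot> b \<cdot> S y)"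
      using sw_antipode(2)[of q K "%z. S (a \<cdot> p) \<cdot> b \<cdot> z \<cdot> S y"] by (simp add: K_assoc antipode_mult)
  qed
  also have "... = ks K F (%x y. eps x \<odot>\<^bsub>K\<^esub> S y)"
    by (intro tsumc_cong) (use sw_antipode(1)[of _ K "%z. z \<cdot> S _"] in simp)
  also have "... = \<one>\<^bsub>K\<^esub>" by simp
  finally show ?thesis .
qed

text \<open>The same computation with \<open>a \<otimes> b \<otimes> c \<mapsto> a S(b) c\<close>.\<close>

lemma uv: "uF \<cdot> vF = \<one>\<^bsub>K\<^esub>"
proof -
  let ?f = "%a b c. a \<cdot> S b \<cdot> c"
  have "uF \<cdot> vF = ks K G (%p q. ks K F (%x y. ?f x (p \<cdot> y) q))"
    unfolding uF_def vF_def by (simp add: K_assoc antipode_mult)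
  also have "... = ks K F (%x y. sw K y (%a b. ks K G (%p q. sw K p (%c d. ?f (x \<cdot> c) (a \<cdot> d) (b \<cdot> q)))))"
    by (rule cocycle(4)) (simp_all add: trilinear_map_def)
  also have "... = ks K F (%x y. sw K y (%a b. ks K G (%p q. eps p \<odot>\<^bsub>K\<^esub> (x \<cdot> S a \<cdot> b \<cdot> q))))"
  proof (intro tsumc_cong)
    fix x y a b p q assume [simp]: "x <: K" "y <: K" "a <: K" "b <: K" "p <: K" "q <: K"
    show "sw K p (%c d. ?f (x \<cdot> c) (a \<cdot> d) (b \<cdot> q)) = eps p \<odot>\<^bsub>K\<^esub> (x \<cdot> S a \<cdot> b \<cdot> q)"
      using sw_antipode(2)[of p K "%z. x \<cdot> z \<cdot> S a \<cdot> b \<cdot> q"] by (simp add: K_assoc antipode_mult)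
  qed
  also have "... = ks K F (%x y. eps y \<odot>\<^bsub>K\<^esub> x)"
  proof (intro tsumc_cong)
    fix x y assume [simp]: "x <: K" "y <: K"
    show "sw K y (%a b. ks K G (%p q. eps p \<odot>\<^bsub>K\<^esub> (x \<cdot> S a \<cdot> b \<cdot> q))) = eps y \<odot>\<^bsub>K\<^esub> x"
      using sw_antipode(1)[of y K "%z. x \<cdot> z"] by (simp add: K_assoc)
  qed
  also have "... = \<one>\<^bsub>K\<^esub>" by simp
  finally show ?thesis .
qed

lemma inv_twist_F: "inv_twist k K F = G"
proof -
  interpret monoid "tpa K K" by (rule tensor_alg_monoid)
  show ?thesis unfolding inv_twist_def
    by (rule inv_unique'[of F G, symmetric]) (simp_all add: FG GF)
qed

lemma inv_uF: "inv\<^bsub>K\<^esub> uF = vF"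
proof -
  interpret ring K by (rule k_algebra_ring) simp
  show ?thesis by (rule inv_unique'[symmetric]) (simp_all add: uv vu)
qed

abbreviation "K' \<equiv> twisted_hopf k K F"
definition "\<Delta>' h = F ** comult K h ** G"

lemma K'_simps [simp]:
  "carrier K' = carrier K" "mult K' = mult K" "one K' = one K" "zero K' = zero K" "add K' = add K"
  "smult K' = smult K" "counit K' = counit K" "comult K' = \<Delta>'" "antipode K' h = uF \<cdot> S h \<cdot> vF"
proof -
  have "tsum k K F (%x y. x \<otimes>\<^bsub>K\<^esub> antipode K y) = uF"
    unfolding uF_def by (rule tsum_eq_tsumc) simp_all
  then show "carrier K' = carrier K" "mult K' = mult K" "one K' = one K" "zero K' = zero K" "add K' = add K"
  "smult K' = smult K" "counit K' = counit K" "comult K' = \<Delta>'" "antipode K' h = uF \<cdot> S h \<cdot> vF"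
    by (simp_all add: twisted_hopf_def Let_def inv_twist_F \<Delta>'_def[abs_def] inv_uF)
qed

lemma same_K': "same_module K' K" by (simp add: same_module_def)

lemmas K'_cong [simp] = same_module_cong[OF same_K']

lemma module_K' [simp]: "module k K'"
  by (rule same_module_module[OF same_module_sym[OF same_K']]) simp

lemma \<Delta>'_maps [simp]:
  "h <: K ==> \<Delta>' h <: KK"
  "linear_map k U K g ==> linear_map k U KK (%u. \<Delta>' (g u))"
  by (simp_all add: \<Delta>'_def)

lemma sw_\<Delta>':
  assumes "h <: K" "module k X"
    "!!v. v <: K ==> linear_map k K X (%w. f v w)" "!!w. w <: K ==> linear_map k K X (%v. f v w)"
  shows "ks X (\<Delta>' h) f = ks X F (%x y. sw X h (%a b. ks X G (%p q. f (x \<cdot> a \<cdot> p) (y \<cdot> b \<cdot> q))))"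
  unfolding \<Delta>'_def using assms by (simp add: bilinear_comp[OF assms(3,4)])

lemma tpa_K' [simp]: "tpa K' K' = tpa K K" "tpa K' C = tpa K C" "tpa C K' = tpa C K"
  unfolding tensor_product_algebra_def by simp_all

lemma K'_alg [simp]: "k_algebra k K'"
  by (rule k_algebraI) (simp_all add: K_assoc)

lemma D12': "t <: KK ==> ks T3 t (%x y. ks T3 (\<Delta>' x) (%a b. t3 a b y)) = L12 F *** D12 t *** L12 G"
  by (rule tensor_linear_eq[of _ K K T3]) (simp_all add: sw_\<Delta>' K3_assoc K_assoc tsumc_rev3[where r = F])

lemma D23': "t <: KK ==> ks T3 t (%x y. ks T3 (\<Delta>' y) (%a b. t3 x a b)) = L23 F *** D23 t *** L23 G"
  by (rule tensor_linear_eq[of _ K K T3]) (simp_all add: sw_\<Delta>' K3_assoc K_assoc tsumc_rev3[where r = F])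

text \<open>Conjugating the coassociativity of \<open>\<Delta>\<close> by the two sides of the cocycle condition gives
  that of \<open>\<Delta>'\<close>.\<close>

lemma coalgebra_K': "coalgebra k K' \<Delta>' eps"
proof (rule coalgebraI)
  fix h assume "h <: K'"
  then have h [simp]: "h <: K" by simp
  have "ks T3 (\<Delta>' h) (%x y. ks T3 (\<Delta>' x) (%a b. t3 a b y)) =
    (L12 F *** D12 F) *** D12 (comult K h) *** (D12 G *** L12 G)"
    by (subst D12', simp, subst \<Delta>'_def) (simp add: D12_mult K3_assoc K_assoc del: tsumc_tpa_mult)
  also have "D12 (comult K h) = D23 (comult K h)"
    by (rule sw_coassoc) (simp_all add: trilinear_map_def)
  also have "(L12 F *** D12 F) *** D23 (comult K h) *** (D12 G *** L12 G) =
    (L23 F *** D23 F) *** D23 (comult K h) *** (D23 G *** L23 G)"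
    by (simp only: cocycle_K3 cocycle_variants_K3(3))
  also have "... = ks T3 (\<Delta>' h) (%x y. ks T3 (\<Delta>' y) (%a b. t3 x a b))"
    by (subst D23', simp, subst \<Delta>'_def) (simp add: D23_mult K3_assoc K_assoc del: tsumc_tpa_mult)
  finally show "tsumc k K' K' (tensor_module k K' (tensor_module k K' K')) (\<Delta>' h) (%x y. tsumc k K' K' (tensor_module k K' (tensor_module k K' K')) (\<Delta>' x)
        (%a b. tens k K' (tensor_module k K' K') a (tens k K' K' b y))) =
      tsumc k K' K' (tensor_module k K' (tensor_module k K' K')) (\<Delta>' h) (%x y. tsumc k K' K' (tensor_module k K' (tensor_module k K' K')) (\<Delta>' y)
        (%a b. tens k K' (tensor_module k K' K') x (tens k K' K' a b)))" by simp
  have "ks K (\<Delta>' h) (%x y. eps x \<odot>\<^bsub>K\<^esub> y) = ks K F (%x y. eps x \<odot>\<^bsub>K\<^esub> sw K h (%a b. eps a \<odot>\<^bsub>K\<^esub> ks K G (%p q. eps p \<odot>\<^bsub>K\<^esub> (y \<cdot> b \<cdot> q))))"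
    by (simp add: sw_\<Delta>' smult_rules(2) K_assoc del: F_counit G_counit sw_counit)
  then show "tsumc k K' K' K' (\<Delta>' h) (%x y. eps x \<odot>\<^bsub>K'\<^esub> y) = h" by simp
  have "ks K (\<Delta>' h) (%x y. eps y \<odot>\<^bsub>K\<^esub> x) = ks K F (%x y. eps y \<odot>\<^bsub>K\<^esub> sw K h (%a b. eps b \<odot>\<^bsub>K\<^esub> ks K G (%p q. eps q \<odot>\<^bsub>K\<^esub> (x \<cdot> a \<cdot> p))))"
    by (simp add: sw_\<Delta>' smult_rules(2) K_assoc del: F_counit G_counit sw_counit)
  then show "tsumc k K' K' K' (\<Delta>' h) (%x y. eps y \<odot>\<^bsub>K'\<^esub> x) = h" by simp
qed simp_all

lemma \<Delta>'_mult:
  assumes [simp]: "g <: K" "h <: K"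
  shows "\<Delta>' (g \<cdot> h) = \<Delta>' g ** \<Delta>' h"
proof -
  have "\<Delta>' g ** \<Delta>' h = F ** comult K g ** (G ** F) ** comult K h ** G"
    by (simp add: \<Delta>'_def KK_assoc)
  then show ?thesis by (simp add: GF \<Delta>'_def KK_assoc)
qed

lemma \<Delta>'_one: "\<Delta>' \<one>\<^bsub>K\<^esub> = tens k K K \<one>\<^bsub>K\<^esub> \<one>\<^bsub>K\<^esub>"
  by (simp add: \<Delta>'_def FG)

lemma antipode_F:
  assumes g: "linear_map k K X g" and X: "module k X"
  shows "ks X F (%x y. g (S x \<cdot> (vF \<cdot> y))) = g \<one>\<^bsub>K\<^esub>" "ks X G (%p q. g (p \<cdot> (uF \<cdot> S q))) = g \<one>\<^bsub>K\<^esub>"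
proof -
  note [simp] = X lin_comp[OF g] lin_closed[OF g]
  have "ks X F (%x y. g (S x \<cdot> (vF \<cdot> y))) = ks X F (%x y. ks X G (%c d. g (S (c \<cdot> x) \<cdot> (d \<cdot> y))))"
    unfolding vF_def by (intro tsumc_cong) (simp add: linear_tsumc[OF g] antipode_mult K_assoc)
  also have "... = ks X G (%c d. ks X F (%x y. g (S (c \<cdot> x) \<cdot> (d \<cdot> y))))"
    by (rule tsumc_swap) simp_all
  also have "... = g \<one>\<^bsub>K\<^esub>" by (subst FG_cancel(2)[where f = "%x y. g (S x \<cdot> y)"]) simp_all
  finally show "ks X F (%x y. g (S x \<cdot> (vF \<cdot> y))) = g \<one>\<^bsub>K\<^esub>" .
  have "ks X G (%p q. g (p \<cdot> (uF \<cdot> S q))) = ks X G (%p q. ks X F (%x y. g (p \<cdot> x \<cdot> S (q \<cdot> y))))"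
    unfolding uF_def by (intro tsumc_cong) (simp add: linear_tsumc[OF g] antipode_mult K_assoc)
  also have "... = g \<one>\<^bsub>K\<^esub>" by (subst FG_cancel(2)[where f = "%x y. g (x \<cdot> S y)"]) simp_all
  finally show "ks X G (%p q. g (p \<cdot> (uF \<cdot> S q))) = g \<one>\<^bsub>K\<^esub>" .
qed

text \<open>The legs of \<open>F\<close> and of its inverse cancel against \<open>u\<close>, after which the antipode
  axiom of \<open>K\<close> applies.\<close>

lemma antipode':
  assumes h [simp]: "h <: K"
  shows "ks K (\<Delta>' h) (%x y. uF \<cdot> S x \<cdot> vF \<cdot> y) = eps h \<odot>\<^bsub>K\<^esub> \<one>\<^bsub>K\<^esub>"
    and "ks K (\<Delta>' h) (%x y. x \<cdot> (uF \<cdot> S y \<cdot> vF)) = eps h \<odot>\<^bsub>K\<^esub> \<one>\<^bsub>K\<^esub>"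
proof -
  have "ks K (\<Delta>' h) (%x y. uF \<cdot> S x \<cdot> vF \<cdot> y) =
    ks K F (%x y. sw K h (%a b. ks K G (%p q. uF \<cdot> S p \<cdot> S a \<cdot> (S x \<cdot> (vF \<cdot> y)) \<cdot> b \<cdot> q)))"
    by (simp add: sw_\<Delta>' antipode_mult K_assoc)
  also have "... = sw K h (%a b. ks K F (%x y. ks K G (%p q. uF \<cdot> S p \<cdot> S a \<cdot> (S x \<cdot> (vF \<cdot> y)) \<cdot> b \<cdot> q)))"
    by (rule tsumc_swap) simp_all
  also have "... = sw K h (%a b. ks K G (%p q. ks K F (%x y. uF \<cdot> S p \<cdot> S a \<cdot> (S x \<cdot> (vF \<cdot> y)) \<cdot> b \<cdot> q)))"
    by (intro tsumc_cong tsumc_swap) simp_all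
  also have "... = sw K h (%a b. ks K G (%p q. uF \<cdot> S p \<cdot> S a \<cdot> b \<cdot> q))"
    by (intro tsumc_cong) (subst antipode_F(1)[where g = "%z. uF \<cdot> S _ \<cdot> S _ \<cdot> z \<cdot> _ \<cdot> _"], simp_all)
  also have "... = ks K G (%p q. sw K h (%a b. uF \<cdot> S p \<cdot> S a \<cdot> b \<cdot> q))"
    by (rule tsumc_swap) simp_all
  also have "... = ks K G (%p q. eps h \<odot>\<^bsub>K\<^esub> (uF \<cdot> S p \<cdot> q))"
  proof (intro tsumc_cong)
    fix p q assume [simp]: "p <: K" "q <: K"
    show "sw K h (%a b. uF \<cdot> S p \<cdot> S a \<cdot> b \<cdot> q) = eps h \<odot>\<^bsub>K\<^esub> (uF \<cdot> S p \<cdot> q)"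
      using sw_antipode(1)[of h K "%z. uF \<cdot> S p \<cdot> z \<cdot> q"] by (simp add: K_assoc)
  qed
  also have "... = eps h \<odot>\<^bsub>K\<^esub> (uF \<cdot> vF)" by (simp add: vF_def K_assoc)
  finally show "ks K (\<Delta>' h) (%x y. uF \<cdot> S x \<cdot> vF \<cdot> y) = eps h \<odot>\<^bsub>K\<^esub> \<one>\<^bsub>K\<^esub>" by (simp add: uv)
  have "ks K (\<Delta>' h) (%x y. x \<cdot> (uF \<cdot> S y \<cdot> vF)) =
    ks K F (%x y. sw K h (%a b. ks K G (%p q. x \<cdot> a \<cdot> (p \<cdot> (uF \<cdot> S q)) \<cdot> S b \<cdot> S y \<cdot> vF)))"
    by (simp add: sw_\<Delta>' antipode_mult K_assoc)
  also have "... = ks K F (%x y. sw K h (%a b. x \<cdot> a \<cdot> S b \<cdot> S y \<cdot> vF))"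
    by (intro tsumc_cong) (subst antipode_F(2)[where g = "%z. _ \<cdot> _ \<cdot> z \<cdot> S _ \<cdot> S _ \<cdot> vF"], simp_all)
  also have "... = ks K F (%x y. eps h \<odot>\<^bsub>K\<^esub> (x \<cdot> S y \<cdot> vF))"
  proof (intro tsumc_cong)
    fix p q assume [simp]: "p <: K" "q <: K"
    show "sw K h (%a b. p \<cdot> a \<cdot> S b \<cdot> S q \<cdot> vF) = eps h \<odot>\<^bsub>K\<^esub> (p \<cdot> S q \<cdot> vF)"
      using sw_antipode(2)[of h K "%z. p \<cdot> z \<cdot> S q \<cdot> vF"] by (simp add: K_assoc)
  qed
  also have "... = eps h \<odot>\<^bsub>K\<^esub> (uF \<cdot> vF)" by (simp add: uF_def)
  finally show "ks K (\<Delta>' h) (%x y. x \<cdot> (uF \<cdot> S y \<cdot> vF)) = eps h \<odot>\<^bsub>K\<^esub> \<one>\<^bsub>K\<^esub>" by (simp add: uv)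
qed

theorem hopf_algebra_K': "hopf_algebra k K'"
proof -
  have 1: "algebra_map k K' (tpa K' K') (comult K')"
    unfolding algebra_map_def ring_hom_def
    by (auto simp: \<Delta>'_mult \<Delta>'_one lin_add[OF \<Delta>'_maps(2)[OF lin_ident]])
  have 2: "algebra_map k K' (self_module k) (counit K')"
    using hopf unfolding hopf_algebra_def algebra_map_def ring_hom_def by simp
  have 3: "convolution_inverse_of_id k K' (comult K') (counit K') (antipode K')"
    unfolding convolution_inverse_of_id_def
  proof (intro conjI ballI)
    have "linear_map k K K (%h. uF \<cdot> S h \<cdot> vF)" by simp
    then show "linear_map k K' K' (antipode K')" by (simp add: linear_map_def)
    fix h assume "h <: K'"
    then have h [simp]: "h <: K" by simp
    have "tsum k K (\<Delta>' h) (%x y. uF \<cdot> S x \<cdot> vF \<cdot> y) = ks K (\<Delta>' h) (%x y. uF \<cdot> S x \<cdot> vF \<cdot> y)"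
      by (rule tsum_eq_tsumc) simp_all
    then show "tsum k K' (comult K' h) (%y z. antipode K' y \<otimes>\<^bsub>K'\<^esub> z) = counit K' h \<odot>\<^bsub>K'\<^esub> \<one>\<^bsub>K'\<^esub>"
      by (simp add: antipode' del: tsumc_mult)
    have "tsum k K (\<Delta>' h) (%x y. x \<cdot> (uF \<cdot> S y \<cdot> vF)) = ks K (\<Delta>' h) (%x y. x \<cdot> (uF \<cdot> S y \<cdot> vF))"
      by (rule tsum_eq_tsumc) simp_all
    then show "tsum k K' (comult K' h) (%y z. y \<otimes>\<^bsub>K'\<^esub> antipode K' z) = counit K' h \<odot>\<^bsub>K'\<^esub> \<one>\<^bsub>K'\<^esub>"
      by (simp add: antipode' del: tsumc_mult)
  qed
  show ?thesis unfolding hopf_algebra_def using 1 2 3 coalgebra_K' by simp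
qed

end

section \<open>Triangular structures\<close>

context ground begin

lemma tens_smult [simp]:
  assumes "module k V" "module k W" "v <: V" "w <: W" "c <: k"
  shows "tens k V W v (c \<odot>\<^bsub>W\<^esub> w) = c \<odot>\<^bsub>tensor_module k V W\<^esub> tens k V W v w"
    and "tens k V W (c \<odot>\<^bsub>V\<^esub> v) w = c \<odot>\<^bsub>tensor_module k V W\<^esub> tens k V W v w"
  using lin_smult[OF lin_tens_right[OF assms(1-3)] assms(5,4)]
    lin_smult[OF lin_tens_left[OF assms(1,2,4)] assms(5,3)] by simp_all

lemma tsumc_smult_tensor [simp]:
  assumes "module k V" "module k W" "module k X" "c <: k" "t <: (tensor_module k V W)"
    and "!!v. v <: V ==> linear_map k W X (%w. f v w)" "!!w. w <: W ==> linear_map k V X (%v. f v w)"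
  shows "tsumc k V W X (c \<odot>\<^bsub>tensor_module k V W\<^esub> t) f = c \<odot>\<^bsub>X\<^esub> tsumc k V W X t f"
  by (rule lin_smult[of k "tensor_module k V W" X "%t. tsumc k V W X t f"]) (use assms in simp_all)

end

context hopf begin

abbreviation "flipK t \<equiv> ks KK t (%x y. tens k K K y x)"
abbreviation "L13 t \<equiv> ks T3 t (%x y. t3 x \<one>\<^bsub>K\<^esub> y)"

lemma flipK_mult: "[|s <: KK; t <: KK|] ==> flipK (s ** t) = flipK s ** flipK t"
  by (rule tsumc_multiplicative[of K K "tpa K K" "%x y. tens k K K y x" s t, unfolded tpa_cong tpa_simps]) simp_all

end

locale triangular = hopf k K for k :: "'k ring" and K :: "('k, 'h) hopf" +
  fixes R :: "('k, 'h, 'h) tensor"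
  assumes R_in [simp]: "R <: KK"
    and R_inv: "R ** flipK R = tens k K K \<one>\<^bsub>K\<^esub> \<one>\<^bsub>K\<^esub>" "flipK R ** R = tens k K K \<one>\<^bsub>K\<^esub> \<one>\<^bsub>K\<^esub>"
    and R_cocomm: "h <: K ==> flipK (comult K h) ** R = R ** comult K h"
    and R_hex: "ks T3 R (%x y. sw T3 x (%a b. t3 a b y)) = L13 R *** ks T3 R (%x y. t3 \<one>\<^bsub>K\<^esub> x y)"
begin

text \<open>Triangularity, \<open>R\<^sup>-\<^sup>1 = R\<^sub>2\<^sub>1\<close>, as a cancellation rule for two sums over
  \<open>R\<close>.\<close>

lemma R_cancel:
  assumes "!!v. v <: K ==> linear_map k K X (%w. f v w)" "!!w. w <: K ==> linear_map k K X (%v. f v w)" "module k X"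
  shows "ks X R (%r s. ks X R (%r' s'. f (r \<cdot> s') (s \<cdot> r'))) = f \<one>\<^bsub>K\<^esub> \<one>\<^bsub>K\<^esub>"
    and "ks X R (%r s. ks X R (%r' s'. f (s \<cdot> r') (r \<cdot> s'))) = f \<one>\<^bsub>K\<^esub> \<one>\<^bsub>K\<^esub>"
proof -
  have [simp]: "f v w <: X" if "v <: K" "w <: K" for v w
    by (rule lin_closed[OF assms(1)]) fact+
  note [simp] = bilinear_comp[OF assms(1,2)] assms
  show "ks X R (%r s. ks X R (%r' s'. f (r \<cdot> s') (s \<cdot> r'))) = f \<one>\<^bsub>K\<^esub> \<one>\<^bsub>K\<^esub>"
    using arg_cong[OF R_inv(1), of "%z. ks X z f"] by (subst tsumc_swap) simp_all
  show "ks X R (%r s. ks X R (%r' s'. f (s \<cdot> r') (r \<cdot> s'))) = f \<one>\<^bsub>K\<^esub> \<one>\<^bsub>K\<^esub>"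
    using arg_cong[OF R_inv(2), of "%z. ks X z f"] by simp
qed

lemma R_comult:
  assumes "h <: K" "!!v. v <: K ==> linear_map k K X (%w. f v w)"
    "!!w. w <: K ==> linear_map k K X (%v. f v w)" "module k X"
  shows "sw X h (%a b. ks X R (%r s. f (b \<cdot> r) (a \<cdot> s))) = ks X R (%r s. sw X h (%a b. f (r \<cdot> a) (s \<cdot> b)))"
proof -
  note [simp] = bilinear_comp[OF assms(2,3)] assms
  show ?thesis using arg_cong[OF R_cocomm[OF assms(1)], of "%z. ks X z f"] by simp
qed

lemma R_hex1:
  assumes f: "trilinear_map k K K K X f" and X [simp]: "module k X"
  shows "ks X R (%r s. sw X r (%a b. f a b s)) = ks X R (%r s. ks X R (%r' s'. f r r' (s \<cdot> s')))"
proof -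
  note [simp] = trilinear_comp[OF f]
  have "ks X R (%r s. ks X R (%r' s'. f r r' (s \<cdot> s'))) = ks X R (%r' s'. ks X R (%r s. f r r' (s \<cdot> s')))"
    by (rule tsumc_swap) simp_all
  then show ?thesis using arg_cong[OF R_hex, of "%z. ev3 X z f"] by simp
qed

lemma R_hex2:
  assumes f: "trilinear_map k K K K X f" and X [simp]: "module k X"
  shows "ks X R (%r s. sw X s (%a b. f r a b)) = ks X R (%r s. ks X R (%r' s'. f (r \<cdot> r') s' s))"
proof -
  note [simp] = trilinear_comp[OF f]
  let ?D = "%t. ks T3 t (%x y. sw T3 x (%a b. t3 a b y))" and ?L = "%t. ks T3 t (%x y. t3 \<one>\<^bsub>K\<^esub> x y)"
  interpret M: monoid K3 by (rule tensor_alg_monoid)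
  have m: "?D (s ** t) = ?D s *** ?D t" "?L (s ** t) = ?L s *** ?L t"
    "L13 (s ** t) = L13 s *** L13 t" if [simp]: "s <: KK" "t <: KK" for s t
    by (rule lift_mult; simp; rule tsumc_swap; simp)+
  let ?Q = "flipK R"
  have i: "?D ?Q *** ?D R = \<one>\<^bsub>K3\<^esub>" "L13 R *** L13 ?Q = \<one>\<^bsub>K3\<^esub>" "?L R *** ?L ?Q = \<one>\<^bsub>K3\<^esub>"
    by (subst m[symmetric]; simp del: tsumc_tsumc add: R_inv)+
  have c: "?D ?Q <: K3" "L13 ?Q <: K3" "?L ?Q <: K3" "L13 R <: K3" "?L R <: K3" by simp_all
  have "?D ?Q = ?D ?Q *** (L13 R *** (?L R *** ?L ?Q) *** L13 ?Q)"
    unfolding i using c i(2) by (simp del: tsumc_tsumc tpa_simps)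
  also have "... = ?D ?Q *** (L13 R *** ?L R) *** (?L ?Q *** L13 ?Q)"
    using c by (simp only: M.m_assoc M.m_closed)
  also have "... = ?L ?Q *** L13 ?Q"
    unfolding R_hex[symmetric] i using c by (simp only: M.l_one M.m_closed)
  finally have "ev3 X (?D ?Q) (%a b c. f c a b) = ev3 X (?L ?Q *** L13 ?Q) (%a b c. f c a b)" by (rule arg_cong)
  moreover have "ks X R (%r s. ks X R (%r' s'. f (r \<cdot> r') s' s)) = ks X R (%r' s'. ks X R (%r s. f (r \<cdot> r') s' s))"
    by (rule tsumc_swap) simp_all
  ultimately show ?thesis by simp
qed

text \<open>Applying the counit to a hexagon identity gives \<open>(1 \<otimes> e) R = R\<close> with \<open>e = (\<epsilon> \<otimes> id) R\<close>, and
  \<open>R\<close> can be cancelled.\<close>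

lemma R_counit [simp]:
  assumes g: "linear_map k K X g" and X [simp]: "module k X"
  shows "ks X R (%r s. eps r \<odot>\<^bsub>X\<^esub> g s) = g \<one>\<^bsub>K\<^esub>" "ks X R (%r s. eps s \<odot>\<^bsub>X\<^esub> g r) = g \<one>\<^bsub>K\<^esub>"
proof -
  note [simp] = lin_comp[OF g] lin_closed[OF g] lin_smult[OF g]
  define e where "e = ks K R (%r s. eps r \<odot>\<^bsub>K\<^esub> s)"
  define e' where "e' = ks K R (%r s. eps s \<odot>\<^bsub>K\<^esub> r)"
  have [simp]: "e <: K" "e' <: K" by (simp_all add: e_def e'_def)
  have "ks KK R (%r s. sw KK r (%a b. eps a \<odot>\<^bsub>KK\<^esub> tens k K K b s)) =
      ks KK R (%r s. ks KK R (%r' s'. eps r \<odot>\<^bsub>KK\<^esub> tens k K K r' (s \<cdot> s')))"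
    by (rule R_hex1) (simp_all add: trilinear_map_def)
  moreover have "tens k K K \<one>\<^bsub>K\<^esub> e ** R = ks KK R (%r s. ks KK R (%r' s'. eps r \<odot>\<^bsub>KK\<^esub> tens k K K r' (s \<cdot> s')))"
    by (simp add: e_def tpa_mult)
  ultimately have "R = tens k K K \<one>\<^bsub>K\<^esub> e ** R" by simp
  from arg_cong[OF this, of "%z. z ** flipK R"]
  have "R ** flipK R = tens k K K \<one>\<^bsub>K\<^esub> e ** (R ** flipK R)"
    using KK_assoc[of "tens k K K \<one>\<^bsub>K\<^esub> e" R "flipK R"] by (simp only: tens_closed K_mod K_simps R_in tsumc_closed module_tensor \<open>e <: K\<close>)
  then have "tens k K K \<one>\<^bsub>K\<^esub> \<one>\<^bsub>K\<^esub> = tens k K K \<one>\<^bsub>K\<^esub> e" unfolding R_inv by simp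
  then have "ks K (tens k K K \<one>\<^bsub>K\<^esub> \<one>\<^bsub>K\<^esub>) (%x y. eps x \<odot>\<^bsub>K\<^esub> y) = ks K (tens k K K \<one>\<^bsub>K\<^esub> e) (%x y. eps x \<odot>\<^bsub>K\<^esub> y)" by simp
  then have e: "e = \<one>\<^bsub>K\<^esub>" by simp
  show "ks X R (%r s. eps r \<odot>\<^bsub>X\<^esub> g s) = g \<one>\<^bsub>K\<^esub>"
    using linear_tsumc[OF g K_mod K_mod K_mod X, of "%r s. eps r \<odot>\<^bsub>K\<^esub> s" R] e by (simp add: e_def)
  have "ks KK R (%r s. sw KK s (%a b. eps b \<odot>\<^bsub>KK\<^esub> tens k K K r a)) =
      ks KK R (%r s. ks KK R (%r' s'. eps s \<odot>\<^bsub>KK\<^esub> tens k K K (r \<cdot> r') s'))"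
    by (rule R_hex2) (simp_all add: trilinear_map_def)
  moreover have "tens k K K e' \<one>\<^bsub>K\<^esub> ** R = ks KK R (%r s. ks KK R (%r' s'. eps s \<odot>\<^bsub>KK\<^esub> tens k K K (r \<cdot> r') s'))"
    by (simp add: e'_def tpa_mult)
  ultimately have "R = tens k K K e' \<one>\<^bsub>K\<^esub> ** R" by simp
  from arg_cong[OF this, of "%z. z ** flipK R"]
  have "R ** flipK R = tens k K K e' \<one>\<^bsub>K\<^esub> ** (R ** flipK R)"
    using KK_assoc[of "tens k K K e' \<one>\<^bsub>K\<^esub>" R "flipK R"] by (simp only: tens_closed K_mod K_simps R_in tsumc_closed module_tensor \<open>e' <: K\<close>)
  then have "tens k K K \<one>\<^bsub>K\<^esub> \<one>\<^bsub>K\<^esub> = tens k K K e' \<one>\<^bsub>K\<^esub>" unfolding R_inv by simp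
  then have "ks K (tens k K K \<one>\<^bsub>K\<^esub> \<one>\<^bsub>K\<^esub>) (%x y. eps y \<odot>\<^bsub>K\<^esub> x) = ks K (tens k K K e' \<one>\<^bsub>K\<^esub>) (%x y. eps y \<odot>\<^bsub>K\<^esub> x)" by simp
  then have e: "e' = \<one>\<^bsub>K\<^esub>" by simp
  show "ks X R (%r s. eps s \<odot>\<^bsub>X\<^esub> g r) = g \<one>\<^bsub>K\<^esub>"
    using linear_tsumc[OF g K_mod K_mod K_mod X, of "%r s. eps s \<odot>\<^bsub>K\<^esub> r" R] e by (simp add: e'_def)
qed

end

lemma triangularI:
  assumes "triangular_hopf_algebra k K R" "cring k"
  shows "triangular k K R"
proof -
  interpret hopf k K using assms by (simp add: hopf_def hopf_axioms_def ground_def triangular_hopf_algebra_def Let_def)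
  note d = assms(1)[unfolded triangular_hopf_algebra_def Let_def]
  interpret M: monoid "tpa K K" by (rule tensor_alg_monoid)
  have U: "R \<in> Units (tpa K K)" using d by blast
  have R [simp]: "R <: KK" using d M.Units_closed[of R] by simp
  have flip: "tflip k K K t = flipK t" if "t <: KK" for t using that by (rule tflip_eq) simp_all
  have inv: "inv\<^bsub>tpa K K\<^esub> R = flipK R" using d by (simp add: flip)
  have "R ** flipK R = \<one>\<^bsub>tpa K K\<^esub>" "flipK R ** R = \<one>\<^bsub>tpa K K\<^esub>"
    unfolding inv[symmetric] by (rule M.Units_r_inv[OF U], rule M.Units_l_inv[OF U])
  then have i: "R ** flipK R = tens k K K \<one>\<^bsub>K\<^esub> \<one>\<^bsub>K\<^esub>" "flipK R ** R = tens k K K \<one>\<^bsub>K\<^esub> \<one>\<^bsub>K\<^esub>" by simp_all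
  have cocomm: "flipK (comult K h) ** R = R ** comult K h" if [simp]: "h <: K" for h
  proof -
    have "flipK (comult K h) = R ** comult K h ** flipK R"
      using d that unfolding inv[symmetric] by (simp add: flip)
    then have "flipK (comult K h) ** R = R ** comult K h ** (flipK R ** R)"
      by (simp add: KK_assoc)
    then show ?thesis by (simp add: i)
  qed
  have "tassoc k K K K (tmap k (tpa K K) K (comult K) id R) =
      tassoc k K K K (tmap k (tpa K K) K (%x. tens k K K x \<one>\<^bsub>K\<^esub>) id R \<otimes>\<^bsub>tpa (tpa K K) K\<^esub> tmap k (tpa K K) K (tens k K K \<one>\<^bsub>K\<^esub>) id R)"
    using d by simp
  then have "ks T3 R (%x y. sw T3 x (%a b. t3 a b y)) = L13 R *** ks T3 R (%x y. t3 \<one>\<^bsub>K\<^esub> x y)"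
    by (simp add: tassoc_eq tmap_eq[of _ K K])
  then show ?thesis using i cocomm R hopf_axioms
    by (auto simp: triangular_def triangular_axioms_def)
qed

lemma twistI:
  assumes "hopf_twist_element k K F" "hopf_algebra k K" "cring k"
  shows "twist k K F (inv_twist k K F)"
proof -
  interpret hopf k K using assms by (simp add: hopf_def hopf_axioms_def ground_def)
  note d = assms(1)[unfolded hopf_twist_element_def Let_def]
  interpret M: monoid "tpa K K" by (rule tensor_alg_monoid)
  let ?G = "inv_twist k K F"
  have U: "F \<in> Units (tpa K K)" using d by blast
  have F [simp]: "F <: KK" using d M.Units_closed[of F] by simp
  have G: "?G <: KK" using M.Units_inv_closed[of F] d by (simp add: inv_twist_def)
  have "F ** ?G = \<one>\<^bsub>tpa K K\<^esub>" "?G ** F = \<one>\<^bsub>tpa K K\<^esub>"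
    unfolding inv_twist_def by (rule M.Units_r_inv[OF U], rule M.Units_l_inv[OF U])
  then have i: "F ** ?G = tens k K K \<one>\<^bsub>K\<^esub> \<one>\<^bsub>K\<^esub>" "?G ** F = tens k K K \<one>\<^bsub>K\<^esub> \<one>\<^bsub>K\<^esub>" by simp_all
  have c: "ks K F (%x y. eps x \<odot>\<^bsub>K\<^esub> y) = \<one>\<^bsub>K\<^esub>" "ks K F (%x y. eps y \<odot>\<^bsub>K\<^esub> x) = \<one>\<^bsub>K\<^esub>"
    using d tsum_eq_tsumc[of k K K K F "%x y. eps x \<odot>\<^bsub>K\<^esub> y"] tsum_eq_tsumc[of k K K K F "%x y. eps y \<odot>\<^bsub>K\<^esub> x"] by simp_all
  have "tassoc k K K K (tens k (tpa K K) K F \<one>\<^bsub>K\<^esub> \<otimes>\<^bsub>tpa (tpa K K) K\<^esub> tmap k (tpa K K) K (comult K) id F) =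
      tens k K (tpa K K) \<one>\<^bsub>K\<^esub> F \<otimes>\<^bsub>tpa K (tpa K K)\<^esub> tmap k K (tpa K K) id (comult K) F"
    using d by simp
  moreover have "tassoc k K K K (tens k (tpa K K) K F \<one>\<^bsub>K\<^esub> \<otimes>\<^bsub>tpa (tpa K K) K\<^esub> tmap k (tpa K K) K (comult K) id F) =
     ks T3 F (%x y. sw T3 x (%a b. ks T3 F (%p q. t3 (p \<cdot> a) (q \<cdot> b) y)))"
    by (simp add: tassoc_eq tmap_eq[of _ K K]) (intro tsumc_cong tsumc_swap, simp_all)
  moreover have "tens k K (tpa K K) \<one>\<^bsub>K\<^esub> F \<otimes>\<^bsub>tpa K (tpa K K)\<^esub> tmap k K (tpa K K) id (comult K) F =
      ks T3 F (%x y. sw T3 y (%a b. ks T3 F (%p q. t3 x (p \<cdot> a) (q \<cdot> b))))"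
    by (simp add: tmap_eq[of _ K K] tpa_mult) (intro tsumc_cong tsumc_swap, simp_all)
  ultimately have "ks T3 F (%x y. sw T3 x (%a b. ks T3 F (%p q. t3 (p \<cdot> a) (q \<cdot> b) y))) =
      ks T3 F (%x y. sw T3 y (%a b. ks T3 F (%p q. t3 x (p \<cdot> a) (q \<cdot> b))))" by simp
  then show ?thesis using i F G c hopf_axioms by (auto simp: twist_def twist_axioms_def)
qed

locale triangular_twist = triangular k K R + twist k K F G
  for k :: "'k ring" and K :: "('k, 'h) hopf" and R F G :: "('k, 'h, 'h) tensor"
begin

definition "R' = flipK F ** R ** G"

lemma twisted_R_eq: "twisted_R k K R F = R'"
  by (simp add: twisted_R_def Let_def R'_def inv_twist_F tflip_eq)

lemma R'_in [simp]: "R' <: KK" by (simp add: R'_def)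

abbreviation "L31 t \<equiv> ks T3 t (%x y. t3 y \<one>\<^bsub>K\<^esub> x)"
abbreviation "L32 t \<equiv> ks T3 t (%x y. t3 \<one>\<^bsub>K\<^esub> y x)"
abbreviation "D312 t \<equiv> ks T3 t (%x y. sw T3 y (%a b. t3 a b x))"
abbreviation "D31_2 t \<equiv> ks T3 t (%x y. sw T3 x (%a b. t3 b y a))"
abbreviation "D13_2 t \<equiv> ks T3 t (%x y. sw T3 x (%a b. t3 a y b))"
abbreviation "D1_32 t \<equiv> ks T3 t (%p q. sw T3 q (%c d. t3 p d c))"

text \<open>The subscripts say in which legs the factors of \<open>F\<close> are placed; a bracketed pair of legs carries
  a coproduct. These are the cocycle condition with its legs permuted, and the compatibility of
  \<open>R\<close> with the coproduct.\<close>

lemma leg_identities: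
  "L12 F *** D312 F = L31 F *** D31_2 F"
  "L13 G *** L32 F = D13_2 F *** D1_32 G"
  "L13 R *** D13_2 F = D31_2 F *** L13 R"
  "D1_32 G *** L23 R = L23 R *** D23 G"
proof -
  show "L12 F *** D312 F = L31 F *** D31_2 F"
    using cocycle(1)[of T3 "%a b c. t3 b c a"] by (simp add: trilinear_map_def swap_comult)
  show "L13 G *** L32 F = D13_2 F *** D1_32 G"
    using cocycle(3)[of T3 "%a b c. t3 a c b"]
    by (simp add: trilinear_map_def tsumc_swap[of K K K K T3 _ F G]) (subst swap_comult2, simp_all)
  show "L13 R *** D13_2 F = D31_2 F *** L13 R"
  proof -
    have "L13 R *** D13_2 F = ks T3 F (%x y. ks T3 R (%r s. sw T3 x (%a b. t3 (r \<cdot> a) y (s \<cdot> b))))"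
      by simp (intro tsumc_cong tsumc_swap, simp_all)
    also have "... = ks T3 F (%x y. sw T3 x (%a b. ks T3 R (%r s. t3 (b \<cdot> r) y (a \<cdot> s))))"
      by (intro tsumc_cong R_comult[symmetric, where f = "%u v. t3 u _ v"]) simp_all
    also have "... = D31_2 F *** L13 R" by (simp add: swap_comult)
    finally show ?thesis .
  qed
  show "D1_32 G *** L23 R = L23 R *** D23 G"
  proof -
    have "L23 R *** D23 G = ks T3 G (%x y. ks T3 R (%r s. sw T3 y (%a b. t3 x (r \<cdot> a) (s \<cdot> b))))"
      by simp (intro tsumc_cong tsumc_swap, simp_all)
    also have "... = ks T3 G (%x y. sw T3 y (%a b. ks T3 R (%r s. t3 x (b \<cdot> r) (a \<cdot> s))))"
      by (intro tsumc_cong R_comult[symmetric, where f = "%u v. t3 _ u v"]) simp_all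
    also have "... = D1_32 G *** L23 R" by (simp add: swap_comult)
    finally show ?thesis by simp
  qed
qed

text \<open>The first hexagon for \<open>R\<^sub>F = F\<^sub>2\<^sub>1 R G\<close> is a rearrangement in \<open>K
  \<otimes> K \<otimes> K\<close>: in \<open>F\<^sub>1\<^sub>2 (\<Delta> \<otimes> id)(F\<^sub>2\<^sub>1 R G)
  G\<^sub>1\<^sub>2\<close> the factors from \<open>F\<close> and \<open>G\<close> are moved past the two
  factors of \<open>(\<Delta> \<otimes> id) R\<close> by the leg identities. The second hexagon follows from
  the first since \<open>R\<^sub>F\<^sup>-\<^sup>1 = (R\<^sub>F)\<^sub>2\<^sub>1\<close>.\<close>

theorem triangular_K': "triangular k K' R'"
proof -
  interpret H': hopf k K' using hopf_algebra_K' by unfold_locales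
  let ?fl = "flipK"
  have ff: "?fl (?fl t) = t" if "t <: KK" for t using that by simp
  have fR': "?fl R' = F ** ?fl R ** ?fl G"
    unfolding R'_def by (simp only: flipK_mult ff F_in G_in R_in tsumc_closed module_tensor K_mod tpa_closed K_alg)
  note c = F_in G_in R_in tsumc_closed module_tensor K_mod tpa_closed K_alg
  note inv = FG GF R_inv flipK_mult[OF F_in G_in, symmetric] flipK_mult[OF G_in F_in, symmetric]
  have fl1: "?fl (tens k K K \<one>\<^bsub>K\<^esub> \<one>\<^bsub>K\<^esub>) = tens k K K \<one>\<^bsub>K\<^esub> \<one>\<^bsub>K\<^esub>" by simp
  have i1: "R' ** ?fl R' = tens k K K \<one>\<^bsub>K\<^esub> \<one>\<^bsub>K\<^esub>"
  proof -
    have "R' ** ?fl R' = ?fl F ** (R ** (G ** F) ** ?fl R) ** ?fl G"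
      unfolding fR' by (simp only: R'_def KK_assoc c)
    also have "... = ?fl F ** ?fl G" by (simp only: inv c KK_one)
    finally show ?thesis by (simp only: inv fl1)
  qed
  have i2: "?fl R' ** R' = tens k K K \<one>\<^bsub>K\<^esub> \<one>\<^bsub>K\<^esub>"
  proof -
    have "?fl R' ** R' = F ** (?fl R ** (?fl G ** ?fl F) ** R) ** G"
      unfolding fR' by (simp only: R'_def KK_assoc c)
    also have "?fl G ** ?fl F = tens k K K \<one>\<^bsub>K\<^esub> \<one>\<^bsub>K\<^esub>" by (simp only: inv fl1)
    also have "F ** (?fl R ** tens k K K \<one>\<^bsub>K\<^esub> \<one>\<^bsub>K\<^esub> ** R) ** G = tens k K K \<one>\<^bsub>K\<^esub> \<one>\<^bsub>K\<^esub>"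
      by (simp only: inv c KK_one)
    finally show ?thesis .
  qed
  have cocomm: "?fl (\<Delta>' h) ** R' = R' ** \<Delta>' h" if [simp]: "h <: K" for h
  proof -
    have "?fl (\<Delta>' h) ** R' = ?fl F ** ?fl (comult K h) ** (?fl G ** ?fl F) ** R ** G"
      unfolding \<Delta>'_def R'_def by (simp only: flipK_mult KK_assoc c that hopf_maps)
    also have "?fl G ** ?fl F = tens k K K \<one>\<^bsub>K\<^esub> \<one>\<^bsub>K\<^esub>" by (simp only: inv fl1)
    also have "?fl F ** ?fl (comult K h) ** tens k K K \<one>\<^bsub>K\<^esub> \<one>\<^bsub>K\<^esub> ** R ** G =
        ?fl F ** (?fl (comult K h) ** R) ** G"
      by (simp only: KK_assoc c KK_one that hopf_maps tens_closed K_simps)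
    also have "... = ?fl F ** R ** (G ** F) ** comult K h ** G"
      unfolding R_cocomm[OF that] by (simp only: KK_assoc c inv KK_one that hopf_maps)
    also have "... = R' ** \<Delta>' h"
      unfolding \<Delta>'_def R'_def by (simp only: KK_assoc c that hopf_maps)
    finally show ?thesis .
  qed
  have L: "L13 (s ** t) = L13 s *** L13 t" if [simp]: "s <: KK" "t <: KK" for s t
    by (rule lift_mult) simp_all
  have f3: "L13 (?fl F) = L31 F" "L23 (?fl F) = L32 F" "D12 (?fl F) = D312 F" by simp_all
  interpret M: monoid K3 by (rule tensor_alg_monoid)
  note c3 = M.m_assoc M.m_closed
  have cl: "L12 t <: K3" "L13 t <: K3" "L23 t <: K3" "D12 t <: K3" "D23 t <: K3"
    "L31 t <: K3" "L32 t <: K3" "D312 t <: K3" "D31_2 t <: K3" "D13_2 t <: K3" "D1_32 t <: K3" for t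
    by simp_all
  have "ks T3 R' (%x y. ks T3 (\<Delta>' x) (%a b. t3 a b y)) = L12 F *** D12 R' *** L12 G"
    by (rule D12') simp
  also have "D12 R' = D312 F *** D12 R *** D12 G"
    unfolding f3(3)[symmetric] R'_def by (simp only: D12_mult tpa_closed c)
  also have "L12 F *** (D312 F *** D12 R *** D12 G) *** L12 G =
      (L12 F *** D312 F) *** D12 R *** (D12 G *** L12 G)"
    using cl by (simp only: c3)
  also have "... = (L31 F *** D31_2 F) *** (L13 R *** L23 R) *** (D23 G *** L23 G)"
    by (simp only: leg_identities cocycle_variants_K3 R_hex)
  also have "... = L31 F *** (D31_2 F *** L13 R) *** (L23 R *** D23 G) *** L23 G"
    using cl by (simp only: c3)
  also have "... = L31 F *** (L13 R *** D13_2 F) *** (D1_32 G *** L23 R) *** L23 G"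
    by (simp only: leg_identities)
  also have "... = L31 F *** L13 R *** (D13_2 F *** D1_32 G) *** L23 R *** L23 G"
    using cl by (simp only: c3)
  also have "... = L31 F *** L13 R *** (L13 G *** L32 F) *** L23 R *** L23 G"
    by (simp only: leg_identities)
  also have "... = (L31 F *** L13 R *** L13 G) *** (L32 F *** L23 R *** L23 G)"
    using cl by (simp only: c3)
  also have "... = L13 R' *** L23 R'"
    unfolding f3(1,2)[symmetric] R'_def by (simp only: L L23_mult tpa_closed c)
  finally have "ks T3 R' (%x y. ks T3 (\<Delta>' x) (%a b. t3 a b y)) = L13 R' *** L23 R'" .
  then show ?thesis using i1 i2 cocomm H'.hopf_axioms
    by (simp add: triangular_def triangular_axioms_def del: tsumc_tpa_mult tsumc_tsumc)
qed

end

section \<open>Modules over the Hopf algebra\<close>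

context hopf begin

lemma K_module_simps [simp]:
  assumes "K_module k K V"
  shows "module k V" "[|h <: K; v <: V|] ==> act V h v <: V"
    "v <: V ==> act V \<one>\<^bsub>K\<^esub> v = v"
    "[|h <: K; h' <: K; v <: V|] ==> act V (h \<cdot> h') v = act V h (act V h' v)"
  using assms by (auto simp: K_module_def linear_map_def)

lemma K_module_linear [simp]:
  assumes V: "K_module k K V"
  shows "[|linear_map k X V g; h <: K|] ==> linear_map k X V (%u. act V h (g u))"
    "[|linear_map k X K i; v <: V|] ==> linear_map k X V (%u. act V (i u) v)"
proof -
  have 1: "linear_map k V V (%v. act V h v)" if "h <: K" for h using V that unfolding K_module_def by blast
  have 2: "linear_map k K V (%h. act V h v)" if "v <: V" for v using V that unfolding K_module_def by blast
  show "[|linear_map k X V g; h <: K|] ==> linear_map k X V (%u. act V h (g u))"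
    by (rule lin_comp[OF 1])
  show "[|linear_map k X K i; v <: V|] ==> linear_map k X V (%u. act V (i u) v)"
    by (rule lin_comp[OF 2])
qed

lemma K_module_push [simp]:
  assumes V: "K_module k K V" and m: "module k Y" "module k Z"
    and f: "!!a b. [|a <: Y; b <: Z|] ==> f a b <: V"
    and g: "!!a b. [|a <: Y; b <: Z|] ==> g a b <: K"
  shows "h <: K ==> act V h (tsumc k Y Z V t f) = tsumc k Y Z V t (%a b. act V h (f a b))"
    "v <: V ==> act V (tsumc k Y Z K t g) v = tsumc k Y Z V t (%a b. act V (g a b) v)"
proof -
  show "h <: K ==> act V h (tsumc k Y Z V t f) = tsumc k Y Z V t (%a b. act V h (f a b))"
    by (rule linear_tsumc) (use assms in simp_all)
  show "v <: V ==> act V (tsumc k Y Z K t g) v = tsumc k Y Z V t (%a b. act V (g a b) v)"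
    by (rule linear_tsumc[of K V "%h. act V h v"]) (use assms in simp_all)
qed

lemma K_module_rules:
  assumes V: "K_module k K V"
  shows act_add: "[|h <: K; v <: V; w <: V|] ==> act V h (v \<oplus>\<^bsub>V\<^esub> w) = act V h v \<oplus>\<^bsub>V\<^esub> act V h w"
    and act_smult: "[|h <: K; v <: V; c <: k|] ==> act V h (c \<odot>\<^bsub>V\<^esub> v) = c \<odot>\<^bsub>V\<^esub> act V h v"
    and act_smult2: "[|h <: K; v <: V; c <: k|] ==> act V (c \<odot>\<^bsub>K\<^esub> h) v = c \<odot>\<^bsub>V\<^esub> act V h v"
    and act_uminus: "[|h <: K; v <: V|] ==> act V h (\<ominus>\<^bsub>V\<^esub> v) = \<ominus>\<^bsub>V\<^esub> act V h v"
    and act_minus: "[|h <: K; v <: V; w <: V|] ==> act V h (v \<ominus>\<^bsub>V\<^esub> w) = act V h v \<ominus>\<^bsub>V\<^esub> act V h w"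
    and act_zero: "h <: K ==> act V h \<zero>\<^bsub>V\<^esub> = \<zero>\<^bsub>V\<^esub>"
proof -
  have l: "linear_map k V V (%v. act V h v)" if "h <: K" for h using V that by simp
  have l2: "linear_map k K V (%h. act V h v)" if "v <: V" for v using V that by simp
  have m: "module k V" using V by simp
  show "[|h <: K; v <: V; w <: V|] ==> act V h (v \<oplus>\<^bsub>V\<^esub> w) = act V h v \<oplus>\<^bsub>V\<^esub> act V h w"
    by (rule lin_add[OF l])
  show "[|h <: K; v <: V; c <: k|] ==> act V h (c \<odot>\<^bsub>V\<^esub> v) = c \<odot>\<^bsub>V\<^esub> act V h v"
    by (rule lin_smult[OF l])
  show "[|h <: K; v <: V; c <: k|] ==> act V (c \<odot>\<^bsub>K\<^esub> h) v = c \<odot>\<^bsub>V\<^esub> act V h v"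
    by (rule lin_smult[OF l2])
  show "[|h <: K; v <: V|] ==> act V h (\<ominus>\<^bsub>V\<^esub> v) = \<ominus>\<^bsub>V\<^esub> act V h v"
    by (rule lin_uminus[OF m m l])
  show "[|h <: K; v <: V; w <: V|] ==> act V h (v \<ominus>\<^bsub>V\<^esub> w) = act V h v \<ominus>\<^bsub>V\<^esub> act V h w"
    by (rule lin_minus[OF m m l])
  show "h <: K ==> act V h \<zero>\<^bsub>V\<^esub> = \<zero>\<^bsub>V\<^esub>"
    by (rule lin_zero[OF m m l])
qed

lemma K_module_algebra_simps [simp]:
  assumes "K_module_algebra k K A"
  shows "k_algebra k A" "K_module k K A" "h <: K ==> act A h \<one>\<^bsub>A\<^esub> = eps h \<odot>\<^bsub>A\<^esub> \<one>\<^bsub>A\<^esub>"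
  using assms unfolding K_module_algebra_def by blast+

lemma act_mult:
  assumes A: "K_module_algebra k K A" and [simp]: "h <: K" "a <: A" "a' <: A"
  shows "act A h (a \<otimes>\<^bsub>A\<^esub> a') = sw A h (%x y. act A x a \<otimes>\<^bsub>A\<^esub> act A y a')"
proof -
  note [simp] = K_module_algebra_simps[OF A]
  have "act A h (a \<otimes>\<^bsub>A\<^esub> a') = tsum k A (comult K h) (%x y. act A x a \<otimes>\<^bsub>A\<^esub> act A y a')"
    using assms unfolding K_module_algebra_def by blast
  also have "... = sw A h (%x y. act A x a \<otimes>\<^bsub>A\<^esub> act A y a')" by (rule tsum_eq_tsumc) simp_all
  finally show ?thesis .
qed

lemma K_moduleI:
  assumes "module k V" "!!h. h <: K ==> linear_map k V V (%v. act V h v)"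
    "!!v. v <: V ==> linear_map k K V (%h. act V h v)" "!!v. v <: V ==> act V \<one>\<^bsub>K\<^esub> v = v"
    "!!h h' v. [|h <: K; h' <: K; v <: V|] ==> act V (h \<cdot> h') v = act V h (act V h' v)"
  shows "K_module k K V"
  unfolding K_module_def by (intro conjI ballI assms)

lemma K_module_algebraI:
  assumes "k_algebra k A" "K_module k K A" "!!h. h <: K ==> act A h \<one>\<^bsub>A\<^esub> = eps h \<odot>\<^bsub>A\<^esub> \<one>\<^bsub>A\<^esub>"
    and m: "!!h a a'. [|h <: K; a <: A; a' <: A|] ==>
      act A h (a \<otimes>\<^bsub>A\<^esub> a') = sw A h (%x y. act A x a \<otimes>\<^bsub>A\<^esub> act A y a')"
  shows "K_module_algebra k K A"
proof -
  have eq: "tsum k A (comult K h) (%x y. act A x a \<otimes>\<^bsub>A\<^esub> act A y a') = act A h (a \<otimes>\<^bsub>A\<^esub> a')"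
    if "h <: K" "a <: A" "a' <: A" for h a a'
    unfolding m[OF that] by (rule tsum_eq_tsumc) (use assms(1,2) that in simp_all)
  then show ?thesis unfolding K_module_algebra_def by (intro conjI ballI assms(1-3) eq[symmetric])
qed

end

section \<open>Free algebras and quotient algebras\<close>

context ground begin

lemma free_algebra_simps:
  "carrier (free_algebra k X) = carrier (free_module k (lists X))"
  "add (free_algebra k X) = add (free_module k (lists X))" "zero (free_algebra k X) = zero (free_module k (lists X))"
  "smult (free_algebra k X) = smult (free_module k (lists X))" "one (free_algebra k X) = basis_vec k []"
  "mult (free_algebra k X) = (%p q w. \<Oplus>\<^bsub>k\<^esub>i\<in>{..length w}. p (take i w) \<otimes>\<^bsub>k\<^esub> q (drop i w))"
  by (simp_all add: free_algebra_def)

lemma same_free_algebra: "same_module (free_algebra k X) (free_module k (lists X))"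
  by (simp add: same_module_def free_algebra_simps)

lemma module_free_algebra [simp]: "module k (free_algebra k X)"
  by (rule same_module_module[OF same_module_sym[OF same_free_algebra] module_free[OF cring_k]])

lemma word_in [simp]: "w \<in> lists X ==> basis_vec k w <: (free_algebra k X)"
  by (simp add: free_algebra_simps basis_vec_in[OF cring_k])

lemma free_algebra_linear_eq:
  assumes "module k V" "linear_map k (free_algebra k X) V f" "linear_map k (free_algebra k X) V g"
    and "!!w. w \<in> lists X ==> f (basis_vec k w) = g (basis_vec k w)" "p <: (free_algebra k X)"
  shows "f p = g p"
  using assms free_module_linear_eq[of k V "lists X" f g p]
  by (simp add: same_module_linear_map[OF same_free_algebra] free_algebra_simps)

lemma basis_mult:
  "basis_vec k v \<otimes>\<^bsub>free_algebra k X\<^esub> basis_vec k w = basis_vec k (v @ w)"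
proof
  interpret cring k by (rule cring_k)
  fix u
  let ?s = "\<Oplus>\<^bsub>k\<^esub>i\<in>{..length u}. if length v = i then basis_vec k v (take (length v) u) \<otimes>\<^bsub>k\<^esub> basis_vec k w (drop (length v) u) else \<zero>\<^bsub>k\<^esub>"
  have "(\<Oplus>\<^bsub>k\<^esub>i\<in>{..length u}. basis_vec k v (take i u) \<otimes>\<^bsub>k\<^esub> basis_vec k w (drop i u)) = ?s"
    by (intro finsum_cong') (auto simp: basis_vec_def)
  also have "... = basis_vec k (v @ w) u"
  proof (cases "length v \<le> length u")
    case True
    then have "?s = basis_vec k v (take (length v) u) \<otimes>\<^bsub>k\<^esub> basis_vec k w (drop (length v) u)"
      by (intro finsum_singleton[of "length v"]) (auto simp: basis_vec_def)
    then show ?thesis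
      by (auto simp: basis_vec_def) (metis append_take_drop_id)
  next
    case False
    then have "?s = (\<Oplus>\<^bsub>k\<^esub>i\<in>{..length u}. \<zero>\<^bsub>k\<^esub>)" by (intro finsum_cong') auto
    then show ?thesis using False by (auto simp: basis_vec_def)
  qed
  finally show "(basis_vec k v \<otimes>\<^bsub>free_algebra k X\<^esub> basis_vec k w) u = basis_vec k (v @ w) u"
    by (simp add: free_algebra_simps)
qed

text \<open>The convolution of two finitely supported functions on words is supported on the concatenations of their
  supports.\<close>

lemma free_algebra_mult_linear:
  assumes q: "q <: (free_algebra k X)"
  shows "linear_map k (free_algebra k X) (free_algebra k X) (%p. p \<otimes>\<^bsub>free_algebra k X\<^esub> q)"
    and "linear_map k (free_algebra k X) (free_algebra k X) (%p. q \<otimes>\<^bsub>free_algebra k X\<^esub> p)"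
proof -
  interpret cring k by (rule cring_k)
  have v: "p w <: k" if "p <: (free_algebra k X)" for p w
    using that by (simp add: free_algebra_simps free_module_carrier)
  have closed: "p \<otimes>\<^bsub>free_algebra k X\<^esub> q <: (free_algebra k X)"
    if p: "p <: (free_algebra k X)" and q: "q <: (free_algebra k X)" for p q
  proof -
    let ?S = "(%(u, v). u @ v) ` ({w. p w \<noteq> \<zero>\<^bsub>k\<^esub>} \<times> {w. q w \<noteq> \<zero>\<^bsub>k\<^esub>})"
    have "(p \<otimes>\<^bsub>free_algebra k X\<^esub> q) w = \<zero>\<^bsub>k\<^esub>" if "w \<notin> ?S" for w
    proof -
      have "p (take i w) = \<zero>\<^bsub>k\<^esub> \<or> q (drop i w) = \<zero>\<^bsub>k\<^esub>" for i
        using that by (force simp: image_iff intro: append_take_drop_id[symmetric])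
      then have "p (take i w) \<otimes>\<^bsub>k\<^esub> q (drop i w) = \<zero>\<^bsub>k\<^esub>" for i using v[OF p] v[OF q] by (metis l_null r_null)
      then show ?thesis by (simp add: free_algebra_simps)
    qed
    then have sub: "{w. (p \<otimes>\<^bsub>free_algebra k X\<^esub> q) w \<noteq> \<zero>\<^bsub>k\<^esub>} \<subseteq> ?S" by blast
    have fin: "finite ?S" "?S \<subseteq> lists X"
      using p q unfolding free_algebra_simps free_module_carrier by (blast, fastforce)
    have "(p \<otimes>\<^bsub>free_algebra k X\<^esub> q) w <: k" for w
      using v[OF p] v[OF q] by (simp add: free_algebra_simps Pi_def)
    then show ?thesis
      using sub fin finite_subset[OF sub fin(1)] unfolding free_algebra_simps(1) free_module_carrier by blast
  qed
  show "linear_map k (free_algebra k X) (free_algebra k X) (%p. p \<otimes>\<^bsub>free_algebra k X\<^esub> q)"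
  proof (rule linear_mapI)
    fix p p' assume p: "p <: (free_algebra k X)" "p' <: (free_algebra k X)"
    show "(p \<oplus>\<^bsub>free_algebra k X\<^esub> p') \<otimes>\<^bsub>free_algebra k X\<^esub> q = p \<otimes>\<^bsub>free_algebra k X\<^esub> q \<oplus>\<^bsub>free_algebra k X\<^esub> p' \<otimes>\<^bsub>free_algebra k X\<^esub> q"
      by (rule ext) (simp add: free_algebra_simps free_module_simps v[OF p(1)] v[OF p(2)] v[OF q] p(1) l_distr finsum_addf)
  next
    fix c p assume p: "c <: k" "p <: (free_algebra k X)"
    show "(c \<odot>\<^bsub>free_algebra k X\<^esub> p) \<otimes>\<^bsub>free_algebra k X\<^esub> q = c \<odot>\<^bsub>free_algebra k X\<^esub> (p \<otimes>\<^bsub>free_algebra k X\<^esub> q)"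
      by (rule ext) (simp add: free_algebra_simps free_module_simps v[OF p(2)] v[OF q] p(1) m_assoc finsum_rdistr)
  qed (rule closed[OF _ q])
  show "linear_map k (free_algebra k X) (free_algebra k X) (%p. q \<otimes>\<^bsub>free_algebra k X\<^esub> p)"
  proof (rule linear_mapI)
    fix p p' assume p: "p <: (free_algebra k X)" "p' <: (free_algebra k X)"
    show "q \<otimes>\<^bsub>free_algebra k X\<^esub> (p \<oplus>\<^bsub>free_algebra k X\<^esub> p') = q \<otimes>\<^bsub>free_algebra k X\<^esub> p \<oplus>\<^bsub>free_algebra k X\<^esub> q \<otimes>\<^bsub>free_algebra k X\<^esub> p'"
      by (rule ext) (simp add: free_algebra_simps free_module_simps v[OF p(1)] v[OF p(2)] v[OF q] p(1) r_distr finsum_addf)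
  next
    fix c p assume p: "c <: k" "p <: (free_algebra k X)"
    show "q \<otimes>\<^bsub>free_algebra k X\<^esub> (c \<odot>\<^bsub>free_algebra k X\<^esub> p) = c \<odot>\<^bsub>free_algebra k X\<^esub> (q \<otimes>\<^bsub>free_algebra k X\<^esub> p)"
      by (rule ext) (simp add: free_algebra_simps free_module_simps v[OF p(2)] v[OF q] p(1) m_lcomm finsum_rdistr)
  qed (rule closed[OF q])
qed

lemma k_algebra_free [simp]: "k_algebra k (free_algebra k X)"
proof (rule k_algebraI)
  let ?A = "free_algebra k X"
  note l = free_algebra_mult_linear
  have c: "p \<otimes>\<^bsub>?A\<^esub> q <: ?A" if "p <: ?A" "q <: ?A" for p q
    using lin_closed[OF l(1)] that by blast
  show one: "\<one>\<^bsub>?A\<^esub> <: ?A" by (simp add: free_algebra_simps(5))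
  note e = free_algebra_linear_eq[OF module_free_algebra]
  show "\<one>\<^bsub>?A\<^esub> \<otimes>\<^bsub>?A\<^esub> x = x" if "x <: ?A" for x
    by (rule e[OF l(2)[OF one] lin_ident _ that]) (simp add: free_algebra_simps(5) basis_mult)
  show "x \<otimes>\<^bsub>?A\<^esub> \<one>\<^bsub>?A\<^esub> = x" if "x <: ?A" for x
    by (rule e[OF l(1)[OF one] lin_ident _ that]) (simp add: free_algebra_simps(5) basis_mult)
  note lc = lin_comp[OF l(1)] lin_comp[OF l(2)]
  have 1: "(basis_vec k u \<otimes>\<^bsub>?A\<^esub> basis_vec k v) \<otimes>\<^bsub>?A\<^esub> z = basis_vec k u \<otimes>\<^bsub>?A\<^esub> (basis_vec k v \<otimes>\<^bsub>?A\<^esub> z)"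
    if "u \<in> lists X" "v \<in> lists X" "z <: ?A" for u v z
    by (rule e[OF l(2) lin_comp[OF l(2) l(2)] _ that(3)]) (use that in \<open>simp_all add: basis_mult c\<close>)
  have 2: "(basis_vec k u \<otimes>\<^bsub>?A\<^esub> y) \<otimes>\<^bsub>?A\<^esub> z = basis_vec k u \<otimes>\<^bsub>?A\<^esub> (y \<otimes>\<^bsub>?A\<^esub> z)"
    if "u \<in> lists X" "y <: ?A" "z <: ?A" for u y z
    by (rule e[OF lin_comp[OF l(1) l(2)] lin_comp[OF l(2) l(1)] _ that(2)])
      (use that 1 in \<open>simp_all add: c\<close>)
  show "x \<otimes>\<^bsub>?A\<^esub> y \<otimes>\<^bsub>?A\<^esub> z = x \<otimes>\<^bsub>?A\<^esub> (y \<otimes>\<^bsub>?A\<^esub> z)" if "x <: ?A" "y <: ?A" "z <: ?A" for x y z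
    by (rule e[OF lin_comp[OF l(1) l(1)] l(1) _ that(1)]) (use that 2 in \<open>simp_all add: c\<close>)
qed (simp_all add: free_algebra_mult_linear)

lemma ideal_submodule:
  assumes A: "k_algebra k A" and I: "ideal I A"
  shows "submodule I k A"
proof -
  interpret A: module k A using A by simp
  interpret I: ideal I A by fact
  show ?thesis
  proof (rule A.submoduleI)
    fix c x assume cx: "c <: k" "x \<in> I"
    then have x: "x <: A" using I.a_subset by blast
    have "(c \<odot>\<^bsub>A\<^esub> \<one>\<^bsub>A\<^esub>) \<otimes>\<^bsub>A\<^esub> x \<in> I" by (rule I.I_l_closed[OF cx(2)]) (use A cx in simp)
    then show "c \<odot>\<^bsub>A\<^esub> x \<in> I" using A x cx by simp
  qed (use I.a_subset in auto)
qed

lemma quot_algebra: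
  assumes A: "k_algebra k A" and I: "ideal I A"
  shows k_algebra_quot: "k_algebra k (quot_module A I)"
    and quot_mult: "[|x <: A; y <: A|] ==>
      (I +>\<^bsub>A\<^esub> x) \<otimes>\<^bsub>quot_module A I\<^esub> (I +>\<^bsub>A\<^esub> y) = I +>\<^bsub>A\<^esub> (x \<otimes>\<^bsub>A\<^esub> y)"
proof -
  note S = ideal_submodule[OF A I]
  have mA: "module k A" using A by simp
  note q = quot_module_add[OF mA S] quot_module_smult[OF mA S]
  show m: "(I +>\<^bsub>A\<^esub> x) \<otimes>\<^bsub>quot_module A I\<^esub> (I +>\<^bsub>A\<^esub> y) = I +>\<^bsub>A\<^esub> (x \<otimes>\<^bsub>A\<^esub> y)" if "x <: A" "y <: A" for x y
    using ideal.rcoset_mult_add[OF I that] by (simp add: quot_module_simps)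
  show "k_algebra k (quot_module A I)"
  proof (rule k_algebraI)
    show "module k (quot_module A I)" by (rule module_quot[OF mA S])
    show "\<one>\<^bsub>quot_module A I\<^esub> <: (quot_module A I)" using A by (auto simp: quot_module_simps)
    fix x assume "x <: (quot_module A I)"
    then obtain a where a: "a <: A" "x = I +>\<^bsub>A\<^esub> a" by (auto simp: quot_module_simps)
    show "\<one>\<^bsub>quot_module A I\<^esub> \<otimes>\<^bsub>quot_module A I\<^esub> x = x" "x \<otimes>\<^bsub>quot_module A I\<^esub> \<one>\<^bsub>quot_module A I\<^esub> = x"
      using a A m by (simp_all add: quot_module_simps(3))
    show "linear_map k (quot_module A I) (quot_module A I) (%y. x \<otimes>\<^bsub>quot_module A I\<^esub> y)"
      unfolding a(2) by (rule linear_mapI; unfold quot_module_simps(1), elim imageE)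
        (use a A in \<open>simp_all add: m q alg_r_distr\<close>)
    show "linear_map k (quot_module A I) (quot_module A I) (%y. y \<otimes>\<^bsub>quot_module A I\<^esub> x)"
      unfolding a(2) by (rule linear_mapI; unfold quot_module_simps(1), elim imageE)
        (use a A in \<open>simp_all add: m q alg_l_distr\<close>)
    fix y z assume "y <: (quot_module A I)" "z <: (quot_module A I)"
    then obtain b c where b: "b <: A" "y = I +>\<^bsub>A\<^esub> b" "c <: A" "z = I +>\<^bsub>A\<^esub> c"
      by (auto simp: quot_module_simps)
    show "x \<otimes>\<^bsub>quot_module A I\<^esub> y \<otimes>\<^bsub>quot_module A I\<^esub> z = x \<otimes>\<^bsub>quot_module A I\<^esub> (y \<otimes>\<^bsub>quot_module A I\<^esub> z)"
      using a b A by (simp add: m alg_assoc)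
  qed
qed

lemma quot_descend:
  assumes M: "module k M" and N: "submodule N k M" and X: "module k X" and f: "linear_map k M X f"
    and z: "!!x. x \<in> N ==> f x = \<zero>\<^bsub>X\<^esub>"
  shows quot_descend_linear: "linear_map k (quot_module M N) X (%Y. f (SOME x. x \<in> Y))"
    and quot_descend_coset: "x <: M ==> f (SOME y. y \<in> N +>\<^bsub>M\<^esub> x) = f x"
proof -
  show c: "f (SOME y. y \<in> N +>\<^bsub>M\<^esub> x) = f x" if x: "x <: M" for x
  proof -
    have Y: "N +>\<^bsub>M\<^esub> x <: (quot_module M N)" using x by (simp add: quot_module_simps)
    define y where "y = (SOME y. y \<in> N +>\<^bsub>M\<^esub> x)"
    have y: "y <: M" "N +>\<^bsub>M\<^esub> x = N +>\<^bsub>M\<^esub> y" using coset_repr[OF M N Y] by (simp_all add: y_def)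
    then have "y \<ominus>\<^bsub>M\<^esub> x \<in> N" using coset_eq_iff[OF M N y(1) x] by simp
    then have "f y \<ominus>\<^bsub>X\<^esub> f x = \<zero>\<^bsub>X\<^esub>" using z lin_minus[OF M X f y(1) x] by simp
    then have "f y = f x"
      using module_minus_eq_zero[OF X] lin_closed[OF f y(1)] lin_closed[OF f x] by blast
    then show ?thesis by (simp add: y_def)
  qed
  show "linear_map k (quot_module M N) X (%Y. f (SOME x. x \<in> Y))"
    by (rule linear_mapI; unfold quot_module_simps(1), elim imageE)
      (simp_all add: quot_module_add[OF M N] quot_module_smult[OF M N] c M lin_closed[OF f] lin_add[OF f] lin_smult[OF f])
qed

text \<open>The elements \<open>x\<close> for which all products \<open>b x b'\<close>, with \<open>b, b'\<close> in a multiplicatively closed spanning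
  set, are mapped to \<open>0\<close> form an ideal.\<close>

lemma vanish_on_ideal:
  assumes A: "k_algebra k A" and X: "module k X" and L: "linear_map k A X L"
    and B: "B \<subseteq> carrier A" "\<one>\<^bsub>A\<^esub> \<in> B" "!!b b'. [|b \<in> B; b' \<in> B|] ==> b \<otimes>\<^bsub>A\<^esub> b' \<in> B"
    and span: "!!f a. [|linear_map k A X f; !!b. b \<in> B ==> f b = \<zero>\<^bsub>X\<^esub>; a <: A|] ==> f a = \<zero>\<^bsub>X\<^esub>"
    and S: "S \<subseteq> carrier A" "!!b s b'. [|b \<in> B; s \<in> S; b' \<in> B|] ==> L (b \<otimes>\<^bsub>A\<^esub> s \<otimes>\<^bsub>A\<^esub> b') = \<zero>\<^bsub>X\<^esub>"
    and x: "x \<in> Idl\<^bsub>A\<^esub> S"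
  shows "L x = \<zero>\<^bsub>X\<^esub>"
proof -
  interpret A: ring A using A by (rule k_algebra_ring)
  have mA: "module k A" using A by simp
  note [simp] = A X
  have bc: "b <: A" if "b \<in> B" for b using B(1) that by blast
  define J where "J = {x \<in> carrier A. \<forall>b\<in>B. \<forall>b'\<in>B. L (b \<otimes>\<^bsub>A\<^esub> x \<otimes>\<^bsub>A\<^esub> b') = \<zero>\<^bsub>X\<^esub>}"
  have lin: "linear_map k A X (%x. L (b \<otimes>\<^bsub>A\<^esub> x \<otimes>\<^bsub>A\<^esub> b'))" if "b \<in> B" "b' \<in> B" for b b'
    by (rule lin_comp[OF L]) (use that bc in simp)
  have Jsub: "J \<subseteq> carrier A" by (auto simp: J_def)
  interpret X: module k X by fact
  have "ideal J A"
  proof (rule idealI)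
    show "ring A" by (rule A.ring_axioms)
    show "subgroup J (add_monoid A)"
    proof (rule subgroup.intro)
      fix x y assume xy: "x \<in> J" "y \<in> J"
      then show "x \<otimes>\<^bsub>add_monoid A\<^esub> y \<in> J" using lin_add[OF lin] by (auto simp: J_def)
      show "inv\<^bsub>add_monoid A\<^esub> x \<in> J"
        using xy lin_uminus[OF mA X lin] by (auto simp: J_def a_inv_def[symmetric])
    qed (use lin_zero[OF mA X lin] Jsub in \<open>auto simp: J_def\<close>)
    fix a y assume a: "a \<in> J" and y: "y <: A"
    have aA: "a <: A" using a Jsub by blast
    have "L (b \<otimes>\<^bsub>A\<^esub> (y \<otimes>\<^bsub>A\<^esub> a) \<otimes>\<^bsub>A\<^esub> b') = \<zero>\<^bsub>X\<^esub>" if b: "b \<in> B" "b' \<in> B" for b b'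
    proof (rule span[of "%y. L (b \<otimes>\<^bsub>A\<^esub> (y \<otimes>\<^bsub>A\<^esub> a) \<otimes>\<^bsub>A\<^esub> b')", OF _ _ y])
      show "linear_map k A X (%y. L (b \<otimes>\<^bsub>A\<^esub> (y \<otimes>\<^bsub>A\<^esub> a) \<otimes>\<^bsub>A\<^esub> b'))"
        by (rule lin_comp[OF L]) (use b bc aA in simp)
      fix c assume c: "c \<in> B"
      have "b \<otimes>\<^bsub>A\<^esub> (c \<otimes>\<^bsub>A\<^esub> a) \<otimes>\<^bsub>A\<^esub> b' = (b \<otimes>\<^bsub>A\<^esub> c) \<otimes>\<^bsub>A\<^esub> a \<otimes>\<^bsub>A\<^esub> b'" using b c bc aA by (simp add: A.m_assoc)
      then show "L (b \<otimes>\<^bsub>A\<^esub> (c \<otimes>\<^bsub>A\<^esub> a) \<otimes>\<^bsub>A\<^esub> b') = \<zero>\<^bsub>X\<^esub>" using a b B(3)[OF b(1) c] by (simp add: J_def)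
    qed
    then show "y \<otimes>\<^bsub>A\<^esub> a \<in> J" using y aA by (simp add: J_def)
    have "L (b \<otimes>\<^bsub>A\<^esub> (a \<otimes>\<^bsub>A\<^esub> y) \<otimes>\<^bsub>A\<^esub> b') = \<zero>\<^bsub>X\<^esub>" if b: "b \<in> B" "b' \<in> B" for b b'
    proof (rule span[of "%y. L (b \<otimes>\<^bsub>A\<^esub> (a \<otimes>\<^bsub>A\<^esub> y) \<otimes>\<^bsub>A\<^esub> b')", OF _ _ y])
      show "linear_map k A X (%y. L (b \<otimes>\<^bsub>A\<^esub> (a \<otimes>\<^bsub>A\<^esub> y) \<otimes>\<^bsub>A\<^esub> b'))"
        by (rule lin_comp[OF L]) (use b bc aA in simp)
      fix c assume c: "c \<in> B"
      have "b \<otimes>\<^bsub>A\<^esub> (a \<otimes>\<^bsub>A\<^esub> c) \<otimes>\<^bsub>A\<^esub> b' = b \<otimes>\<^bsub>A\<^esub> a \<otimes>\<^bsub>A\<^esub> (c \<otimes>\<^bsub>A\<^esub> b')" using b c bc aA by (simp add: A.m_assoc)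
      then show "L (b \<otimes>\<^bsub>A\<^esub> (a \<otimes>\<^bsub>A\<^esub> c) \<otimes>\<^bsub>A\<^esub> b') = \<zero>\<^bsub>X\<^esub>" using a b B(3)[OF c b(2)] by (simp add: J_def)
    qed
    then show "a \<otimes>\<^bsub>A\<^esub> y \<in> J" using y aA by (simp add: J_def)
  qed
  moreover have "S \<subseteq> J" using S by (auto simp: J_def)
  ultimately have "x \<in> J" using A.genideal_minimal x by blast
  then have "L (\<one>\<^bsub>A\<^esub> \<otimes>\<^bsub>A\<^esub> x \<otimes>\<^bsub>A\<^esub> \<one>\<^bsub>A\<^esub>) = \<zero>\<^bsub>X\<^esub>" "x <: A" using B(2) unfolding J_def by blast+
  then show ?thesis by simp
qed

end

section \<open>Universal enveloping algebras\<close>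

text \<open>The universal enveloping algebra and its structure maps are built from an equivariant bilinear bracket.\<close>

locale braided_bracket = triangular k K R
  for k :: "'k ring" and K :: "('k, 'h) hopf" and R :: "('k, 'h, 'h) tensor" +
  fixes g :: "('k, 'h, 'g) braided_lie"
  assumes g_module [simp]: "K_module k K g"
    and bracket_linear: "v <: g ==> linear_map k g g (%u. bracket g u v)"
      "u <: g ==> linear_map k g g (%v. bracket g u v)"
    and bracket_act: "[|h <: K; u <: g; v <: g|] ==>
      act g h (bracket g u v) = sw g h (%x y. bracket g (act g x u) (act g y v))"
begin

abbreviation "FA \<equiv> free_algebra k (carrier g)"
abbreviation "TA \<equiv> tensor_algebra k g"
abbreviation "UA \<equiv> env_algebra k R g"
abbreviation "UK \<equiv> env_kmod k K R g"
abbreviation "iota \<equiv> env_incl k R g"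
abbreviation "LI \<equiv> letter_ideal k g"
abbreviation "EI \<equiv> env_ideal k R g"
abbreviation "tcl w \<equiv> LI +>\<^bsub>FA\<^esub> basis_vec k w"
abbreviation "cls w \<equiv> EI +>\<^bsub>TA\<^esub> tcl w"
abbreviation "words \<equiv> lists (carrier g)"

lemma g_mod [simp]: "module k g" by (rule K_module_simps(1)) simp

lemma bracket_simps [simp]:
  "[|u <: g; v <: g|] ==> bracket g u v <: g"
  "[|linear_map k X g f; v <: g|] ==> linear_map k X g (%x. bracket g (f x) v)"
  "[|linear_map k X g f; v <: g|] ==> linear_map k X g (%x. bracket g v (f x))"
  using lin_closed[OF bracket_linear(1)] lin_comp[OF bracket_linear(1)] lin_comp[OF bracket_linear(2)]
  by blast+

lemma letter_relations_subset: "letter_relations k g \<subseteq> carrier FA"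
  unfolding letter_relations_def Let_def by (auto intro!: ops_closed(2,3,5) word_in)

lemma LI_ideal: "ideal LI FA"
  unfolding letter_ideal_def using k_algebra_ring[OF k_algebra_free] letter_relations_subset
  by (rule ring.genideal_ideal)

lemma LI_sub: "submodule LI k FA" by (rule ideal_submodule[OF k_algebra_free LI_ideal])

lemma TA_alg [simp]: "k_algebra k TA"
  unfolding tensor_algebra_def by (rule k_algebra_quot[OF k_algebra_free LI_ideal])

lemma tcl_in [simp]: "w \<in> words ==> tcl w <: TA"
  unfolding tensor_algebra_def quot_module_simps by (rule imageI) simp

lemma tcl_mult: "[|v \<in> words; w \<in> words|] ==> tcl v \<otimes>\<^bsub>TA\<^esub> tcl w = tcl (v @ w)"
  unfolding tensor_algebra_def by (simp add: quot_mult[OF k_algebra_free LI_ideal] basis_mult)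

lemma tcl_one: "\<one>\<^bsub>TA\<^esub> = tcl []"
  by (simp add: tensor_algebra_def quot_module_simps free_algebra_simps(5))

lemma tcl_linear: "linear_map k g TA (%u. tcl [u])"
proof -
  note c = coset_eq_iff[OF module_free_algebra LI_sub]
  note q = quot_module_add[OF module_free_algebra LI_sub] quot_module_smult[OF module_free_algebra LI_sub]
  have gen: "x \<in> LI" if "x \<in> letter_relations k g" for x
    unfolding letter_ideal_def
    using ring.genideal_self[OF k_algebra_ring[OF k_algebra_free] letter_relations_subset] that by blast
  show ?thesis
  proof (rule linear_mapI)
    fix u v assume uv: "u <: g" "v <: g"
    have "basis_vec k [u \<oplus>\<^bsub>g\<^esub> v] \<ominus>\<^bsub>FA\<^esub> (basis_vec k [u] \<oplus>\<^bsub>FA\<^esub> basis_vec k [v]) \<in> letter_relations k g"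
      unfolding letter_relations_def Let_def using uv by blast
    from gen[OF this] have "tcl [u \<oplus>\<^bsub>g\<^esub> v] = LI +>\<^bsub>FA\<^esub> (basis_vec k [u] \<oplus>\<^bsub>FA\<^esub> basis_vec k [v])"
      by (subst c) (use uv in simp_all)
    then show "tcl [u \<oplus>\<^bsub>g\<^esub> v] = tcl [u] \<oplus>\<^bsub>TA\<^esub> tcl [v]"
      using uv by (simp add: tensor_algebra_def q)
  next
    fix a u assume au: "a <: k" "u <: g"
    have "basis_vec k [a \<odot>\<^bsub>g\<^esub> u] \<ominus>\<^bsub>FA\<^esub> a \<odot>\<^bsub>FA\<^esub> basis_vec k [u] \<in> letter_relations k g"
      unfolding letter_relations_def Let_def using au by blast
    from gen[OF this] have "tcl [a \<odot>\<^bsub>g\<^esub> u] = LI +>\<^bsub>FA\<^esub> (a \<odot>\<^bsub>FA\<^esub> basis_vec k [u])"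
      by (subst c) (use au in simp_all)
    then show "tcl [a \<odot>\<^bsub>g\<^esub> u] = a \<odot>\<^bsub>TA\<^esub> tcl [u]"
      using au by (simp add: tensor_algebra_def q)
  qed simp
qed

text \<open>Classes of words span the tensor algebra.\<close>

lemma TA_span:
  assumes "module k X" "linear_map k TA X f" "!!w. w \<in> words ==> f (tcl w) = \<zero>\<^bsub>X\<^esub>" "t <: TA"
  shows "f t = \<zero>\<^bsub>X\<^esub>"
proof -
  obtain p where p: "p <: FA" "t = LI +>\<^bsub>FA\<^esub> p"
    using assms(4) by (auto simp: tensor_algebra_def quot_module_simps)
  have l: "linear_map k FA TA (%p. LI +>\<^bsub>FA\<^esub> p)"
    unfolding tensor_algebra_def by (rule lin_coset[OF module_free_algebra LI_sub])
  show ?thesis unfolding p(2)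
    by (rule free_algebra_linear_eq[OF assms(1) lin_comp[OF assms(2) l] lin_const_zero[OF assms(1)] assms(3) p(1)])
qed

abbreviation "env_relations \<equiv> {tensor_algebra_incl k g u \<otimes>\<^bsub>TA\<^esub> tensor_algebra_incl k g v \<ominus>\<^bsub>TA\<^esub>
    tsum k TA R (%r s. tensor_algebra_incl k g (act g s v) \<otimes>\<^bsub>TA\<^esub> tensor_algebra_incl k g (act g r u)) \<ominus>\<^bsub>TA\<^esub>
    tensor_algebra_incl k g (bracket g u v) | u v. u <: g \<and> v <: g}"

lemma incl_tcl: "tensor_algebra_incl k g u = tcl [u]"
  by (simp add: tensor_algebra_incl_def)

lemma env_relation_eq:
  assumes "u <: g" "v <: g"
  shows "tensor_algebra_incl k g u \<otimes>\<^bsub>TA\<^esub> tensor_algebra_incl k g v \<ominus>\<^bsub>TA\<^esub>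
    tsum k TA R (%r s. tensor_algebra_incl k g (act g s v) \<otimes>\<^bsub>TA\<^esub> tensor_algebra_incl k g (act g r u)) \<ominus>\<^bsub>TA\<^esub>
    tensor_algebra_incl k g (bracket g u v) =
    tcl [u, v] \<ominus>\<^bsub>TA\<^esub> ks TA R (%r s. tcl [act g s v, act g r u]) \<ominus>\<^bsub>TA\<^esub> tcl [bracket g u v]"
proof -
  have "tsum k TA R (%r s. tensor_algebra_incl k g (act g s v) \<otimes>\<^bsub>TA\<^esub> tensor_algebra_incl k g (act g r u)) =
    ks TA R (%r s. tensor_algebra_incl k g (act g s v) \<otimes>\<^bsub>TA\<^esub> tensor_algebra_incl k g (act g r u))"
    by (rule tsum_eq_tsumc) (use assms in \<open>simp_all add: incl_tcl\<close>)
  also have "... = ks TA R (%r s. tcl [act g s v, act g r u])"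
    by (rule tsumc_cong) (use assms in \<open>simp add: incl_tcl tcl_mult\<close>)
  finally show ?thesis using assms by (simp add: incl_tcl tcl_mult)
qed

lemma env_relations_subset: "env_relations \<subseteq> carrier TA"
proof
  fix x assume "x \<in> env_relations"
  then obtain u v where uv: "u <: g" "v <: g"
    "x = tcl [u, v] \<ominus>\<^bsub>TA\<^esub> ks TA R (%r s. tcl [act g s v, act g r u]) \<ominus>\<^bsub>TA\<^esub> tcl [bracket g u v]"
    using env_relation_eq by auto
  then show "x <: TA" by simp
qed

lemma EI_ideal: "ideal EI TA"
  unfolding env_ideal_def Let_def using k_algebra_ring[OF TA_alg] env_relations_subset
  by (rule ring.genideal_ideal)

lemma EI_sub: "submodule EI k TA" by (rule ideal_submodule[OF TA_alg EI_ideal])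

lemma UA_alg [simp]: "k_algebra k UA"
  unfolding env_algebra_def by (rule k_algebra_quot[OF TA_alg EI_ideal])

lemma cls_in [simp]: "w \<in> words ==> cls w <: UA"
  unfolding env_algebra_def quot_module_simps by (rule imageI) simp

lemma cls_mult: "[|v \<in> words; w \<in> words|] ==> cls v \<otimes>\<^bsub>UA\<^esub> cls w = cls (v @ w)"
  unfolding env_algebra_def by (simp add: quot_mult[OF TA_alg EI_ideal] tcl_mult)

lemma cls_one: "\<one>\<^bsub>UA\<^esub> = cls []"
  by (simp add: env_algebra_def quot_module_simps tcl_one)

lemma iota_cls: "iota u = cls [u]"
  by (simp add: env_incl_def incl_tcl)

lemma UA_coset_linear: "linear_map k TA UA (%t. EI +>\<^bsub>TA\<^esub> t)"
  unfolding env_algebra_def by (rule lin_coset[OF _ EI_sub]) simp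

lemma iota_linear: "linear_map k g UA iota"
  using lin_comp[OF UA_coset_linear tcl_linear] by (simp add: iota_cls[abs_def])

lemma UA_span:
  assumes X: "module k X" and f: "linear_map k UA X f" "linear_map k UA X f'"
    and eq: "!!w. w \<in> words ==> f (cls w) = f' (cls w)" and t: "t <: UA"
  shows "f t = f' t"
proof -
  obtain p where p: "p <: TA" "t = EI +>\<^bsub>TA\<^esub> p"
    using t by (auto simp: env_algebra_def quot_module_simps)
  have "f (EI +>\<^bsub>TA\<^esub> p) \<ominus>\<^bsub>X\<^esub> f' (EI +>\<^bsub>TA\<^esub> p) = \<zero>\<^bsub>X\<^esub>"
    by (rule TA_span[OF X lin_minusf[OF X lin_comp[OF f(1) UA_coset_linear] lin_comp[OF f(2) UA_coset_linear]] _ p(1)])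
      (use X f eq lin_closed[OF f(2) cls_in] in \<open>simp add: module_minus_eq_zero\<close>)
  then show ?thesis unfolding p(2)
    using module_minus_eq_zero[OF X lin_closed[OF f(1)] lin_closed[OF f(2)]] t p(2) by blast
qed

lemma env_relation:
  assumes [simp]: "u <: g" "v <: g"
  shows "iota u \<otimes>\<^bsub>UA\<^esub> iota v = ks UA R (%r s. iota (act g s v) \<otimes>\<^bsub>UA\<^esub> iota (act g r u)) \<oplus>\<^bsub>UA\<^esub> iota (bracket g u v)"
proof -
  let ?t = "tcl [u, v] \<ominus>\<^bsub>TA\<^esub> ks TA R (%r s. tcl [act g s v, act g r u]) \<ominus>\<^bsub>TA\<^esub> tcl [bracket g u v]"
  have "?t \<in> env_relations" unfolding env_relation_eq[OF assms, symmetric] using assms by blast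
  then have "?t \<in> EI"
    unfolding env_ideal_def Let_def using ring.genideal_self[OF k_algebra_ring[OF TA_alg] env_relations_subset] by blast
  then have "EI +>\<^bsub>TA\<^esub> ?t = EI"
    using submodule_abelian_subgroup[OF _ EI_sub] by (simp add: abelian_subgroup.a_rcos_const)
  then have z: "EI +>\<^bsub>TA\<^esub> ?t = \<zero>\<^bsub>UA\<^esub>" by (simp add: env_algebra_def quot_module_simps)
  have mT: "module k TA" and mU: "module k UA" by simp_all
  have "EI +>\<^bsub>TA\<^esub> ?t = cls [u, v] \<ominus>\<^bsub>UA\<^esub> ks UA R (%r s. cls [act g s v, act g r u]) \<ominus>\<^bsub>UA\<^esub> cls [bracket g u v]"
    using lin_minus[OF mT mU UA_coset_linear] linear_tsumc[OF UA_coset_linear, of K K "%r s. tcl [act g s v, act g r u]" R]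
    by simp
  moreover have "ks UA R (%r s. cls [act g s v, act g r u]) = ks UA R (%r s. iota (act g s v) \<otimes>\<^bsub>UA\<^esub> iota (act g r u))"
    by (rule tsumc_cong) (simp add: iota_cls cls_mult)
  moreover have "cls [u, v] = iota u \<otimes>\<^bsub>UA\<^esub> iota v" by (simp add: iota_cls cls_mult)
  moreover have "x = y \<oplus>\<^bsub>UA\<^esub> z" if "x \<ominus>\<^bsub>UA\<^esub> y \<ominus>\<^bsub>UA\<^esub> z = \<zero>\<^bsub>UA\<^esub>" "x <: UA" "y <: UA" "z <: UA" for x y z
  proof -
    interpret module k UA by simp
    have "x \<ominus>\<^bsub>UA\<^esub> y = z" using that module_minus_eq_zero[OF mU, of "x \<ominus>\<^bsub>UA\<^esub> y" z] by simp
    then have "x = z \<oplus>\<^bsub>UA\<^esub> y" using that by (auto simp: a_minus_def M.a_assoc M.l_neg)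
    then show ?thesis using that by (simp add: M.a_comm)
  qed
  ultimately show ?thesis using z lin_closed[OF iota_linear] by (simp add: iota_cls)
qed

text \<open>The universal property of \<open>\<U>(\<gg>)\<close> as a module: a family of values on words extends to a linear
  map if it is linear in each letter and compatible with exchanging two neighbouring letters.\<close>

lemma env_ext:
  assumes X [simp]: "module k X" and c: "!!w. w \<in> words ==> f w <: X"
    and lin: "!!w w'. [|w \<in> words; w' \<in> words|] ==> linear_map k g X (%u. f (w @ u # w'))"
    and rel: "!!w w' u v. [|w \<in> words; w' \<in> words; u <: g; v <: g|] ==>
      f (w @ u # v # w') = ks X R (%r s. f (w @ act g s v # act g r u # w')) \<oplus>\<^bsub>X\<^esub> f (w @ bracket g u v # w')"
  shows env_ext_linear: "linear_map k UA X (env_ext k X f)"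
    and env_ext_cls: "w \<in> words ==> env_ext k X f (cls w) = f w"
proof -
  define L1 where "L1 = linear_ext k X f"
  have fw: "f \<in> words \<rightarrow> carrier X" using c by blast
  have L1: "linear_map k FA X L1" unfolding L1_def same_module_linear_map(1)[OF same_free_algebra]
    by (rule lin_linear_ext[OF X fw])
  have L1b: "L1 (basis_vec k w) = f w" if "w \<in> words" for w
    unfolding L1_def by (rule linear_ext_basis[OF X that fw])
  have FAm: "module k FA" and TAm: "module k TA" by simp_all
  have L1z: "L1 x = \<zero>\<^bsub>X\<^esub>" if "x \<in> LI" for x
  proof (rule vanish_on_ideal[OF k_algebra_free X L1, where B = "basis_vec k ` words" and S = "letter_relations k g"])
    show "x \<in> Idl\<^bsub>FA\<^esub> letter_relations k g" using that by (simp add: letter_ideal_def)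
    show "f a = \<zero>\<^bsub>X\<^esub>" if "linear_map k FA X f" "!!b. b \<in> basis_vec k ` words ==> f b = \<zero>\<^bsub>X\<^esub>" "a <: FA" for f a
      by (rule free_algebra_linear_eq[OF X that(1) lin_const_zero[OF X] that(2) that(3)]) auto
    show "b \<otimes>\<^bsub>FA\<^esub> b' \<in> basis_vec k ` words" if "b \<in> basis_vec k ` words" "b' \<in> basis_vec k ` words" for b b'
    proof -
      note b = that
      obtain x where x: "b = basis_vec k x" "x \<in> words" using b(1) by (rule imageE)
      obtain y where y: "b' = basis_vec k y" "y \<in> words" using b(2) by (rule imageE)
      show ?thesis unfolding x(1) y(1) basis_mult by (rule imageI) (use x y in simp)
    qed
    fix b s b' assume b: "b \<in> basis_vec k ` words" "b' \<in> basis_vec k ` words" and s: "s \<in> letter_relations k g"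
    obtain w where w1: "b = basis_vec k w" "w \<in> words" using b(1) by (rule imageE)
    obtain w' where w2: "b' = basis_vec k w'" "w' \<in> words" using b(2) by (rule imageE)
    note w = w1(2) w2(2) w1(1) w2(1)
    define M where "M = (%s. L1 (b \<otimes>\<^bsub>FA\<^esub> s \<otimes>\<^bsub>FA\<^esub> b'))"
    have M: "linear_map k FA X M" unfolding M_def by (rule lin_comp[OF L1]) (use w in simp)
    have Mb: "M (basis_vec k v) = f (w @ v @ w')" if "v \<in> words" for v
      unfolding M_def using w that by (simp add: basis_mult L1b)
    note m = lin_minus[OF FAm X M] lin_add[OF M] lin_smult[OF M]
    note z = module_minus_eq_zero[OF X]
    have "M s = \<zero>\<^bsub>X\<^esub>"
      using s unfolding letter_relations_def Let_def
      by (auto simp: m Mb lin_add[OF lin[OF w(1,2)]] lin_smult[OF lin[OF w(1,2)]] z lin_closed[OF lin[OF w(1,2)]])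
    then show "L1 (b \<otimes>\<^bsub>FA\<^esub> s \<otimes>\<^bsub>FA\<^esub> b') = \<zero>\<^bsub>X\<^esub>" by (simp add: M_def)
  qed (use letter_relations_subset in \<open>auto simp: free_algebra_simps(5) intro!: word_in\<close>)
  define L2 where "L2 = (%Y. L1 (SOME x. x \<in> Y))"
  have L2: "linear_map k TA X L2" unfolding L2_def tensor_algebra_def
    by (rule quot_descend_linear[OF FAm LI_sub X L1 L1z])
  have L2b: "L2 (tcl w) = f w" if "w \<in> words" for w
    unfolding L2_def using quot_descend_coset[OF FAm LI_sub X L1 L1z] L1b that by simp
  have L2z: "L2 x = \<zero>\<^bsub>X\<^esub>" if "x \<in> EI" for x
  proof (rule vanish_on_ideal[OF TA_alg X L2, where B = "tcl ` words" and S = env_relations])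
    show "x \<in> Idl\<^bsub>TA\<^esub> env_relations" using that by (simp add: env_ideal_def Let_def)
    show "f a = \<zero>\<^bsub>X\<^esub>" if "linear_map k TA X f" "!!b. b \<in> tcl ` words ==> f b = \<zero>\<^bsub>X\<^esub>" "a <: TA" for f a
      by (rule TA_span[OF X that(1) that(2) that(3)]) auto
    show "b \<otimes>\<^bsub>TA\<^esub> b' \<in> tcl ` words" if "b \<in> tcl ` words" "b' \<in> tcl ` words" for b b'
    proof -
      note b = that
      obtain x where x: "b = tcl x" "x \<in> words" using b(1) by (rule imageE)
      obtain y where y: "b' = tcl y" "y \<in> words" using b(2) by (rule imageE)
      show ?thesis unfolding x(1) y(1) tcl_mult[OF x(2) y(2)] by (rule imageI) (use x y in simp)
    qed
    fix b s b' assume b: "b \<in> tcl ` words" "b' \<in> tcl ` words" and s: "s \<in> env_relations"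
    obtain w where w1: "b = tcl w" "w \<in> words" using b(1) by (rule imageE)
    obtain w' where w2: "b' = tcl w'" "w' \<in> words" using b(2) by (rule imageE)
    note w = w1(2) w2(2) w1(1) w2(1)
    obtain u v where uv [simp]: "u <: g" "v <: g" and
      s: "s = tcl [u, v] \<ominus>\<^bsub>TA\<^esub> ks TA R (%r s. tcl [act g s v, act g r u]) \<ominus>\<^bsub>TA\<^esub> tcl [bracket g u v]"
      using s env_relation_eq by auto
    define M where "M = (%s. L2 (b \<otimes>\<^bsub>TA\<^esub> s \<otimes>\<^bsub>TA\<^esub> b'))"
    have M: "linear_map k TA X M" unfolding M_def by (rule lin_comp[OF L2]) (use w in simp)
    have Mb: "M (tcl v) = f (w @ v @ w')" if "v \<in> words" for v
      unfolding M_def using w that by (simp add: tcl_mult L2b)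
    note m = lin_minus[OF TAm X M]
    have sum: "M (ks TA R (%r s. tcl [act g s v, act g r u])) = ks X R (%r s. f (w @ act g s v # act g r u # w'))"
      by (subst linear_tsumc[OF M]) (auto intro!: tsumc_cong simp: Mb)
    have cc: "ks X R (%r s. f (w @ act g s v # act g r u # w')) <: X" "f (w @ bracket g u v # w') <: X"
      using c w by simp_all
    interpret X: module k X by fact
    have "(x \<oplus>\<^bsub>X\<^esub> y) \<ominus>\<^bsub>X\<^esub> x \<ominus>\<^bsub>X\<^esub> y = \<zero>\<^bsub>X\<^esub>" if "x <: X" "y <: X" for x y
    proof -
      have "(x \<oplus>\<^bsub>X\<^esub> y) \<ominus>\<^bsub>X\<^esub> x = y"
        using that by (simp add: a_minus_def X.M.a_comm[of x y] X.M.a_assoc X.M.r_neg)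
      then show ?thesis using that by (simp add: module_minus_eq_zero[OF X])
    qed
    then have "M s = \<zero>\<^bsub>X\<^esub>" unfolding s using w cc by (simp add: m sum Mb rel[OF w(1,2) uv])
    then show "L2 (b \<otimes>\<^bsub>TA\<^esub> s \<otimes>\<^bsub>TA\<^esub> b') = \<zero>\<^bsub>X\<^esub>" by (simp add: M_def)
  qed (use env_relations_subset in \<open>auto simp: tcl_one intro!: tcl_in\<close>)
  have e: "env_ext k X f = (%\<xi>. L2 (SOME t. t \<in> \<xi>))"
    by (simp add: env_ext_def L2_def L1_def fun_eq_iff)
  show "linear_map k UA X (env_ext k X f)" unfolding e env_algebra_def
    by (rule quot_descend_linear[OF TAm EI_sub X L2 L2z])
  show "env_ext k X f (cls w) = f w" if "w \<in> words"
    unfolding e using quot_descend_coset[OF TAm EI_sub X L2 L2z] L2b that by simp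
qed

lemma UK_fields:
  "carrier UA = carrier UK" "mult UA = mult UK" "one UA = one UK" "zero UA = zero UK" "add UA = add UK" "smult UA = smult UK"
  and act_UK: "act UK h = env_ext k UA (%w. word_act k K R g w h)"
  by (simp_all add: env_kmod_def Let_def module.defs kmod.defs)

lemma same_UA: "same_module UA UK" by (simp add: same_module_def UK_fields)

lemmas UA_cong [simp] = UK_fields same_module_cong[OF same_UA]

lemma UK_alg [simp]: "k_algebra k UK"
proof (rule k_algebraI)
  show "module k UK" by (rule same_module_module[OF same_UA]) simp
  note a = k_algebra_ring[OF UA_alg]
  show "x \<otimes>\<^bsub>UK\<^esub> y \<otimes>\<^bsub>UK\<^esub> z = x \<otimes>\<^bsub>UK\<^esub> (y \<otimes>\<^bsub>UK\<^esub> z)" if "x <: UK" "y <: UK" "z <: UK" for x y z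
    using alg_assoc[OF UA_alg, of x y z] that by simp
  show "linear_map k UK UK (%y. x \<otimes>\<^bsub>UK\<^esub> y)" if "x <: UK" for x
    using lin_mult2[OF UA_alg lin_ident, of x] that by simp
  show "linear_map k UK UK (%y. y \<otimes>\<^bsub>UK\<^esub> x)" if "x <: UK" for x
    using lin_mult1[OF UA_alg lin_ident, of x] that by simp
  show "\<one>\<^bsub>UK\<^esub> <: UK" "x <: UK ==> \<one>\<^bsub>UK\<^esub> \<otimes>\<^bsub>UK\<^esub> x = x" "x <: UK ==> x \<otimes>\<^bsub>UK\<^esub> \<one>\<^bsub>UK\<^esub> = x" for x
    using alg_simps(2,4,5)[OF UA_alg] by simp_all
qed

lemmas UK_simps [simp] = alg_simps[OF UK_alg]
lemmas UK_assoc = alg_assoc[OF UK_alg]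

lemma iota_simps [simp]:
  "u <: g ==> iota u <: UK"
  "linear_map k X g f ==> linear_map k X UK (%x. iota (f x))"
  using lin_closed[OF iota_linear] lin_comp[OF iota_linear] by simp_all

lemma cls_rules:
  "w \<in> words ==> cls w <: UK" "cls [] = \<one>\<^bsub>UK\<^esub>"
  "[|u <: g; w \<in> words|] ==> cls (u # w) = iota u \<otimes>\<^bsub>UK\<^esub> cls w"
  "[|v \<in> words; w \<in> words|] ==> cls (v @ w) = cls v \<otimes>\<^bsub>UK\<^esub> cls w"
  using cls_in cls_one cls_mult[of "[u]" w] cls_mult[of v w] by (simp_all add: iota_cls)

lemma iota_relation:
  assumes "u <: g" "v <: g"
  shows "iota u \<otimes>\<^bsub>UK\<^esub> iota v = ks UK R (%r s. iota (act g s v) \<otimes>\<^bsub>UK\<^esub> iota (act g r u)) \<oplus>\<^bsub>UK\<^esub> iota (bracket g u v)"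
  using env_relation[OF assms] by simp

text \<open>Induction over \<open>\<U>(\<gg>)\<close>: it is spanned by words, and a word is a letter times a shorter
  word.\<close>

lemma env_linear_eq:
  assumes X: "module k X" and f: "linear_map k UK X f" "linear_map k UK X f'"
    and one: "f \<one>\<^bsub>UK\<^esub> = f' \<one>\<^bsub>UK\<^esub>"
    and step: "!!u \<xi>. [|u <: g; \<xi> <: UK; f \<xi> = f' \<xi>|] ==> f (iota u \<otimes>\<^bsub>UK\<^esub> \<xi>) = f' (iota u \<otimes>\<^bsub>UK\<^esub> \<xi>)"
    and t: "t <: UK"
  shows "f t = f' t"
proof (rule UA_span[OF X])
  show "linear_map k UA X f" "linear_map k UA X f'" "t <: UA" using f t by simp_all
  show "f (cls w) = f' (cls w)" if "w \<in> words" for w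
    using that by (induction w) (simp_all add: one step cls_rules)
qed

lemma word_prod_rules:
  assumes B: "k_algebra k B" and \<phi>: "linear_map k g B \<phi>"
  shows "w \<in> words ==> word_prod B \<phi> w <: B"
    "[|v \<in> words; w \<in> words|] ==> word_prod B \<phi> (v @ w) = word_prod B \<phi> v \<otimes>\<^bsub>B\<^esub> word_prod B \<phi> w"
    "word_prod B \<phi> (u # w) = \<phi> u \<otimes>\<^bsub>B\<^esub> word_prod B \<phi> w" "word_prod B \<phi> [] = \<one>\<^bsub>B\<^esub>"
proof -
  note [simp] = B lin_closed[OF \<phi>]
  show 1: "w \<in> words ==> word_prod B \<phi> w <: B" for w
    by (induction w) (auto simp: word_prod_def)
  show "[|v \<in> words; w \<in> words|] ==> word_prod B \<phi> (v @ w) = word_prod B \<phi> v \<otimes>\<^bsub>B\<^esub> word_prod B \<phi> w"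
    using 1 by (induction v) (auto simp: word_prod_def alg_assoc[OF B])
qed (simp_all add: word_prod_def)

text \<open>The universal property of \<open>\<U>(\<gg>)\<close> as an algebra: products of values on letters are linear in each letter, and
  the relation for two letters can be multiplied by the values of the remaining ones.\<close>

lemma env_hom:
  assumes B: "k_algebra k B" and \<phi>: "linear_map k g B \<phi>"
    and rel: "!!u v. [|u <: g; v <: g|] ==>
      \<phi> u \<otimes>\<^bsub>B\<^esub> \<phi> v = ks B R (%r s. \<phi> (act g s v) \<otimes>\<^bsub>B\<^esub> \<phi> (act g r u)) \<oplus>\<^bsub>B\<^esub> \<phi> (bracket g u v)"
  shows env_hom_linear: "linear_map k UK B (env_ext k B (word_prod B \<phi>))"
    and env_hom_one: "env_ext k B (word_prod B \<phi>) \<one>\<^bsub>UK\<^esub> = \<one>\<^bsub>B\<^esub>"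
    and env_hom_step: "[|u <: g; \<xi> <: UK|] ==>
      env_ext k B (word_prod B \<phi>) (iota u \<otimes>\<^bsub>UK\<^esub> \<xi>) = \<phi> u \<otimes>\<^bsub>B\<^esub> env_ext k B (word_prod B \<phi>) \<xi>"
    and env_hom_mult: "[|\<xi> <: UK; \<eta> <: UK|] ==> env_ext k B (word_prod B \<phi>) (\<xi> \<otimes>\<^bsub>UK\<^esub> \<eta>) =
      env_ext k B (word_prod B \<phi>) \<xi> \<otimes>\<^bsub>B\<^esub> env_ext k B (word_prod B \<phi>) \<eta>"
    and env_hom_iota: "u <: g ==> env_ext k B (word_prod B \<phi>) (iota u) = \<phi> u"
proof -
  let ?f = "word_prod B \<phi>"
  note w = word_prod_rules[OF B \<phi>]
  note [simp] = B lin_closed[OF \<phi>] w(1) lin_comp[OF \<phi>]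
  have 1: "linear_map k g B (%u. ?f (w @ u # w'))" if [simp]: "w \<in> words" "w' \<in> words" for w w'
    by (subst lin_cong[OF g_mod, of _ "%u. ?f w \<otimes>\<^bsub>B\<^esub> (\<phi> u \<otimes>\<^bsub>B\<^esub> ?f w')"]) (simp_all add: w(2,3) \<phi>)
  have 2: "?f (w @ u # v # w') = ks B R (%r s. ?f (w @ act g s v # act g r u # w')) \<oplus>\<^bsub>B\<^esub> ?f (w @ bracket g u v # w')"
    if [simp]: "w \<in> words" "w' \<in> words" "u <: g" "v <: g" for w w' u v
  proof -
    have "?f (w @ u # v # w') = ?f w \<otimes>\<^bsub>B\<^esub> ((\<phi> u \<otimes>\<^bsub>B\<^esub> \<phi> v) \<otimes>\<^bsub>B\<^esub> ?f w')"
      by (simp add: w(2,3) alg_assoc[OF B])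
    also have "... = ks B R (%r s. ?f w \<otimes>\<^bsub>B\<^esub> ((\<phi> (act g s v) \<otimes>\<^bsub>B\<^esub> \<phi> (act g r u)) \<otimes>\<^bsub>B\<^esub> ?f w')) \<oplus>\<^bsub>B\<^esub>
        ?f w \<otimes>\<^bsub>B\<^esub> (\<phi> (bracket g u v) \<otimes>\<^bsub>B\<^esub> ?f w')"
      unfolding rel[OF that(3,4)] by (simp add: alg_l_distr alg_r_distr)
    also have "ks B R (%r s. ?f w \<otimes>\<^bsub>B\<^esub> ((\<phi> (act g s v) \<otimes>\<^bsub>B\<^esub> \<phi> (act g r u)) \<otimes>\<^bsub>B\<^esub> ?f w')) =
        ks B R (%r s. ?f (w @ act g s v # act g r u # w'))"
      by (rule tsumc_cong) (simp add: w(2,3) alg_assoc[OF B])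
    finally show ?thesis by (simp add: w(2,3))
  qed
  have "linear_map k UA B (env_ext k B ?f)"
    by (rule env_ext_linear[OF alg_simps(1)[OF B] w(1) 1 2])
  then show l: "linear_map k UK B (env_ext k B ?f)" by (simp only: same_module_linear_map(1)[OF same_UA])
  have c: "env_ext k B ?f (cls v) = ?f v" if "v \<in> words" for v
    by (rule env_ext_cls[OF alg_simps(1)[OF B] w(1) 1 2 that])
  show one: "env_ext k B ?f \<one>\<^bsub>UK\<^esub> = \<one>\<^bsub>B\<^esub>" using c[of "[]"] by (simp add: cls_rules w(4))
  have lc: "env_ext k B ?f \<xi> <: B" if "\<xi> <: UK" for \<xi> by (rule lin_closed[OF l that])
  show step: "env_ext k B ?f (iota u \<otimes>\<^bsub>UK\<^esub> \<xi>) = \<phi> u \<otimes>\<^bsub>B\<^esub> env_ext k B ?f \<xi>"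
    if u: "u <: g" and x: "\<xi> <: UK" for u \<xi>
  proof (rule UA_span[of B "%\<xi>. env_ext k B ?f (iota u \<otimes>\<^bsub>UK\<^esub> \<xi>)" "%\<xi>. \<phi> u \<otimes>\<^bsub>B\<^esub> env_ext k B ?f \<xi>"])
    show "linear_map k UA B (%\<xi>. env_ext k B ?f (iota u \<otimes>\<^bsub>UK\<^esub> \<xi>))"
      using lin_comp[OF l lin_mult2[OF UK_alg lin_ident]] u by simp
    show "linear_map k UA B (%\<xi>. \<phi> u \<otimes>\<^bsub>B\<^esub> env_ext k B ?f \<xi>)" using l u by simp
    show "env_ext k B ?f (iota u \<otimes>\<^bsub>UK\<^esub> cls w') = \<phi> u \<otimes>\<^bsub>B\<^esub> env_ext k B ?f (cls w')" if "w' \<in> words" for w'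
      using c[of "u # w'"] c[of w'] u that by (simp add: cls_rules w(3))
  qed (use x in simp_all)
  show "env_ext k B ?f (\<xi> \<otimes>\<^bsub>UK\<^esub> \<eta>) = env_ext k B ?f \<xi> \<otimes>\<^bsub>B\<^esub> env_ext k B ?f \<eta>"
    if x: "\<xi> <: UK" and y: "\<eta> <: UK" for \<xi> \<eta>
    by (rule env_linear_eq[of B "%\<xi>. env_ext k B ?f (\<xi> \<otimes>\<^bsub>UK\<^esub> \<eta>)" "%\<xi>. env_ext k B ?f \<xi> \<otimes>\<^bsub>B\<^esub> env_ext k B ?f \<eta>" \<xi>])
      (use x y l in \<open>simp_all add: lin_comp[OF l] one step lc UK_assoc alg_assoc[OF B]\<close>)
  show "env_ext k B ?f (iota u) = \<phi> u" if "u <: g" for u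
    using step[of u "\<one>\<^bsub>UK\<^esub>"] that by (simp add: one)
qed

section \<open>The enveloping algebra as a module algebra\<close>

abbreviation "wact w h \<equiv> word_act k K R g w h"

lemma wact:
  assumes "w \<in> words"
  shows wact_closed: "h <: K ==> wact w h <: UK"
    and wact_linear: "linear_map k K UK (%h. wact w h)"
    and wact_Cons: "[|u <: g; h <: K|] ==> wact (u # w) h = sw UK h (%x y. iota (act g x u) \<otimes>\<^bsub>UK\<^esub> wact w y)"
proof -
  have step: "wact (u # w) h = sw UK h (%x y. iota (act g x u) \<otimes>\<^bsub>UK\<^esub> wact w y)"
    if "linear_map k K UK (%h. wact w h)" "u <: g" "h <: K" for u w h
    using that lin_closed[OF that(1)] by (simp, intro tsum_eq_tsumc) simp_all
  show l: "linear_map k K UK (%h. wact w h)"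
    using assms
  proof (induction w)
    case Nil
    then show ?case by simp
  next
    case (Cons u w)
    then show ?case using lin_comp[OF Cons.IH] lin_closed[OF Cons.IH]
      by (subst lin_cong[OF K_mod step[OF Cons.IH]]) (simp_all del: word_act.simps)
  qed
  show "h <: K ==> wact w h <: UK" by (rule lin_closed[OF l])
  show "[|u <: g; h <: K|] ==> wact (u # w) h = sw UK h (%x y. iota (act g x u) \<otimes>\<^bsub>UK\<^esub> wact w y)"
    by (rule step[OF l])
qed

lemma wact_simps [simp]:
  "[|w \<in> words; h <: K|] ==> wact w h <: UK"
  "[|w \<in> words; linear_map k X K f|] ==> linear_map k X UK (%x. wact w (f x))"
  using wact_closed lin_comp[OF wact_linear] by simp_all

declare word_act.simps [simp del]

lemma wact_Nil [simp]: "wact [] h = eps h \<odot>\<^bsub>UK\<^esub> \<one>\<^bsub>UK\<^esub>"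
  by (simp add: word_act.simps)

text \<open>Words multiply by concatenation, so this is the module algebra property on words.\<close>

lemma wact_append:
  assumes w: "w \<in> words" "w' \<in> words" and h: "h <: K"
  shows "wact (w @ w') h = sw UK h (%x y. wact w x \<otimes>\<^bsub>UK\<^esub> wact w' y)"
  using w(1) h
proof (induction w arbitrary: h)
  case Nil
  then show ?case using w(2) by simp
next
  case (Cons u w)
  then have [simp]: "u <: g" "w \<in> words" "h <: K" "w' \<in> words" using w by auto
  have "wact ((u # w) @ w') h = sw UK h (%x y. sw UK y (%a b. iota (act g x u) \<otimes>\<^bsub>UK\<^esub> (wact w a \<otimes>\<^bsub>UK\<^esub> wact w' b)))"
    by (simp add: wact_Cons Cons.IH)
  also have "... = sw UK h (%x y. sw UK x (%a b. iota (act g a u) \<otimes>\<^bsub>UK\<^esub> (wact w b \<otimes>\<^bsub>UK\<^esub> wact w' y)))"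
    by (rule sw_coassoc[symmetric]) (simp_all add: trilinear_map_def)
  also have "... = sw UK h (%x y. wact (u # w) x \<otimes>\<^bsub>UK\<^esub> wact w' y)"
    by (simp add: wact_Cons UK_assoc)
  finally show ?case .
qed

lemma wact_letter [simp]: "[|u <: g; h <: K|] ==> wact [u] h = iota (act g h u)"
  by (simp add: wact_Cons)

lemma wact_pair: "[|u <: g; v <: g; h <: K|] ==>
    wact [u, v] h = sw UK h (%x y. iota (act g x u) \<otimes>\<^bsub>UK\<^esub> iota (act g y v))"
  by (simp add: wact_Cons)

text \<open>The action is compatible with the relation for two letters because \<open>R\<close> intertwines the coproduct
  with the opposite one and the bracket is equivariant.\<close>

lemma wact_relation:
  assumes [simp]: "u <: g" "v <: g" "h <: K"
  shows "wact [u, v] h = ks UK R (%r s. wact [act g s v, act g r u] h) \<oplus>\<^bsub>UK\<^esub> wact [bracket g u v] h"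
proof -
  have "wact [u, v] h = sw UK h (%x y. ks UK R (%r s. iota (act g (s \<cdot> y) v) \<otimes>\<^bsub>UK\<^esub> iota (act g (r \<cdot> x) u)) \<oplus>\<^bsub>UK\<^esub>
      iota (bracket g (act g x u) (act g y v)))"
    by (simp add: wact_pair iota_relation)
  also have "... = sw UK h (%x y. ks UK R (%r s. iota (act g (s \<cdot> y) v) \<otimes>\<^bsub>UK\<^esub> iota (act g (r \<cdot> x) u))) \<oplus>\<^bsub>UK\<^esub>
      sw UK h (%x y. iota (bracket g (act g x u) (act g y v)))"
    by (rule tsumc_addf) simp_all
  also have "sw UK h (%x y. iota (bracket g (act g x u) (act g y v))) = wact [bracket g u v] h"
    using linear_tsumc[of g UK iota K K "%x y. bracket g (act g x u) (act g y v)" "comult K h"] by (simp add: bracket_act)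
  also have "sw UK h (%x y. ks UK R (%r s. iota (act g (s \<cdot> y) v) \<otimes>\<^bsub>UK\<^esub> iota (act g (r \<cdot> x) u))) =
      ks UK R (%r s. sw UK h (%x y. iota (act g (s \<cdot> y) v) \<otimes>\<^bsub>UK\<^esub> iota (act g (r \<cdot> x) u)))"
    by (rule tsumc_swap) simp_all
  also have "... = sw UK h (%x y. ks UK R (%r s. iota (act g (x \<cdot> s) v) \<otimes>\<^bsub>UK\<^esub> iota (act g (y \<cdot> r) u)))"
    by (rule R_comult[symmetric, where f = "%p q. iota (act g q v) \<otimes>\<^bsub>UK\<^esub> iota (act g p u)"]) simp_all
  also have "... = ks UK R (%r s. sw UK h (%x y. iota (act g (x \<cdot> s) v) \<otimes>\<^bsub>UK\<^esub> iota (act g (y \<cdot> r) u)))"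
    by (rule tsumc_swap) simp_all
  also have "... = ks UK R (%r s. wact [act g s v, act g r u] h)"
    by (simp add: wact_pair)
  finally show ?thesis .
qed

lemma act_env_ext:
  assumes h [simp]: "h <: K"
  shows "linear_map k UK UK (%\<xi>. act UK h \<xi>)" "w \<in> words ==> act UK h (cls w) = wact w h"
proof -
  let ?f = "%w. wact w h"
  have 1: "linear_map k g UK (%u. ?f (w @ u # w'))" if [simp]: "w \<in> words" "w' \<in> words" for w w'
    by (subst lin_cong[OF g_mod, of _ "%u. sw UK h (%x y. wact w x \<otimes>\<^bsub>UK\<^esub> sw UK y (%a b. iota (act g a u) \<otimes>\<^bsub>UK\<^esub> wact w' b))"])
      (simp_all add: wact_append wact_Cons)
  have 2: "?f (w @ u # v # w') = ks UK R (%r s. ?f (w @ act g s v # act g r u # w')) \<oplus>\<^bsub>UK\<^esub> ?f (w @ bracket g u v # w')"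
    if [simp]: "w \<in> words" "w' \<in> words" "u <: g" "v <: g" for w w' u v
  proof -
    have e: "wact (w @ z @ w') h = sw UK h (%x y. sw UK y (%a b. wact w x \<otimes>\<^bsub>UK\<^esub> (wact z a \<otimes>\<^bsub>UK\<^esub> wact w' b)))" if "z \<in> words" for z
      using that by (simp add: wact_append)
    have "?f (w @ [u, v] @ w') = sw UK h (%x y. sw UK y (%a b. ks UK R (%r s. wact w x \<otimes>\<^bsub>UK\<^esub> (wact [act g s v, act g r u] a \<otimes>\<^bsub>UK\<^esub> wact w' b)) \<oplus>\<^bsub>UK\<^esub>
       wact w x \<otimes>\<^bsub>UK\<^esub> (wact [bracket g u v] a \<otimes>\<^bsub>UK\<^esub> wact w' b)))"
      by (subst e, simp, intro tsumc_cong) (subst wact_relation; simp add: alg_l_distr alg_r_distr del: wact_letter)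
    also have "... = sw UK h (%x y. sw UK y (%a b. ks UK R (%r s. wact w x \<otimes>\<^bsub>UK\<^esub> (wact [act g s v, act g r u] a \<otimes>\<^bsub>UK\<^esub> wact w' b)))) \<oplus>\<^bsub>UK\<^esub>
       sw UK h (%x y. sw UK y (%a b. wact w x \<otimes>\<^bsub>UK\<^esub> (wact [bracket g u v] a \<otimes>\<^bsub>UK\<^esub> wact w' b)))"
      by (simp add: tsumc_addf del: wact_letter)
    also have "sw UK h (%x y. sw UK y (%a b. wact w x \<otimes>\<^bsub>UK\<^esub> (wact [bracket g u v] a \<otimes>\<^bsub>UK\<^esub> wact w' b))) = ?f (w @ [bracket g u v] @ w')"
      by (subst e) simp_all
    also have "sw UK h (%x y. sw UK y (%a b. ks UK R (%r s. wact w x \<otimes>\<^bsub>UK\<^esub> (wact [act g s v, act g r u] a \<otimes>\<^bsub>UK\<^esub> wact w' b)))) =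
       sw UK h (%x y. ks UK R (%r s. sw UK y (%a b. wact w x \<otimes>\<^bsub>UK\<^esub> (wact [act g s v, act g r u] a \<otimes>\<^bsub>UK\<^esub> wact w' b))))"
      by (intro tsumc_cong tsumc_swap) simp_all
    also have "... = ks UK R (%r s. sw UK h (%x y. sw UK y (%a b. wact w x \<otimes>\<^bsub>UK\<^esub> (wact [act g s v, act g r u] a \<otimes>\<^bsub>UK\<^esub> wact w' b))))"
      by (intro tsumc_swap) simp_all
    also have "... = ks UK R (%r s. ?f (w @ [act g s v, act g r u] @ w'))"
      by (intro tsumc_cong, subst e) simp_all
    finally show ?thesis by simp
  qed
  have c: "?f w <: UK" if "w \<in> words" for w using that by simp
  have a: "act UK h = env_ext k UK ?f"
    by (simp add: act_UK env_ext_def[abs_def] linear_ext_def same_module_finsum[OF same_UA] cong: if_cong)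
  show "linear_map k UK UK (%\<xi>. act UK h \<xi>)" unfolding a same_module_linear_map(1)[OF same_UA, symmetric]
    by (rule env_ext_linear[OF UK_simps(1) c 1 2])
  show "act UK h (cls w) = wact w h" if "w \<in> words" unfolding a by (rule env_ext_cls[OF UK_simps(1) c 1 2 that])
qed

text \<open>By the universal property the action is determined on words, where all properties are inherited from
  concatenation of words.\<close>

theorem UK_module_algebra: "K_module_algebra k K UK"
proof -
  note lin = act_env_ext(1) and acls = act_env_ext(2)
  have span: "f t = f' t" if "module k X" "linear_map k UK X f" "linear_map k UK X f'"
    "!!w. w \<in> words ==> f (cls w) = f' (cls w)" "t <: UK" for f f' t and X :: "('k, 'x, 'm) module_scheme"
    using UA_span[of X f f' t] that by simp
  have [simp]: "act UK h \<xi> <: UK" if "h <: K" "\<xi> <: UK" for h \<xi>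
    by (rule lin_closed[OF lin[OF that(1)] that(2)])
  have [simp]: "linear_map k X UK (%x. act UK h (f x))" if "h <: K" "linear_map k X UK f"
    for h f and X :: "('k, 'x, 'm) module_scheme"
    by (rule lin_comp[OF lin[OF that(1)] that(2)])
  have lin2 [simp]: "linear_map k K UK (%h. act UK h \<xi>)" if x: "\<xi> <: UK" for \<xi>
  proof (rule linear_mapI)
    fix h h' assume [simp]: "h <: K" "h' <: K"
    show "act UK (h \<oplus>\<^bsub>K\<^esub> h') \<xi> = act UK h \<xi> \<oplus>\<^bsub>UK\<^esub> act UK h' \<xi>"
      by (rule span[of UK "%\<xi>. act UK (h \<oplus>\<^bsub>K\<^esub> h') \<xi>" "%\<xi>. act UK h \<xi> \<oplus>\<^bsub>UK\<^esub> act UK h' \<xi>", OF _ _ _ _ x])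
        (simp_all add: acls lin_add[OF wact_linear])
  next
    fix c h assume [simp]: "c <: k" "h <: K"
    show "act UK (c \<odot>\<^bsub>K\<^esub> h) \<xi> = c \<odot>\<^bsub>UK\<^esub> act UK h \<xi>"
      by (rule span[of UK "%\<xi>. act UK (c \<odot>\<^bsub>K\<^esub> h) \<xi>" "%\<xi>. c \<odot>\<^bsub>UK\<^esub> act UK h \<xi>", OF _ _ _ _ x])
        (simp_all add: acls lin_smult[OF wact_linear])
  qed (use x in simp)
  have lin2' [simp]: "linear_map k X UK (%x. act UK (i x) \<xi>)" if "\<xi> <: UK" "linear_map k X K i" for \<xi> i and X :: "('k, 'x, 'm) module_scheme"
    by (rule lin_comp[OF lin2[OF that(1)] that(2)])
  have m: "act UK h (\<xi> \<otimes>\<^bsub>UK\<^esub> \<eta>) = sw UK h (%x y. act UK x \<xi> \<otimes>\<^bsub>UK\<^esub> act UK y \<eta>)"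
    if [simp]: "h <: K" and x: "\<xi> <: UK" and y: "\<eta> <: UK" for h \<xi> \<eta>
  proof (rule span[of UK "%\<xi>. act UK h (\<xi> \<otimes>\<^bsub>UK\<^esub> \<eta>)" "%\<xi>. sw UK h (%x y. act UK x \<xi> \<otimes>\<^bsub>UK\<^esub> act UK y \<eta>)", OF _ _ _ _ x])
    fix w assume [simp]: "w \<in> words"
    have [simp]: "cls w <: UK" by (simp add: cls_rules)
    show "act UK h (cls w \<otimes>\<^bsub>UK\<^esub> \<eta>) = sw UK h (%x y. act UK x (cls w) \<otimes>\<^bsub>UK\<^esub> act UK y \<eta>)"
    proof (rule span[of UK "%\<eta>. act UK h (cls w \<otimes>\<^bsub>UK\<^esub> \<eta>)" "%\<eta>. sw UK h (%x y. act UK x (cls w) \<otimes>\<^bsub>UK\<^esub> act UK y \<eta>)", OF _ _ _ _ y])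
      fix w' assume [simp]: "w' \<in> words"
      show "act UK h (cls w \<otimes>\<^bsub>UK\<^esub> cls w') = sw UK h (%x y. act UK x (cls w) \<otimes>\<^bsub>UK\<^esub> act UK y (cls w'))"
        using acls[of h "w @ w'"] by (simp add: cls_rules acls wact_append)
    qed simp_all
  qed (use y in simp_all)
  have one: "act UK h \<one>\<^bsub>UK\<^esub> = eps h \<odot>\<^bsub>UK\<^esub> \<one>\<^bsub>UK\<^esub>" if "h <: K" for h
    using acls[OF that, of "[]"] by (simp add: cls_rules)
  have io: "act UK h (iota u) = iota (act g h u)" if "h <: K" "u <: g" for h u
    using acls[OF that(1), of "[u]"] that by (simp add: cls_rules)
  have a1: "act UK \<one>\<^bsub>K\<^esub> \<xi> = \<xi>" if x: "\<xi> <: UK" for \<xi>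
    by (rule env_linear_eq[of UK "%\<xi>. act UK \<one>\<^bsub>K\<^esub> \<xi>" "%\<xi>. \<xi>", OF _ _ _ _ _ x]) (simp_all add: m io one)
  have aa: "act UK (h \<cdot> h') \<xi> = act UK h (act UK h' \<xi>)"
    if "h <: K" "h' <: K" and x: "\<xi> <: UK" for h h' \<xi>
  proof (rule span[of UK "%\<xi>. act UK (h \<cdot> h') \<xi>" "%\<xi>. act UK h (act UK h' \<xi>)", OF _ _ _ _ x])
    fix w assume "w \<in> words"
    then show "act UK (h \<cdot> h') (cls w) = act UK h (act UK h' (cls w))" using that(1,2)
    proof (induction w arbitrary: h h')
      case Nil
      then show ?case by (simp add: cls_rules one lin_smult[OF lin] smult_rules(2))
        (metis cring.cring_simprules(14) cring_k hopf_maps(2))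
    next
      case (Cons u w)
      then have [simp]: "u <: g" "w \<in> words" "h <: K" "h' <: K" by auto
      have [simp]: "cls w <: UK" by (simp add: cls_rules)
      have "act UK h (act UK h' (cls (u # w))) =
          sw UK h' (%c d. sw UK h (%a b. iota (act g a (act g c u)) \<otimes>\<^bsub>UK\<^esub> act UK b (act UK d (cls w))))"
        by (simp add: cls_rules m io linear_tsumc[OF lin])
      also have "... = sw UK h (%a b. sw UK h' (%c d. iota (act g a (act g c u)) \<otimes>\<^bsub>UK\<^esub> act UK b (act UK d (cls w))))"
        by (rule tsumc_swap) simp_all
      also have "... = act UK (h \<cdot> h') (cls (u # w))"
        by (simp add: cls_rules m io Cons.IH[symmetric])
      finally show ?case by simp
    qed
  qed (use that in simp_all)
  show ?thesis
    by (rule K_module_algebraI[OF UK_alg K_moduleI one m]) (simp_all add: a1 aa)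
qed

lemma act_iota [simp]: "[|h <: K; u <: g|] ==> act UK h (iota u) = iota (act g h u)"
  using act_env_ext(2)[of h "[u]"] by (simp add: cls_rules)

end

section \<open>Braided tensor squares of module algebras\<close>

lemma (in ground) same_algebra:
  assumes "same_module A A'" "mult A = mult A'" "one A = one A'" "k_algebra k A"
  shows "k_algebra k A'"
proof -
  have c: "carrier A' = carrier A" "mult A' = mult A" "one A' = one A"
    using assms by (simp_all add: same_module_def)
  note s = same_module_linear_map[OF same_module_sym[OF assms(1)]]
  show ?thesis
    by (rule k_algebraI, rule same_module_module[OF assms(1)]) (simp_all add: c s assms(4) alg_assoc[OF assms(4)])
qed

lemma (in hopf) same_module_algebra:
  assumes "same_module A A'" "mult A = mult A'" "one A = one A'" "act A = act A'" "K_module_algebra k K A"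
  shows "K_module_algebra k K A'"
proof -
  have c: "carrier A' = carrier A" "mult A' = mult A" "one A' = one A" "act A' = act A" "smult A' = smult A"
    using assms by (simp_all add: same_module_def)
  note s = same_module_linear_map[OF same_module_sym[OF assms(1)]] same_module_tsumc[OF same_module_sym[OF assms(1)]]
  note [simp] = K_module_algebra_simps[OF assms(5)]
  show ?thesis
    by (intro K_module_algebraI K_moduleI same_algebra[OF assms(1-3)] same_module_module[OF assms(1)])
      (simp_all add: c s act_mult[OF assms(5)])
qed

context hopf begin

text \<open>Two ways to split into four legs, both by coassociativity.\<close>

lemma sw4:
  assumes h: "h <: K" and X: "module k X"
    and l: "!!b c d. [|b <: K; c <: K; d <: K|] ==> linear_map k K X (%a. f a b c d)"
      "!!a c d. [|a <: K; c <: K; d <: K|] ==> linear_map k K X (%b. f a b c d)"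
      "!!a b d. [|a <: K; b <: K; d <: K|] ==> linear_map k K X (%c. f a b c d)"
      "!!a b c. [|a <: K; b <: K; c <: K|] ==> linear_map k K X (%d. f a b c d)"
  shows "sw X h (%x y. sw X x (%x1 x2. sw X y (%y1 y2. f x1 x2 y1 y2))) = sw X h (%x y. sw X y (%z w. sw X z (%p q. f x p q w)))"
proof -
  note [simp] = X h l
  have "sw X h (%x y. sw X x (%x1 x2. sw X y (%y1 y2. f x1 x2 y1 y2))) = sw X h (%x y. sw X y (%z w. sw X w (%y1 y2. f x z y1 y2)))"
    by (rule sw_coassoc) (simp_all add: trilinear_map_def)
  also have "... = sw X h (%x y. sw X y (%z w. sw X z (%p q. f x p q w)))"
    by (intro tsumc_cong sw_coassoc[symmetric]) (simp_all add: trilinear_map_def)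
  finally show ?thesis .
qed

end

lemma braided_tensor_simps [simp]:
  "carrier (braided_tensor k R L) = carrier (tensor_module k L L)" "zero (braided_tensor k R L) = zero (tensor_module k L L)"
  "add (braided_tensor k R L) = add (tensor_module k L L)" "smult (braided_tensor k R L) = smult (tensor_module k L L)"
  "one (braided_tensor k R L) = tens k L L \<one>\<^bsub>L\<^esub> \<one>\<^bsub>L\<^esub>"
  by (simp_all add: braided_tensor_def Let_def)

lemma same_braided_tensor: "same_module (braided_tensor k R L) (tensor_module k L L)"
  by (simp add: same_module_def)

lemmas braided_tensor_cong [simp] = same_module_cong[OF same_braided_tensor]

locale braided_square = triangular k K R
  for k :: "'k ring" and K :: "('k, 'h) hopf" and R :: "('k, 'h, 'h) tensor" +
  fixes L :: "('k, 'h, 'l, 'm) kmod_scheme"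
  assumes L_module_algebra: "K_module_algebra k K L"
begin

lemmas L_simps [simp] = K_module_algebra_simps[OF L_module_algebra]

abbreviation "LL \<equiv> tensor_module k L L"
abbreviation "BT \<equiv> braided_tensor k R L"
abbreviation lmult (infixl "\<star>" 70) where "x \<star> y \<equiv> x \<otimes>\<^bsub>L\<^esub> y"
abbreviation "ls X t f \<equiv> tsumc k L L X t f"

lemma L_mod [simp]: "module k L" by (rule alg_simps(1)) simp

lemmas L_alg [simp] = alg_simps[OF L_simps(1)]
lemmas L_assoc = alg_assoc[OF L_simps(1)]
lemmas L_act = act_mult[OF L_module_algebra]

lemma BT_module [simp]: "module k BT"
  by (rule same_module_module[OF same_module_sym[OF same_braided_tensor]]) simp

lemma BT_mult:
  assumes "s <: LL" "t <: LL"
  shows "s \<otimes>\<^bsub>BT\<^esub> t = ls LL s (%a c. ls LL t (%a' c'. ks LL R (%x y. tens k L L (a \<star> act L y a') (act L x c \<star> c'))))"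
proof -
  have 1: "tsum k LL R (%x y. tens k L L (a \<star> act L y a') (act L x c \<star> c')) = ks LL R (%x y. tens k L L (a \<star> act L y a') (act L x c \<star> c'))"
    if "a <: L" "c <: L" "a' <: L" "c' <: L" for a c a' c'
    using that by (intro tsum_eq_tsumc) simp_all
  have 2: "tsum k LL t (%a' c'. tsum k LL R (%x y. tens k L L (a \<star> act L y a') (act L x c \<star> c'))) =
      ls LL t (%a' c'. ks LL R (%x y. tens k L L (a \<star> act L y a') (act L x c \<star> c')))"
    if "a <: L" "c <: L" for a c
    using that assms by (subst tsum_eq_tsumc[of k L L]) (auto simp: 1 intro!: tsumc_cong)
  show ?thesis
    using assms unfolding braided_tensor_def Let_def by simp (subst tsum_eq_tsumc[of k L L], auto simp: 2 intro!: tsumc_cong)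
qed

lemma BT_closed [simp]: "[|s <: LL; t <: LL|] ==> s \<otimes>\<^bsub>BT\<^esub> t <: LL"
  by (simp add: BT_mult)

lemma BT_linear [simp]:
  assumes "linear_map k X LL f" "s <: LL"
  shows "linear_map k X LL (%x. s \<otimes>\<^bsub>BT\<^esub> f x)" "linear_map k X LL (%x. f x \<otimes>\<^bsub>BT\<^esub> s)"
proof -
  have m: "module k LL" by simp
  have "linear_map k LL LL (%t. s \<otimes>\<^bsub>BT\<^esub> t)" "linear_map k LL LL (%t. t \<otimes>\<^bsub>BT\<^esub> s)"
    using assms(2) by (subst lin_cong[OF m, OF BT_mult]; simp)+
  then show "linear_map k X LL (%x. s \<otimes>\<^bsub>BT\<^esub> f x)" "linear_map k X LL (%x. f x \<otimes>\<^bsub>BT\<^esub> s)"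
    using lin_comp[of k LL LL _ X f] assms(1) by blast+
qed

lemma BT_mult_tens:
  "[|a <: L; c <: L; a' <: L; c' <: L|] ==>
    tens k L L a c \<otimes>\<^bsub>BT\<^esub> tens k L L a' c' = ks LL R (%x y. tens k L L (a \<star> act L y a') (act L x c \<star> c'))"
  by (simp add: BT_mult)

lemma BT_push:
  assumes "module k V" "module k W" "!!v w. [|v <: V; w <: W|] ==> f v w <: LL" "z <: LL"
  shows "z \<otimes>\<^bsub>BT\<^esub> tsumc k V W LL t f = tsumc k V W LL t (%v w. z \<otimes>\<^bsub>BT\<^esub> f v w)"
    and "tsumc k V W LL t f \<otimes>\<^bsub>BT\<^esub> z = tsumc k V W LL t (%v w. f v w \<otimes>\<^bsub>BT\<^esub> z)"
  using assms by (intro linear_tsumc[of LL LL]; simp)+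

text \<open>The two hexagon identities split the same triple sum over \<open>R\<close> into the braidings of either
  bracketing.\<close>

lemma BT_assoc_tens:
  assumes [simp]: "a <: L" "c <: L" "a' <: L" "c' <: L" "a'' <: L" "c'' <: L"
  shows "(tens k L L a c \<otimes>\<^bsub>BT\<^esub> tens k L L a' c') \<otimes>\<^bsub>BT\<^esub> tens k L L a'' c'' =
    tens k L L a c \<otimes>\<^bsub>BT\<^esub> (tens k L L a' c' \<otimes>\<^bsub>BT\<^esub> tens k L L a'' c'')"
proof -
  let ?t = "%r s p q p' q'. tens k L L (a \<star> (act L s a' \<star> act L (q \<cdot> q') a'')) (act L (p \<cdot> r) c \<star> (act L p' c' \<star> c''))"
  have "(tens k L L a c \<otimes>\<^bsub>BT\<^esub> tens k L L a' c') \<otimes>\<^bsub>BT\<^esub> tens k L L a'' c'' =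
      ks LL R (%r s. ks LL R (%p q. sw LL p (%x y. tens k L L (a \<star> (act L s a' \<star> act L q a'')) (act L (x \<cdot> r) c \<star> (act L y c' \<star> c'')))))"
    by (simp add: BT_mult_tens BT_push L_act L_assoc)
  also have "... = ks LL R (%r s. ks LL R (%p q. ks LL R (%p' q'. ?t r s p q p' q')))"
    by (intro tsumc_cong R_hex1[where f = "%x y q. tens k L L (a \<star> (act L _ a' \<star> act L q a'')) (act L (x \<cdot> _) c \<star> (act L y c' \<star> c''))"])
      (simp_all add: trilinear_map_def)
  also have "... = ks LL R (%p' q'. ks LL R (%p q. ks LL R (%r s. ?t r s p q p' q')))"
    by (rule tsumc_rev3) simp_all
  also have "... = ks LL R (%p' q'. ks LL R (%p q. sw LL q (%x y. tens k L L (a \<star> (act L x a' \<star> act L (y \<cdot> q') a'')) (act L p c \<star> (act L p' c' \<star> c'')))))"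
    by (intro tsumc_cong R_hex2[symmetric, where f = "%p x y. tens k L L (a \<star> (act L x a' \<star> act L (y \<cdot> _) a'')) (act L p c \<star> (act L _ c' \<star> c''))"])
      (simp_all add: trilinear_map_def)
  also have "... = tens k L L a c \<otimes>\<^bsub>BT\<^esub> (tens k L L a' c' \<otimes>\<^bsub>BT\<^esub> tens k L L a'' c'')"
    by (simp add: BT_mult_tens BT_push L_act L_assoc)
  finally show ?thesis .
qed

text \<open>Associativity is the content of the preceding lemma; all identities are linear, hence checked on pure
  tensors.\<close>

theorem BT_alg [simp]: "k_algebra k BT"
proof (rule k_algebraI)
  fix x y z assume "x <: BT" "y <: BT" "z <: BT"
  then have x: "x <: LL" "y <: LL" "z <: LL" by simp_all
  have 1: "(tens k L L a c \<otimes>\<^bsub>BT\<^esub> tens k L L b d) \<otimes>\<^bsub>BT\<^esub> t = tens k L L a c \<otimes>\<^bsub>BT\<^esub> (tens k L L b d \<otimes>\<^bsub>BT\<^esub> t)"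
    if "a <: L" "c <: L" "b <: L" "d <: L" "t <: LL" for a c b d t
    by (rule tensor_linear_eq[OF that(5), where X = LL]) (use that in \<open>simp_all add: BT_assoc_tens\<close>)
  have 2: "(tens k L L a c \<otimes>\<^bsub>BT\<^esub> s) \<otimes>\<^bsub>BT\<^esub> t = tens k L L a c \<otimes>\<^bsub>BT\<^esub> (s \<otimes>\<^bsub>BT\<^esub> t)"
    if "a <: L" "c <: L" "s <: LL" "t <: LL" for a c s t
    by (rule tensor_linear_eq[OF that(3), where X = LL]) (use that in \<open>simp_all add: 1\<close>)
  show "x \<otimes>\<^bsub>BT\<^esub> y \<otimes>\<^bsub>BT\<^esub> z = x \<otimes>\<^bsub>BT\<^esub> (y \<otimes>\<^bsub>BT\<^esub> z)"
    by (rule tensor_linear_eq[OF x(1), where X = LL]) (use x in \<open>simp_all add: 2\<close>)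
next
  fix x assume "x <: BT"
  then have x: "x <: LL" by simp
  have one [simp]: "tens k L L \<one>\<^bsub>L\<^esub> \<one>\<^bsub>L\<^esub> <: LL" by simp
  show "\<one>\<^bsub>BT\<^esub> \<otimes>\<^bsub>BT\<^esub> x = x"
    by (rule tensor_linear_eq[OF x, where X = LL]) (simp_all add: BT_mult_tens)
  show "x \<otimes>\<^bsub>BT\<^esub> \<one>\<^bsub>BT\<^esub> = x"
    by (rule tensor_linear_eq[OF x, where X = LL]) (simp_all add: BT_mult_tens)
  show "linear_map k BT BT (%y. x \<otimes>\<^bsub>BT\<^esub> y)" "linear_map k BT BT (%y. y \<otimes>\<^bsub>BT\<^esub> x)"
    using x by simp_all
qed simp_all

text \<open>The diagonal action on \<open>L \<otimes> L\<close>.\<close>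

definition "actT h t = sw LL h (%x y. ls LL t (%a c. tens k L L (act L x a) (act L y c)))"

lemma actT_simps [simp]:
  "actT h t <: LL"
  "[|h <: K; linear_map k X LL f; module k X|] ==> linear_map k X LL (%x. actT h (f x))"
  "[|linear_map k X K i; t <: LL|] ==> linear_map k X LL (%x. actT (i x) t)"
  "[|h <: K; a <: L; c <: L|] ==>
    actT h (tens k L L a c) = sw LL h (%x y. tens k L L (act L x a) (act L y c))"
  by (simp_all add: actT_def)

text \<open>The braiding is equivariant since \<open>R\<close> intertwines the coproduct with the opposite one, applied
  to the two inner legs of \<open>h\<^sub>1 \<otimes> h\<^sub>2 \<otimes> h\<^sub>3 \<otimes>
  h\<^sub>4\<close>.\<close>

lemma actT_mult_tens:
  assumes [simp]: "a <: L" "c <: L" "a' <: L" "c' <: L" "h <: K"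
  shows "actT h (tens k L L a c \<otimes>\<^bsub>BT\<^esub> tens k L L a' c') =
    sw LL h (%x y. actT x (tens k L L a c) \<otimes>\<^bsub>BT\<^esub> actT y (tens k L L a' c'))"
proof -
  let ?t = "%x1 x2 y1 y2. tens k L L (act L x1 a \<star> act L x2 a') (act L y1 c \<star> act L y2 c')"
  have "actT h (tens k L L a c \<otimes>\<^bsub>BT\<^esub> tens k L L a' c') =
      ks LL R (%r s. actT h (tens k L L (a \<star> act L s a') (act L r c \<star> c')))"
    unfolding BT_mult_tens[OF assms(1-4)] by (rule linear_tsumc) simp_all
  also have "... = ks LL R (%r s. sw LL h (%x y. sw LL x (%x1 x2. sw LL y (%y1 y2. ?t x1 (x2 \<cdot> s) (y1 \<cdot> r) y2))))"
    by (intro tsumc_cong) (simp add: L_act, intro tsumc_cong tsumc_swap, simp_all)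
  also have "... = ks LL R (%r s. sw LL h (%x y. sw LL y (%z w. sw LL z (%p q. ?t x (p \<cdot> s) (q \<cdot> r) w))))"
    by (intro tsumc_cong sw4) simp_all
  also have "... = sw LL h (%x y. sw LL y (%z w. ks LL R (%r s. sw LL z (%p q. ?t x (p \<cdot> s) (q \<cdot> r) w))))"
    by (subst swap_comult[where t = R, symmetric]) simp_all
  also have "... = sw LL h (%x y. sw LL y (%z w. sw LL z (%p q. ks LL R (%r s. ?t x (p \<cdot> s) (q \<cdot> r) w))))"
    by (intro tsumc_cong tsumc_swap) simp_all
  also have "... = sw LL h (%x y. sw LL y (%z w. ks LL R (%r s. sw LL z (%p q. ?t x (s \<cdot> q) (r \<cdot> p) w))))"
    by (intro tsumc_cong R_comult[where f = "%u v. ?t _ v u _"]) simp_all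
  also have "... = sw LL h (%x y. sw LL y (%z w. sw LL z (%p q. ks LL R (%r s. ?t x (s \<cdot> q) (r \<cdot> p) w))))"
    by (intro tsumc_cong tsumc_swap) simp_all
  also have "... = sw LL h (%x y. sw LL x (%x1 x2. sw LL y (%y1 y2. ks LL R (%r s. ?t x1 (s \<cdot> y1) (r \<cdot> x2) y2))))"
    by (rule sw4[symmetric]) simp_all
  also have "... = sw LL h (%x y. actT x (tens k L L a c) \<otimes>\<^bsub>BT\<^esub> actT y (tens k L L a' c'))"
    by (intro tsumc_cong) (simp add: BT_push BT_mult_tens, intro tsumc_swap, simp_all)
  finally show ?thesis .
qed

lemma actT_mult:
  assumes [simp]: "s <: LL" "t <: LL" "h <: K"
  shows "actT h (s \<otimes>\<^bsub>BT\<^esub> t) = sw LL h (%x y. actT x s \<otimes>\<^bsub>BT\<^esub> actT y t)"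
proof -
  have 1: "actT h (tens k L L a c \<otimes>\<^bsub>BT\<^esub> t) = sw LL h (%x y. actT x (tens k L L a c) \<otimes>\<^bsub>BT\<^esub> actT y t)"
    if [simp]: "a <: L" "c <: L" for a c
    by (rule tensor_linear_eq[OF assms(2), where X = LL]) (simp_all add: actT_mult_tens del: actT_simps(4))
  show ?thesis
    by (rule tensor_linear_eq[OF assms(1), where X = LL]) (simp_all add: 1 del: actT_simps(4))
qed

lemma actT_one: "h <: K ==> actT h (tens k L L \<one>\<^bsub>L\<^esub> \<one>\<^bsub>L\<^esub>) = eps h \<odot>\<^bsub>LL\<^esub> tens k L L \<one>\<^bsub>L\<^esub> \<one>\<^bsub>L\<^esub>"
  by simp

end

section \<open>The enveloping algebra as a braided Hopf algebra\<close>

lemma (in ground) k_algebra_self [simp]: "k_algebra k (self_module k)"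
proof -
  interpret cring k by (rule cring_k)
  show ?thesis
    by (rule k_algebraI) (auto simp: m_assoc l_distr r_distr m_lcomm intro!: linear_mapI)
qed

sublocale braided_bracket \<subseteq> U: braided_square k K R UK
  using UK_module_algebra by unfold_locales

context braided_bracket begin

abbreviation "UU \<equiv> tensor_module k UK UK"
abbreviation "BU \<equiv> braided_tensor k R UK"
abbreviation umult (infixl "\<star>" 70) where "x \<star> y \<equiv> x \<otimes>\<^bsub>UK\<^esub> y"
abbreviation "us X t f \<equiv> tsumc k UK UK X t f"
abbreviation "tu x y \<equiv> tens k UK UK x y"

definition "dlt u = tu (iota u) \<one>\<^bsub>UK\<^esub> \<oplus>\<^bsub>UU\<^esub> tu \<one>\<^bsub>UK\<^esub> (iota u)"

lemma dlt_simps [simp]: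
  "u <: g ==> dlt u <: UU" "linear_map k X g f ==> linear_map k X UU (%x. dlt (f x))"
  by (simp_all add: dlt_def)

lemma dlt_mult:
  assumes u [simp]: "u <: g" and t: "t <: UU"
  shows "dlt u \<otimes>\<^bsub>BU\<^esub> t = us UU t (%x y. tu (iota u \<star> x) y \<oplus>\<^bsub>UU\<^esub> ks UU R (%r s. tu (act UK s x) (iota (act g r u) \<star> y)))"
proof -
  interpret mUU: module k UU by simp
  have d: "(a \<oplus>\<^bsub>UU\<^esub> b) \<otimes>\<^bsub>BU\<^esub> t = a \<otimes>\<^bsub>BU\<^esub> t \<oplus>\<^bsub>UU\<^esub> b \<otimes>\<^bsub>BU\<^esub> t" if "a <: UU" "b <: UU" "t <: UU" for a b t
    using alg_l_distr[OF U.BT_alg, of a b t] that by simp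
  have "dlt u \<otimes>\<^bsub>BU\<^esub> tu x y = tu (iota u \<star> x) y \<oplus>\<^bsub>UU\<^esub> ks UU R (%r s. tu (act UK s x) (iota (act g r u) \<star> y))"
    if [simp]: "x <: UK" "y <: UK" for x y
    by (simp add: dlt_def d U.BT_mult_tens)
  note pure = this
  show ?thesis
    by (rule tensor_linear_eq[OF t, where X = UU]) (simp_all add: pure)
qed

lemma us_dlt:
  assumes u [simp]: "u <: g" and t [simp]: "t <: UU" and X [simp]: "module k X"
    and f: "!!v. v <: UK ==> linear_map k UK X (%w. f v w)" "!!w. w <: UK ==> linear_map k UK X (%v. f v w)"
  shows "us X (dlt u \<otimes>\<^bsub>BU\<^esub> t) f =
    us X t (%x y. f (iota u \<star> x) y \<oplus>\<^bsub>X\<^esub> ks X R (%r s. f (act UK s x) (iota (act g r u) \<star> y)))"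
proof -
  have [simp]: "f v w <: X" if "v <: UK" "w <: UK" for v w
    by (rule lin_closed[OF f(1)]) fact+
  note [simp] = f bilinear_comp[OF f]
  show ?thesis unfolding dlt_mult[OF u t] by (simp add: tsumc_add_tensor)
qed

text \<open>Primitive elements satisfy the relations of \<open>\<U>(\<gg>)\<close>: in the mixed terms the braiding is
  applied twice, which is the identity by triangularity.\<close>

lemma dlt_relation:
  assumes [simp]: "u <: g" "v <: g"
  shows "dlt u \<otimes>\<^bsub>BU\<^esub> dlt v = ks BU R (%r s. dlt (act g s v) \<otimes>\<^bsub>BU\<^esub> dlt (act g r u)) \<oplus>\<^bsub>BU\<^esub> dlt (bracket g u v)"
proof -
  interpret mUU: module k UU by simp
  have e: "dlt a \<otimes>\<^bsub>BU\<^esub> dlt b = (tu (iota a \<star> iota b) \<one>\<^bsub>UK\<^esub> \<oplus>\<^bsub>UU\<^esub> ks UU R (%r s. tu (iota (act g s b)) (iota (act g r a)))) \<oplus>\<^bsub>UU\<^esub>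
      (tu (iota a) (iota b) \<oplus>\<^bsub>UU\<^esub> tu \<one>\<^bsub>UK\<^esub> (iota a \<star> iota b))"
    if [simp]: "a <: g" "b <: g" for a b
    by (simp add: dlt_mult) (simp add: dlt_def tsumc_add_tensor)
  let ?P1 = "ks UU R (%r s. tu (iota (act g s v) \<star> iota (act g r u)) \<one>\<^bsub>UK\<^esub>)"
  let ?P2 = "ks UU R (%r s. tu \<one>\<^bsub>UK\<^esub> (iota (act g s v) \<star> iota (act g r u)))"
  let ?T = "ks UU R (%r s. tu (iota (act g s v)) (iota (act g r u)))"
  have canc: "ks UU R (%r s. ks UU R (%r' s'. tu (iota (act g s' (act g r u))) (iota (act g r' (act g s v))))) = tu (iota u) (iota v)"
  proof -
    have "ks UU R (%r s. ks UU R (%r' s'. tu (iota (act g s' (act g r u))) (iota (act g r' (act g s v))))) =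
        ks UU R (%r' s'. ks UU R (%r s. tu (iota (act g (s' \<cdot> r) u)) (iota (act g (r' \<cdot> s) v))))"
      by simp (rule tsumc_swap, simp_all)
    also have "... = tu (iota u) (iota v)"
      by (subst R_cancel(2)[where f = "%x y. tu (iota (act g x u)) (iota (act g y v))"]) simp_all
    finally show ?thesis .
  qed
  have "ks UU R (%r s. dlt (act g s v) \<otimes>\<^bsub>BU\<^esub> dlt (act g r u)) = (?P1 \<oplus>\<^bsub>UU\<^esub> tu (iota u) (iota v)) \<oplus>\<^bsub>UU\<^esub> (?T \<oplus>\<^bsub>UU\<^esub> ?P2)"
    by (simp add: e tsumc_addf canc)
  moreover have "tu (iota u \<star> iota v) \<one>\<^bsub>UK\<^esub> = ?P1 \<oplus>\<^bsub>UU\<^esub> tu (iota (bracket g u v)) \<one>\<^bsub>UK\<^esub>"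
    unfolding iota_relation[OF assms] by (subst lin_add[OF lin_tens_left]) simp_all
  moreover have "tu \<one>\<^bsub>UK\<^esub> (iota u \<star> iota v) = ?P2 \<oplus>\<^bsub>UU\<^esub> tu \<one>\<^bsub>UK\<^esub> (iota (bracket g u v))"
    unfolding iota_relation[OF assms] by (subst lin_add[OF lin_tens_right]) simp_all
  ultimately show ?thesis
    by (simp add: e[OF assms]) (simp add: dlt_def mUU.M.a_ac)
qed

text \<open>Induction over \<open>\<U>(\<gg>)\<close> for statements quantified over the acting element, which changes
  from \<open>h\<close> to \<open>h\<^sub>2\<close> in the induction step.\<close>

lemma env_linear_eq_act:
  assumes X: "module k X" and f: "!!h. h <: K ==> linear_map k UK X (f h)" "!!h. h <: K ==> linear_map k UK X (f' h)"
    and one: "!!h. h <: K ==> f h \<one>\<^bsub>UK\<^esub> = f' h \<one>\<^bsub>UK\<^esub>"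
    and step: "!!h u \<xi>. [|h <: K; u <: g; \<xi> <: UK; !!h. h <: K ==> f h \<xi> = f' h \<xi>|]
      ==> f h (iota u \<star> \<xi>) = f' h (iota u \<star> \<xi>)"
    and h: "h <: K" and t: "t <: UK"
  shows "f h t = f' h t"
proof (rule UA_span[OF X])
  show "linear_map k UA X (f h)" "linear_map k UA X (f' h)" "t <: UA" using f h t by simp_all
  show "f h (cls w) = f' h (cls w)" if "w \<in> words" for w
    using that h by (induction w arbitrary: h) (simp_all add: one step cls_rules)
qed

text \<open>Coproduct and counit: the algebra maps that make all letters primitive.\<close>

definition "Dl = env_ext k BU (word_prod BU dlt)"
definition "ce = env_ext k (self_module k) (word_prod (self_module k) (%u. \<zero>\<^bsub>k\<^esub>))"

lemma dlt_linear: "linear_map k g BU dlt"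
  using dlt_simps(2)[OF lin_ident] by simp

lemmas Dl_hom = env_hom[OF U.BT_alg dlt_linear dlt_relation, folded Dl_def]

lemma Dl_linear: "linear_map k UK UU Dl"
  using Dl_hom(1) by simp

lemma Dl_simps [simp]:
  "\<xi> <: UK ==> Dl \<xi> <: UU" "linear_map k X UK f ==> linear_map k X UU (%x. Dl (f x))"
  "Dl \<one>\<^bsub>UK\<^esub> = tu \<one>\<^bsub>UK\<^esub> \<one>\<^bsub>UK\<^esub>" "[|u <: g; \<xi> <: UK|] ==> Dl (iota u \<star> \<xi>) = dlt u \<otimes>\<^bsub>BU\<^esub> Dl \<xi>"
  using lin_closed[OF Dl_linear] lin_comp[OF Dl_linear] Dl_hom(2,3) by simp_all

lemma Dl_mult: "[|\<xi> <: UK; \<eta> <: UK|] ==> Dl (\<xi> \<star> \<eta>) = Dl \<xi> \<otimes>\<^bsub>BU\<^esub> Dl \<eta>"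
  by (rule Dl_hom(4))

lemma ce_hom:
  "linear_map k UK (self_module k) ce" "ce \<one>\<^bsub>UK\<^esub> = \<one>\<^bsub>k\<^esub>"
  "[|u <: g; \<xi> <: UK|] ==> ce (iota u \<star> \<xi>) = \<zero>\<^bsub>k\<^esub>"
  "[|\<xi> <: UK; \<eta> <: UK|] ==> ce (\<xi> \<star> \<eta>) = ce \<xi> \<otimes>\<^bsub>k\<^esub> ce \<eta>"
proof -
  interpret cring k by (rule cring_k)
  have z: "linear_map k g (self_module k) (%u. \<zero>\<^bsub>k\<^esub>)"
    using lin_const_zero[of k "self_module k" g] by simp
  have s: "ks (self_module k) R (%r s. \<zero>\<^bsub>k\<^esub>) = \<zero>\<^bsub>k\<^esub>" using tsumc_zero[of K K "self_module k" R] by simp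
  have "\<zero>\<^bsub>k\<^esub> \<otimes>\<^bsub>self_module k\<^esub> \<zero>\<^bsub>k\<^esub> = ks (self_module k) R (%r s. \<zero>\<^bsub>k\<^esub> \<otimes>\<^bsub>self_module k\<^esub> \<zero>\<^bsub>k\<^esub>) \<oplus>\<^bsub>self_module k\<^esub> \<zero>\<^bsub>k\<^esub>"
    by (simp add: s)
  note e = env_hom[OF k_algebra_self z this, folded ce_def]
  show 1: "linear_map k UK (self_module k) ce" by (rule e(1))
  show "ce \<one>\<^bsub>UK\<^esub> = \<one>\<^bsub>k\<^esub>" using e(2) by simp
  show "[|u <: g; \<xi> <: UK|] ==> ce (iota u \<star> \<xi>) = \<zero>\<^bsub>k\<^esub>"
    using e(3)[of u \<xi>] lin_closed[OF 1, of \<xi>] by simp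
  show "[|\<xi> <: UK; \<eta> <: UK|] ==> ce (\<xi> \<star> \<eta>) = ce \<xi> \<otimes>\<^bsub>k\<^esub> ce \<eta>" using e(4) by simp
qed

lemma ce_simps [simp]:
  "\<xi> <: UK ==> ce \<xi> <: k" "linear_map k X UK f ==> linear_map k X (self_module k) (%x. ce (f x))"
  "ce \<one>\<^bsub>UK\<^esub> = \<one>\<^bsub>k\<^esub>" "[|u <: g; \<xi> <: UK|] ==> ce (iota u \<star> \<xi>) = \<zero>\<^bsub>k\<^esub>"
  using lin_closed[OF ce_hom(1)] lin_comp[OF ce_hom(1)] ce_hom(2,3) by simp_all

lemma act_step: "[|h <: K; u <: g; \<xi> <: UK|] ==>
    act UK h (iota u \<star> \<xi>) = sw UK h (%x y. iota (act g x u) \<star> act UK y \<xi>)"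
  by (simp add: U.L_act)

text \<open>The coproduct is an algebra map and equivariant on letters, and the action is compatible with both products.\<close>

lemma Dl_act:
  assumes "h <: K" "\<xi> <: UK"
  shows "Dl (act UK h \<xi>) = U.actT h (Dl \<xi>)"
proof (rule env_linear_eq_act[of UU "%h \<xi>. Dl (act UK h \<xi>)" "%h \<xi>. U.actT h (Dl \<xi>)", OF _ _ _ _ _ assms])
  have d: "U.actT x (dlt u) = dlt (act g x u)" if [simp]: "x <: K" "u <: g" for x u
    unfolding dlt_def by (subst lin_add[of k UU UU]) simp_all
  fix h u \<xi> assume [simp]: "h <: K" "u <: g" "\<xi> <: UK"
    and IH: "!!h. h <: K ==> Dl (act UK h \<xi>) = U.actT h (Dl \<xi>)"
  have "Dl (act UK h (iota u \<star> \<xi>)) = sw UU h (%x y. dlt (act g x u) \<otimes>\<^bsub>BU\<^esub> Dl (act UK y \<xi>))"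
    by (simp add: act_step linear_tsumc[OF Dl_linear])
  also have "... = U.actT h (dlt u \<otimes>\<^bsub>BU\<^esub> Dl \<xi>)" by (simp add: U.actT_mult d IH)
  finally show "Dl (act UK h (iota u \<star> \<xi>)) = U.actT h (Dl (iota u \<star> \<xi>))" by simp
next
  fix h assume [simp]: "h <: K"
  show "Dl (act UK h \<one>\<^bsub>UK\<^esub>) = U.actT h (Dl \<one>\<^bsub>UK\<^esub>)"
    by (simp add: U.actT_one lin_smult[OF Dl_linear] del: U.actT_simps(4))
qed simp_all

lemma ce_act:
  assumes "h <: K" "\<xi> <: UK"
  shows "ce (act UK h \<xi>) = eps h \<otimes>\<^bsub>k\<^esub> ce \<xi>"
proof (rule env_linear_eq[of "self_module k" "%\<xi>. ce (act UK h \<xi>)" "%\<xi>. eps h \<otimes>\<^bsub>k\<^esub> ce \<xi>", OF _ _ _ _ _ assms(2)])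
  interpret cring k by (rule cring_k)
  note [simp] = assms(1)
  have z: "tsumc k K K (self_module k) t (%x y. \<zero>\<^bsub>k\<^esub>) = \<zero>\<^bsub>k\<^esub>" for t using tsumc_zero[of K K "self_module k" t] by simp
  show "ce (act UK h \<one>\<^bsub>UK\<^esub>) = eps h \<otimes>\<^bsub>k\<^esub> ce \<one>\<^bsub>UK\<^esub>" by (simp add: lin_smult[OF ce_hom(1)])
  show "linear_map k UK (self_module k) (%\<xi>. eps h \<otimes>\<^bsub>k\<^esub> ce \<xi>)"
    using lin_smultf[OF _ ce_hom(1), of "eps h"] by simp
  fix u \<xi> assume [simp]: "u <: g" "\<xi> <: UK"
  show "ce (act UK h (iota u \<star> \<xi>)) = eps h \<otimes>\<^bsub>k\<^esub> ce (iota u \<star> \<xi>)"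
    by (simp add: act_step linear_tsumc[OF ce_hom(1)] z)
qed (use assms in simp_all)

abbreviation "YU \<equiv> tensor_module k UK UU"
abbreviation "t3u a b c \<equiv> tens k UK UU a (tu b c)"

lemma us_actT:
  assumes [simp]: "h <: K" "t <: UU" "module k X"
    and f: "!!v. v <: UK ==> linear_map k UK X (%w. f v w)" "!!w. w <: UK ==> linear_map k UK X (%v. f v w)"
  shows "us X (U.actT h t) f = sw X h (%x y. us X t (%a c. f (act UK x a) (act UK y c)))"
  unfolding U.actT_def by (simp add: f bilinear_comp[OF f])

text \<open>Multiplying by a letter \<open>u\<close> acts on three legs as \<open>u \<otimes> 1 \<otimes> 1\<close>,
  \<open>1 \<otimes> u \<otimes> 1\<close> and \<open>1 \<otimes> 1 \<otimes> u\<close>, each moved past the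
  legs on its left by \<open>R\<close>. The three terms \<open>?A\<close>, \<open>?B\<close>, \<open>?C\<close>
  arise from both bracketings, the last one by the second hexagon identity.\<close>

lemma Dl_coassoc:
  assumes "\<xi> <: UK"
  shows "us YU (Dl \<xi>) (%x y. us YU (Dl x) (%a b. t3u a b y)) = us YU (Dl \<xi>) (%x y. us YU (Dl y) (%a b. t3u x a b))"
proof (rule env_linear_eq[of YU "%\<xi>. us YU (Dl \<xi>) (%x y. us YU (Dl x) (%a b. t3u a b y))"
      "%\<xi>. us YU (Dl \<xi>) (%x y. us YU (Dl y) (%a b. t3u x a b))", OF _ _ _ _ _ assms])
  fix u \<xi> assume [simp]: "u <: g" "\<xi> <: UK"
    and IH: "us YU (Dl \<xi>) (%x y. us YU (Dl x) (%a b. t3u a b y)) = us YU (Dl \<xi>) (%x y. us YU (Dl y) (%a b. t3u x a b))"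
  interpret mY: module k YU by simp
  let ?A = "%a b c. t3u (iota u \<star> a) b c"
  let ?B = "%a b c. ks YU R (%r s. t3u (act UK s a) (iota (act g r u) \<star> b) c)"
  let ?C = "%a b c. ks YU R (%r s. ks YU R (%r' s'. t3u (act UK s' a) (act UK s b) (iota (act g (r \<cdot> r') u) \<star> c)))"
  define f where "f a b c = ?A a b c \<oplus>\<^bsub>YU\<^esub> ?B a b c \<oplus>\<^bsub>YU\<^esub> ?C a b c" for a b c
  have f: "trilinear_map k UK UK UK YU f" unfolding f_def trilinear_map_def by simp
  note [simp] = trilinear_comp[OF f]
  have ev: "us YU (Dl \<xi>) (%x y. us YU (Dl x) (%a b. f a b y)) = us YU (Dl \<xi>) (%x y. us YU (Dl y) (%a b. f x a b))"
    using arg_cong[OF IH, of "%z. tsumc k UK UU YU z (%a w. us YU w (%b c. f a b c))"] by simp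
  have C: "ks YU R (%r s. us YU (Dl (act UK s x)) (%a b. t3u a b (iota (act g r u) \<star> y))) = us YU (Dl x) (%a b. ?C a b y)"
    if [simp]: "x <: UK" "y <: UK" for x y
  proof -
    have "ks YU R (%r s. us YU (Dl (act UK s x)) (%a b. t3u a b (iota (act g r u) \<star> y))) =
        ks YU R (%r s. us YU (Dl x) (%a b. sw YU s (%c d. t3u (act UK c a) (act UK d b) (iota (act g r u) \<star> y))))"
      by (intro tsumc_cong) (simp add: Dl_act us_actT, rule tsumc_swap, simp_all)
    also have "... = us YU (Dl x) (%a b. ks YU R (%r s. sw YU s (%c d. t3u (act UK c a) (act UK d b) (iota (act g r u) \<star> y))))"
      by (rule tsumc_swap) simp_all
    also have "... = us YU (Dl x) (%a b. ?C a b y)"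
      by (intro tsumc_cong R_hex2[where f = "%r c d. t3u (act UK c _) (act UK d _) (iota (act g r u) \<star> y)"]) (simp_all add: trilinear_map_def)
    finally show ?thesis .
  qed
  have D: "ks YU R (%r s. us YU (Dl (iota (act g r u) \<star> y)) (%a b. t3u (act UK s x) a b)) =
      us YU (Dl y) (%a b. ?B x a b \<oplus>\<^bsub>YU\<^esub> ?C x a b)" if [simp]: "x <: UK" "y <: UK" for x y
  proof -
    have "ks YU R (%r s. us YU (Dl (iota (act g r u) \<star> y)) (%a b. t3u (act UK s x) a b)) =
        ks YU R (%r s. us YU (Dl y) (%a b. t3u (act UK s x) (iota (act g r u) \<star> a) b \<oplus>\<^bsub>YU\<^esub>
          ks YU R (%r' s'. t3u (act UK s x) (act UK s' a) (iota (act g (r' \<cdot> r) u) \<star> b))))"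
      by (intro tsumc_cong) (simp add: us_dlt)
    also have "... = us YU (Dl y) (%a b. ks YU R (%r s. t3u (act UK s x) (iota (act g r u) \<star> a) b \<oplus>\<^bsub>YU\<^esub>
          ks YU R (%r' s'. t3u (act UK s x) (act UK s' a) (iota (act g (r' \<cdot> r) u) \<star> b))))"
      by (rule tsumc_swap) simp_all
    also have "... = us YU (Dl y) (%a b. ?B x a b \<oplus>\<^bsub>YU\<^esub> ks YU R (%r s.
          ks YU R (%r' s'. t3u (act UK s x) (act UK s' a) (iota (act g (r' \<cdot> r) u) \<star> b))))"
      by (intro tsumc_cong tsumc_addf) simp_all
    also have "... = us YU (Dl y) (%a b. ?B x a b \<oplus>\<^bsub>YU\<^esub> ?C x a b)"
      by (intro tsumc_cong arg_cong2[where f = "add YU"] refl tsumc_swap) simp_all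
    finally show ?thesis .
  qed
  have "us YU (Dl (iota u \<star> \<xi>)) (%x y. us YU (Dl x) (%a b. t3u a b y)) =
      us YU (Dl \<xi>) (%x y. us YU (Dl (iota u \<star> x)) (%a b. t3u a b y) \<oplus>\<^bsub>YU\<^esub>
        ks YU R (%r s. us YU (Dl (act UK s x)) (%a b. t3u a b (iota (act g r u) \<star> y))))"
    by (simp only: Dl_simps(4) \<open>u <: g\<close> \<open>\<xi> <: UK\<close>) (rule us_dlt, simp_all)
  also have "... = us YU (Dl \<xi>) (%x y. us YU (Dl x) (%a b. f a b y))"
  proof (intro tsumc_cong)
    fix x y assume [simp]: "x <: UK" "y <: UK"
    show "us YU (Dl (iota u \<star> x)) (%a b. t3u a b y) \<oplus>\<^bsub>YU\<^esub>
        ks YU R (%r s. us YU (Dl (act UK s x)) (%a b. t3u a b (iota (act g r u) \<star> y))) = us YU (Dl x) (%a b. f a b y)"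
      unfolding C[OF \<open>x <: UK\<close> \<open>y <: UK\<close>] f_def by (simp add: us_dlt tsumc_addf)
  qed
  also note ev
  also have "us YU (Dl \<xi>) (%x y. us YU (Dl y) (%a b. f x a b)) = us YU (Dl \<xi>) (%x y. us YU (Dl y) (%a b. t3u (iota u \<star> x) a b) \<oplus>\<^bsub>YU\<^esub>
      ks YU R (%r s. us YU (Dl (iota (act g r u) \<star> y)) (%a b. t3u (act UK s x) a b)))"
  proof (intro tsumc_cong)
    fix x y assume [simp]: "x <: UK" "y <: UK"
    show "us YU (Dl y) (%a b. f x a b) = us YU (Dl y) (%a b. t3u (iota u \<star> x) a b) \<oplus>\<^bsub>YU\<^esub>
      ks YU R (%r s. us YU (Dl (iota (act g r u) \<star> y)) (%a b. t3u (act UK s x) a b))"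
      unfolding D[OF \<open>x <: UK\<close> \<open>y <: UK\<close>] f_def by (simp add: tsumc_addf mY.M.a_assoc)
  qed
  also have "... = us YU (Dl (iota u \<star> \<xi>)) (%x y. us YU (Dl y) (%a b. t3u x a b))"
    by (simp only: Dl_simps(4) \<open>u <: g\<close> \<open>\<xi> <: UK\<close>) (rule us_dlt[symmetric], simp_all)
  finally show "us YU (Dl (iota u \<star> \<xi>)) (%x y. us YU (Dl x) (%a b. t3u a b y)) =
    us YU (Dl (iota u \<star> \<xi>)) (%x y. us YU (Dl y) (%a b. t3u x a b))" .
qed simp_all

lemma Dl_counit:
  assumes "\<xi> <: UK"
  shows "us UK (Dl \<xi>) (%x y. ce x \<odot>\<^bsub>UK\<^esub> y) = \<xi>" "us UK (Dl \<xi>) (%x y. ce y \<odot>\<^bsub>UK\<^esub> x) = \<xi>"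
proof -
  interpret mU: module k UK by simp
  show "us UK (Dl \<xi>) (%x y. ce x \<odot>\<^bsub>UK\<^esub> y) = \<xi>"
  proof (rule env_linear_eq[of UK "%\<xi>. us UK (Dl \<xi>) (%x y. ce x \<odot>\<^bsub>UK\<^esub> y)" "%\<xi>. \<xi>", OF _ _ _ _ _ assms])
    fix u \<xi> assume [simp]: "u <: g" "\<xi> <: UK" and IH: "us UK (Dl \<xi>) (%x y. ce x \<odot>\<^bsub>UK\<^esub> y) = \<xi>"
    have "us UK (Dl (iota u \<star> \<xi>)) (%x y. ce x \<odot>\<^bsub>UK\<^esub> y) = us UK (Dl \<xi>) (%x y. ks UK R (%r s. eps s \<odot>\<^bsub>UK\<^esub> (ce x \<odot>\<^bsub>UK\<^esub> (iota (act g r u) \<star> y))))"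
      by (simp add: us_dlt ce_act smult_rules(2) del: R_counit)
    also have "... = us UK (Dl \<xi>) (%x y. iota u \<star> (ce x \<odot>\<^bsub>UK\<^esub> y))" by simp
    also have "... = iota u \<star> us UK (Dl \<xi>) (%x y. ce x \<odot>\<^bsub>UK\<^esub> y)" by (rule tsumc_mult(1)[symmetric]) simp_all
    finally show "us UK (Dl (iota u \<star> \<xi>)) (%x y. ce x \<odot>\<^bsub>UK\<^esub> y) = iota u \<star> \<xi>" by (simp only: IH)
  qed simp_all
  show "us UK (Dl \<xi>) (%x y. ce y \<odot>\<^bsub>UK\<^esub> x) = \<xi>"
  proof (rule env_linear_eq[of UK "%\<xi>. us UK (Dl \<xi>) (%x y. ce y \<odot>\<^bsub>UK\<^esub> x)" "%\<xi>. \<xi>", OF _ _ _ _ _ assms])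
    fix u \<xi> assume [simp]: "u <: g" "\<xi> <: UK" and IH: "us UK (Dl \<xi>) (%x y. ce y \<odot>\<^bsub>UK\<^esub> x) = \<xi>"
    have "us UK (Dl (iota u \<star> \<xi>)) (%x y. ce y \<odot>\<^bsub>UK\<^esub> x) = us UK (Dl \<xi>) (%x y. iota u \<star> (ce y \<odot>\<^bsub>UK\<^esub> x))"
      by (simp add: us_dlt)
    also have "... = iota u \<star> us UK (Dl \<xi>) (%x y. ce y \<odot>\<^bsub>UK\<^esub> x)" by (rule tsumc_mult(1)[symmetric]) simp_all
    finally show "us UK (Dl (iota u \<star> \<xi>)) (%x y. ce y \<odot>\<^bsub>UK\<^esub> x) = iota u \<star> \<xi>" by (simp only: IH)
  qed simp_all
qed


subsection \<open>The antipode\<close>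

abbreviation "wan w \<equiv> word_antipode k K R g w"

lemma wan_closed [simp]: "w \<in> words ==> wan w <: UK"
proof (induction w)
  case (Cons u w)
  then have [simp]: "u <: g" "wan w <: UK" by auto
  have "tsum k UK R (%r s. act UK s (wan w) \<star> iota (act g r u)) = ks UK R (%r s. act UK s (wan w) \<star> iota (act g r u))"
    by (rule tsum_eq_tsumc) simp_all
  then show ?case by simp
qed simp

lemma wan_Nil: "wan [] = \<one>\<^bsub>UK\<^esub>" by simp

lemma wan_Cons: "[|u <: g; w \<in> words|] ==> wan (u # w) = \<ominus>\<^bsub>UK\<^esub> ks UK R (%r s. act UK s (wan w) \<star> iota (act g r u))"
  by (simp del: tsumc_push) (intro arg_cong[where f = "a_inv UK"] tsum_eq_tsumc, simp_all)

declare word_antipode.simps [simp del]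

text \<open>The antipode is braided antimultiplicative; this reduces its compatibility with the relations of
  \<open>\<U>(\<gg>)\<close> to words of length two.\<close>

lemma wan_append:
  assumes "w \<in> words" "w' \<in> words"
  shows "wan (w @ w') = ks UK R (%r s. act UK s (wan w') \<star> act UK r (wan w))"
  using assms
proof (induction w)
  case Nil
  have "ks UK R (%r s. act UK s (wan w') \<star> act UK r \<one>\<^bsub>UK\<^esub>) = ks UK R (%r s. eps r \<odot>\<^bsub>UK\<^esub> act UK s (wan w'))"
    using Nil by simp
  also have "... = wan w'" using Nil by simp
  finally show ?case by (simp add: wan_Nil)
next
  case (Cons u w)
  then have [simp]: "u <: g" "w \<in> words" "w' \<in> words" and
    IH: "wan (w @ w') = ks UK R (%r s. act UK s (wan w') \<star> act UK r (wan w))" by auto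
  let ?t = "%a b c. act UK a (wan w') \<star> (act UK b (wan w) \<star> iota (act g c u))"
  have "ks UK R (%r s. act UK s (wan (w @ w')) \<star> iota (act g r u)) =
      ks UK R (%r s. ks UK R (%r' s'. sw UK s (%x y. ?t (x \<cdot> s') (y \<cdot> r') r)))"
    unfolding IH by (simp add: U.L_act UK_assoc)
  also have "... = ks UK R (%r' s'. ks UK R (%r s. sw UK s (%x y. ?t (x \<cdot> s') (y \<cdot> r') r)))"
    by (rule tsumc_swap) simp_all
  also have "... = ks UK R (%r' s'. ks UK R (%r s. ks UK R (%r2 s2. ?t (s2 \<cdot> s') (s \<cdot> r') (r \<cdot> r2))))"
    by (intro tsumc_cong R_hex2[where f = "%r x y. ?t (x \<cdot> _) (y \<cdot> _) r"]) (simp_all add: trilinear_map_def)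
  also have "... = ks UK R (%r2 s2. ks UK R (%r s. ks UK R (%r' s'. ?t (s2 \<cdot> s') (s \<cdot> r') (r \<cdot> r2))))"
    by (rule tsumc_rev3) simp_all
  also have "... = ks UK R (%r s. ks UK R (%p q. ks UK R (%p' q'. ?t (q \<cdot> q') (s \<cdot> p') (r \<cdot> p))))"
    by (rule tsumc_swap) simp_all
  also have "... = ks UK R (%r s. ks UK R (%p q. sw UK p (%x y. ?t q (s \<cdot> y) (r \<cdot> x))))"
    by (intro tsumc_cong R_hex1[symmetric, where f = "%x y q. ?t q (_ \<cdot> y) (_ \<cdot> x)"]) (simp_all add: trilinear_map_def)
  also have "... = ks UK R (%p q. ks UK R (%r s. sw UK p (%x y. ?t q (s \<cdot> y) (r \<cdot> x))))"
    by (rule tsumc_swap) simp_all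
  also have "... = ks UK R (%p q. sw UK p (%x y. ks UK R (%r s. ?t q (x \<cdot> s) (y \<cdot> r))))"
    by (intro tsumc_cong R_comult[symmetric, where f = "%c b. ?t _ b c"]) simp_all
  also have "... = ks UK R (%p q. act UK q (wan w') \<star> act UK p (ks UK R (%r s. act UK s (wan w) \<star> iota (act g r u))))"
    by (intro tsumc_cong) (simp add: U.L_act, rule tsumc_swap, simp_all)
  finally have "wan ((u # w) @ w') = \<ominus>\<^bsub>UK\<^esub> ks UK R (%p q. act UK q (wan w') \<star> act UK p (ks UK R (%r s. act UK s (wan w) \<star> iota (act g r u))))"
    by (simp add: wan_Cons del: tsumc_push K_module_push tsumc_mult)
  also have "... = ks UK R (%p q. \<ominus>\<^bsub>UK\<^esub> (act UK q (wan w') \<star> act UK p (ks UK R (%r s. act UK s (wan w) \<star> iota (act g r u)))))"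
    by (rule tsumc_push(4)) simp_all
  also have "... = ks UK R (%p q. act UK q (wan w') \<star> act UK p (wan (u # w)))"
    by (intro tsumc_cong) (simp add: wan_Cons act_uminus alg_minus_mult del: tsumc_push K_module_push tsumc_mult)
  finally show ?case .
qed

lemma wan_letter: "u <: g ==> wan [u] = \<ominus>\<^bsub>UK\<^esub> iota u"
  by (simp add: wan_Cons wan_Nil del: tsumc_push)

lemma wan_pair: "[|u <: g; v <: g|] ==> wan [u, v] = ks UK R (%r s. iota (act g s v) \<star> iota (act g r u))"
proof -
  assume [simp]: "u <: g" "v <: g"
  interpret mU: module k UK by simp
  have "wan [u, v] = \<ominus>\<^bsub>UK\<^esub> ks UK R (%r s. \<ominus>\<^bsub>UK\<^esub> (iota (act g s v) \<star> iota (act g r u)))"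
    by (simp add: wan_Cons[of u "[v]"] wan_letter act_uminus alg_minus_mult del: tsumc_push)
  also have "ks UK R (%r s. \<ominus>\<^bsub>UK\<^esub> (iota (act g s v) \<star> iota (act g r u))) = \<ominus>\<^bsub>UK\<^esub> ks UK R (%r s. iota (act g s v) \<star> iota (act g r u))"
    by (rule tsumc_push(4)[symmetric]) simp_all
  finally show ?thesis by (simp del: tsumc_push)
qed

text \<open>For two letters the antipode reverses the product up to the braiding, and the braiding is an involution.\<close>

lemma wan_relation:
  assumes [simp]: "u <: g" "v <: g"
  shows "wan [u, v] = ks UK R (%r s. wan [act g s v, act g r u]) \<oplus>\<^bsub>UK\<^esub> wan [bracket g u v]"
proof -
  interpret mU: module k UK by simp
  have "ks UK R (%r s. wan [act g s v, act g r u]) = ks UK R (%r s. ks UK R (%r' s'. iota (act g (s' \<cdot> r) u) \<star> iota (act g (r' \<cdot> s) v)))"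
    by (simp add: wan_pair)
  also have "... = ks UK R (%r' s'. ks UK R (%r s. iota (act g (s' \<cdot> r) u) \<star> iota (act g (r' \<cdot> s) v)))"
    by (rule tsumc_swap) simp_all
  also have "... = iota u \<star> iota v"
    by (subst R_cancel(2)[where f = "%x y. iota (act g x u) \<star> iota (act g y v)"]) simp_all
  finally show ?thesis
    by (simp add: wan_pair wan_letter iota_relation[OF assms] mU.M.a_assoc mU.M.r_neg)
qed

definition "an = env_ext k UK (word_antipode k K R g)"

lemma wan_insert:
  assumes "w \<in> words" "w' \<in> words" "z \<in> words"
  shows "wan (w @ z @ w') = ks UK R (%r s. ks UK R (%r' s'. act UK s (act UK s' (wan w') \<star> act UK r' (wan z)) \<star> act UK r (wan w)))"
  using assms by (simp add: wan_append)

text \<open>By antimultiplicativity the values on \<open>w z w'\<close> depend linearly on the value on \<open>z\<close>,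
  so that compatibility with the relations is needed only for \<open>z\<close> of length two.\<close>

lemma an_env_ext:
  shows an_linear: "linear_map k UK UK an" and an_cls: "w \<in> words ==> an (cls w) = wan w"
proof -
  have 1: "linear_map k g UK (%u. wan (w @ u # w'))" if [simp]: "w \<in> words" "w' \<in> words" for w w'
    by (subst lin_cong[OF g_mod, of _ "%u. ks UK R (%r s. act UK s (\<ominus>\<^bsub>UK\<^esub> ks UK R (%r' s'. act UK s' (wan w') \<star> iota (act g r' u))) \<star> act UK r (wan w))"])
      (simp_all add: wan_append wan_Cons)
  have 2: "wan (w @ u # v # w') = ks UK R (%r s. wan (w @ act g s v # act g r u # w')) \<oplus>\<^bsub>UK\<^esub> wan (w @ bracket g u v # w')"
    if [simp]: "w \<in> words" "w' \<in> words" "u <: g" "v <: g" for w w' u v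
  proof -
    define M where "M = (%z. ks UK R (%r s. ks UK R (%r' s'. act UK s (act UK s' (wan w') \<star> act UK r' z) \<star> act UK r (wan w))))"
    have M: "linear_map k UK UK M" unfolding M_def by simp
    have e: "wan (w @ z @ w') = M (wan z)" if "z \<in> words" for z unfolding M_def by (rule wan_insert) (use that in simp_all)
    have "wan (w @ [u, v] @ w') = M (ks UK R (%r s. wan [act g s v, act g r u]) \<oplus>\<^bsub>UK\<^esub> wan [bracket g u v])"
      by (subst e, simp) (subst wan_relation, simp_all)
    also have "... = ks UK R (%r s. M (wan [act g s v, act g r u])) \<oplus>\<^bsub>UK\<^esub> M (wan [bracket g u v])"
      by (subst lin_add[OF M]) (simp_all add: linear_tsumc[OF M])
    also have "... = ks UK R (%r s. wan (w @ [act g s v, act g r u] @ w')) \<oplus>\<^bsub>UK\<^esub> wan (w @ [bracket g u v] @ w')"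
      by (subst e, simp, intro arg_cong2[where f = "add UK"] refl tsumc_cong) (subst e; simp)
    finally show ?thesis by simp
  qed
  show "linear_map k UK UK an" unfolding an_def same_module_linear_map(1)[OF same_UA, symmetric]
    by (rule env_ext_linear[OF UK_simps(1) wan_closed 1 2])
  show "an (cls w) = wan w" if "w \<in> words"
    unfolding an_def by (rule env_ext_cls[OF UK_simps(1) wan_closed 1 2 that])
qed

lemma an_simps [simp]:
  "\<xi> <: UK ==> an \<xi> <: UK" "linear_map k X UK f ==> linear_map k X UK (%x. an (f x))" "an \<one>\<^bsub>UK\<^esub> = \<one>\<^bsub>UK\<^esub>"
  using lin_closed[OF an_linear] lin_comp[OF an_linear] an_cls[of "[]"] by (simp_all add: cls_rules wan_Nil)

lemma an_step:
  assumes [simp]: "u <: g" and x: "\<xi> <: UK"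
  shows "an (iota u \<star> \<xi>) = \<ominus>\<^bsub>UK\<^esub> ks UK R (%r s. act UK s (an \<xi>) \<star> iota (act g r u))"
proof (rule UA_span[of UK "%\<xi>. an (iota u \<star> \<xi>)" "%\<xi>. \<ominus>\<^bsub>UK\<^esub> ks UK R (%r s. act UK s (an \<xi>) \<star> iota (act g r u))"])
  show "an (iota u \<star> cls w) = \<ominus>\<^bsub>UK\<^esub> ks UK R (%r s. act UK s (an (cls w)) \<star> iota (act g r u))" if "w \<in> words" for w
    using an_cls[of "u # w"] an_cls[OF that] that by (simp add: cls_rules wan_Cons del: tsumc_push)
qed (use x in simp_all)

lemma an_act:
  assumes "h <: K" "\<xi> <: UK"
  shows "an (act UK h \<xi>) = act UK h (an \<xi>)"
proof (rule env_linear_eq_act[of UK "%h \<xi>. an (act UK h \<xi>)" "%h \<xi>. act UK h (an \<xi>)", OF _ _ _ _ _ assms])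
  fix h u \<xi> assume [simp]: "h <: K" "u <: g" "\<xi> <: UK"
    and IH: "!!h. h <: K ==> an (act UK h \<xi>) = act UK h (an \<xi>)"
  let ?t = "%a b. \<ominus>\<^bsub>UK\<^esub> (act UK b (an \<xi>) \<star> iota (act g a u))"
  have "an (act UK h (iota u \<star> \<xi>)) = sw UK h (%x y. ks UK R (%r s. ?t (r \<cdot> x) (s \<cdot> y)))"
    by (simp add: act_step linear_tsumc[OF an_linear] an_step IH)
  also have "... = ks UK R (%r s. sw UK h (%x y. ?t (r \<cdot> x) (s \<cdot> y)))"
    by (rule tsumc_swap) simp_all
  also have "... = sw UK h (%x y. ks UK R (%r s. ?t (y \<cdot> r) (x \<cdot> s)))"
    by (rule R_comult[symmetric, where f = "?t"]) simp_all
  also have "... = ks UK R (%r s. sw UK h (%x y. ?t (y \<cdot> r) (x \<cdot> s)))"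
    by (rule tsumc_swap) simp_all
  also have "... = act UK h (an (iota u \<star> \<xi>))"
    by (simp add: an_step U.L_act act_uminus)
  finally show "an (act UK h (iota u \<star> \<xi>)) = act UK h (an (iota u \<star> \<xi>))" .
qed (simp_all add: lin_smult[OF an_linear])

text \<open>Induction on words. In the first identity the two contributions of a letter cancel at once; in the second one
  they combine to a linear map \<open>M\<close> of the value for the shorter word, which is a multiple of
  \<open>1\<close>, and \<open>M(1) = 0\<close>.\<close>

lemma an_convolution:
  assumes "\<xi> <: UK"
  shows "us UK (Dl \<xi>) (%x y. an x \<star> y) = ce \<xi> \<odot>\<^bsub>UK\<^esub> \<one>\<^bsub>UK\<^esub>" "us UK (Dl \<xi>) (%x y. x \<star> an y) = ce \<xi> \<odot>\<^bsub>UK\<^esub> \<one>\<^bsub>UK\<^esub>"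
proof -
  interpret mU: module k UK by simp
  show "us UK (Dl \<xi>) (%x y. an x \<star> y) = ce \<xi> \<odot>\<^bsub>UK\<^esub> \<one>\<^bsub>UK\<^esub>"
  proof (rule env_linear_eq[of UK "%\<xi>. us UK (Dl \<xi>) (%x y. an x \<star> y)" "%\<xi>. ce \<xi> \<odot>\<^bsub>UK\<^esub> \<one>\<^bsub>UK\<^esub>", OF _ _ _ _ _ assms])
    fix u \<xi> assume [simp]: "u <: g" "\<xi> <: UK"
    have "us UK (Dl (iota u \<star> \<xi>)) (%x y. an x \<star> y) = us UK (Dl \<xi>) (%x y.
        (\<ominus>\<^bsub>UK\<^esub> ks UK R (%r s. act UK s (an x) \<star> iota (act g r u))) \<star> y \<oplus>\<^bsub>UK\<^esub> ks UK R (%r s. act UK s (an x) \<star> (iota (act g r u) \<star> y)))"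
      by (simp add: us_dlt an_step an_act)
    also have "... = us UK (Dl \<xi>) (%x y. \<zero>\<^bsub>UK\<^esub>)"
      by (intro tsumc_cong) (simp add: alg_minus_mult UK_assoc mU.M.l_neg del: tsumc_push(4) flip: tsumc_push(4))
    finally show "us UK (Dl (iota u \<star> \<xi>)) (%x y. an x \<star> y) = ce (iota u \<star> \<xi>) \<odot>\<^bsub>UK\<^esub> \<one>\<^bsub>UK\<^esub>" by simp
  qed simp_all
  show "us UK (Dl \<xi>) (%x y. x \<star> an y) = ce \<xi> \<odot>\<^bsub>UK\<^esub> \<one>\<^bsub>UK\<^esub>"
  proof (rule env_linear_eq[of UK "%\<xi>. us UK (Dl \<xi>) (%x y. x \<star> an y)" "%\<xi>. ce \<xi> \<odot>\<^bsub>UK\<^esub> \<one>\<^bsub>UK\<^esub>", OF _ _ _ _ _ assms])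
    fix u \<xi> assume [simp]: "u <: g" "\<xi> <: UK" and IH: "us UK (Dl \<xi>) (%x y. x \<star> an y) = ce \<xi> \<odot>\<^bsub>UK\<^esub> \<one>\<^bsub>UK\<^esub>"
    define M where "M z = iota u \<star> z \<ominus>\<^bsub>UK\<^esub> ks UK R (%r s. act UK s z \<star> iota (act g r u))" for z
    have M: "linear_map k UK UK M" unfolding M_def by simp
    have "ks UK R (%r s. act UK s x \<star> an (iota (act g r u) \<star> y)) = \<ominus>\<^bsub>UK\<^esub> ks UK R (%r s. act UK s (x \<star> an y) \<star> iota (act g r u))"
      if [simp]: "x <: UK" "y <: UK" for x y
    proof -
      let ?t = "%a b c. \<ominus>\<^bsub>UK\<^esub> (act UK b x \<star> (act UK c (an y) \<star> iota (act g a u)))"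
      have "ks UK R (%r s. act UK s x \<star> an (iota (act g r u) \<star> y)) = ks UK R (%r s. ks UK R (%r' s'. ?t (r' \<cdot> r) s s'))"
        by (simp add: an_step alg_minus_mult)
      also have "... = ks UK R (%r' s'. ks UK R (%r s. ?t (r' \<cdot> r) s s'))"
        by (rule tsumc_swap) simp_all
      also have "... = ks UK R (%r s. sw UK s (%a b. ?t r a b))"
        by (rule R_hex2[symmetric]) (simp_all add: trilinear_map_def)
      finally show ?thesis by (simp add: U.L_act UK_assoc)
    qed
    then have "us UK (Dl (iota u \<star> \<xi>)) (%x y. x \<star> an y) = us UK (Dl \<xi>) (%x y. M (x \<star> an y))"
      by (simp add: us_dlt M_def UK_assoc a_minus_def del: tsumc_push)
    also have "... = M (us UK (Dl \<xi>) (%x y. x \<star> an y))"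
      by (rule linear_tsumc[OF M, symmetric]) simp_all
    also have "... = ce \<xi> \<odot>\<^bsub>UK\<^esub> M \<one>\<^bsub>UK\<^esub>" unfolding IH by (simp add: lin_smult[OF M])
    also have "M \<one>\<^bsub>UK\<^esub> = \<zero>\<^bsub>UK\<^esub>" unfolding M_def by (simp add: a_minus_def mU.M.r_neg del: tsumc_push)
    finally show "us UK (Dl (iota u \<star> \<xi>)) (%x y. x \<star> an y) = ce (iota u \<star> \<xi>) \<odot>\<^bsub>UK\<^esub> \<one>\<^bsub>UK\<^esub>" by simp
  qed simp_all
qed

end

text \<open>A criterion for braided Hopf algebras in terms of Sweedler sums over a module algebra \<open>L\<close> with the
  same module algebra structure as the record \<open>L'\<close>.\<close>

lemma (in braided_square) braided_hopf_algebraI: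
  fixes L' :: "('k, 'h, 'l) braided_hopf"
  assumes L': "same_module L L'" "mult L = mult L'" "one L = one L'" "act L = act L'"
    and D: "linear_map k L LL (bcomult L')" and c: "linear_map k L (self_module k) (bcounit L')"
    and an: "linear_map k L L (bantipode L')"
    and coassoc: "!!\<xi>. \<xi> <: L ==>
      ls (tensor_module k L LL) (bcomult L' \<xi>) (%x y. ls (tensor_module k L LL) (bcomult L' x) (%a b. tens k L LL a (tens k L L b y))) =
      ls (tensor_module k L LL) (bcomult L' \<xi>) (%x y. ls (tensor_module k L LL) (bcomult L' y) (%a b. tens k L LL x (tens k L L a b)))"
    and counit: "!!\<xi>. \<xi> <: L ==> ls L (bcomult L' \<xi>) (%x y. bcounit L' x \<odot>\<^bsub>L\<^esub> y) = \<xi>"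
      "!!\<xi>. \<xi> <: L ==> ls L (bcomult L' \<xi>) (%x y. bcounit L' y \<odot>\<^bsub>L\<^esub> x) = \<xi>"
    and equivariant: "!!h \<xi>. [|h <: K; \<xi> <: L|] ==> bcomult L' (act L h \<xi>) = actT h (bcomult L' \<xi>)"
      "!!h \<xi>. [|h <: K; \<xi> <: L|] ==> bcounit L' (act L h \<xi>) = eps h \<otimes>\<^bsub>k\<^esub> bcounit L' \<xi>"
      "!!h \<xi>. [|h <: K; \<xi> <: L|] ==> bantipode L' (act L h \<xi>) = act L h (bantipode L' \<xi>)"
    and one: "bcomult L' \<one>\<^bsub>L\<^esub> = tens k L L \<one>\<^bsub>L\<^esub> \<one>\<^bsub>L\<^esub>" "bcounit L' \<one>\<^bsub>L\<^esub> = \<one>\<^bsub>k\<^esub>"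
    and mult: "!!\<xi> \<eta>. [|\<xi> <: L; \<eta> <: L|] ==> bcomult L' (\<xi> \<star> \<eta>) = bcomult L' \<xi> \<otimes>\<^bsub>BT\<^esub> bcomult L' \<eta>"
      "!!\<xi> \<eta>. [|\<xi> <: L; \<eta> <: L|] ==> bcounit L' (\<xi> \<star> \<eta>) = bcounit L' \<xi> \<otimes>\<^bsub>k\<^esub> bcounit L' \<eta>"
    and conv: "!!\<xi>. \<xi> <: L ==> ls L (bcomult L' \<xi>) (%x y. bantipode L' x \<star> y) = bcounit L' \<xi> \<odot>\<^bsub>L\<^esub> \<one>\<^bsub>L\<^esub>"
      "!!\<xi>. \<xi> <: L ==> ls L (bcomult L' \<xi>) (%x y. x \<star> bantipode L' y) = bcounit L' \<xi> \<odot>\<^bsub>L\<^esub> \<one>\<^bsub>L\<^esub>"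
  shows "braided_hopf_algebra k K R L'"
proof -
  have f: "carrier L' = carrier L" "mult L' = mult L" "one L' = one L" "act L' = act L" "smult L' = smult L" "add L' = add L"
    using L' by (simp_all add: same_module_def)
  note s = same_module_cong[OF same_module_sym[OF L'(1)]]
  note [simp] = lin_closed[OF D] lin_closed[OF c, simplified] lin_closed[OF an]
  have bt: "braided_tensor k R L' = BT"
    unfolding braided_tensor_def Let_def by (simp add: f s)
  have a: "K_module_algebra k K L'" by (rule same_module_algebra[OF L' L_module_algebra])
  have co: "coalgebra k L' (bcomult L') (bcounit L')"
    unfolding coalgebra_def Let_def
    using coalgebraI[OF L_mod D c coassoc counit] unfolding coalgebra_def Let_def
    by (simp add: f s tmap_def[abs_def] tassoc_def[abs_def] Let_def)
  have eq: "tsum k LL (comult K h) (%x y. tmap k L' L' (act L' x) (act L' y) (bcomult L' \<xi>)) = actT h (bcomult L' \<xi>)"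
    if [simp]: "h <: K" "\<xi> <: L" for h \<xi>
  proof -
    have "tmap k L' L' (act L' x) (act L' y) (bcomult L' \<xi>) = ls LL (bcomult L' \<xi>) (%a b. tens k L L (act L x a) (act L y b))"
      if "x <: K" "y <: K" for x y
      using that by (simp add: tmap_def f s) (rule tsum_eq_tsumc, simp_all)
    then show ?thesis unfolding actT_def by (subst tsum_eq_tsumc[of k K K]) (auto intro!: tsumc_cong)
  qed
  have t: "tsum k L (bcomult L' \<xi>) g = ls L (bcomult L' \<xi>) g"
    if "\<xi> <: L" "!!v w. [|v <: L; w <: L|] ==> g v w <: L" for \<xi> g
    using that by (intro tsum_eq_tsumc) simp_all
  show ?thesis
    unfolding braided_hopf_algebra_def algebra_map_def ring_hom_def convolution_inverse_of_id_def
    using a co D c an one mult equivariant conv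
    by (simp add: bt f s eq[unfolded f] t lin_add[OF D] lin_add[OF c, simplified])
qed

context braided_bracket begin

abbreviation "UH \<equiv> universal_enveloping k K R g"

lemma UH_simps:
  "same_module UK UH" "mult UK = mult UH" "one UK = one UH" "act UK = act UH"
  "bcomult UH = Dl" "bcounit UH = ce" "bantipode UH = an"
proof -
  have "(%u. tu (iota u) \<one>\<^bsub>UK\<^esub> \<oplus>\<^bsub>BU\<^esub> tu \<one>\<^bsub>UK\<^esub> (iota u)) = dlt" by (simp add: dlt_def fun_eq_iff)
  then show "same_module UK UH" "mult UK = mult UH" "one UK = one UH" "act UK = act UH"
    "bcomult UH = Dl" "bcounit UH = ce" "bantipode UH = an"
    unfolding Dl_def ce_def an_def
    by (simp_all add: same_module_def universal_enveloping_def Let_def kmod.defs braided_hopf.defs)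
qed

text \<open>The structure maps are given by their values on words; their properties were verified above by induction over
  words.\<close>

theorem universal_enveloping_braided_hopf: "braided_hopf_algebra k K R UH"
  by (rule U.braided_hopf_algebraI[OF UH_simps(1-4)], unfold UH_simps(5-7))
    (simp_all add: Dl_linear ce_hom an_linear Dl_coassoc Dl_counit Dl_act ce_act an_act Dl_mult an_convolution)

lemma UK_coalgebra: "coalgebra k UK Dl ce"
  by (rule coalgebraI) (simp_all add: Dl_linear ce_hom Dl_coassoc Dl_counit)

end

section \<open>Endomorphisms of a module algebra\<close>

locale endomorphisms = hopf k K for k :: "'k ring" and K :: "('k, 'h) hopf" +
  fixes A :: "('k, 'h, 'a, 'm) kmod_scheme"
  assumes A_module_algebra: "K_module_algebra k K A"
begin

abbreviation "E \<equiv> hom_module k K A"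

text \<open>Evaluation, as a constant of its own so that rewriting sees it as a bilinear operation.\<close>

definition ev :: "('a \<Rightarrow> 'a) \<Rightarrow> 'a \<Rightarrow> 'a" where "ev \<psi> a = \<psi> a"

lemmas A_simps [simp] = K_module_algebra_simps[OF A_module_algebra]
lemmas A_mod [simp] = K_module_simps(1)[OF A_simps(2)]
lemmas A_act = act_mult[OF A_module_algebra]
lemma E_in: "\<psi> <: E \<longleftrightarrow> \<psi> \<in> extensional (carrier A) \<and> linear_map k A A (ev \<psi>)"
  by (auto simp: hom_module_def ev_def PiE_def linear_map_def)

lemma E_eqI: "[|\<psi> <: E; \<phi> <: E; !!a. a <: A ==> ev \<psi> a = ev \<phi> a|] ==> \<psi> = \<phi>"
  unfolding ev_def by (rule extensionalityI[of _ "carrier A"]) (simp_all add: E_in)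

lemma ev_linear:
  "[|\<psi> <: E; linear_map k X A g|] ==> linear_map k X A (%x. ev \<psi> (g x))"
  "[|\<psi> <: E; a <: A|] ==> ev \<psi> a <: A"
  using lin_comp[of k A A "ev \<psi>" X g] lin_closed[of k A A "ev \<psi>" a] by (simp_all add: E_in)

lemma E_restrict:
  assumes "linear_map k A A f"
  shows "(\<lambda>a\<in>carrier A. f a) <: E" "a <: A ==> ev (\<lambda>a\<in>carrier A. f a) a = f a"
proof -
  have "linear_map k A A (restrict f (carrier A))"
    by (subst lin_cong[OF A_mod, of _ f]) (simp_all add: assms)
  then show "(\<lambda>a\<in>carrier A. f a) <: E" by (simp add: E_in ev_def[abs_def])
qed (simp add: ev_def)

lemma ev_ops:
  "[|\<psi> <: E; \<phi> <: E|] ==> \<psi> \<oplus>\<^bsub>E\<^esub> \<phi> <: E"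
  "[|\<psi> <: E; \<phi> <: E; a <: A|] ==> ev (\<psi> \<oplus>\<^bsub>E\<^esub> \<phi>) a = ev \<psi> a \<oplus>\<^bsub>A\<^esub> ev \<phi> a"
  "[|c <: k; \<psi> <: E|] ==> c \<odot>\<^bsub>E\<^esub> \<psi> <: E"
  "[|c <: k; \<psi> <: E; a <: A|] ==> ev (c \<odot>\<^bsub>E\<^esub> \<psi>) a = c \<odot>\<^bsub>A\<^esub> ev \<psi> a"
  "[|\<psi> <: E; \<phi> <: E|] ==> \<psi> \<otimes>\<^bsub>E\<^esub> \<phi> <: E"
  "[|\<psi> <: E; \<phi> <: E; a <: A|] ==> ev (\<psi> \<otimes>\<^bsub>E\<^esub> \<phi>) a = ev \<psi> (ev \<phi> a)"
  "\<zero>\<^bsub>E\<^esub> <: E" "a <: A ==> ev \<zero>\<^bsub>E\<^esub> a = \<zero>\<^bsub>A\<^esub>"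
  "\<one>\<^bsub>E\<^esub> <: E" "a <: A ==> ev \<one>\<^bsub>E\<^esub> a = a"
proof -
  have e: "\<psi> \<oplus>\<^bsub>E\<^esub> \<phi> = (\<lambda>a\<in>carrier A. ev \<psi> a \<oplus>\<^bsub>A\<^esub> ev \<phi> a)" "c \<odot>\<^bsub>E\<^esub> \<psi> = (\<lambda>a\<in>carrier A. c \<odot>\<^bsub>A\<^esub> ev \<psi> a)"
    "\<psi> \<otimes>\<^bsub>E\<^esub> \<phi> = (\<lambda>a\<in>carrier A. ev \<psi> (ev \<phi> a))" "\<zero>\<^bsub>E\<^esub> = (\<lambda>a\<in>carrier A. \<zero>\<^bsub>A\<^esub>)" "\<one>\<^bsub>E\<^esub> = (\<lambda>a\<in>carrier A. a)"
    by (simp_all add: hom_module_def ev_def compose_def)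
  show "[|\<psi> <: E; \<phi> <: E|] ==> \<psi> \<oplus>\<^bsub>E\<^esub> \<phi> <: E" "[|c <: k; \<psi> <: E|] ==> c \<odot>\<^bsub>E\<^esub> \<psi> <: E"
    "[|\<psi> <: E; \<phi> <: E|] ==> \<psi> \<otimes>\<^bsub>E\<^esub> \<phi> <: E" "\<zero>\<^bsub>E\<^esub> <: E" "\<one>\<^bsub>E\<^esub> <: E"
    unfolding e by (rule E_restrict(1); simp add: ev_linear)+
  show "[|\<psi> <: E; \<phi> <: E; a <: A|] ==> ev (\<psi> \<oplus>\<^bsub>E\<^esub> \<phi>) a = ev \<psi> a \<oplus>\<^bsub>A\<^esub> ev \<phi> a"
    "[|c <: k; \<psi> <: E; a <: A|] ==> ev (c \<odot>\<^bsub>E\<^esub> \<psi>) a = c \<odot>\<^bsub>A\<^esub> ev \<psi> a"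
    "[|\<psi> <: E; \<phi> <: E; a <: A|] ==> ev (\<psi> \<otimes>\<^bsub>E\<^esub> \<phi>) a = ev \<psi> (ev \<phi> a)"
    "a <: A ==> ev \<zero>\<^bsub>E\<^esub> a = \<zero>\<^bsub>A\<^esub>" "a <: A ==> ev \<one>\<^bsub>E\<^esub> a = a"
    unfolding e by (simp_all add: ev_def)
qed

lemma E_module: "module k E"
proof -
  note [simp] = ev_linear ev_ops E_restrict
  interpret A: module k A by simp
  interpret cring k by (rule cring_k)
  show ?thesis
  proof (rule moduleI)
    show "abelian_group E"
    proof (rule abelian_groupI)
      show "\<exists>y\<in>carrier E. y \<oplus>\<^bsub>E\<^esub> x = \<zero>\<^bsub>E\<^esub>" if x [simp]: "x <: E" for x
        by (rule bexI[of _ "\<lambda>a\<in>carrier A. \<ominus>\<^bsub>A\<^esub> ev x a"], rule E_eqI) (simp_all add: A.M.l_neg)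
    qed ((rule E_eqI | simp); simp add: A.M.a_ac)+
  qed ((rule cring_k | rule E_eqI | simp); simp add: A.smult_l_distr A.smult_r_distr A.smult_assoc1)+
qed

lemma E_linear:
  "[|linear_map k X E f; a <: A|] ==> linear_map k X A (%x. ev (f x) a)"
  "[|linear_map k X E f; \<phi> <: E|] ==> linear_map k X E (%x. f x \<otimes>\<^bsub>E\<^esub> \<phi>)"
  "[|linear_map k X E f; \<phi> <: E|] ==> linear_map k X E (%x. \<phi> \<otimes>\<^bsub>E\<^esub> f x)"
proof -
  note [simp] = ev_linear ev_ops
  have 1: "linear_map k E A (%\<psi>. ev \<psi> a)" if "a <: A" for a
    by (rule linear_mapI) (use that in simp_all)
  have 2: "linear_map k E E (%\<psi>. \<psi> \<otimes>\<^bsub>E\<^esub> \<phi>)" "linear_map k E E (%\<psi>. \<phi> \<otimes>\<^bsub>E\<^esub> \<psi>)" if [simp]: "\<phi> <: E" for \<phi>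
    using that by (intro linear_mapI E_eqI; simp add: lin_add[of k A A "ev \<phi>"] lin_smult[of k A A "ev \<phi>"] E_in[of \<phi>])+
  show "[|linear_map k X E f; a <: A|] ==> linear_map k X A (%x. ev (f x) a)"
    "[|linear_map k X E f; \<phi> <: E|] ==> linear_map k X E (%x. f x \<otimes>\<^bsub>E\<^esub> \<phi>)"
    "[|linear_map k X E f; \<phi> <: E|] ==> linear_map k X E (%x. \<phi> \<otimes>\<^bsub>E\<^esub> f x)"
    by (rule lin_comp[OF 1] lin_comp[OF 2(1)] lin_comp[OF 2(2)]; assumption)+
qed

lemma ev_rules [simp]:
  "module k E"
  "[|\<psi> <: E; linear_map k X A g|] ==> linear_map k X A (%x. ev \<psi> (g x))"
  "[|linear_map k X E f; a <: A|] ==> linear_map k X A (%x. ev (f x) a)"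
  "[|\<psi> <: E; a <: A|] ==> ev \<psi> a <: A"
  "[|\<psi> <: E; \<phi> <: E; a <: A|] ==> ev (\<psi> \<oplus>\<^bsub>E\<^esub> \<phi>) a = ev \<psi> a \<oplus>\<^bsub>A\<^esub> ev \<phi> a"
  "[|c <: k; \<psi> <: E; a <: A|] ==> ev (c \<odot>\<^bsub>E\<^esub> \<psi>) a = c \<odot>\<^bsub>A\<^esub> ev \<psi> a"
  "[|\<psi> <: E; \<phi> <: E; a <: A|] ==> ev (\<psi> \<otimes>\<^bsub>E\<^esub> \<phi>) a = ev \<psi> (ev \<phi> a)"
  "a <: A ==> ev \<zero>\<^bsub>E\<^esub> a = \<zero>\<^bsub>A\<^esub>" "a <: A ==> ev \<one>\<^bsub>E\<^esub> a = a"
  "[|\<psi> <: E; \<phi> <: E; a <: A|] ==> ev (\<psi> \<ominus>\<^bsub>E\<^esub> \<phi>) a = ev \<psi> a \<ominus>\<^bsub>A\<^esub> ev \<phi> a"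
  "\<psi> <: E ==> ev \<psi> \<zero>\<^bsub>A\<^esub> = \<zero>\<^bsub>A\<^esub>"
  "[|c <: k; \<psi> <: E; a <: A|] ==> ev \<psi> (c \<odot>\<^bsub>A\<^esub> a) = c \<odot>\<^bsub>A\<^esub> ev \<psi> a"
  by (simp_all add: E_module ev_ops ev_linear E_linear lin_minus[OF E_module A_mod E_linear(1)[OF lin_ident]]
    lin_zero[OF A_mod A_mod ev_linear(1)[OF _ lin_ident]] lin_smult[OF ev_linear(1)[OF _ lin_ident]])

lemma ev_add: "[|\<psi> <: E; a <: A; b <: A|] ==> ev \<psi> (a \<oplus>\<^bsub>A\<^esub> b) = ev \<psi> a \<oplus>\<^bsub>A\<^esub> ev \<psi> b"
  by (rule lin_add[of k A A "ev \<psi>"]) (simp_all add: E_in)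

lemma ev_push [simp]:
  assumes "module k V" "module k W"
  shows "[|!!v w. [|v <: V; w <: W|] ==> f v w <: E; a <: A|] ==>
      ev (tsumc k V W E t f) a = tsumc k V W A t (%v w. ev (f v w) a)"
    and "[|!!v w. [|v <: V; w <: W|] ==> g v w <: A; \<psi> <: E|] ==>
      ev \<psi> (tsumc k V W A t g) = tsumc k V W A t (%v w. ev \<psi> (g v w))"
proof -
  show "ev (tsumc k V W E t f) a = tsumc k V W A t (%v w. ev (f v w) a)"
    if "!!v w. [|v <: V; w <: W|] ==> f v w <: E" "a <: A"
    by (rule linear_tsumc[of E A "%\<psi>. ev \<psi> a"]) (use assms that in simp_all)
  show "ev \<psi> (tsumc k V W A t g) = tsumc k V W A t (%v w. ev \<psi> (g v w))"
    if "!!v w. [|v <: V; w <: W|] ==> g v w <: A" "\<psi> <: E"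
    by (rule linear_tsumc[of A A "ev \<psi>"]) (use assms that in \<open>simp_all add: E_in[of \<psi>]\<close>)
qed

lemma E_alg [simp]: "k_algebra k E"
  by (rule k_algebraI) ((rule E_eqI | simp add: ev_ops E_linear); simp add: ev_ops)+

lemma E_act_eq:
  assumes [simp]: "h <: K" "\<psi> <: E"
  shows "act E h \<psi> = (\<lambda>a\<in>carrier A. sw A h (%x y. act A x (ev \<psi> (act A (S y) a))))"
proof -
  have "tsum k A (comult K h) (%x y. act A x (ev \<psi> (act A (S y) a))) = sw A h (%x y. act A x (ev \<psi> (act A (S y) a)))"
    if "a <: A" for a
    by (rule tsum_eq_tsumc) (use that in simp_all)
  moreover have "act E h \<psi> = (\<lambda>a\<in>carrier A. tsum k A (comult K h) (%x y. act A x (ev \<psi> (act A (S y) a))))"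
    by (simp add: hom_module_def ev_def)
  ultimately show ?thesis by (simp cong: restrict_cong)
qed

lemma ev_act:
  assumes [simp]: "h <: K" "\<psi> <: E"
  shows "act E h \<psi> <: E" "a <: A ==> ev (act E h \<psi>) a = sw A h (%x y. act A x (ev \<psi> (act A (S y) a)))"
proof -
  have l: "linear_map k A A (%a. sw A h (%x y. act A x (ev \<psi> (act A (S y) a))))" by simp
  show "act E h \<psi> <: E" "a <: A ==> ev (act E h \<psi>) a = sw A h (%x y. act A x (ev \<psi> (act A (S y) a)))"
    unfolding E_act_eq[OF assms] by (rule E_restrict(1)[OF l], rule E_restrict(2)[OF l])
qed

lemma E_K_module [simp]: "K_module k K E"
proof (rule K_moduleI)
  show "linear_map k E E (act E h)" if [simp]: "h <: K" for h
    by (rule linear_mapI; (rule E_eqI)?)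
      (simp_all add: ev_act ev_ops tsumc_addf act_add act_smult del: tsumc_push(1) flip: tsumc_push(1))
  show "linear_map k K E (%h. act E h \<psi>)" if [simp]: "\<psi> <: E" for \<psi>
    by (rule linear_mapI; (rule E_eqI)?) (simp_all add: ev_act ev_ops tsumc_add_tensor lin_add[OF comult_linear] lin_smult[OF comult_linear])
  show "act E \<one>\<^bsub>K\<^esub> \<psi> = \<psi>" if [simp]: "\<psi> <: E" for \<psi>
    by (rule E_eqI) (simp_all add: ev_act)
  show "act E (h \<cdot> h') \<psi> = act E h (act E h' \<psi>)" if [simp]: "h <: K" "h' <: K" "\<psi> <: E" for h h' \<psi>
    by (rule E_eqI) (simp_all add: ev_act antipode_mult)
qed simp

text \<open>In \<open>h\<^sub>1 \<rhd> \<psi>(S(h\<^sub>2) h\<^sub>3 \<rhd> a)\<close> the last two legs cancel.\<close>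

lemma ev_equivariant:
  assumes [simp]: "h <: K" "\<psi> <: E" "a <: A"
  shows "sw A h (%x y. ev (act E x \<psi>) (act A y a)) = act A h (ev \<psi> a)"
proof -
  have "sw A h (%x y. ev (act E x \<psi>) (act A y a)) = sw A h (%x y. sw A x (%p q. act A p (ev \<psi> (act A (S q \<cdot> y) a))))"
    by (simp add: ev_act)
  also have "... = sw A h (%x y. sw A y (%p q. act A x (ev \<psi> (act A (S p \<cdot> q) a))))"
    by (rule sw_coassoc) (simp_all add: trilinear_map_def del: K_module_simps(4))
  also have "... = sw A h (%x y. eps y \<odot>\<^bsub>A\<^esub> act A x (ev \<psi> a))"
  proof (intro tsumc_cong)
    show "sw A y (%p q. act A x (ev \<psi> (act A (S p \<cdot> q) a))) = eps y \<odot>\<^bsub>A\<^esub> act A x (ev \<psi> a)" 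
      if [simp]: "x <: K" "y <: K" for x y
      using sw_antipode(1)[of y A "%z. act A x (ev \<psi> (act A z a))"] by simp
  qed
  finally show ?thesis by simp
qed

text \<open>Since \<open>h \<otimes> v = h\<^sub>1 \<otimes> h\<^sub>2 S(h\<^sub>3) v\<close>, a family of linear maps indexed by \<open>h\<close> is determined by its
  values on \<open>h\<^sub>1 \<otimes> h\<^sub>2 v\<close>. This cancels actions of Hopf algebra elements from identities.\<close>

lemma cancel_act:
  assumes X [simp]: "module k X" and V [simp]: "K_module k K V"
    and T: "!!v. v <: V ==> linear_map k K X (%h. T h v)" "!!h. h <: K ==> linear_map k V X (T h)"
    and T': "!!v. v <: V ==> linear_map k K X (%h. T' h v)" "!!h. h <: K ==> linear_map k V X (T' h)"
    and eq: "!!h v. [|h <: K; v <: V|] ==> sw X h (%x y. T x (act V y v)) = sw X h (%x y. T' x (act V y v))"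
    and h: "h <: K" "v <: V"
  shows "T h v = T' h v"
proof -
  have e: "sw X h (%x y. sw X x (%p q. T p (act V q (act V (S y) v)))) = T h v"
    if T: "!!v. v <: V ==> linear_map k K X (%h. T h v)" "!!h. h <: K ==> linear_map k V X (T h)" for T
  proof -
    note [simp] = h
    note [simp] = bilinear_comp[of V K X "%v h. T h v", OF T]
    have [simp]: "T x w <: X" if "x <: K" "w <: V" for x w by (rule lin_closed[OF T(2)]) fact+
    have "sw X h (%x y. sw X x (%p q. T p (act V q (act V (S y) v)))) = sw X h (%x y. sw X x (%p q. T p (act V (q \<cdot> S y) v)))"
      by (intro tsumc_cong) simp
    also have "... = sw X h (%x y. sw X y (%p q. T x (act V (p \<cdot> S q) v)))"
      by (rule sw_coassoc) (simp_all add: trilinear_map_def del: K_module_simps(4))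
    also have "... = sw X h (%x y. eps y \<odot>\<^bsub>X\<^esub> T x v)"
    proof (intro tsumc_cong)
      show "sw X y (%p q. T x (act V (p \<cdot> S q) v)) = eps y \<odot>\<^bsub>X\<^esub> T x v" 
        if [simp]: "x <: K" "y <: K" for x y
        using sw_antipode(2)[of y X "%z. T x (act V z v)"] by simp
    qed
    also have "... = T h v" by (simp add: T(1))
    finally show ?thesis .
  qed
  have "T h v = sw X h (%x y. sw X x (%p q. T p (act V q (act V (S y) v))))" by (rule e[symmetric]) (rule T; assumption)+
  also have "... = sw X h (%x y. sw X x (%p q. T' p (act V q (act V (S y) v))))"
    by (intro tsumc_cong eq) (use V h in simp_all)
  also have "... = T' h v" by (rule e) (rule T'; assumption)+
  finally show ?thesis .
qed

text \<open>Both sides of the product rule have the same value \<open>h \<rhd> \<psi>(\<phi>(a))\<close> after composing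
  with the action of the last leg of \<open>h\<close> on the argument, so that cancellation applies.\<close>

lemma E_module_algebra: "K_module_algebra k K E"
proof (rule K_module_algebraI)
  show "act E h \<one>\<^bsub>E\<^esub> = eps h \<odot>\<^bsub>E\<^esub> \<one>\<^bsub>E\<^esub>" if [simp]: "h <: K" for h
  proof (rule E_eqI)
    show "ev (act E h \<one>\<^bsub>E\<^esub>) a = ev (eps h \<odot>\<^bsub>E\<^esub> \<one>\<^bsub>E\<^esub>) a" if [simp]: "a <: A" for a
      using sw_antipode(2)[of h A "%z. act A z a"] by (simp add: ev_act)
  qed simp_all
  show "act E h (\<psi> \<otimes>\<^bsub>E\<^esub> \<phi>) = sw E h (%x y. act E x \<psi> \<otimes>\<^bsub>E\<^esub> act E y \<phi>)"
    if [simp]: "h <: K" "\<psi> <: E" "\<phi> <: E" for h \<psi> \<phi>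
  proof (rule E_eqI)
    have eq: "sw A h (%x y. ev (act E x (\<psi> \<otimes>\<^bsub>E\<^esub> \<phi>)) (act A y a)) =
        sw A h (%x y. sw A x (%p q. ev (act E p \<psi>) (ev (act E q \<phi>) (act A y a))))"
      if [simp]: "h <: K" "a <: A" for h a
    proof -
      have "sw A h (%x y. sw A x (%p q. ev (act E p \<psi>) (ev (act E q \<phi>) (act A y a)))) =
          sw A h (%x y. sw A y (%p q. ev (act E x \<psi>) (ev (act E p \<phi>) (act A q a))))"
        by (rule sw_coassoc) (simp_all add: trilinear_map_def)
      also have "... = sw A h (%x y. ev (act E x \<psi>) (sw A y (%p q. ev (act E p \<phi>) (act A q a))))"
        by (intro tsumc_cong) simp
      also have "... = sw A h (%x y. ev (act E x (\<psi> \<otimes>\<^bsub>E\<^esub> \<phi>)) (act A y a))"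
        by (simp add: ev_equivariant)
      finally show ?thesis by simp
    qed
    fix a assume [simp]: "a <: A"
    have "ev (act E h (\<psi> \<otimes>\<^bsub>E\<^esub> \<phi>)) a = sw A h (%x y. ev (act E x \<psi>) (ev (act E y \<phi>) a))"
      by (rule cancel_act[of A A "%h a. ev (act E h (\<psi> \<otimes>\<^bsub>E\<^esub> \<phi>)) a" "%h a. sw A h (%x y. ev (act E x \<psi>) (ev (act E y \<phi>) a))"])
        (simp_all add: eq)
    then show "ev (act E h (\<psi> \<otimes>\<^bsub>E\<^esub> \<phi>)) a = ev (sw E h (%x y. act E x \<psi> \<otimes>\<^bsub>E\<^esub> act E y \<phi>)) a" by simp
  qed simp_all
qed simp_all

end

section \<open>Infinitesimal gauge transformations\<close>

lemma submodule_inter: "[|submodule N k M; submodule N' k M; module k M|] ==> submodule (N \<inter> N') k M"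
  by (simp add: submodule_def submodule_axioms_def subgroup_def) blast

text \<open>Each condition in the definition of the gauge transformations equates two linear functions of the
  transformation.\<close>

lemma equalizers_submodule:
  assumes M: "module k M" and X: "module k X"
    and f: "!!i. i \<in> I ==> linear_map k M X (f i)" "!!i. i \<in> I ==> linear_map k M X (g i)"
  shows "submodule {x \<in> carrier M. \<forall>i\<in>I. f i x = g i x} k M"
proof -
  interpret module k M by fact
  show ?thesis
    by (rule submoduleI) (auto simp: lin_add[OF f(1)] lin_add[OF f(2)] lin_smult[OF f(1)] lin_smult[OF f(2)]
      lin_uminus[OF M X f(1)] lin_uminus[OF M X f(2)] lin_zero[OF M X f(1)] lin_zero[OF M X f(2)])
qed

locale gauge = triangular k K R + endomorphisms k K A
  for k :: "'k ring" and K :: "('k, 'h) hopf" and R :: "('k, 'h, 'h) tensor" and A :: "('k, 'h, 'c, 'a) comod_kmod" +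
  fixes H :: "('k, 'c) hopf"
  assumes H_mod [simp]: "module k H"
    and coact_linear: "linear_map k A (tensor_module k A H) (coact A)"
    and coact_act: "[|h <: K; a <: A|] ==> coact A (act A h a) = tmap k A H (act A h) id (coact A a)"
    and coinv_act: "[|h <: K; b \<in> coinvariants k H A|] ==> act A h b \<in> coinvariants k H A"
begin

abbreviation "AH \<equiv> tensor_module k A H"
abbreviation "ts X t f \<equiv> tsumc k A H X t f"
abbreviation amult (infixl "\<star>" 70) where "x \<star> y \<equiv> x \<otimes>\<^bsub>A\<^esub> y"
abbreviation "aut \<equiv> aut_carrier k K H R A"
abbreviation "g \<equiv> aut_lie k K H R A"

lemma coact_simps [simp]:
  "a <: A ==> coact A a <: AH" "linear_map k X A f ==> linear_map k X AH (%x. coact A (f x))"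
  "[|h <: K; a <: A|] ==> coact A (act A h a) = ts AH (coact A a) (%x c. tens k A H (act A h x) c)"
proof -
  show 1: "a <: A ==> coact A a <: AH" "linear_map k X A f ==> linear_map k X AH (%x. coact A (f x))"
    using lin_closed[OF coact_linear] lin_comp[OF coact_linear] by simp_all
  assume [simp]: "h <: K" "a <: A"
  show "coact A (act A h a) = ts AH (coact A a) (%x c. tens k A H (act A h x) c)"
    by (subst coact_act, simp, simp, subst tmap_eq[of _ A H]) (simp_all add: 1)
qed

lemma coinv_closed: "b \<in> coinvariants k H A ==> b <: A"
  by (simp add: coinvariants_def)

definition "comod_maps = {u \<in> carrier E. \<forall>a\<in>carrier A. coact A (ev u a) = ts AH (coact A a) (%x c. tens k A H (ev u x) c)}"
definition "vertical_maps = {u \<in> carrier E. \<forall>b\<in>coinvariants k H A. ev u b = \<zero>\<^bsub>A\<^esub>}"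

text \<open>The braided derivations are the kernel of the defect of the braided Leibniz rule.\<close>

definition "defect ab u = ev u (fst ab \<star> snd ab) \<ominus>\<^bsub>A\<^esub>
  (ev u (fst ab) \<star> snd ab \<oplus>\<^bsub>A\<^esub> ks A R (%r s. act A s (fst ab) \<star> ev (act E r u) (snd ab)))"
definition "derivations = {u \<in> carrier E. \<forall>ab\<in>carrier A \<times> carrier A. defect ab u = \<zero>\<^bsub>A\<^esub>}"

lemma derivation_iff:
  "[|u <: E; a <: A; b <: A|] ==> defect (a, b) u = \<zero>\<^bsub>A\<^esub> \<longleftrightarrow>
    ev u (a \<star> b) = ev u a \<star> b \<oplus>\<^bsub>A\<^esub> ks A R (%r s. act A s a \<star> ev (act E r u) b)"
  by (simp add: defect_def module_minus_eq_zero[OF A_mod])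

lemma defect_linear: "ab \<in> carrier A \<times> carrier A ==> linear_map k E A (defect ab)"
  unfolding defect_def[abs_def] by auto

lemma aut_eq: "aut = comod_maps \<inter> derivations \<inter> vertical_maps"
proof -
  have 1: "tmap k A H u id (coact A a) = ts AH (coact A a) (%x c. tens k A H (ev u x) c)"
    if "u <: E" "a <: A" for u a
    using that by (subst tmap_eq[of _ A H]) (simp_all add: E_in ev_def[abs_def])
  have 2: "tsum k A R (%r s. act A s a \<star> act E r u b) = ks A R (%r s. act A s a \<star> ev (act E r u) b)"
    if [simp]: "u <: E" "a <: A" "b <: A" for u a b
  proof -
    have "tsum k A R (%r s. act A s a \<star> ev (act E r u) b) = ks A R (%r s. act A s a \<star> ev (act E r u) b)"
      by (rule tsum_eq_tsumc) simp_all
    then show ?thesis by (simp add: ev_def)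
  qed
  show ?thesis
    unfolding aut_carrier_def comod_maps_def derivations_def vertical_maps_def
    by (auto simp: 1 2 derivation_iff) (simp_all add: ev_def)
qed

lemma aut_submodule: "submodule aut k E"
proof -
  have "submodule comod_maps k E" unfolding comod_maps_def
    by (rule equalizers_submodule[of k E AH]) simp_all
  moreover have "submodule derivations k E" unfolding derivations_def
    by (rule equalizers_submodule[of k E A _ defect "%_ _. \<zero>\<^bsub>A\<^esub>"]) (simp_all add: defect_linear)
  moreover have "submodule vertical_maps k E" unfolding vertical_maps_def
    by (rule equalizers_submodule[of k E A]) (simp_all add: coinv_closed)
  ultimately show ?thesis unfolding aut_eq by (intro submodule_inter) simp_all
qed

lemma aut_E: "u \<in> aut ==> u <: E" by (simp add: aut_eq comod_maps_def)

lemma aut_comod: "[|u \<in> aut; a <: A|] ==> coact A (ev u a) = ts AH (coact A a) (%x c. tens k A H (ev u x) c)"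
  by (simp add: aut_eq comod_maps_def)

lemma aut_der: "[|u \<in> aut; a <: A; b <: A|] ==>
    ev u (a \<star> b) = ev u a \<star> b \<oplus>\<^bsub>A\<^esub> ks A R (%r s. act A s a \<star> ev (act E r u) b)"
  using derivation_iff[of u a b] by (auto simp: aut_eq derivations_def)

lemma aut_coinv: "[|u \<in> aut; b \<in> coinvariants k H A|] ==> ev u b = \<zero>\<^bsub>A\<^esub>"
  by (simp add: aut_eq vertical_maps_def)

text \<open>Only the braided Leibniz rule needs work. Both sides are trilinear in \<open>h, a, b\<close>. On
  \<open>h\<^sub>1, h\<^sub>2 \<rhd> a, h\<^sub>3 \<rhd> b\<close> they become \<open>h \<rhd> u(a b)\<close>
  with and without the Leibniz rule for \<open>u\<close> applied, hence agree; the actions on \<open>a\<close>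
  and \<open>b\<close> are then cancelled.\<close>

lemma aut_act:
  assumes h: "h <: K" and u: "u \<in> aut"
  shows "act E h u \<in> aut"
proof -
  note [simp] = aut_E[OF u] h
  have "act E h u \<in> comod_maps"
    by (simp add: comod_maps_def ev_act linear_tsumc[OF coact_linear] aut_comod[OF u]) (intro ballI tsumc_swap, simp_all)
  moreover have "act E h u \<in> vertical_maps"
    by (simp add: vertical_maps_def coinv_closed ev_act aut_coinv[OF u] coinv_act act_zero)
  moreover have "ev (act E h u) (a \<star> b) = ev (act E h u) a \<star> b \<oplus>\<^bsub>A\<^esub> ks A R (%r s. act A s a \<star> ev (act E r (act E h u)) b)"
    if ab: "a <: A" "b <: A" for a b
  proof -
    define T where "T h a b = ev (act E h u) (a \<star> b)" for h a b
    define T' where "T' h a b = ev (act E h u) a \<star> b \<oplus>\<^bsub>A\<^esub> ks A R (%r s. act A s a \<star> ev (act E (r \<cdot> h) u) b)" for h a b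
    have eq: "sw A h (%x y. sw A x (%p q. T p (act A q a) (act A y b))) = sw A h (%x y. sw A x (%p q. T' p (act A q a) (act A y b)))"
      if [simp]: "h <: K" "a <: A" "b <: A" for h a b
    proof -
      have 1: "sw A h (%x y. sw A x (%p q. T p (act A q a) (act A y b))) = act A h (ev u (a \<star> b))"
      proof -
        have "sw A h (%x y. sw A x (%p q. T p (act A q a) (act A y b))) = sw A h (%x y. sw A y (%p q. T x (act A p a) (act A q b)))"
          unfolding T_def by (rule sw_coassoc) (simp_all add: trilinear_map_def)
        also have "... = sw A h (%x y. ev (act E x u) (act A y (a \<star> b)))"
          by (intro tsumc_cong) (simp add: A_act T_def)
        finally show ?thesis by (simp add: ev_equivariant)
      qed
      have 2: "sw A h (%x y. sw A x (%p q. ev (act E p u) (act A q a) \<star> act A y b)) = act A h (ev u a \<star> b)"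
      proof -
        have "sw A h (%x y. sw A x (%p q. ev (act E p u) (act A q a) \<star> act A y b)) =
            sw A h (%x y. sw A x (%p q. ev (act E p u) (act A q a)) \<star> act A y b)"
          by (intro tsumc_cong) simp
        then show ?thesis by (simp add: ev_equivariant A_act)
      qed
      let ?t = "%x r s y. act A s a \<star> ev (act E r u) (act A y b)"
      have 3: "sw A h (%x y. sw A x (%p q. ks A R (%r s. act A (s \<cdot> q) a \<star> ev (act E (r \<cdot> p) u) (act A y b)))) =
          act A h (ks A R (%r s. act A s a \<star> ev (act E r u) b))"
      proof -
        have "sw A h (%x y. sw A x (%p q. ks A R (%r s. act A (s \<cdot> q) a \<star> ev (act E (r \<cdot> p) u) (act A y b)))) =
            sw A h (%x y. ks A R (%r s. sw A x (%p q. act A (s \<cdot> q) a \<star> ev (act E (r \<cdot> p) u) (act A y b))))"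
          by (intro tsumc_cong tsumc_swap) simp_all
        also have "... = sw A h (%x y. sw A x (%p q. ks A R (%r s. act A (p \<cdot> s) a \<star> ev (act E (q \<cdot> r) u) (act A y b))))"
          by (intro tsumc_cong R_comult[symmetric, where f = "%r s. act A s a \<star> ev (act E r u) (act A _ b)"]) simp_all
        also have "... = sw A h (%x y. sw A y (%p q. ks A R (%r s. act A (x \<cdot> s) a \<star> ev (act E (p \<cdot> r) u) (act A q b))))"
          by (rule sw_coassoc) (simp_all add: trilinear_map_def)
        also have "... = sw A h (%x y. ks A R (%r s. sw A y (%p q. act A (x \<cdot> s) a \<star> ev (act E (p \<cdot> r) u) (act A q b))))"
          by (intro tsumc_cong tsumc_swap) simp_all
        also have "... = sw A h (%x y. ks A R (%r s. act A x (act A s a) \<star> act A y (ev (act E r u) b)))"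
        proof (intro tsumc_cong)
          fix x y r s assume [simp]: "x <: K" "y <: K" "r <: K" "s <: K"
          have "sw A y (%p q. act A (x \<cdot> s) a \<star> ev (act E (p \<cdot> r) u) (act A q b)) =
              act A x (act A s a) \<star> sw A y (%p q. ev (act E p (act E r u)) (act A q b))"
            by simp
          then show "sw A y (%p q. act A (x \<cdot> s) a \<star> ev (act E (p \<cdot> r) u) (act A q b)) = act A x (act A s a) \<star> act A y (ev (act E r u) b)"
            by (simp add: ev_equivariant del: tsumc_mult)
        qed
        also have "... = ks A R (%r s. sw A h (%x y. act A x (act A s a) \<star> act A y (ev (act E r u) b)))"
          by (rule tsumc_swap) simp_all
        also have "... = act A h (ks A R (%r s. act A s a \<star> ev (act E r u) b))"
          by (simp add: A_act)
        finally show ?thesis .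
      qed
      have "sw A h (%x y. sw A x (%p q. T' p (act A q a) (act A y b))) = act A h (ev u a \<star> b \<oplus>\<^bsub>A\<^esub> ks A R (%r s. act A s a \<star> ev (act E r u) b))"
        unfolding T'_def by (simp add: tsumc_addf act_add 2[simplified] 3[simplified])
      then show ?thesis unfolding 1 aut_der[OF u \<open>a <: A\<close> \<open>b <: A\<close>] by simp
    qed
    have tri: "trilinear_map k K A A A T" "trilinear_map k K A A A T'"
      unfolding T_def[abs_def] T'_def[abs_def] by (simp_all add: trilinear_map_def)
    note [simp] = trilinear_comp[OF tri(1)] trilinear_comp[OF tri(2)]
    have eq1: "sw A h (%p q. T p (act A q a) b) = sw A h (%p q. T' p (act A q a) b)"
      if [simp]: "h <: K" "a <: A" "b <: A" for h a b
      by (rule cancel_act[of A A "%h b. sw A h (%p q. T p (act A q a) b)" "%h b. sw A h (%p q. T' p (act A q a) b)", OF _ _ _ _ _ _ eq])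
        simp_all
    have "T h a b = T' h a b"
      by (rule cancel_act[of A A "%h a. T h a b" "%h a. T' h a b", OF _ _ _ _ _ _ eq1]) (use ab in simp_all)
    then show ?thesis using ab by (simp add: T_def T'_def)
  qed
  ultimately show ?thesis by (simp add: aut_eq derivations_def derivation_iff)
qed

text \<open>The sum can be formed in the submodule, as a module of its own; the inclusion is linear.\<close>

lemma sum_in_submodule:
  assumes X: "module k X" and N: "submodule N k X" and f: "!!v w. [|v <: K; w <: K|] ==> f v w \<in> N"
  shows "ks X t f \<in> N" "ks (X\<lparr>carrier := N\<rparr>) t f = ks X t f"
proof -
  have m: "module k (X\<lparr>carrier := N\<rparr>)" by (rule submodule.submodule_is_module[OF N X])
  have sub: "N \<subseteq> carrier X" using module.submoduleE(1)[OF X N] .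
  have "linear_map k (X\<lparr>carrier := N\<rparr>) X (%x. x)" by (rule linear_mapI) (use sub in auto)
  from linear_tsumc[OF this, of K K f t] show e: "ks (X\<lparr>carrier := N\<rparr>) t f = ks X t f" using m X f by simp
  show "ks X t f \<in> N" unfolding e[symmetric] using tsumc_closed[OF K_mod K_mod m, of t f] by simp
qed

definition "br u v = u \<otimes>\<^bsub>E\<^esub> v \<ominus>\<^bsub>E\<^esub> ks E R (%r s. act E s v \<otimes>\<^bsub>E\<^esub> act E r u)"

lemmas E_act_mult = act_mult[OF E_module_algebra]
lemmas E_simps [simp] = alg_simps[OF E_alg]

text \<open>The failure of \<open>u \<circ> v\<close> to be a braided derivation.\<close>

definition "cross1 u v a b = ks A R (%r s. act A s (ev v a) \<star> ev (act E r u) b)"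
definition "cross2 u v a b = ks A R (%r s. ev u (act A s a) \<star> ev (act E r v) b)"

text \<open>A product of braided derivations satisfies the Leibniz rule up to two cross terms: expanding \<open>u(v(a
  b))\<close> gives four terms, and the one with both maps applied to \<open>b\<close> is the expected one by
  the first hexagon identity.\<close>

lemma defect_product:
  assumes u: "u \<in> aut" and v: "v \<in> aut" and [simp]: "a <: A" "b <: A"
  shows "defect (a, b) (u \<otimes>\<^bsub>E\<^esub> v) = cross1 u v a b \<oplus>\<^bsub>A\<^esub> cross2 u v a b"
proof -
  interpret A: module k A by simp
  note [simp] = aut_E[OF u] aut_E[OF v]
  have "ks A R (%r s. act A s a \<star> ev (act E r (u \<otimes>\<^bsub>E\<^esub> v)) b) = ks A R (%r s. sw A r (%x y. act A s a \<star> ev (act E x u) (ev (act E y v) b)))"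
    by (simp add: E_act_mult)
  also have "... = ks A R (%r s. ks A R (%r' s'. act A (s \<cdot> s') a \<star> ev (act E r u) (ev (act E r' v) b)))"
    by (rule R_hex1) (simp_all add: trilinear_map_def)
  also have "... = ks A R (%r' s'. ks A R (%r s. act A (s \<cdot> s') a \<star> ev (act E r u) (ev (act E r' v) b)))"
    by (rule tsumc_swap) simp_all
  finally have e: "ks A R (%r s. act A s a \<star> ev (act E r (u \<otimes>\<^bsub>E\<^esub> v)) b) =
      ks A R (%r' s'. ks A R (%r s. act A (s \<cdot> s') a \<star> ev (act E r u) (ev (act E r' v) b)))" .
  have "ev (u \<otimes>\<^bsub>E\<^esub> v) (a \<star> b) = ev u (ev v a \<star> b) \<oplus>\<^bsub>A\<^esub> ks A R (%r s. ev u (act A s a \<star> ev (act E r v) b))"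
    by (simp add: aut_der[OF v] ev_add)
  also have "... = (ev u (ev v a) \<star> b \<oplus>\<^bsub>A\<^esub> cross1 u v a b) \<oplus>\<^bsub>A\<^esub>
      (cross2 u v a b \<oplus>\<^bsub>A\<^esub> ks A R (%r s. act A s a \<star> ev (act E r (u \<otimes>\<^bsub>E\<^esub> v)) b))"
    unfolding e by (simp add: aut_der[OF u] tsumc_addf cross1_def cross2_def)
  finally have "ev (u \<otimes>\<^bsub>E\<^esub> v) (a \<star> b) = (ev u (ev v a) \<star> b \<oplus>\<^bsub>A\<^esub> ks A R (%r s. act A s a \<star> ev (act E r (u \<otimes>\<^bsub>E\<^esub> v)) b)) \<oplus>\<^bsub>A\<^esub>
      (cross1 u v a b \<oplus>\<^bsub>A\<^esub> cross2 u v a b)"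
    by (simp add: cross1_def cross2_def A.M.a_ac del: E_act_mult)
  moreover have "(x \<oplus>\<^bsub>A\<^esub> y) \<ominus>\<^bsub>A\<^esub> x = y" if "x <: A" "y <: A" for x y
    using that by (simp add: a_minus_def A.M.a_comm[of x y] A.M.a_assoc A.M.r_neg)
  ultimately show ?thesis by (simp add: defect_def cross1_def cross2_def)
qed

text \<open>Equivariance of evaluation splits the action on \<open>v(a)\<close>, after which the second hexagon identity matches the
  braidings.\<close>

lemma cross1_swap:
  assumes [simp]: "u <: E" "v <: E" "a <: A" "b <: A"
  shows "ks A R (%r s. cross2 (act E s v) (act E r u) a b) = cross1 u v a b"
proof -
  let ?t = "%x y z. ev (act E x v) (act A y a) \<star> ev (act E z u) b"
  have "cross1 u v a b = ks A R (%r s. sw A s (%x y. ?t x y r))"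
    unfolding cross1_def
  proof (intro tsumc_cong)
    show "act A s (ev v a) \<star> ev (act E r u) b = sw A s (%x y. ?t x y r)" if [simp]: "r <: K" "s <: K" for r s
      unfolding ev_equivariant[OF that(2) \<open>v <: E\<close> \<open>a <: A\<close>, symmetric] by simp
  qed
  also have "... = ks A R (%r s. ks A R (%r' s'. ?t s' s (r \<cdot> r')))"
    by (rule R_hex2) (simp_all add: trilinear_map_def)
  also have "... = ks A R (%r' s'. ks A R (%r s. ?t s' s (r \<cdot> r')))"
    by (rule tsumc_swap) simp_all
  finally show ?thesis by (simp add: cross2_def)
qed

text \<open>The same two steps give a product of two braidings in opposite directions, which is the identity by
  triangularity.\<close>

lemma cross2_swap:
  assumes [simp]: "u <: E" "v <: E" "a <: A" "b <: A"
  shows "ks A R (%r s. cross1 (act E s v) (act E r u) a b) = cross2 u v a b"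
proof -
  let ?t = "%x y z. ev (act E x u) (act A y a) \<star> ev (act E z v) b"
  have "ks A R (%r s. cross1 (act E s v) (act E r u) a b) = ks A R (%r0 s0. ks A R (%r s. sw A s (%x y. ?t (x \<cdot> r0) y (r \<cdot> s0))))"
    unfolding cross1_def
  proof (intro tsumc_cong)
    show "act A s (ev (act E r0 u) a) \<star> ev (act E r (act E s0 v)) b = sw A s (%x y. ?t (x \<cdot> r0) y (r \<cdot> s0))"
      if [simp]: "r <: K" "s <: K" "r0 <: K" "s0 <: K" for r s r0 s0
      using ev_equivariant[of s "act E r0 u" a, symmetric] by simp
  qed
  also have "... = ks A R (%r0 s0. ks A R (%r s. ks A R (%r' s'. ?t (s' \<cdot> r0) s (r \<cdot> r' \<cdot> s0))))"
    by (rule tsumc_cong, rule R_hex2[where f = "%r x y. ?t (x \<cdot> _) y (r \<cdot> _)"]) (simp_all add: trilinear_map_def)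
  also have "... = ks A R (%r s. ks A R (%r0 s0. ks A R (%r' s'. ?t (s' \<cdot> r0) s (r \<cdot> r' \<cdot> s0))))"
    by (rule tsumc_swap) simp_all
  also have "... = ks A R (%r s. ks A R (%r' s'. ks A R (%r0 s0. ?t (s' \<cdot> r0) s (r \<cdot> r' \<cdot> s0))))"
    by (intro tsumc_cong tsumc_swap) simp_all
  also have "... = ks A R (%r s. ks A R (%r' s'. ks A R (%r0 s0. ?t (s' \<cdot> r0) s (r \<cdot> (r' \<cdot> s0)))))"
    by simp
  also have "... = ks A R (%r s. ?t \<one>\<^bsub>K\<^esub> s (r \<cdot> \<one>\<^bsub>K\<^esub>))"
    by (intro tsumc_cong R_cancel(2)[where f = "%x y. ?t x _ (_ \<cdot> y)"]) simp_all
  finally show ?thesis by (simp add: cross2_def)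
qed

text \<open>The cross terms of \<open>u \<circ> v\<close> and of the braided opposite product cancel in pairs.\<close>

lemma br_closed:
  assumes u: "u \<in> aut" and v: "v \<in> aut"
  shows "br u v \<in> aut"
proof -
  interpret A: module k A by simp
  note [simp] = aut_E[OF u] aut_E[OF v]
  have comod: "coact A (ev u (ev v a)) = ts AH (coact A a) (%x c. tens k A H (ev u (ev v x)) c)"
    if [simp]: "a <: A" and u: "u \<in> aut" and v: "v \<in> aut" for u v a
    using aut_E[OF u] aut_E[OF v] by (simp add: aut_comod[OF u] aut_comod[OF v])
  have l: "linear_map k A AH (coact A)" by (rule coact_linear)
  have "u \<otimes>\<^bsub>E\<^esub> v \<in> comod_maps" by (simp add: comod_maps_def comod u v)
  moreover have "act E s v \<otimes>\<^bsub>E\<^esub> act E r u \<in> comod_maps" if [simp]: "s <: K" "r <: K" for r s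
    using aut_act[OF _ u] aut_act[OF _ v] by (simp add: comod_maps_def comod)
  moreover have sc: "submodule comod_maps k E" unfolding comod_maps_def
    by (rule equalizers_submodule[of k E AH]) simp_all
  ultimately have "br u v \<in> comod_maps"
    using sum_in_submodule(1)[OF _ sc] module.submoduleE(3,5)[OF ev_rules(1) sc] unfolding br_def a_minus_def by simp
  moreover have "br u v \<in> vertical_maps"
    using aut_act[OF _ u] aut_act[OF _ v]
    by (simp add: vertical_maps_def br_def coinv_closed aut_coinv u v module_minus_eq_zero[OF A_mod])
  moreover have "defect (a, b) (br u v) = \<zero>\<^bsub>A\<^esub>" if [simp]: "a <: A" "b <: A" for a b
  proof -
    have D: "linear_map k E A (defect (a, b))" by (rule defect_linear) simp
    have c: "cross1 u v a b <: A" "cross2 u v a b <: A" by (simp_all add: cross1_def cross2_def)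
    have "defect (a, b) (br u v) = defect (a, b) (u \<otimes>\<^bsub>E\<^esub> v) \<ominus>\<^bsub>A\<^esub> ks A R (%r s. defect (a, b) (act E s v \<otimes>\<^bsub>E\<^esub> act E r u))"
      unfolding br_def by (simp add: lin_minus[OF _ _ D] linear_tsumc[OF D])
    also have "ks A R (%r s. defect (a, b) (act E s v \<otimes>\<^bsub>E\<^esub> act E r u)) =
        ks A R (%r s. cross1 (act E s v) (act E r u) a b \<oplus>\<^bsub>A\<^esub> cross2 (act E s v) (act E r u) a b)"
      by (intro tsumc_cong defect_product aut_act u v) simp_all
    also have "... = cross2 u v a b \<oplus>\<^bsub>A\<^esub> cross1 u v a b"
      by (subst tsumc_addf) (simp_all add: cross1_swap cross2_swap, simp_all add: cross1_def cross2_def)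
    finally show ?thesis
      using c by (simp add: defect_product[OF u v] a_minus_def A.M.a_comm A.M.r_neg)
  qed
  ultimately show ?thesis by (simp add: aut_eq derivations_def br_def)
qed

lemma g_simps [simp]:
  "carrier g = aut" "zero g = zero E" "add g = add E" "smult g = smult E" "act g = act E"
  and g_bracket: "[|u \<in> aut; v \<in> aut|] ==> bracket g u v = br u v"
proof -
  show "carrier g = aut" "zero g = zero E" "add g = add E" "smult g = smult E" "act g = act E"
    by (simp_all add: aut_lie_def Let_def kmod.defs braided_lie.defs)
  assume "u \<in> aut" "v \<in> aut"
  then have [simp]: "u <: E" "v <: E" by (simp_all add: aut_E)
  have "tsum k E R (%r s. act E s v \<otimes>\<^bsub>E\<^esub> act E r u) = ks E R (%r s. act E s v \<otimes>\<^bsub>E\<^esub> act E r u)"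
    by (rule tsum_eq_tsumc) simp_all
  then show "bracket g u v = br u v"
    by (simp add: aut_lie_def Let_def kmod.defs braided_lie.defs br_def)
qed

lemma same_g: "same_module (E\<lparr>carrier := aut\<rparr>) g" by (simp add: same_module_def)

lemma g_module: "module k g"
  by (rule same_module_module[OF same_g submodule.submodule_is_module[OF aut_submodule]]) simp

lemma g_sum: "(!!v w. [|v <: K; w <: K|] ==> f v w \<in> aut) ==> ks g t f = ks E t f"
  by (subst same_module_tsumc(3)[OF same_module_sym[OF same_g]]) (rule sum_in_submodule(2)[OF ev_rules(1) aut_submodule])

lemma g_linear: "[|linear_map k X E f; !!x. x <: X ==> f x \<in> aut|] ==> linear_map k X g f"
  by (simp add: linear_map_def)

lemma g_incl: "linear_map k g E (%u. u)"
  by (rule linear_mapI) (simp_all add: aut_E)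

lemma br_linear:
  "v <: E ==> linear_map k E E (%u. br u v)" "v <: E ==> linear_map k E E (%u. br v u)"
  by (simp_all add: br_def E_linear)

text \<open>The braided opposite product is equivariant since \<open>R\<close> intertwines the coproduct with the
  opposite one.\<close>

lemma br_act:
  assumes [simp]: "h <: K" "u <: E" "v <: E"
  shows "act E h (br u v) = sw E h (%x y. br (act E x u) (act E y v))"
proof -
  interpret E: module k E by simp
  have "ks E R (%r s. act E h (act E s v \<otimes>\<^bsub>E\<^esub> act E r u)) = ks E R (%r s. sw E h (%x y. act E (x \<cdot> s) v \<otimes>\<^bsub>E\<^esub> act E (y \<cdot> r) u))"
    by (simp add: E_act_mult)
  also have "... = sw E h (%x y. ks E R (%r s. act E (x \<cdot> s) v \<otimes>\<^bsub>E\<^esub> act E (y \<cdot> r) u))"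
    by (rule tsumc_swap) simp_all
  also have "... = ks E R (%r s. sw E h (%x y. act E (s \<cdot> y) v \<otimes>\<^bsub>E\<^esub> act E (r \<cdot> x) u))"
    by (rule R_comult[where f = "%r s. act E s v \<otimes>\<^bsub>E\<^esub> act E r u"]) (simp_all add: E_linear)
  also have "... = sw E h (%x y. ks E R (%r s. act E (s \<cdot> y) v \<otimes>\<^bsub>E\<^esub> act E (r \<cdot> x) u))"
    by (rule tsumc_swap) simp_all
  finally have "ks E R (%r s. act E h (act E s v \<otimes>\<^bsub>E\<^esub> act E r u)) = sw E h (%x y. ks E R (%r s. act E s (act E y v) \<otimes>\<^bsub>E\<^esub> act E r (act E x u)))"
    by simp
  then show ?thesis
    by (simp add: br_def a_minus_def act_add act_uminus E_act_mult tsumc_addf del: tsumc_push(4) flip: tsumc_push(4))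
qed

theorem aut_bracket: "braided_bracket k K R g"
proof
  note [simp] = aut_E aut_act
  show "K_module k K g"
  proof (rule K_moduleI[OF g_module])
    show "linear_map k g g (act g h)" if "h <: K" for h
      by (rule g_linear) (use that in \<open>simp_all add: g_incl\<close>)
    show "linear_map k K g (%h. act g h u)" if "u <: g" for u
      by (rule g_linear) (use that in simp_all)
  qed simp_all
  show "linear_map k g g (%u. bracket g u v)" if "v <: g" for v
    by (subst lin_cong[OF g_module, of _ "%u. br u v"], use that in \<open>simp add: g_bracket\<close>)
      (rule g_linear, use that in \<open>simp_all add: br_closed lin_comp[OF br_linear(1) g_incl]\<close>)
  show "linear_map k g g (%v. bracket g u v)" if "u <: g" for u
    by (subst lin_cong[OF g_module, of _ "%v. br u v"], use that in \<open>simp add: g_bracket\<close>)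
      (rule g_linear, use that in \<open>simp_all add: br_closed lin_comp[OF br_linear(2) g_incl]\<close>)
  show "act g h (bracket g u v) = sw g h (%x y. bracket g (act g x u) (act g y v))"
    if "h <: K" "u <: g" "v <: g" for h u v
    using that by (simp add: g_bracket br_closed g_sum br_act)
qed

end

section \<open>Twisting back and forth\<close>

context twist begin

text \<open>\<open>G \<Delta>'(h) = \<Delta>(h) G\<close> and \<open>\<Delta>'(h) F = F \<Delta>(h)\<close>.\<close>

lemma \<Delta>'_intertwine:
  assumes [simp]: "h <: K" "module k X"
    and f: "!!v. v <: K ==> linear_map k K X (%w. f v w)" "!!w. w <: K ==> linear_map k K X (%v. f v w)"
  shows "ks X G (%p q. ks X (\<Delta>' h) (%a b. f (p \<cdot> a) (q \<cdot> b))) = sw X h (%a b. ks X G (%p q. f (a \<cdot> p) (b \<cdot> q)))"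
    and "ks X (\<Delta>' h) (%a b. ks X F (%p q. f (a \<cdot> p) (b \<cdot> q))) = ks X F (%p q. sw X h (%a b. f (p \<cdot> a) (q \<cdot> b)))"
proof -
  note [simp] = bilinear_comp[OF f] f
  have "ks X (G ** \<Delta>' h) f = ks X (comult K h ** G) f"
    by (simp add: \<Delta>'_def KK_assoc[symmetric] GF del: tsumc_tpa_mult)
  then show "ks X G (%p q. ks X (\<Delta>' h) (%a b. f (p \<cdot> a) (q \<cdot> b))) = sw X h (%a b. ks X G (%p q. f (a \<cdot> p) (b \<cdot> q)))"
    by simp
  have "ks X (\<Delta>' h ** F) f = ks X (F ** comult K h) f"
    by (simp add: \<Delta>'_def KK_assoc GF del: tsumc_tpa_mult)
  then show "ks X (\<Delta>' h) (%a b. ks X F (%p q. f (a \<cdot> p) (b \<cdot> q))) = ks X F (%p q. sw X h (%a b. f (p \<cdot> a) (q \<cdot> b)))"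
    by simp
qed

text \<open>Since \<open>G \<Delta>' = \<Delta> G\<close>, the cocycle condition for \<open>G\<close> and \<open>\<Delta>'\<close> is the inverted cocycle condition
  for \<open>F\<close> and \<open>\<Delta>\<close>.\<close>

theorem twist_inverse: "twist k K' G F"
proof -
  interpret H': hopf k K' using hopf_algebra_K' by unfold_locales
  have c: "ks K G (%x y. eps x \<odot>\<^bsub>K\<^esub> y) = \<one>\<^bsub>K\<^esub>" "ks K G (%x y. eps y \<odot>\<^bsub>K\<^esub> x) = \<one>\<^bsub>K\<^esub>"
    using G_counit[OF lin_ident K_mod] by simp_all
  have "ks T3 G (%x y. ks T3 (\<Delta>' x) (%a b. ks T3 G (%p q. t3 (p \<cdot> a) (q \<cdot> b) y))) =
      ks T3 G (%x y. sw T3 x (%a b. ks T3 G (%p q. t3 (a \<cdot> p) (b \<cdot> q) y)))"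
    by (rule tsumc_cong, rule trans[OF tsumc_swap \<Delta>'_intertwine(1)[where f = "%a b. t3 a b _"]]) simp_all
  also have "... = ks T3 G (%x y. sw T3 y (%a b. ks T3 G (%p q. t3 x (a \<cdot> p) (b \<cdot> q))))"
    by (rule cocycle(2)) (simp_all add: trilinear_map_def)
  also have "... = ks T3 G (%x y. ks T3 (\<Delta>' y) (%a b. ks T3 G (%p q. t3 x (p \<cdot> a) (q \<cdot> b))))"
    by (rule tsumc_cong, rule sym, rule trans[OF tsumc_swap \<Delta>'_intertwine(1)[where f = "%a b. t3 _ a b"]]) simp_all
  finally show ?thesis using c H'.hopf_axioms by (simp add: twist_def twist_axioms_def FG GF)
qed

end

context triangular_twist begin

text \<open>\<open>R G = G\<^sub>2\<^sub>1 R\<^sub>F\<close>, from the definition \<open>R\<^sub>F = F\<^sub>2\<^sub>1 R G\<close>.\<close>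

lemma R_twist:
  assumes [simp]: "module k X"
    and f: "!!v. v <: K ==> linear_map k K X (%w. f v w)" "!!w. w <: K ==> linear_map k K X (%v. f v w)"
  shows "ks X R (%r s. ks X G (%x y. f (r \<cdot> x) (s \<cdot> y))) = ks X G (%x y. ks X R' (%r s. f (y \<cdot> r) (x \<cdot> s)))"
proof -
  note [simp] = bilinear_comp[OF f] f
  have "flipK G ** (flipK F ** (R ** G)) = (flipK G ** flipK F) ** (R ** G)"
    by (rule KK_assoc[symmetric]) simp_all
  also have "flipK G ** flipK F = tens k K K \<one>\<^bsub>K\<^esub> \<one>\<^bsub>K\<^esub>"
    unfolding flipK_mult[OF G_in F_in, symmetric] GF by simp
  finally have "ks X (R ** G) f = ks X (flipK G ** R') f"
    by (simp add: R'_def KK_assoc del: tsumc_tpa_mult tpa_push)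
  then show ?thesis by simp
qed

lemma R'_inverse: "flipK G ** R' ** F = R"
proof -
  have 1: "flipK G ** flipK F = tens k K K \<one>\<^bsub>K\<^esub> \<one>\<^bsub>K\<^esub>"
    unfolding flipK_mult[OF G_in F_in, symmetric] GF by simp
  have "flipK G ** R' ** F = (flipK G ** flipK F) ** R ** (G ** F)"
    unfolding R'_def by (simp only: KK_assoc F_in G_in R_in tsumc_closed module_tensor K_mod tpa_closed K_alg)
  then show ?thesis by (simp only: 1 GF KK_one R_in)
qed

end

text \<open>A triangular Hopf algebra \<open>K\<^sub>2\<close> that is the twist of \<open>K\<close> up to the values of its structure maps
  outside of the carrier. In this form the relation is symmetric: \<open>K\<close> is the twist of \<open>K\<^sub>2\<close> by \<open>G\<close>.\<close>

locale twist_pair = triangular_twist k K R F G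
  for k :: "'k ring" and K :: "('k, 'h) hopf" and R F G :: "('k, 'h, 'h) tensor" +
  fixes K2 :: "('k, 'h) hopf" and R2 :: "('k, 'h, 'h) tensor"
  assumes K2_triangular: "triangular k K2 R2"
    and K2_simps [simp]: "carrier K2 = carrier K" "mult K2 = mult K" "one K2 = one K" "zero K2 = zero K" "add K2 = add K"
      "smult K2 = smult K" "counit K2 = counit K"
    and K2_comult [simp]: "h <: K ==> comult K2 h = \<Delta>' h"
    and R2: "R2 = R'"

sublocale twist_pair \<subseteq> S: triangular k K2 R2 by (rule K2_triangular)

context twist_pair begin

lemma same_K2: "same_module K2 K" by (simp add: same_module_def)

lemmas K2_cong [simp] = same_module_cong[OF same_K2]

lemma K2_K_module [simp]: "K_module k K2 V \<longleftrightarrow> K_module k K V"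
  unfolding K_module_def by (simp only: K2_simps K2_cong)

end

context triangular_twist begin

lemma twist_pair: "twist_pair k K R F G K' R'"
proof -
  show ?thesis
    using triangular_K' triangular_twist_axioms by (simp add: twist_pair_def twist_pair_axioms_def)
qed

lemma twist_pair_inverse: "twist_pair k K' R' G F K R"
proof -
  interpret T: triangular k K' R' by (rule triangular_K')
  interpret T: twist k K' G F by (rule twist_inverse)
  interpret T: triangular_twist k K' R' G F by unfold_locales
  have c: "comult K h = T.\<Delta>' h" if [simp]: "h <: K" for h
  proof -
    have "T.\<Delta>' h = G ** (F ** comult K h ** G) ** F"
      by (simp add: T.\<Delta>'_def \<Delta>'_def)
    also have "... = (G ** F) ** comult K h ** (G ** F)"
      by (simp only: KK_assoc F_in G_in that hopf_maps module_tensor K_mod tpa_closed K_alg)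
    finally show ?thesis by (simp only: GF KK_one that hopf_maps)
  qed
  have "T.R' = R" using R'_inverse by (simp add: T.R'_def)
  then show ?thesis using c triangular_axioms T.triangular_twist_axioms
    by (simp add: twist_pair_def twist_pair_axioms_def)
qed

end

section \<open>Twisted module algebras\<close>

context twist_pair begin

abbreviation "tw L \<equiv> twisted_algebra k K F L"

lemma tw_simps [simp]:
  "carrier (tw L) = carrier L" "one (tw L) = one L" "zero (tw L) = zero L" "add (tw L) = add L" "smult (tw L) = smult L"
  "act (tw L) = act L"
  by (simp_all add: twisted_algebra_def)

lemma same_tw: "same_module (tw L) L" by (simp add: same_module_def)

lemmas tw_cong [simp] = same_module_cong[OF same_tw]

lemma module_tw [simp]: "module k L ==> module k (tw L)"
  by (rule same_module_module[OF same_module_sym[OF same_tw]])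

lemma K_module_tw [simp]: "K_module k K L ==> K_module k K (tw L)"
  unfolding K_module_def by (simp only: tw_simps tw_cong module_tw simp_thms) (erule conjunct2)

lemma tw_mult:
  assumes L: "K_module_algebra k K L" and "a <: L" "b <: L"
  shows "a \<otimes>\<^bsub>tw L\<^esub> b = ks L G (%x y. act L x a \<otimes>\<^bsub>L\<^esub> act L y b)"
proof -
  note [simp] = K_module_algebra_simps[OF L] assms(2,3)
  have "a \<otimes>\<^bsub>tw L\<^esub> b = tsum k L G (%x y. act L x a \<otimes>\<^bsub>L\<^esub> act L y b)"
    by (simp add: twisted_algebra_def inv_twist_F)
  then show ?thesis using tsum_eq_tsumc[of k K K L G] by simp
qed

text \<open>Associativity of the twisted product is the cocycle condition for the inverse twist, and equivariance is
  \<open>G \<Delta>'(h) = \<Delta>(h) G\<close>.\<close>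

theorem tw_module_algebra:
  assumes L: "K_module_algebra k K L"
  shows "K_module_algebra k K2 (tw L)"
proof -
  note [simp] = K_module_algebra_simps[OF L]
  note m = tw_mult[OF L]
  have ml: "module k L" by simp
  have alg: "k_algebra k (tw L)"
  proof (rule k_algebraI)
    show "linear_map k (tw L) (tw L) (%y. x \<otimes>\<^bsub>tw L\<^esub> y)" "linear_map k (tw L) (tw L) (%y. y \<otimes>\<^bsub>tw L\<^esub> x)"
      if "x <: (tw L)" for x
      using that by (simp_all, (subst lin_cong[OF ml, OF m], simp_all)+)
    show "x \<otimes>\<^bsub>tw L\<^esub> y \<otimes>\<^bsub>tw L\<^esub> z = x \<otimes>\<^bsub>tw L\<^esub> (y \<otimes>\<^bsub>tw L\<^esub> z)"
      if "x <: (tw L)" "y <: (tw L)" "z <: (tw L)" for x y z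
    proof -
      have [simp]: "x <: L" "y <: L" "z <: L" using that by simp_all
      let ?t = "%a b c. act L a x \<otimes>\<^bsub>L\<^esub> (act L b y \<otimes>\<^bsub>L\<^esub> act L c z)"
      have "x \<otimes>\<^bsub>tw L\<^esub> y \<otimes>\<^bsub>tw L\<^esub> z = ks L G (%p q. ks L G (%a b. sw L p (%c d. ?t (c \<cdot> a) (d \<cdot> b) q)))"
        by (simp add: m act_mult[OF L] alg_assoc[of L])
      also have "... = ks L G (%p q. sw L p (%c d. ks L G (%a b. ?t (c \<cdot> a) (d \<cdot> b) q)))"
        by (intro tsumc_cong tsumc_swap) simp_all
      also have "... = ks L G (%p q. sw L q (%c d. ks L G (%a b. ?t p (c \<cdot> a) (d \<cdot> b))))"
        by (rule cocycle(2)) (simp_all add: trilinear_map_def)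
      also have "... = ks L G (%p q. ks L G (%a b. sw L q (%c d. ?t p (c \<cdot> a) (d \<cdot> b))))"
        by (intro tsumc_cong tsumc_swap) simp_all
      also have "... = x \<otimes>\<^bsub>tw L\<^esub> (y \<otimes>\<^bsub>tw L\<^esub> z)"
        by (simp add: m act_mult[OF L])
      finally show ?thesis .
    qed
  qed (simp_all add: m)
  show ?thesis
  proof (rule S.K_module_algebraI[OF alg])
    show "act (tw L) h (a \<otimes>\<^bsub>tw L\<^esub> a') = tsumc k K2 K2 (tw L) (comult K2 h) (%x y. act (tw L) x a \<otimes>\<^bsub>tw L\<^esub> act (tw L) y a')"
      if "h <: K2" "a <: (tw L)" "a' <: (tw L)" for h a a'
    proof -
      have [simp]: "h <: K" "a <: L" "a' <: L" using that by simp_all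
      have "act L h (a \<otimes>\<^bsub>tw L\<^esub> a') = ks L G (%p q. sw L h (%x y. act L (x \<cdot> p) a \<otimes>\<^bsub>L\<^esub> act L (y \<cdot> q) a'))"
        by (simp add: m act_mult[OF L])
      also have "... = sw L h (%x y. ks L G (%p q. act L (x \<cdot> p) a \<otimes>\<^bsub>L\<^esub> act L (y \<cdot> q) a'))"
        by (rule tsumc_swap) simp_all
      also have "... = ks L G (%p q. ks L (\<Delta>' h) (%x y. act L (p \<cdot> x) a \<otimes>\<^bsub>L\<^esub> act L (q \<cdot> y) a'))"
        by (rule \<Delta>'_intertwine(1)[symmetric, where f = "%x y. act L x a \<otimes>\<^bsub>L\<^esub> act L y a'"]) simp_all
      also have "... = ks L (\<Delta>' h) (%x y. ks L G (%p q. act L (p \<cdot> x) a \<otimes>\<^bsub>L\<^esub> act L (q \<cdot> y) a'))"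
        by (rule tsumc_swap) simp_all
      finally show ?thesis by (simp add: m)
    qed
  qed simp_all
qed

end

section \<open>Twisting gauge transformations\<close>

text \<open>\<open>A\<^sub>2\<close> is the twist of \<open>A\<close>, described by the values of its product on the carrier. In this form the
  relation between \<open>A\<close> and \<open>A\<^sub>2\<close> is symmetric.\<close>

locale gauge_pair = twist_pair k K R F G K2 R2 + gauge k K R A H
  for k :: "'k ring" and K :: "('k, 'h) hopf" and R F G :: "('k, 'h, 'h) tensor"
    and K2 :: "('k, 'h) hopf" and R2 :: "('k, 'h, 'h) tensor"
    and A :: "('k, 'h, 'c, 'a) comod_kmod" and H :: "('k, 'c) hopf" +
  fixes A2 :: "('k, 'h, 'c, 'a) comod_kmod"
  assumes A2_gauge: "gauge k K2 R2 A2 H"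
    and A2_simps [simp]: "carrier A2 = carrier A" "one A2 = one A" "zero A2 = zero A" "add A2 = add A" "smult A2 = smult A"
      "act A2 = act A" "coact A2 = coact A"
    and A2_mult: "[|a <: A; b <: A|] ==> a \<otimes>\<^bsub>A2\<^esub> b = ks A G (%x y. act A x a \<star> act A y b)"

sublocale gauge_pair \<subseteq> S: gauge k K2 R2 A2 H by (rule A2_gauge)

context gauge_pair begin

abbreviation "E2 \<equiv> hom_module k K2 A2"
abbreviation "aut2 \<equiv> aut_carrier k K2 H R2 A2"

lemma same_A2: "same_module A2 A" by (simp add: same_module_def)

lemmas A2_cong [simp] = same_module_cong[OF same_A2]

lemma E2_simps [simp]:
  "carrier E2 = carrier E" "mult E2 = mult E" "one E2 = one E" "zero E2 = zero E" "add E2 = add E" "smult E2 = smult E"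
  by (simp_all add: hom_module_def)

lemma same_E2: "same_module E2 E" by (simp add: same_module_def)

lemmas E2_cong [simp] = same_module_cong[OF same_E2]

lemma E2_minus: "a_minus E2 = a_minus E" by (rule same_module_a_minus[OF same_E2])

text \<open>\<open>D(\<psi>)(a) = (G\<^sup>\<alpha> \<rhd> \<psi>)(G\<^sub>\<alpha> \<rhd> a)\<close>, the isomorphism from the twist of \<open>Hom(A, A)\<close> to
  \<open>Hom(A\<^sub>F, A\<^sub>F)\<close>.\<close>

definition "D \<psi> = (\<lambda>a\<in>carrier A. ks A G (%x y. ev (act E x \<psi>) (act A y a)))"

lemma ev_D:
  assumes [simp]: "\<psi> <: E"
  shows "D \<psi> <: E" "a <: A ==> ev (D \<psi>) a = ks A G (%x y. ev (act E x \<psi>) (act A y a))"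
proof -
  have l: "linear_map k A A (%a. ks A G (%x y. ev (act E x \<psi>) (act A y a)))" by simp
  show "D \<psi> <: E" "a <: A ==> ev (D \<psi>) a = ks A G (%x y. ev (act E x \<psi>) (act A y a))"
    unfolding D_def by (rule E_restrict(1)[OF l], rule E_restrict(2)[OF l])
qed

lemma D_linear_E: "linear_map k E E D"
proof (rule linear_mapI)
  interpret mE: module k E by simp
  show "D (\<psi> \<oplus>\<^bsub>E\<^esub> \<phi>) = D \<psi> \<oplus>\<^bsub>E\<^esub> D \<phi>" if [simp]: "\<psi> <: E" "\<phi> <: E" for \<psi> \<phi>
    by (rule E_eqI) (simp_all add: ev_D act_add tsumc_addf)
  show "D (c \<odot>\<^bsub>E\<^esub> \<psi>) = c \<odot>\<^bsub>E\<^esub> D \<psi>" if [simp]: "c <: k" "\<psi> <: E" for c \<psi>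
    by (rule E_eqI) (simp_all add: ev_D act_smult)
qed (simp add: ev_D)

lemma D_simps [simp]:
  "\<psi> <: E ==> D \<psi> <: E" "linear_map k X E f ==> linear_map k X E (%x. D (f x))"
  by (rule ev_D, assumption, rule lin_comp[OF D_linear_E])

lemma act2_simps [simp]:
  "[|h <: K; \<psi> <: E|] ==> act E2 h \<psi> <: E"
  "[|linear_map k X E f; h <: K|] ==> linear_map k X E (%x. act E2 h (f x))"
  "[|linear_map k X K i; \<psi> <: E|] ==> linear_map k X E (%x. act E2 (i x) \<psi>)"
  using S.K_module_simps(2)[OF S.E_K_module] S.K_module_linear[OF S.E_K_module] by simp_all

text \<open>After composing with the action of the second leg of \<open>h\<close> on the argument both sides become
  \<open>h \<rhd> D(\<psi>)(a)\<close>, by equivariance of evaluation for the two coproducts.\<close>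

lemma D_act:
  assumes h: "h <: K" and [simp]: "\<psi> <: E"
  shows "D (act E h \<psi>) = act E2 h (D \<psi>)"
proof (rule E_eqI)
  fix a assume a: "a <: A"
  have eq: "ks A (\<Delta>' h) (%x y. ev (D (act E x \<psi>)) (act A y a)) = ks A (\<Delta>' h) (%x y. ev (act E2 x (D \<psi>)) (act A y a))"
    if [simp]: "h <: K" "a <: A" for h a
  proof -
    have "ks A (\<Delta>' h) (%x y. ev (D (act E x \<psi>)) (act A y a)) =
        ks A (\<Delta>' h) (%x y. ks A G (%p q. ev (act E (p \<cdot> x) \<psi>) (act A (q \<cdot> y) a)))"
      by (intro tsumc_cong) (simp add: ev_D)
    also have "... = ks A G (%p q. ks A (\<Delta>' h) (%x y. ev (act E (p \<cdot> x) \<psi>) (act A (q \<cdot> y) a)))"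
      by (rule tsumc_swap) simp_all
    also have "... = sw A h (%x y. ks A G (%p q. ev (act E (x \<cdot> p) \<psi>) (act A (y \<cdot> q) a)))"
      by (rule \<Delta>'_intertwine(1)[where f = "%x y. ev (act E x \<psi>) (act A y a)"]) simp_all
    also have "... = ks A G (%p q. sw A h (%x y. ev (act E (x \<cdot> p) \<psi>) (act A (y \<cdot> q) a)))"
      by (rule tsumc_swap) simp_all
    also have "... = act A h (ev (D \<psi>) a)" by (simp add: ev_D ev_equivariant)
    finally show ?thesis using S.ev_equivariant[of h "D \<psi>" a] by simp
  qed
  show "ev (D (act E h \<psi>)) a = ev (act E2 h (D \<psi>)) a"
    by (rule S.cancel_act[of A A "%h a. ev (D (act E h \<psi>)) a" "%h a. ev (act E2 h (D \<psi>)) a"])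
      (use a h eq in simp_all)
qed (use h in simp_all)

text \<open>\<open>D\<close> is equivariant, so that \<open>F\<close> and \<open>G\<close> meet and cancel.\<close>

lemma D_inverse:
  assumes [simp]: "\<psi> <: E" "a <: A"
  shows "ks A F (%x y. ev (act E2 x (D \<psi>)) (act A y a)) = ev \<psi> a"
proof -
  have "ks A F (%x y. ev (act E2 x (D \<psi>)) (act A y a)) = ks A F (%x y. ks A G (%p q. ev (act E (p \<cdot> x) \<psi>) (act A (q \<cdot> y) a)))"
    by (intro tsumc_cong) (simp add: D_act[symmetric] ev_D)
  also have "... = ks A G (%p q. ks A F (%x y. ev (act E (p \<cdot> x) \<psi>) (act A (q \<cdot> y) a)))"
    by (rule tsumc_swap) simp_all
  also have "... = ev (act E \<one>\<^bsub>K\<^esub> \<psi>) (act A \<one>\<^bsub>K\<^esub> a)"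
    by (rule FG_cancel(2)[where f = "%x y. ev (act E x \<psi>) (act A y a)"]) simp_all
  finally show ?thesis by simp
qed

text \<open>Evaluating both sides, the legs are distributed as in the two sides of the cocycle condition for
  \<open>G\<close>.\<close>

lemma D_mult:
  assumes [simp]: "\<psi> <: E" "\<phi> <: E"
  shows "D \<psi> \<otimes>\<^bsub>E\<^esub> D \<phi> = D (ks E G (%x y. act E x \<psi> \<otimes>\<^bsub>E\<^esub> act E y \<phi>))"
proof (rule E_eqI)
  fix a assume [simp]: "a <: A"
  let ?t = "%x y z. ev (act E x \<psi>) (ev (act E y \<phi>) (act A z a))"
  have "ev (D \<psi> \<otimes>\<^bsub>E\<^esub> D \<phi>) a = ks A G (%p q. ks A G (%x y. ev (act E p \<psi>) (act A q (ev (act E x \<phi>) (act A y a)))))"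
    by (simp add: ev_D) (rule tsumc_swap, simp_all)
  also have "... = ks A G (%p q. ks A G (%x y. sw A q (%c d. ?t p (c \<cdot> x) (d \<cdot> y))))"
  proof (intro tsumc_cong)
    show "ev (act E p \<psi>) (act A q (ev (act E x \<phi>) (act A y a))) = sw A q (%c d. ?t p (c \<cdot> x) (d \<cdot> y))"
      if [simp]: "p <: K" "q <: K" "x <: K" "y <: K" for p q x y
      using ev_equivariant[of q "act E x \<phi>" "act A y a", symmetric] by simp
  qed
  also have "... = ks A G (%p q. sw A q (%c d. ks A G (%x y. ?t p (c \<cdot> x) (d \<cdot> y))))"
    by (intro tsumc_cong tsumc_swap) simp_all
  also have "... = ks A G (%p q. sw A p (%c d. ks A G (%x y. ?t (c \<cdot> x) (d \<cdot> y) q)))"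
    by (rule cocycle(2)[symmetric]) (simp_all add: trilinear_map_def)
  also have "... = ks A G (%p q. ks A G (%x y. sw A p (%c d. ?t (c \<cdot> x) (d \<cdot> y) q)))"
    by (intro tsumc_cong tsumc_swap) simp_all
  also have "... = ev (D (ks E G (%x y. act E x \<psi> \<otimes>\<^bsub>E\<^esub> act E y \<phi>))) a"
    by (simp add: ev_D E_act_mult)
  finally show "ev (D \<psi> \<otimes>\<^bsub>E\<^esub> D \<phi>) a = ev (D (ks E G (%x y. act E x \<psi> \<otimes>\<^bsub>E\<^esub> act E y \<phi>))) a" .
qed simp_all

text \<open>For the Leibniz rule the cocycle condition is used twice: to bring \<open>D(u)\<close> of a twisted product
  into a form to which the Leibniz rule of \<open>u\<close> applies, and to recognise twisted products in the
  result. In between, \<open>R G = G\<^sub>2\<^sub>1 R\<^sub>F\<close> replaces the braiding.\<close>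

lemma D_aut:
  assumes u: "u \<in> aut"
  shows "D u \<in> aut2"
proof -
  note [simp] = aut_E[OF u]
  have c: "coinvariants k H A2 = coinvariants k H A" by (simp add: coinvariants_def)
  note xu = aut_act[OF _ u]
  have "D u \<in> S.comod_maps"
    by (simp add: S.comod_maps_def ev_D linear_tsumc[OF coact_linear] aut_comod[OF xu]) (intro ballI tsumc_swap, simp_all)
  moreover have "D u \<in> S.vertical_maps"
    by (simp add: S.vertical_maps_def c coinv_closed ev_D aut_coinv[OF xu] coinv_act)
  moreover have "ev (D u) (a \<otimes>\<^bsub>A2\<^esub> b) = ev (D u) a \<otimes>\<^bsub>A2\<^esub> b \<oplus>\<^bsub>A\<^esub> ks A R2 (%r s. act A s a \<otimes>\<^bsub>A2\<^esub> ev (act E2 r (D u)) b)"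
    if [simp]: "a <: A" "b <: A" for a b
  proof -
    let ?t = "%x y z. ev (act E x u) (act A y a \<star> act A z b)"
    let ?v = "%x y z. act A x a \<star> ev (act E y u) (act A z b)"
    have 1: "ev (D u) (a \<otimes>\<^bsub>A2\<^esub> b) = ks A G (%p q. ks A G (%x y. sw A p (%c d. ?t (c \<cdot> x) (d \<cdot> y) q)))"
    proof -
      have "ev (D u) (a \<otimes>\<^bsub>A2\<^esub> b) = ks A G (%x y. ks A G (%p q. sw A q (%c d. ?t p (c \<cdot> x) (d \<cdot> y))))"
        by (simp add: A2_mult ev_D A_act)
      also have "... = ks A G (%p q. ks A G (%x y. sw A q (%c d. ?t p (c \<cdot> x) (d \<cdot> y))))"
        by (rule tsumc_swap) simp_all
      also have "... = ks A G (%p q. sw A q (%c d. ks A G (%x y. ?t p (c \<cdot> x) (d \<cdot> y))))"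
        by (intro tsumc_cong tsumc_swap) simp_all
      also have "... = ks A G (%p q. sw A p (%c d. ks A G (%x y. ?t (c \<cdot> x) (d \<cdot> y) q)))"
        by (rule cocycle(2)[symmetric]) (simp_all add: trilinear_map_def)
      also have "... = ks A G (%p q. ks A G (%x y. sw A p (%c d. ?t (c \<cdot> x) (d \<cdot> y) q)))"
        by (intro tsumc_cong tsumc_swap) simp_all
      finally show ?thesis .
    qed
    have "sw A p (%c d. ?t (c \<cdot> x) (d \<cdot> y) q) = act A p (ev (act E x u) (act A y a)) \<star> act A q b \<oplus>\<^bsub>A\<^esub>
        ks A R (%r s. sw A p (%c d. ?v (c \<cdot> (s \<cdot> y)) (d \<cdot> (r \<cdot> x)) q))"
      if [simp]: "p <: K" "q <: K" "x <: K" "y <: K" for p q x y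
    proof -
      have "sw A p (%c d. ?t (c \<cdot> x) (d \<cdot> y) q) = sw A p (%c d. ev (act E c (act E x u)) (act A d (act A y a)) \<star> act A q b \<oplus>\<^bsub>A\<^esub>
          ks A R (%r s. ?v (s \<cdot> d \<cdot> y) (r \<cdot> c \<cdot> x) q))"
      proof (rule tsumc_cong)
        show "?t (c \<cdot> x) (d \<cdot> y) q = ev (act E c (act E x u)) (act A d (act A y a)) \<star> act A q b \<oplus>\<^bsub>A\<^esub>
          ks A R (%r s. ?v (s \<cdot> d \<cdot> y) (r \<cdot> c \<cdot> x) q)" if [simp]: "c <: K" "d <: K" for c d
          using aut_der[OF aut_act[OF that(1) xu[OF \<open>x <: K\<close>]], of "act A d (act A y a)" "act A q b"] by simp
      qed
      also have "... = sw A p (%c d. ev (act E c (act E x u)) (act A d (act A y a)) \<star> act A q b) \<oplus>\<^bsub>A\<^esub>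
          sw A p (%c d. ks A R (%r s. ?v (s \<cdot> d \<cdot> y) (r \<cdot> c \<cdot> x) q))"
        by (rule tsumc_addf) simp_all
      also have "sw A p (%c d. ks A R (%r s. ?v (s \<cdot> d \<cdot> y) (r \<cdot> c \<cdot> x) q)) =
          ks A R (%r s. sw A p (%c d. ?v (s \<cdot> d \<cdot> y) (r \<cdot> c \<cdot> x) q))"
        by (rule tsumc_swap) simp_all
      also have "... = sw A p (%c d. ks A R (%r s. ?v (c \<cdot> s \<cdot> y) (d \<cdot> r \<cdot> x) q))"
        by (rule R_comult[symmetric, where f = "%r s. ?v (s \<cdot> _) (r \<cdot> _) q"]) simp_all
      also have "... = ks A R (%r s. sw A p (%c d. ?v (c \<cdot> s \<cdot> y) (d \<cdot> r \<cdot> x) q))"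
        by (rule tsumc_swap) simp_all
      also have "sw A p (%c d. ev (act E c (act E x u)) (act A d (act A y a)) \<star> act A q b) =
          sw A p (%c d. ev (act E c (act E x u)) (act A d (act A y a))) \<star> act A q b"
        by simp
      finally show ?thesis by (simp add: ev_equivariant del: tsumc_mult)
    qed
    note e = this
    have "ev (D u) (a \<otimes>\<^bsub>A2\<^esub> b) = ks A G (%p q. ks A G (%x y. act A p (ev (act E x u) (act A y a)) \<star> act A q b \<oplus>\<^bsub>A\<^esub>
        ks A R (%r s. sw A p (%c d. ?v (c \<cdot> (s \<cdot> y)) (d \<cdot> (r \<cdot> x)) q))))"
      unfolding 1 by (intro tsumc_cong e)
    also have "... = ks A G (%p q. ks A G (%x y. act A p (ev (act E x u) (act A y a)) \<star> act A q b)) \<oplus>\<^bsub>A\<^esub>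
        ks A G (%p q. ks A G (%x y. ks A R (%r s. sw A p (%c d. ?v (c \<cdot> (s \<cdot> y)) (d \<cdot> (r \<cdot> x)) q))))"
      by (simp add: tsumc_addf)
    also have "ks A G (%p q. ks A G (%x y. act A p (ev (act E x u) (act A y a)) \<star> act A q b)) = ev (D u) a \<otimes>\<^bsub>A2\<^esub> b"
      by (simp add: A2_mult ev_D)
    also have "ks A G (%p q. ks A G (%x y. ks A R (%r s. sw A p (%c d. ?v (c \<cdot> (s \<cdot> y)) (d \<cdot> (r \<cdot> x)) q)))) =
        ks A R2 (%r s. act A s a \<otimes>\<^bsub>A2\<^esub> ev (act E2 r (D u)) b)"
    proof -
      have "ks A G (%p q. ks A G (%x y. ks A R (%r s. sw A p (%c d. ?v (c \<cdot> (s \<cdot> y)) (d \<cdot> (r \<cdot> x)) q)))) =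
          ks A G (%p q. ks A R (%r s. ks A G (%x y. sw A p (%c d. ?v (c \<cdot> (s \<cdot> y)) (d \<cdot> (r \<cdot> x)) q))))"
        by (intro tsumc_cong tsumc_swap) simp_all
      also have "... = ks A G (%p q. ks A G (%x y. ks A R' (%r s. sw A p (%c d. ?v (c \<cdot> (x \<cdot> s)) (d \<cdot> (y \<cdot> r)) q))))"
        by (rule tsumc_cong, rule R_twist[where f = "%x y. sw A _ (%c d. ?v (c \<cdot> y) (d \<cdot> x) _)"]) simp_all
      also have "... = ks A G (%p q. ks A R' (%r s. ks A G (%x y. sw A p (%c d. ?v (c \<cdot> (x \<cdot> s)) (d \<cdot> (y \<cdot> r)) q))))"
        by (intro tsumc_cong tsumc_swap) simp_all
      also have "... = ks A R' (%r s. ks A G (%p q. ks A G (%x y. sw A p (%c d. ?v (c \<cdot> (x \<cdot> s)) (d \<cdot> (y \<cdot> r)) q))))"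
        by (rule tsumc_swap) simp_all
      also have "... = ks A R' (%r s. ks A G (%p q. sw A p (%c d. ks A G (%x y. ?v (c \<cdot> x \<cdot> s) (d \<cdot> y \<cdot> r) q))))"
        by (rule tsumc_cong, rule tsumc_cong, rule trans[OF tsumc_swap]) (simp_all add: K_assoc)
      also have "... = ks A R' (%r s. ks A G (%p q. sw A q (%c d. ks A G (%x y. ?v (p \<cdot> s) (c \<cdot> x \<cdot> r) (d \<cdot> y)))))"
        by (rule tsumc_cong, rule cocycle(2)[where f = "%x y z. ?v (x \<cdot> _) (y \<cdot> _) z"]) (simp_all add: trilinear_map_def)
      also have "... = ks A R' (%r s. ks A G (%p q. ks A G (%x y. sw A q (%c d. ?v (p \<cdot> s) (c \<cdot> x \<cdot> r) (d \<cdot> y)))))"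
        by (intro tsumc_cong tsumc_swap) simp_all
      also have "... = ks A R' (%r s. ks A G (%p q. ks A G (%x y. act A p (act A s a) \<star> act A q (ev (act E x (act E r u)) (act A y b)))))"
      proof (intro tsumc_cong)
        show "sw A q (%c d. ?v (p \<cdot> s) (c \<cdot> x \<cdot> r) (d \<cdot> y)) = act A p (act A s a) \<star> act A q (ev (act E x (act E r u)) (act A y b))"
          if [simp]: "p <: K" "q <: K" "x <: K" "y <: K" "r <: K" "s <: K" for p q x y r s
          using ev_equivariant[of q "act E x (act E r u)" "act A y b", symmetric] by simp
      qed
      also have "... = ks A R2 (%r s. act A s a \<otimes>\<^bsub>A2\<^esub> ev (D (act E r u)) b)"
        by (simp add: A2_mult ev_D R2)
      finally show ?thesis by (simp add: D_act)
    qed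
    finally show ?thesis .
  qed
  ultimately show ?thesis by (simp add: S.aut_eq S.derivations_def S.derivation_iff[unfolded A2_simps])
qed

text \<open>Since \<open>D\<close> is equivariant and multiplicative up to \<open>G\<close>, both terms of the bracket
  are images under \<open>D\<close>, and \<open>R G = G\<^sub>2\<^sub>1 R\<^sub>F\<close> identifies the second
  one.\<close>

lemma D_br:
  assumes [simp]: "u <: E" "v <: E"
  shows "S.br (D u) (D v) = D (ks E G (%x y. br (act E x u) (act E y v)))"
proof -
  interpret mE: module k E by simp
  have "ks E R2 (%r s. act E2 s (D v) \<otimes>\<^bsub>E\<^esub> act E2 r (D u)) = ks E R2 (%r s. D (ks E G (%x y. act E (x \<cdot> s) v \<otimes>\<^bsub>E\<^esub> act E (y \<cdot> r) u)))"
    by (intro tsumc_cong) (simp add: D_act[symmetric] D_mult)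
  also have "... = D (ks E R2 (%r s. ks E G (%x y. act E (x \<cdot> s) v \<otimes>\<^bsub>E\<^esub> act E (y \<cdot> r) u)))"
    by (rule linear_tsumc[OF D_linear_E, symmetric]) simp_all
  also have "ks E R2 (%r s. ks E G (%x y. act E (x \<cdot> s) v \<otimes>\<^bsub>E\<^esub> act E (y \<cdot> r) u)) =
      ks E G (%x y. ks E R' (%r s. act E (x \<cdot> s) v \<otimes>\<^bsub>E\<^esub> act E (y \<cdot> r) u))"
    unfolding R2 by (rule tsumc_swap) simp_all
  also have "... = ks E R (%r s. ks E G (%x y. act E (s \<cdot> y) v \<otimes>\<^bsub>E\<^esub> act E (r \<cdot> x) u))"
    by (rule R_twist[symmetric, where f = "%x y. act E y v \<otimes>\<^bsub>E\<^esub> act E x u"]) simp_all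
  also have "... = ks E G (%x y. ks E R (%r s. act E (s \<cdot> y) v \<otimes>\<^bsub>E\<^esub> act E (r \<cdot> x) u))"
    by (rule tsumc_swap) simp_all
  finally have e: "ks E R2 (%r s. act E2 s (D v) \<otimes>\<^bsub>E\<^esub> act E2 r (D u)) =
      D (ks E G (%x y. ks E R (%r s. act E s (act E y v) \<otimes>\<^bsub>E\<^esub> act E r (act E x u))))" by simp
  have "S.br (D u) (D v) = D u \<otimes>\<^bsub>E\<^esub> D v \<ominus>\<^bsub>E\<^esub> ks E R2 (%r s. act E2 s (D v) \<otimes>\<^bsub>E\<^esub> act E2 r (D u))"
    by (simp add: S.br_def E2_minus)
  also have "... = D (ks E G (%x y. act E x u \<otimes>\<^bsub>E\<^esub> act E y v) \<ominus>\<^bsub>E\<^esub>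
      ks E G (%x y. ks E R (%r s. act E s (act E y v) \<otimes>\<^bsub>E\<^esub> act E r (act E x u))))"
    unfolding e D_mult[OF assms] by (rule lin_minus[OF _ _ D_linear_E, symmetric]) simp_all
  also have "ks E G (%x y. act E x u \<otimes>\<^bsub>E\<^esub> act E y v) \<ominus>\<^bsub>E\<^esub>
      ks E G (%x y. ks E R (%r s. act E s (act E y v) \<otimes>\<^bsub>E\<^esub> act E r (act E x u))) = ks E G (%x y. br (act E x u) (act E y v))"
    unfolding br_def a_minus_def by (simp add: tsumc_addf del: tsumc_push(4) flip: tsumc_push(4))
  finally show ?thesis .
qed

end

section \<open>Twisting enveloping algebras\<close>

context triangular_twist begin

abbreviation "L21 t \<equiv> ks T3 t (%x y. t3 y x \<one>\<^bsub>K\<^esub>)"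
abbreviation "D21 t \<equiv> ks T3 t (%x y. sw T3 x (%a b. t3 b a y))"
abbreviation "D213 t \<equiv> ks T3 t (%x y. sw T3 y (%c d. t3 c x d))"

text \<open>The way \<open>F\<close> and \<open>R\<close> move past each other when a letter is multiplied to an element.
  In steps: \<open>(id \<otimes> \<Delta>) F\<close> is replaced by the cocycle condition,
  \<open>R\<^sub>2\<^sub>1\<close> is moved to the left through \<open>(\<Delta> \<otimes> id) F\<close> and
  \<open>F\<^sub>1\<^sub>2\<close>, where it becomes the twisted one, and the remaining factors of
  \<open>F\<close> are collected by the cocycle condition with its first two legs exchanged.\<close>

lemma leg_identity_step: "D23 F *** L21 R *** D213 G = L23 G *** L21 R' *** L13 F"
proof -
  interpret M: monoid K3 by (rule tensor_alg_monoid)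
  note c3 = M.m_assoc M.m_closed
  have cl: "L12 t <: K3" "L13 t <: K3" "L23 t <: K3" "D12 t <: K3" "D23 t <: K3"
    "L21 t <: K3" "D21 t <: K3" "D213 t <: K3" for t
    by simp_all
  have 1: "D23 F = L23 G *** L12 F *** D12 F"
  proof -
    have "D23 F = L23 G *** L23 F *** D23 F" unfolding leg_inverse(2) using cl(5)[of F] by (simp only: M.l_one)
    also have "... = L23 G *** (L23 F *** D23 F)" using cl by (simp only: c3)
    finally show ?thesis unfolding cocycle_K3[symmetric] using cl by (simp only: c3)
  qed
  have 2: "D12 F *** L21 R = L21 R *** D21 F"
  proof -
    have "D12 F *** L21 R = ks T3 F (%x y. sw T3 x (%a b. ks T3 R (%r s. t3 (a \<cdot> s) (b \<cdot> r) y)))"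
      by (simp add: swap_comult)
    also have "... = ks T3 F (%x y. ks T3 R (%r s. sw T3 x (%a b. t3 (s \<cdot> b) (r \<cdot> a) y)))"
      by (intro tsumc_cong R_comult[where f = "%u v. t3 v u _"]) simp_all
    also have "... = L21 R *** D21 F"
      by simp (intro tsumc_cong tsumc_swap, simp_all)
    finally show ?thesis .
  qed
  have 3: "L12 F *** L21 R = L21 R' *** L21 F"
  proof -
    have L: "L21 (s ** t) = L21 s *** L21 t" if [simp]: "s <: KK" "t <: KK" for s t
      by (rule lift_mult) simp_all
    have f: "L12 F = L21 (flipK F)" by simp
    have "flipK F ** R = R' ** F"
      unfolding R'_def by (simp only: KK_assoc GF KK_one F_in G_in R_in tsumc_closed module_tensor K_mod tpa_closed K_alg)
    then show ?thesis unfolding f by (subst L[symmetric], simp, simp)+ simp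
  qed
  have 4: "L21 F *** D21 F = L13 F *** D213 F"
    using cocycle(1)[of T3 "%a b c. t3 b a c"] by (simp add: trilinear_map_def swap_comult)
  have 5: "D213 F *** D213 G = \<one>\<^bsub>K3\<^esub>"
  proof -
    have "D213 (s ** t) = D213 s *** D213 t" if [simp]: "s <: KK" "t <: KK" for s t
      by (rule lift_mult; simp; rule tsumc_swap; simp)
    from this[of F G] show ?thesis by (simp add: FG)
  qed
  have "D23 F *** L21 R *** D213 G = L23 G *** L12 F *** (D12 F *** L21 R) *** D213 G"
    unfolding 1 using cl by (simp only: c3)
  also have "... = L23 G *** (L12 F *** L21 R) *** D21 F *** D213 G"
    unfolding 2 using cl by (simp only: c3)
  also have "... = L23 G *** L21 R' *** (L21 F *** D21 F) *** D213 G"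
    unfolding 3 using cl by (simp only: c3)
  also have "... = L23 G *** L21 R' *** L13 F *** (D213 F *** D213 G)"
    unfolding 4 using cl by (simp only: c3)
  finally show ?thesis unfolding 5 using cl by (simp only: c3 M.r_one)
qed

lemma R_twist_step:
  assumes f: "trilinear_map k K K K X f" and X [simp]: "module k X"
  shows "ks X G (%x y. sw X y (%c d. ks X R (%r s. ks X F (%p q. sw X q (%q1 q2. f (p \<cdot> s \<cdot> c) (q1 \<cdot> r \<cdot> x) (q2 \<cdot> d)))))) =
    ks X F (%p q. ks X R' (%r s. ks X G (%x y. f (s \<cdot> p) (x \<cdot> r) (y \<cdot> q))))"
proof -
  note [simp] = trilinear_comp[OF f]
  have "ks X G (%x y. sw X y (%c d. ks X R (%r s. ks X F (%p q. sw X q (%q1 q2. f (p \<cdot> s \<cdot> c) (q1 \<cdot> r \<cdot> x) (q2 \<cdot> d)))))) =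
      ks X R (%r s. ks X G (%x y. sw X y (%c d. ks X F (%p q. sw X q (%q1 q2. f (p \<cdot> s \<cdot> c) (q1 \<cdot> r \<cdot> x) (q2 \<cdot> d))))))"
    by (rule swap_comult[symmetric]) simp_all
  also have "... = ks X R (%r s. ks X F (%p q. sw X q (%q1 q2. ks X G (%x y. sw X y (%c d. f (p \<cdot> s \<cdot> c) (q1 \<cdot> r \<cdot> x) (q2 \<cdot> d))))))"
    by (rule tsumc_cong, rule swap_comult2) simp_all
  also have "... = ks X F (%p q. sw X q (%q1 q2. ks X R (%r s. ks X G (%x y. sw X y (%c d. f (p \<cdot> s \<cdot> c) (q1 \<cdot> r \<cdot> x) (q2 \<cdot> d))))))"
    by (rule swap_comult) simp_all
  finally show ?thesis
    using arg_cong[OF leg_identity_step, of "%z. ev3 X z f"] by simp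
qed

end

text \<open>A braided bracket over \<open>K\<^sub>2\<close> whose transport along \<open>\<phi>\<close> is the twist of a braided bracket over \<open>K\<close>.\<close>

locale bracket_twist = twist_pair k K R F G K2 R2 + braided_bracket k K R g
  for k :: "'k ring" and K :: "('k, 'h) hopf" and R F G :: "('k, 'h, 'h) tensor"
    and K2 :: "('k, 'h) hopf" and R2 :: "('k, 'h, 'h) tensor"
    and g :: "('k, 'h, 'g) braided_lie" +
  fixes g2 :: "('k, 'h, 'e) braided_lie" and \<phi> :: "'e \<Rightarrow> 'g"
  assumes g2_bracket: "braided_bracket k K2 R2 g2"
    and \<phi>_linear: "linear_map k g2 g \<phi>"
    and \<phi>_act: "[|h <: K; u <: g2|] ==> \<phi> (act g2 h u) = act g h (\<phi> u)"
    and \<phi>_bracket: "[|u <: g2; v <: g2|] ==>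
      \<phi> (bracket g2 u v) = ks g G (%x y. bracket g (act g x (\<phi> u)) (act g y (\<phi> v)))"

sublocale bracket_twist \<subseteq> S: braided_bracket k K2 R2 g2 by (rule g2_bracket)

context bracket_twist begin

abbreviation "UF \<equiv> tw UK"
abbreviation fmult (infixl "\<circ>\<^sub>F" 70) where "x \<circ>\<^sub>F y \<equiv> x \<otimes>\<^bsub>UF\<^esub> y"
abbreviation "iota2 \<equiv> S.iota"
abbreviation "U2 \<equiv> S.UK"

lemmas UF_module_algebra = tw_module_algebra[OF UK_module_algebra]
lemmas UF_alg [simp] = S.K_module_algebra_simps(1)[OF UF_module_algebra]
lemmas UF_mult = tw_mult[OF UK_module_algebra]
lemmas UF_assoc = alg_assoc[OF UF_alg, unfolded tw_simps]

lemma \<phi>_simps [simp]: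
  "u <: g2 ==> \<phi> u <: g" "linear_map k X g2 f ==> linear_map k X g (%x. \<phi> (f x))"
  using lin_closed[OF \<phi>_linear] lin_comp[OF \<phi>_linear] by simp_all

lemma K_modules2 [simp]: "K_module k K g2" "K_module k K U2"
  using S.g_module S.U.L_simps(2) K2_K_module by blast+

text \<open>The relation of \<open>\<U>(\<gg>)\<close> applied below \<open>G\<close>; the braiding becomes the twisted
  one by \<open>R G = G\<^sub>2\<^sub>1 R\<^sub>F\<close>.\<close>

lemma UF_relation:
  assumes [simp]: "u <: g2" "v <: g2"
  shows "iota (\<phi> u) \<circ>\<^sub>F iota (\<phi> v) = ks UK R2 (%r s. iota (\<phi> (act g2 s v)) \<circ>\<^sub>F iota (\<phi> (act g2 r u))) \<oplus>\<^bsub>UK\<^esub> iota (\<phi> (bracket g2 u v))"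
proof -
  have "iota (\<phi> u) \<circ>\<^sub>F iota (\<phi> v) = ks UK G (%x y. ks UK R (%r s. iota (act g (s \<cdot> y) (\<phi> v)) \<star> iota (act g (r \<cdot> x) (\<phi> u))) \<oplus>\<^bsub>UK\<^esub>
      iota (bracket g (act g x (\<phi> u)) (act g y (\<phi> v))))"
    by (simp add: UF_mult) (rule tsumc_cong, subst iota_relation, simp_all)
  also have "... = ks UK G (%x y. ks UK R (%r s. iota (act g (s \<cdot> y) (\<phi> v)) \<star> iota (act g (r \<cdot> x) (\<phi> u)))) \<oplus>\<^bsub>UK\<^esub>
      ks UK G (%x y. iota (bracket g (act g x (\<phi> u)) (act g y (\<phi> v))))"
    by (rule tsumc_addf) simp_all
  also have "ks UK G (%x y. iota (bracket g (act g x (\<phi> u)) (act g y (\<phi> v)))) = iota (\<phi> (bracket g2 u v))"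
    using linear_tsumc[OF iota_linear, of K K "%x y. bracket g (act g x (\<phi> u)) (act g y (\<phi> v))" G] by (simp add: \<phi>_bracket)
  also have "ks UK G (%x y. ks UK R (%r s. iota (act g (s \<cdot> y) (\<phi> v)) \<star> iota (act g (r \<cdot> x) (\<phi> u)))) =
      ks UK R (%r s. ks UK G (%x y. iota (act g (s \<cdot> y) (\<phi> v)) \<star> iota (act g (r \<cdot> x) (\<phi> u))))"
    by (rule tsumc_swap) simp_all
  also have "... = ks UK G (%x y. ks UK R' (%r s. iota (act g (x \<cdot> s) (\<phi> v)) \<star> iota (act g (y \<cdot> r) (\<phi> u))))"
    by (rule R_twist[where f = "%x y. iota (act g y (\<phi> v)) \<star> iota (act g x (\<phi> u))"]) simp_all
  also have "... = ks UK R' (%r s. ks UK G (%x y. iota (act g (x \<cdot> s) (\<phi> v)) \<star> iota (act g (y \<cdot> r) (\<phi> u))))"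
    by (rule tsumc_swap) simp_all
  also have "... = ks UK R2 (%r s. iota (\<phi> (act g2 s v)) \<circ>\<^sub>F iota (\<phi> (act g2 r u)))"
    by (simp add: UF_mult \<phi>_act R2)
  finally show ?thesis .
qed

definition "\<Phi> = env_ext k UF (word_prod UF (%u. iota (\<phi> u)))"

lemma UF_hom:
  shows \<Phi>_linear: "linear_map k U2 UK \<Phi>" and \<Phi>_one: "\<Phi> \<one>\<^bsub>U2\<^esub> = \<one>\<^bsub>UK\<^esub>"
    and \<Phi>_step: "[|u <: g2; \<xi> <: U2|] ==> \<Phi> (iota2 u \<otimes>\<^bsub>U2\<^esub> \<xi>) = iota (\<phi> u) \<circ>\<^sub>F \<Phi> \<xi>"
    and \<Phi>_mult: "[|\<xi> <: U2; \<eta> <: U2|] ==> \<Phi> (\<xi> \<otimes>\<^bsub>U2\<^esub> \<eta>) = \<Phi> \<xi> \<circ>\<^sub>F \<Phi> \<eta>"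
proof -
  have l: "linear_map k g2 UF (%u. iota (\<phi> u))" by simp
  have r: "iota (\<phi> u) \<circ>\<^sub>F iota (\<phi> v) = tsumc k K2 K2 UF R2 (%r s. iota (\<phi> (act g2 s v)) \<circ>\<^sub>F iota (\<phi> (act g2 r u))) \<oplus>\<^bsub>UF\<^esub> iota (\<phi> (bracket g2 u v))"
    if "u <: g2" "v <: g2" for u v using UF_relation[OF that] by simp
  note h = S.env_hom[OF UF_alg l r, folded \<Phi>_def]
  show "linear_map k U2 UK \<Phi>" "\<Phi> \<one>\<^bsub>U2\<^esub> = \<one>\<^bsub>UK\<^esub>" using h(1,2) by simp_all
  show "[|u <: g2; \<xi> <: U2|] ==> \<Phi> (iota2 u \<otimes>\<^bsub>U2\<^esub> \<xi>) = iota (\<phi> u) \<circ>\<^sub>F \<Phi> \<xi>" by (rule h(3))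
  show "[|\<xi> <: U2; \<eta> <: U2|] ==> \<Phi> (\<xi> \<otimes>\<^bsub>U2\<^esub> \<eta>) = \<Phi> \<xi> \<circ>\<^sub>F \<Phi> \<eta>" by (rule h(4))
qed

lemma \<Phi>_simps [simp]:
  "\<xi> <: U2 ==> \<Phi> \<xi> <: UK" "linear_map k X U2 f ==> linear_map k X UK (%x. \<Phi> (f x))"
  using lin_closed[OF \<Phi>_linear] lin_comp[OF \<Phi>_linear] by simp_all

lemma U2_act_step:
  "[|h <: K; u <: g2; \<xi> <: U2|] ==>
    act U2 h (iota2 u \<otimes>\<^bsub>U2\<^esub> \<xi>) = ks U2 (\<Delta>' h) (%x y. iota2 (act g2 x u) \<otimes>\<^bsub>U2\<^esub> act U2 y \<xi>)"
  using S.act_step[of h u \<xi>] by simp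

lemma UF_act:
  "[|h <: K; \<xi> <: UK; \<eta> <: UK|] ==> act UK h (\<xi> \<circ>\<^sub>F \<eta>) = ks UK (\<Delta>' h) (%x y. act UK x \<xi> \<circ>\<^sub>F act UK y \<eta>)"
  using S.act_mult[OF UF_module_algebra, of h \<xi> \<eta>] by simp

lemma \<Phi>_act:
  assumes "h <: K" "\<xi> <: U2"
  shows "\<Phi> (act U2 h \<xi>) = act UK h (\<Phi> \<xi>)"
proof (rule S.env_linear_eq_act[of UK "%h \<xi>. \<Phi> (act U2 h \<xi>)" "%h \<xi>. act UK h (\<Phi> \<xi>)" h \<xi>])
  fix h u \<xi> assume "h <: K2" and [simp]: "u <: g2" "\<xi> <: U2"
    and IH: "!!h. h <: K2 ==> \<Phi> (act U2 h \<xi>) = act UK h (\<Phi> \<xi>)"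
  then have h [simp]: "h <: K" by simp
  show "\<Phi> (act U2 h (iota2 u \<otimes>\<^bsub>U2\<^esub> \<xi>)) = act UK h (\<Phi> (iota2 u \<otimes>\<^bsub>U2\<^esub> \<xi>))"
    using IH by (simp add: U2_act_step linear_tsumc[OF \<Phi>_linear] \<Phi>_step UF_act \<phi>_act)
qed (use assms in \<open>simp_all add: \<Phi>_one lin_smult[OF \<Phi>_linear]\<close>)

text \<open>A map \<open>\<Psi>\<close> that sends the product of a letter with an element to the product twisted by
  \<open>F\<close> undoes \<open>\<Phi>\<close>, which twists by \<open>G\<close>.\<close>

lemma \<Phi>_left_inverse:
  assumes \<Psi>: "linear_map k UK U2 \<Psi>" and one: "\<Psi> \<one>\<^bsub>UK\<^esub> = \<one>\<^bsub>U2\<^esub>"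
    and step: "!!u \<xi>. [|u <: g; \<xi> <: UK|] ==>
      \<Psi> (iota u \<star> \<xi>) = ks U2 F (%x y. act U2 x (iota2 (\<psi> u)) \<otimes>\<^bsub>U2\<^esub> act U2 y (\<Psi> \<xi>))"
    and act: "!!h \<xi>. [|h <: K; \<xi> <: UK|] ==> \<Psi> (act UK h \<xi>) = act U2 h (\<Psi> \<xi>)"
    and \<psi>: "!!u. u <: g2 ==> \<psi> (\<phi> u) = u"
    and z: "\<zeta> <: U2"
  shows "\<Psi> (\<Phi> \<zeta>) = \<zeta>"
proof (rule S.env_linear_eq[of U2 "%\<zeta>. \<Psi> (\<Phi> \<zeta>)" "%\<zeta>. \<zeta>", OF _ _ _ _ _ z])
  note [simp] = lin_closed[OF \<Psi>] lin_comp[OF \<Psi>]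
  fix u \<zeta> assume [simp]: "u <: g2" "\<zeta> <: U2" and IH: "\<Psi> (\<Phi> \<zeta>) = \<zeta>"
  have "\<Psi> (\<Phi> (iota2 u \<otimes>\<^bsub>U2\<^esub> \<zeta>)) = ks U2 G (%x y. \<Psi> (iota (\<phi> (act g2 x u)) \<star> \<Phi> (act U2 y \<zeta>)))"
    by (simp add: \<Phi>_step UF_mult linear_tsumc[OF \<Psi>] \<phi>_act \<Phi>_act)
  also have "... = ks U2 G (%x y. ks U2 F (%p q. iota2 (act g2 (p \<cdot> x) u) \<otimes>\<^bsub>U2\<^esub> act U2 (q \<cdot> y) \<zeta>))"
    by (intro tsumc_cong) (simp add: step \<psi> \<Phi>_act act IH)
  also have "... = ks U2 F (%p q. ks U2 G (%x y. iota2 (act g2 (p \<cdot> x) u) \<otimes>\<^bsub>U2\<^esub> act U2 (q \<cdot> y) \<zeta>))"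
    by (rule tsumc_swap) simp_all
  also have "... = iota2 (act g2 \<one>\<^bsub>K\<^esub> u) \<otimes>\<^bsub>U2\<^esub> act U2 \<one>\<^bsub>K\<^esub> \<zeta>"
    by (rule FG_cancel(1)[where f = "%x y. iota2 (act g2 x u) \<otimes>\<^bsub>U2\<^esub> act U2 y \<zeta>"]) simp_all
  finally show "\<Psi> (\<Phi> (iota2 u \<otimes>\<^bsub>U2\<^esub> \<zeta>)) = iota2 u \<otimes>\<^bsub>U2\<^esub> \<zeta>" by simp
qed (simp_all add: \<Phi>_one one lin_comp[OF \<Psi>])

end

section \<open>The twist of an enveloping algebra as a braided Hopf algebra\<close>

sublocale bracket_twist \<subseteq> V: braided_square k K2 R2 "twisted_algebra k K F (env_kmod k K R g)"
  using UF_module_algebra by unfold_locales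

context bracket_twist begin

abbreviation "BF \<equiv> braided_tensor k R2 UF"

text \<open>\<open>F\<close> acting on a tensor, and the coproduct of the twist.\<close>

definition "FT t = us UU t (%a b. ks UU F (%x y. tu (act UK x a) (act UK y b)))"
definition "DF \<xi> = FT (Dl \<xi>)"

lemma FT_simps [simp]:
  "FT t <: UU" "linear_map k X UU f ==> linear_map k X UU (%x. FT (f x))"
  by (simp_all add: FT_def)

lemma DF_simps [simp]:
  "DF \<xi> <: UU" "linear_map k X UK f ==> linear_map k X UU (%x. DF (f x))"
  by (simp_all add: DF_def)

lemma us_FT:
  assumes "t <: UU" "module k X"
    and "!!v. v <: UK ==> linear_map k UK X (%w. f v w)" "!!w. w <: UK ==> linear_map k UK X (%v. f v w)"
  shows "us X (FT t) f = us X t (%a b. ks X F (%x y. f (act UK x a) (act UK y b)))"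
  unfolding FT_def using assms by (simp add: bilinear_comp[OF assms(3,4)])

lemma UF_maps [simp]:
  "[|x <: UK; y <: UK|] ==> x \<circ>\<^sub>F y <: UK"
  "[|linear_map k X UK f; y <: UK|] ==> linear_map k X UK (%x. f x \<circ>\<^sub>F y)"
  "[|linear_map k X UK f; y <: UK|] ==> linear_map k X UK (%x. y \<circ>\<^sub>F f x)"
  using alg_simps(3)[OF UF_alg, of x y] lin_mult1[OF UF_alg, of X f y] lin_mult2[OF UF_alg, of X f y] by simp_all

lemma UF_one [simp]:
  "x <: UK ==> \<one>\<^bsub>UK\<^esub> \<circ>\<^sub>F x = x" "x <: UK ==> x \<circ>\<^sub>F \<one>\<^bsub>UK\<^esub> = x"
  using alg_simps(4,5)[OF UF_alg, of x] by simp_all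

lemma BF_maps [simp]:
  "[|s <: UU; t <: UU|] ==> s \<otimes>\<^bsub>BF\<^esub> t <: UU"
  "[|linear_map k X UU f; s <: UU|] ==> linear_map k X UU (%x. s \<otimes>\<^bsub>BF\<^esub> f x)"
  "[|linear_map k X UU f; s <: UU|] ==> linear_map k X UU (%x. f x \<otimes>\<^bsub>BF\<^esub> s)"
  using V.BT_closed[of s t] V.BT_linear[of X f s] by simp_all

text \<open>The effect on two legs of multiplying by the primitive element of a letter in the twisted braided tensor square.\<close>

definition "dstep u a b = tu (iota u \<circ>\<^sub>F a) b \<oplus>\<^bsub>UU\<^esub> ks UU R2 (%r s. tu (act UK s a) (iota (act g r u) \<circ>\<^sub>F b))"

lemma dstep_simps [simp]:
  assumes "u <: g"
  shows "[|a <: UK; b <: UK|] ==> dstep u a b <: UU"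
    "[|linear_map k X UK f; b <: UK; module k X|] ==> linear_map k X UU (%x. dstep u (f x) b)"
    "[|linear_map k X UK f; a <: UK; module k X|] ==> linear_map k X UU (%x. dstep u a (f x))"
  using assms by (simp_all add: dstep_def)

lemma BF_dlt:
  assumes u [simp]: "u <: g" and t: "t <: UU"
  shows "dlt u \<otimes>\<^bsub>BF\<^esub> t = us UU t (dstep u)"
proof -
  interpret mUU: module k UU by simp
  have d: "(a \<oplus>\<^bsub>UU\<^esub> b) \<otimes>\<^bsub>BF\<^esub> t = a \<otimes>\<^bsub>BF\<^esub> t \<oplus>\<^bsub>UU\<^esub> b \<otimes>\<^bsub>BF\<^esub> t" if "a <: UU" "b <: UU" "t <: UU" for a b t
    using alg_l_distr[OF V.BT_alg, of a b t] that by simp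
  have m: "tu a c \<otimes>\<^bsub>BF\<^esub> tu a' c' = ks UU R2 (%x y. tu (a \<circ>\<^sub>F act UK y a') (act UK x c \<circ>\<^sub>F c'))"
    if "a <: UK" "c <: UK" "a' <: UK" "c' <: UK" for a c a' c'
    using V.BT_mult_tens[of a c a' c'] that by simp
  have e: "ks UU R2 (%x y. tu (iota u \<circ>\<^sub>F act UK y a) (act UK x \<one>\<^bsub>UK\<^esub> \<circ>\<^sub>F b)) = tu (iota u \<circ>\<^sub>F a) b"
    if [simp]: "a <: UK" "b <: UK" for a b
  proof -
    have "ks UU R2 (%x y. tu (iota u \<circ>\<^sub>F act UK y a) (act UK x \<one>\<^bsub>UK\<^esub> \<circ>\<^sub>F b)) = ks UU R2 (%x y. eps x \<odot>\<^bsub>UU\<^esub> tu (iota u \<circ>\<^sub>F act UK y a) b)"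
      by (rule tsumc_cong) (simp add: lin_smult[of k UK UK "%z. z \<circ>\<^sub>F b"])
    then show ?thesis using S.R_counit(1)[of UU "%y. tu (iota u \<circ>\<^sub>F act UK y a) b"] by simp
  qed
  have "dlt u \<otimes>\<^bsub>BF\<^esub> tu a b = dstep u a b" if [simp]: "a <: UK" "b <: UK" for a b
  proof -
    have "dlt u \<otimes>\<^bsub>BF\<^esub> tu a b = tu (iota u) \<one>\<^bsub>UK\<^esub> \<otimes>\<^bsub>BF\<^esub> tu a b \<oplus>\<^bsub>UU\<^esub> tu \<one>\<^bsub>UK\<^esub> (iota u) \<otimes>\<^bsub>BF\<^esub> tu a b"
      unfolding dlt_def by (rule d) simp_all
    also have "tu (iota u) \<one>\<^bsub>UK\<^esub> \<otimes>\<^bsub>BF\<^esub> tu a b = tu (iota u \<circ>\<^sub>F a) b"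
      by (subst m) (simp_all only: e that, simp_all)
    also have "tu \<one>\<^bsub>UK\<^esub> (iota u) \<otimes>\<^bsub>BF\<^esub> tu a b = ks UU R2 (%r s. tu (act UK s a) (iota (act g r u) \<circ>\<^sub>F b))"
      by (subst m) simp_all
    finally show ?thesis by (simp only: dstep_def)
  qed
  note pure = this
  show ?thesis
    by (rule tensor_linear_eq[OF t, where X = UU]) (simp_all add: pure)
qed

text \<open>The contribution of the letter in the first leg: the cocycle condition in the form \<open>(\<Delta> \<otimes>
  id)(F) (id \<otimes> \<Delta>)(G) = G\<^sub>1\<^sub>2 F\<^sub>2\<^sub>3\<close>.\<close>

lemma DF_letter1:
  assumes [simp]: "u <: g" "a <: UK" "b <: UK"
  shows "ks UU G (%x y. sw UU y (%c d. ks UU F (%p q. tu (act UK p (iota (act g x u) \<star> act UK c a)) (act UK q (act UK d b))))) =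
    ks UU F (%p q. tu (iota u \<circ>\<^sub>F act UK p a) (act UK q b))"
proof -
  let ?f = "%x y z. tu (iota (act g x u) \<star> act UK y a) (act UK z b)"
  have "ks UU G (%x y. sw UU y (%c d. ks UU F (%p q. tu (act UK p (iota (act g x u) \<star> act UK c a)) (act UK q (act UK d b))))) =
      ks UU G (%x y. sw UU y (%c d. ks UU F (%p q. sw UU p (%p1 p2. ?f (p1 \<cdot> x) (p2 \<cdot> c) (q \<cdot> d)))))"
    by (simp add: act_step)
  also have "... = ks UU F (%p q. sw UU p (%p1 p2. ks UU G (%x y. sw UU y (%c d. ?f (p1 \<cdot> x) (p2 \<cdot> c) (q \<cdot> d)))))"
    by (rule swap_comult2) simp_all
  also have "... = ks UU G (%x y. ks UU F (%p q. ?f x (y \<cdot> p) q))"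
    by (rule cocycle(3)[symmetric]) (simp_all add: trilinear_map_def)
  also have "... = ks UU F (%p q. ks UU G (%x y. ?f x (y \<cdot> p) q))"
    by (rule tsumc_swap) simp_all
  finally show ?thesis by (simp add: UF_mult)
qed

text \<open>The contribution of the letter in the second leg, which is moved past the first leg by the braiding.\<close>

lemma DF_letter2:
  assumes [simp]: "u <: g" "a <: UK" "b <: UK"
  shows "ks UU G (%x y. sw UU y (%c d. ks UU R (%r s. ks UU F (%p q.
      tu (act UK p (act UK s (act UK c a))) (act UK q (iota (act g r (act g x u)) \<star> act UK d b)))))) =
    ks UU F (%p q. ks UU R2 (%r s. tu (act UK s (act UK p a)) (iota (act g r u) \<circ>\<^sub>F act UK q b)))"
proof -
  let ?f = "%x y z. tu (act UK x a) (iota (act g y u) \<star> act UK z b)"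
  have "ks UU G (%x y. sw UU y (%c d. ks UU R (%r s. ks UU F (%p q.
        tu (act UK p (act UK s (act UK c a))) (act UK q (iota (act g r (act g x u)) \<star> act UK d b)))))) =
      ks UU G (%x y. sw UU y (%c d. ks UU R (%r s. ks UU F (%p q. sw UU q (%q1 q2. ?f (p \<cdot> s \<cdot> c) (q1 \<cdot> r \<cdot> x) (q2 \<cdot> d))))))"
    by (simp add: act_step)
  also have "... = ks UU F (%p q. ks UU R' (%r s. ks UU G (%x y. ?f (s \<cdot> p) (x \<cdot> r) (y \<cdot> q))))"
    by (rule R_twist_step) (simp_all add: trilinear_map_def)
  finally show ?thesis by (simp add: UF_mult R2)
qed

text \<open>Both contributions of the letter, summed over the coproduct of \<open>\<xi>\<close>.\<close>

lemma DF_step: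
  assumes [simp]: "u <: g" "\<xi> <: UK"
  shows "DF (iota u \<circ>\<^sub>F \<xi>) = dlt u \<otimes>\<^bsub>BF\<^esub> DF \<xi>"
proof -
  have FT: "linear_map k UU UU FT" by simp
  let ?P = "%x c d a b. ks UU F (%p q. tu (act UK p (iota (act g x u) \<star> act UK c a)) (act UK q (act UK d b)))"
  let ?Q = "%x c d a b. ks UU R (%r s. ks UU F (%p q.
      tu (act UK p (act UK s (act UK c a))) (act UK q (iota (act g r (act g x u)) \<star> act UK d b))))"
  have "DF (iota u \<circ>\<^sub>F \<xi>) = ks UU G (%x y. FT (dlt (act g x u) \<otimes>\<^bsub>BU\<^esub> U.actT y (Dl \<xi>)))"
    by (simp add: DF_def UF_mult linear_tsumc[OF Dl_linear] linear_tsumc[OF FT] Dl_act)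
  also have "... = ks UU G (%x y. us UU (Dl \<xi>) (%a b. sw UU y (%c d. ?P x c d a b \<oplus>\<^bsub>UU\<^esub> ?Q x c d a b)))"
  proof (rule tsumc_cong)
    fix x y assume [simp]: "x <: K" "y <: K"
    have "FT (dlt (act g x u) \<otimes>\<^bsub>BU\<^esub> U.actT y (Dl \<xi>)) = sw UU y (%c d. us UU (Dl \<xi>) (%a b. ?P x c d a b \<oplus>\<^bsub>UU\<^esub> ?Q x c d a b))"
      unfolding FT_def by (subst us_dlt) (simp_all add: us_actT)
    also have "... = us UU (Dl \<xi>) (%a b. sw UU y (%c d. ?P x c d a b \<oplus>\<^bsub>UU\<^esub> ?Q x c d a b))"
      by (rule tsumc_swap) simp_all
    finally show "FT (dlt (act g x u) \<otimes>\<^bsub>BU\<^esub> U.actT y (Dl \<xi>)) = us UU (Dl \<xi>) (%a b. sw UU y (%c d. ?P x c d a b \<oplus>\<^bsub>UU\<^esub> ?Q x c d a b))" .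
  qed
  also have "... = us UU (Dl \<xi>) (%a b. ks UU G (%x y. sw UU y (%c d. ?P x c d a b \<oplus>\<^bsub>UU\<^esub> ?Q x c d a b)))"
    by (rule tsumc_swap) simp_all
  also have "... = us UU (Dl \<xi>) (%a b. ks UU F (%p q. dstep u (act UK p a) (act UK q b)))"
  proof (rule tsumc_cong)
    fix a b assume [simp]: "a <: UK" "b <: UK"
    have "ks UU G (%x y. sw UU y (%c d. ?P x c d a b \<oplus>\<^bsub>UU\<^esub> ?Q x c d a b)) =
        ks UU G (%x y. sw UU y (%c d. ?P x c d a b)) \<oplus>\<^bsub>UU\<^esub> ks UU G (%x y. sw UU y (%c d. ?Q x c d a b))"
      by (subst tsumc_addf[symmetric], simp_all) (rule tsumc_cong, rule tsumc_addf, simp_all)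
    also have "... = ks UU F (%p q. dstep u (act UK p a) (act UK q b))"
      unfolding DF_letter1[OF \<open>u <: g\<close> \<open>a <: UK\<close> \<open>b <: UK\<close>]
        DF_letter2[OF \<open>u <: g\<close> \<open>a <: UK\<close> \<open>b <: UK\<close>] dstep_def
      by (rule tsumc_addf[symmetric]) simp_all
    finally show "ks UU G (%x y. sw UU y (%c d. ?P x c d a b \<oplus>\<^bsub>UU\<^esub> ?Q x c d a b)) =
        ks UU F (%p q. dstep u (act UK p a) (act UK q b))" .
  qed
  also have "... = dlt u \<otimes>\<^bsub>BF\<^esub> DF \<xi>"
    by (simp add: BF_dlt DF_def us_FT)
  finally show ?thesis .
qed

lemma DF_one: "DF \<one>\<^bsub>UK\<^esub> = tu \<one>\<^bsub>UK\<^esub> \<one>\<^bsub>UK\<^esub>"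
  by (simp add: DF_def FT_def)

text \<open>The first factor is an image under \<open>\<Phi>\<close>, hence built from letters by twisted products, and a
  letter can be split off on both sides.\<close>

lemma DF_mult:
  assumes surj: "!!\<eta>. \<eta> <: UK ==> \<exists>\<zeta>\<in>carrier U2. \<Phi> \<zeta> = \<eta>" and [simp]: "\<eta> <: UK" "\<xi> <: UK"
  shows "DF (\<eta> \<circ>\<^sub>F \<xi>) = DF \<eta> \<otimes>\<^bsub>BF\<^esub> DF \<xi>"
proof -
  obtain \<zeta> where z: "\<zeta> <: U2" "\<Phi> \<zeta> = \<eta>" using surj[OF assms(2)] by blast
  have "DF (\<Phi> \<zeta> \<circ>\<^sub>F \<xi>) = DF (\<Phi> \<zeta>) \<otimes>\<^bsub>BF\<^esub> DF \<xi>"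
  proof (rule S.env_linear_eq[of UU "%\<zeta>. DF (\<Phi> \<zeta> \<circ>\<^sub>F \<xi>)" "%\<zeta>. DF (\<Phi> \<zeta>) \<otimes>\<^bsub>BF\<^esub> DF \<xi>", OF _ _ _ _ _ z(1)])
    have "tu \<one>\<^bsub>UK\<^esub> \<one>\<^bsub>UK\<^esub> \<otimes>\<^bsub>BF\<^esub> DF \<xi> = DF \<xi>" using alg_simps(4)[OF V.BT_alg, of "DF \<xi>"] by simp
    then show "DF (\<Phi> \<one>\<^bsub>U2\<^esub> \<circ>\<^sub>F \<xi>) = DF (\<Phi> \<one>\<^bsub>U2\<^esub>) \<otimes>\<^bsub>BF\<^esub> DF \<xi>" by (simp add: \<Phi>_one DF_one)
    fix u \<zeta> assume [simp]: "u <: g2" "\<zeta> <: U2" and IH: "DF (\<Phi> \<zeta> \<circ>\<^sub>F \<xi>) = DF (\<Phi> \<zeta>) \<otimes>\<^bsub>BF\<^esub> DF \<xi>"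
    have "DF (\<Phi> (iota2 u \<otimes>\<^bsub>U2\<^esub> \<zeta>) \<circ>\<^sub>F \<xi>) = dlt (\<phi> u) \<otimes>\<^bsub>BF\<^esub> (DF (\<Phi> \<zeta>) \<otimes>\<^bsub>BF\<^esub> DF \<xi>)"
      by (simp add: \<Phi>_step UF_assoc DF_step IH)
    also have "... = (dlt (\<phi> u) \<otimes>\<^bsub>BF\<^esub> DF (\<Phi> \<zeta>)) \<otimes>\<^bsub>BF\<^esub> DF \<xi>"
      using alg_assoc[OF V.BT_alg, of "dlt (\<phi> u)" "DF (\<Phi> \<zeta>)" "DF \<xi>"] by simp
    finally show "DF (\<Phi> (iota2 u \<otimes>\<^bsub>U2\<^esub> \<zeta>) \<circ>\<^sub>F \<xi>) = DF (\<Phi> (iota2 u \<otimes>\<^bsub>U2\<^esub> \<zeta>)) \<otimes>\<^bsub>BF\<^esub> DF \<xi>"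
      by (simp add: \<Phi>_step DF_step)
  qed simp_all
  then show ?thesis by (simp only: z(2))
qed

text \<open>Both sides transform in the same way when \<open>\<zeta>\<close> is multiplied by a letter.\<close>

lemma \<Phi>_comult:
  assumes "\<zeta> <: U2"
  shows "tsumc k U2 U2 UU (S.Dl \<zeta>) (%a b. tu (\<Phi> a) (\<Phi> b)) = DF (\<Phi> \<zeta>)"
proof (rule S.env_linear_eq[of UU "%\<zeta>. tsumc k U2 U2 UU (S.Dl \<zeta>) (%a b. tu (\<Phi> a) (\<Phi> b))" "%\<zeta>. DF (\<Phi> \<zeta>)", OF _ _ _ _ _ assms])
  fix u \<zeta> assume [simp]: "u <: g2" "\<zeta> <: U2" and IH: "tsumc k U2 U2 UU (S.Dl \<zeta>) (%a b. tu (\<Phi> a) (\<Phi> b)) = DF (\<Phi> \<zeta>)"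
  have "tsumc k U2 U2 UU (S.Dl (iota2 u \<otimes>\<^bsub>U2\<^esub> \<zeta>)) (%a b. tu (\<Phi> a) (\<Phi> b)) =
      tsumc k U2 U2 UU (S.Dl \<zeta>) (%a b. dstep (\<phi> u) (\<Phi> a) (\<Phi> b))"
    using S.us_dlt[of u "S.Dl \<zeta>" UU "%a b. tu (\<Phi> a) (\<Phi> b)"] by (simp add: \<Phi>_step \<Phi>_act \<phi>_act dstep_def)
  also have "... = us UU (tsumc k U2 U2 UU (S.Dl \<zeta>) (%a b. tu (\<Phi> a) (\<Phi> b))) (dstep (\<phi> u))"
    by simp
  also have "... = DF (\<Phi> (iota2 u \<otimes>\<^bsub>U2\<^esub> \<zeta>))"
    by (simp add: IH \<Phi>_step DF_step BF_dlt del: tsumc_tsumc)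
  finally show "tsumc k U2 U2 UU (S.Dl (iota2 u \<otimes>\<^bsub>U2\<^esub> \<zeta>)) (%a b. tu (\<Phi> a) (\<Phi> b)) = DF (\<Phi> (iota2 u \<otimes>\<^bsub>U2\<^esub> \<zeta>))" .
qed (simp_all add: \<Phi>_one DF_one)

text \<open>Equivariance of the coproduct moves the inner \<open>F\<close> to the outside, where the cocycle condition
  and the coassociativity of \<open>\<U>(\<gg>)\<close> apply separately.\<close>

lemma DF_coassoc:
  assumes [simp]: "\<xi> <: UK"
  shows "us YU (DF \<xi>) (%x y. us YU (DF x) (%a b. t3u a b y)) = us YU (DF \<xi>) (%x y. us YU (DF y) (%a b. t3u x a b))"
proof -
  have "us YU (DF \<xi>) (%x y. us YU (DF x) (%a b. t3u a b y)) = us YU (Dl \<xi>) (%a b. ks YU F (%p q. us YU (Dl a) (%a1 a2.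
      sw YU p (%c d. ks YU F (%x y. t3u (act UK (x \<cdot> c) a1) (act UK (y \<cdot> d) a2) (act UK q b))))))"
    by (simp add: DF_def us_FT Dl_act us_actT) (rule tsumc_cong, rule tsumc_cong, rule tsumc_swap, simp_all)
  also have "... = us YU (Dl \<xi>) (%a b. us YU (Dl a) (%a1 a2. ks YU F (%p q.
      sw YU p (%c d. ks YU F (%x y. t3u (act UK (x \<cdot> c) a1) (act UK (y \<cdot> d) a2) (act UK q b))))))"
    by (rule tsumc_cong, rule tsumc_swap) simp_all
  also have "... = us YU (Dl \<xi>) (%a b. us YU (Dl a) (%a1 a2. ks YU F (%p q.
      sw YU q (%c d. ks YU F (%x y. t3u (act UK p a1) (act UK (x \<cdot> c) a2) (act UK (y \<cdot> d) b))))))"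
    by (rule tsumc_cong, rule tsumc_cong, rule cocycle(1)[where f = "%x y z. t3u (act UK x _) (act UK y _) (act UK z _)"])
      (simp_all add: trilinear_map_def)
  also have "... = us YU (Dl \<xi>) (%a b. us YU (Dl b) (%b1 b2. ks YU F (%p q.
      sw YU q (%c d. ks YU F (%x y. t3u (act UK p a) (act UK (x \<cdot> c) b1) (act UK (y \<cdot> d) b2))))))"
    by (rule coalgebra_coassoc[OF UK_coalgebra]) (simp_all add: trilinear_map_def)
  also have "... = us YU (Dl \<xi>) (%a b. ks YU F (%p q. us YU (Dl b) (%b1 b2.
      sw YU q (%c d. ks YU F (%x y. t3u (act UK p a) (act UK (x \<cdot> c) b1) (act UK (y \<cdot> d) b2))))))"
    by (rule tsumc_cong, rule tsumc_swap) simp_all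
  also have "... = us YU (DF \<xi>) (%x y. us YU (DF y) (%a b. t3u x a b))"
    by (simp add: DF_def us_FT Dl_act us_actT) (rule tsumc_cong, rule tsumc_cong, rule tsumc_swap, simp_all)
  finally show ?thesis .
qed

lemma DF_counit:
  assumes [simp]: "\<xi> <: UK"
  shows "us UK (DF \<xi>) (%x y. ce x \<odot>\<^bsub>UK\<^esub> y) = \<xi>" "us UK (DF \<xi>) (%x y. ce y \<odot>\<^bsub>UK\<^esub> x) = \<xi>"
proof -
  have "us UK (DF \<xi>) (%x y. ce x \<odot>\<^bsub>UK\<^esub> y) = us UK (Dl \<xi>) (%a b. ks UK F (%x y. eps x \<odot>\<^bsub>UK\<^esub> (ce a \<odot>\<^bsub>UK\<^esub> act UK y b)))"
    by (simp add: DF_def us_FT ce_act smult_rules(2) del: F_counit)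
  also have "... = \<xi>" by (simp add: Dl_counit)
  finally show "us UK (DF \<xi>) (%x y. ce x \<odot>\<^bsub>UK\<^esub> y) = \<xi>" .
  have "us UK (DF \<xi>) (%x y. ce y \<odot>\<^bsub>UK\<^esub> x) = us UK (Dl \<xi>) (%a b. ks UK F (%x y. eps y \<odot>\<^bsub>UK\<^esub> (ce b \<odot>\<^bsub>UK\<^esub> act UK x a)))"
    by (simp add: DF_def us_FT ce_act smult_rules(2) del: F_counit)
  also have "... = \<xi>" by (simp add: Dl_counit)
  finally show "us UK (DF \<xi>) (%x y. ce y \<odot>\<^bsub>UK\<^esub> x) = \<xi>" .
qed

lemma DF_act:
  assumes [simp]: "h <: K" "\<xi> <: UK"
  shows "DF (act UK h \<xi>) = ks UU (\<Delta>' h) (%x y. us UU (DF \<xi>) (%a b. tu (act UK x a) (act UK y b)))"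
proof -
  have "DF (act UK h \<xi>) = sw UU h (%x y. us UU (Dl \<xi>) (%a b. ks UU F (%p q. tu (act UK (p \<cdot> x) a) (act UK (q \<cdot> y) b))))"
    by (simp add: DF_def FT_def Dl_act us_actT)
  also have "... = us UU (Dl \<xi>) (%a b. sw UU h (%x y. ks UU F (%p q. tu (act UK (p \<cdot> x) a) (act UK (q \<cdot> y) b))))"
    by (rule tsumc_swap) simp_all
  also have "... = us UU (Dl \<xi>) (%a b. ks UU F (%p q. sw UU h (%x y. tu (act UK (p \<cdot> x) a) (act UK (q \<cdot> y) b))))"
    by (rule tsumc_cong, rule tsumc_swap) simp_all
  also have "... = us UU (Dl \<xi>) (%a b. ks UU (\<Delta>' h) (%x y. ks UU F (%p q. tu (act UK (x \<cdot> p) a) (act UK (y \<cdot> q) b))))"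
    by (rule tsumc_cong, rule \<Delta>'_intertwine(2)[symmetric, where f = "%x y. tu (act UK x _) (act UK y _)"]) simp_all
  also have "... = ks UU (\<Delta>' h) (%x y. us UU (Dl \<xi>) (%a b. ks UU F (%p q. tu (act UK (x \<cdot> p) a) (act UK (y \<cdot> q) b))))"
    by (rule tsumc_swap) simp_all
  finally show ?thesis by (simp add: DF_def us_FT)
qed

lemma ce_UF_mult:
  assumes [simp]: "\<xi> <: UK" "\<eta> <: UK"
  shows "ce (\<xi> \<circ>\<^sub>F \<eta>) = ce \<xi> \<otimes>\<^bsub>k\<^esub> ce \<eta>"
proof -
  interpret cring k by (rule cring_k)
  have "ce (\<xi> \<circ>\<^sub>F \<eta>) = ks (self_module k) G (%x y. eps x \<odot>\<^bsub>self_module k\<^esub> (eps y \<odot>\<^bsub>self_module k\<^esub> (ce \<xi> \<otimes>\<^bsub>k\<^esub> ce \<eta>)))"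
    by (simp add: UF_mult linear_tsumc[OF ce_hom(1)] ce_hom(4) ce_act m_ac del: G_counit)
  also have "... = eps \<one>\<^bsub>K\<^esub> \<odot>\<^bsub>self_module k\<^esub> (ce \<xi> \<otimes>\<^bsub>k\<^esub> ce \<eta>)"
    by (rule G_counit(1)) (use lin_mult1[OF k_algebra_self hopf_maps(5)[OF lin_ident], of "ce \<xi> \<otimes>\<^bsub>k\<^esub> ce \<eta>"] in simp_all)
  finally show ?thesis by simp
qed

text \<open>The \<open>F\<close> of the coproduct and the \<open>G\<close> of the product cancel.\<close>

lemma DF_antipode:
  assumes [simp]: "\<xi> <: UK"
  shows "us UK (DF \<xi>) (%x y. an x \<circ>\<^sub>F y) = ce \<xi> \<odot>\<^bsub>UK\<^esub> \<one>\<^bsub>UK\<^esub>" "us UK (DF \<xi>) (%x y. x \<circ>\<^sub>F an y) = ce \<xi> \<odot>\<^bsub>UK\<^esub> \<one>\<^bsub>UK\<^esub>"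
proof -
  have 1: "ks UK F (%p q. act UK p a \<circ>\<^sub>F act UK q b) = a \<star> b" if [simp]: "a <: UK" "b <: UK" for a b
  proof -
    have "ks UK F (%p q. act UK p a \<circ>\<^sub>F act UK q b) = ks UK F (%p q. ks UK G (%x y. act UK (x \<cdot> p) a \<star> act UK (y \<cdot> q) b))"
      by (simp add: UF_mult)
    also have "... = ks UK G (%x y. ks UK F (%p q. act UK (x \<cdot> p) a \<star> act UK (y \<cdot> q) b))"
      by (rule tsumc_swap) simp_all
    also have "... = act UK \<one>\<^bsub>K\<^esub> a \<star> act UK \<one>\<^bsub>K\<^esub> b"
      by (rule FG_cancel(2)[where f = "%x y. act UK x a \<star> act UK y b"]) simp_all
    finally show ?thesis by simp
  qed
  show "us UK (DF \<xi>) (%x y. an x \<circ>\<^sub>F y) = ce \<xi> \<odot>\<^bsub>UK\<^esub> \<one>\<^bsub>UK\<^esub>" "us UK (DF \<xi>) (%x y. x \<circ>\<^sub>F an y) = ce \<xi> \<odot>\<^bsub>UK\<^esub> \<one>\<^bsub>UK\<^esub>"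
    by (simp_all add: DF_def us_FT an_act 1 an_convolution)
qed

abbreviation "LF \<equiv> twisted_braided_hopf k K F UH"

lemma LF_simps:
  "same_module UF LF" "mult UF = mult LF" "one UF = one LF" "act UF = act LF"
  "\<xi> <: UK ==> bcomult LF \<xi> = DF \<xi>" "bcounit LF = ce" "bantipode LF = an"
proof -
  note u = UH_simps(2-4)[symmetric] UH_simps(5-7)
  have f: "carrier UH = carrier UK" "add UH = add UK" "zero UH = zero UK" "smult UH = smult UK"
    using UH_simps(1) by (simp_all add: same_module_def)
  note s = same_module_cong[OF same_module_sym[OF UH_simps(1)]]
  show "same_module UF LF" "mult UF = mult LF" "one UF = one LF" "act UF = act LF" "bcounit LF = ce" "bantipode LF = an"
    by (simp_all add: same_module_def twisted_braided_hopf_def twisted_algebra_def u f s)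
  show "bcomult LF \<xi> = DF \<xi>" if [simp]: "\<xi> <: UK"
  proof -
    have "tmap k UK UK (act UK x) (act UK y) (Dl \<xi>) = us UU (Dl \<xi>) (%a b. tu (act UK x a) (act UK y b))"
      if "x <: K" "y <: K" for x y
      by (rule tmap_eq) (use that in simp_all)
    then have "tsum k UU F (%x y. tmap k UK UK (act UK x) (act UK y) (Dl \<xi>)) =
        ks UU F (%x y. us UU (Dl \<xi>) (%a b. tu (act UK x a) (act UK y b)))"
      by (subst tsum_eq_tsumc[of k K K]) (auto intro!: tsumc_cong)
    also have "... = DF \<xi>" unfolding DF_def FT_def by (rule tsumc_swap) simp_all
    finally show ?thesis
      by (simp add: twisted_braided_hopf_def twisted_algebra_def u f s tmap_def[abs_def])
  qed
qed

theorem twisted_enveloping_braided_hopf: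
  assumes surj: "!!\<eta>. \<eta> <: UK ==> \<exists>\<zeta>\<in>carrier U2. \<Phi> \<zeta> = \<eta>"
  shows "braided_hopf_algebra k K2 R2 LF"
proof (rule V.braided_hopf_algebraI[OF LF_simps(1-4)])
  show "linear_map k UF V.LL (bcomult LF)"
    by (simp, subst lin_cong[OF alg_simps(1)[OF UK_alg], of "bcomult LF" DF]) (simp_all add: LF_simps)
qed (simp_all add: LF_simps(5-7) ce_hom an_linear DF_coassoc DF_counit DF_act V.actT_def ce_act an_act DF_one DF_mult[OF surj] ce_UF_mult DF_antipode)

section \<open>The isomorphism\<close>

lemma \<Phi>_counit:
  assumes "\<zeta> <: U2"
  shows "ce (\<Phi> \<zeta>) = S.ce \<zeta>"
proof -
  interpret cring k by (rule cring_k)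
  have i: "ce (iota u) = \<zero>\<^bsub>k\<^esub>" if "u <: g" for u using ce_simps(4)[of u "\<one>\<^bsub>UK\<^esub>"] that by simp
  have l: "linear_map k U2 (self_module k) S.ce" by (rule S.ce_hom(1))
  show ?thesis
    by (rule S.env_linear_eq[of "self_module k" "%\<zeta>. ce (\<Phi> \<zeta>)" S.ce \<zeta>, OF _ _ _ _ _ assms])
      (simp_all add: \<Phi>_one \<Phi>_step ce_UF_mult i l)
qed

text \<open>\<open>\<Psi>\<close> inherits all compatibilities from its inverse \<open>\<Phi>\<close>.\<close>

lemma inverse_iso:
  assumes \<Psi>: "linear_map k UK U2 \<Psi>" and inv: "!!\<zeta>. \<zeta> <: U2 ==> \<Psi> (\<Phi> \<zeta>) = \<zeta>" "!!\<xi>. \<xi> <: UK ==> \<Phi> (\<Psi> \<xi>) = \<xi>"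
  shows "braided_hopf_iso k K2 LF S.UH \<Psi>"
proof -
  note [simp] = lin_closed[OF \<Psi>] lin_comp[OF \<Psi>] inv
  have f: "carrier LF = carrier UK" "add LF = add UK" "smult LF = smult UK" "one LF = one UK" "act LF = act UK" "mult LF = mult UF"
    using LF_simps(1-4) by (simp_all add: same_module_def)
  have f2: "carrier S.UH = carrier U2" "add S.UH = add U2" "smult S.UH = smult U2" "one S.UH = one U2" "act S.UH = act U2" "mult S.UH = mult U2"
    using S.UH_simps(1-4) by (simp_all add: same_module_def)
  note s2 = same_module_cong[OF same_module_sym[OF S.UH_simps(1)]]
  have l: "linear_map k LF S.UH \<Psi>" using \<Psi> unfolding linear_map_def f f2 .
  have m: "\<Psi> (\<xi> \<circ>\<^sub>F \<eta>) = \<Psi> \<xi> \<otimes>\<^bsub>U2\<^esub> \<Psi> \<eta>" if [simp]: "\<xi> <: UK" "\<eta> <: UK" for \<xi> \<eta>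
    using inv(1)[of "\<Psi> \<xi> \<otimes>\<^bsub>U2\<^esub> \<Psi> \<eta>"] by (simp add: \<Phi>_mult)
  have o: "\<Psi> \<one>\<^bsub>UK\<^esub> = \<one>\<^bsub>U2\<^esub>" using inv(1)[of "\<one>\<^bsub>U2\<^esub>"] by (simp add: \<Phi>_one)
  have a: "\<Psi> (act UK h \<xi>) = act U2 h (\<Psi> \<xi>)" if [simp]: "h <: K" "\<xi> <: UK" for h \<xi>
    using inv(1)[of "act U2 h (\<Psi> \<xi>)"] by (simp add: \<Phi>_act)
  have c: "S.Dl (\<Psi> \<xi>) = tmap k U2 U2 \<Psi> \<Psi> (DF \<xi>)" if [simp]: "\<xi> <: UK" for \<xi>
  proof -
    have "tmap k U2 U2 \<Psi> \<Psi> (DF \<xi>) = us (tensor_module k U2 U2) (DF (\<Phi> (\<Psi> \<xi>))) (%a b. tens k U2 U2 (\<Psi> a) (\<Psi> b))"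
      by (subst tmap_eq[of _ UK UK]) (simp_all add: \<Psi>)
    also have "... = S.Dl (\<Psi> \<xi>)"
      unfolding \<Phi>_comult[OF lin_closed[OF \<Psi> that], symmetric] by simp
    finally show ?thesis by simp
  qed
  have e: "S.ce (\<Psi> \<xi>) = ce \<xi>" if [simp]: "\<xi> <: UK" for \<xi>
    using \<Phi>_counit[of "\<Psi> \<xi>"] by simp
  have b: "bij_betw \<Psi> (carrier UK) (carrier U2)"
    by (rule bij_betw_byWitness[where f' = \<Phi>]) auto
  show ?thesis
    unfolding braided_hopf_iso_def algebra_map_def ring_hom_def
    using b l by (simp add: f f2 m o a c e LF_simps(5-7) S.UH_simps(5-7) s2 tmap_def lin_add[OF \<Psi>])
qed

end

text \<open>The maps \<open>\<Phi>\<close> for the two transports are inverse to each other; in particular they are surjective, as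
  required for the twist to be a braided Hopf algebra.\<close>

lemma enveloping_twist_isomorphic:
  assumes P: "bracket_twist k K R F G K2 R2 g g2 \<phi>" and Q: "bracket_twist k K2 R2 G F K R g2 g \<psi>"
    and inv: "!!u. u <: g2 ==> \<psi> (\<phi> u) = u" "!!u. u <: g ==> \<phi> (\<psi> u) = u"
  shows "braided_hopf_isomorphic k K2 R2 (twisted_braided_hopf k K F (universal_enveloping k K R g))
    (universal_enveloping k K2 R2 g2)"
proof -
  interpret P: bracket_twist k K R F G K2 R2 g g2 \<phi> by (rule P)
  let ?U = "env_kmod k K R g" and ?U2 = "env_kmod k K2 R2 g2"
  define \<Psi> where "\<Psi> = bracket_twist.\<Phi> k K2 R2 G g2 \<psi>"
  have \<Psi>: "linear_map k ?U ?U2 \<Psi>" "\<Psi> \<one>\<^bsub>?U\<^esub> = \<one>\<^bsub>?U2\<^esub>"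
    unfolding \<Psi>_def by (rule bracket_twist.\<Phi>_linear[OF Q], rule bracket_twist.\<Phi>_one[OF Q])
  have "P.\<Phi> (\<Psi> \<xi>) = \<xi>" if "\<xi> <: ?U" for \<xi>
    unfolding \<Psi>_def
    by (rule bracket_twist.\<Phi>_left_inverse[OF Q P.\<Phi>_linear P.\<Phi>_one _ _ inv(2) that])
      (simp_all add: P.\<Phi>_step P.UF_mult P.\<Phi>_act)
  moreover have "\<Psi> (P.\<Phi> \<zeta>) = \<zeta>" if z: "\<zeta> <: ?U2" for \<zeta>
  proof (rule P.\<Phi>_left_inverse[OF \<Psi> _ _ inv(1) z])
    fix h \<xi> assume "h <: K" "\<xi> <: ?U"
    then show "\<Psi> (act ?U h \<xi>) = act ?U2 h (\<Psi> \<xi>)"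
      unfolding \<Psi>_def using bracket_twist.\<Phi>_act[OF Q, of h \<xi>] by simp
  next
    fix u \<xi> assume u: "u <: g" "\<xi> <: ?U"
    then have "\<psi> u <: g2" using bracket_twist.\<phi>_simps(1)[OF Q] by blast
    then show "\<Psi> (P.iota u \<otimes>\<^bsub>?U\<^esub> \<xi>) = P.ks ?U2 F (%x y. act ?U2 x (P.iota2 (\<psi> u)) \<otimes>\<^bsub>?U2\<^esub> act ?U2 y (\<Psi> \<xi>))"
      using bracket_twist.\<Phi>_step[OF Q u] bracket_twist.UF_mult[OF Q, of "P.iota2 (\<psi> u)" "\<Psi> \<xi>"] lin_closed[OF \<Psi>(1) u(2)]
      unfolding \<Psi>_def by simp
  qed
  ultimately have i: "braided_hopf_iso k K2 P.LF P.S.UH \<Psi>"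
    by (intro P.inverse_iso[OF \<Psi>(1)])
  have "\<exists>\<zeta>\<in>carrier ?U2. P.\<Phi> \<zeta> = \<xi>" if "\<xi> <: ?U" for \<xi>
    using \<open>!!\<xi>. \<xi> <: ?U ==> P.\<Phi> (\<Psi> \<xi>) = \<xi>\<close>[OF that] lin_closed[OF \<Psi>(1) that] by blast
  then show ?thesis
    unfolding braided_hopf_isomorphic_def
    using i P.twisted_enveloping_braided_hopf P.S.universal_enveloping_braided_hopf by blast
qed

section \<open>Gauge transformations of a twisted Hopf--Galois extension\<close>

text \<open>The two constructions are inverse to each other, by the cancellation in \<open>D_inverse\<close>.\<close>

lemma D_D:
  assumes P: "gauge_pair k K R F G K2 R2 A H A2" and Q: "gauge_pair k K2 R2 G F K R A2 H A"
    and u: "u <: (hom_module k K A)"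
  shows "gauge_pair.D k K2 F A2 (gauge_pair.D k K G A u) = u"
proof -
  interpret P: gauge_pair k K R F G K2 R2 A H A2 by (rule P)
  show ?thesis
  proof (rule P.E_eqI)
    show "gauge_pair.D k K2 F A2 (P.D u) <: P.E"
      using gauge_pair.ev_D(1)[OF Q, of "P.D u"] u by simp
    show "endomorphisms.ev (gauge_pair.D k K2 F A2 (P.D u)) a = endomorphisms.ev u a" if "a <: A" for a
      using gauge_pair.ev_D(2)[OF Q, of "P.D u" a] P.D_inverse[OF u that] u that by simp
  qed (rule u)
qed

lemma gauge_bracket_twist:
  assumes P: "gauge_pair k K R F G K2 R2 A H A2" and Q: "gauge_pair k K2 R2 G F K R A2 H A"
  shows "bracket_twist k K R F G K2 R2 (aut_lie k K H R A) (aut_lie k K2 H R2 A2) (gauge_pair.D k K2 F A2)"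
proof -
  interpret P: gauge_pair k K R F G K2 R2 A H A2 by (rule P)
  define T where "T = gauge_pair.D k K2 F A2"
  have T: "linear_map k P.E P.E T" using gauge_pair.D_linear_E[OF Q] by (simp add: T_def)
  have T_aut: "T u \<in> P.aut" if "u \<in> P.aut2" for u using gauge_pair.D_aut[OF Q that] by (simp add: T_def)
  have T_D: "T (P.D u) = u" if "u <: P.E" for u unfolding T_def by (rule D_D[OF P Q that])
  have D_T: "P.D (T u) = u" if "u <: P.E" for u unfolding T_def by (rule D_D[OF Q P]) (simp add: that)
  have aut2: "u <: P.E" if "u \<in> P.aut2" for u using P.S.aut_E[OF that] by simp
  interpret B: braided_bracket k K R P.g by (rule P.aut_bracket)
  have "bracket_twist_axioms k K G K2 R2 P.g P.S.g T"
  proof (rule bracket_twist_axioms.intro)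
    show "braided_bracket k K2 R2 P.S.g" by (rule P.S.aut_bracket)
    show "linear_map k P.S.g P.g T"
      by (rule linear_mapI) (simp_all add: T_aut aut2 lin_add[OF T] lin_smult[OF T])
    show "T (act P.S.g h u) = act P.g h (T u)" if "h <: K" "u <: P.S.g" for h u
      using gauge_pair.D_act[OF Q, of h u] that by (simp add: T_def aut2)
    show "T (bracket P.S.g u v) = P.ks P.g G (%x y. bracket P.g (act P.g x (T u)) (act P.g y (T v)))"
      if "u <: P.S.g" "v <: P.S.g" for u v
    proof -
      have uv: "u \<in> P.aut2" "v \<in> P.aut2" using that by simp_all
      note c [simp] = T_aut[OF uv(1)] T_aut[OF uv(2)] P.aut_E[OF T_aut[OF uv(1)]] P.aut_E[OF T_aut[OF uv(2)]]
      have "bracket P.S.g u v = P.S.br (P.D (T u)) (P.D (T v))"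
        using uv by (simp add: P.S.g_bracket D_T aut2)
      also have "... = P.D (P.ks P.E G (%x y. P.br (act P.E x (T u)) (act P.E y (T v))))"
        by (rule P.D_br) simp_all
      finally have "T (bracket P.S.g u v) = P.ks P.E G (%x y. P.br (act P.E x (T u)) (act P.E y (T v)))"
        by (simp add: T_D)
      then show ?thesis by (simp add: P.g_bracket P.aut_act P.g_sum P.br_closed)
    qed
  qed
  then show ?thesis
    unfolding T_def[symmetric] bracket_twist_def using P.twist_pair_axioms B.braided_bracket_axioms by simp
qed

context triangular_twist begin

text \<open>The twisted extension is related to the original one in the same way as the original one to the twisted one:
  twisting the product by \<open>G\<close> and then by \<open>F\<close> gives back the product of
  \<open>A\<close>.\<close>

lemma gauge_pairs:
  assumes A: "gauge k K R A H"
  shows "gauge_pair k K R F G K' R' A H (twisted_algebra k K F A)"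
    and "gauge_pair k K' R' G F K R (twisted_algebra k K F A) H A"
proof -
  interpret A: gauge k K R A H by (rule A)
  interpret P: twist_pair k K R F G K' R' by (rule twist_pair)
  let ?A2 = "twisted_algebra k K F A"
  have s: "coact ?A2 = coact A" by (simp add: twisted_algebra_def)
  have c: "coinvariants k H ?A2 = coinvariants k H A" by (simp add: coinvariants_def s)
  have "K_module_algebra k K' ?A2" by (rule P.tw_module_algebra[OF A.A_module_algebra])
  moreover have "gauge_axioms k K' ?A2 H"
    by (rule gauge_axioms.intro) (simp_all add: s c A.coact_linear A.coact_act A.coinv_act tmap_def del: A.coact_simps(3))
  ultimately have A2: "gauge k K' R' ?A2 H"
    using triangular_K' by (simp add: gauge_def endomorphisms_def endomorphisms_axioms_def triangular_def)
  note m = P.tw_mult[OF A.A_module_algebra]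
  show "gauge_pair k K R F G K' R' A H ?A2"
    using twist_pair A A2 m by (simp add: gauge_pair_def gauge_pair_axioms_def s)
  have "a \<otimes>\<^bsub>A\<^esub> b = ks A F (%x y. act A x a \<otimes>\<^bsub>?A2\<^esub> act A y b)" if [simp]: "a <: A" "b <: A" for a b
  proof -
    have "ks A F (%x y. act A x a \<otimes>\<^bsub>?A2\<^esub> act A y b) = ks A F (%x y. ks A G (%p q. act A (p \<cdot> x) a \<otimes>\<^bsub>A\<^esub> act A (q \<cdot> y) b))"
      by (simp add: m)
    also have "... = ks A G (%p q. ks A F (%x y. act A (p \<cdot> x) a \<otimes>\<^bsub>A\<^esub> act A (q \<cdot> y) b))"
      by (rule tsumc_swap) simp_all
    also have "... = act A \<one>\<^bsub>K\<^esub> a \<otimes>\<^bsub>A\<^esub> act A \<one>\<^bsub>K\<^esub> b"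
      by (rule FG_cancel(2)[where f = "%x y. act A x a \<otimes>\<^bsub>A\<^esub> act A y b"]) simp_all
    finally show ?thesis by simp
  qed
  then show "gauge_pair k K' R' G F K R ?A2 H A"
    using twist_pair_inverse A A2 by (simp add: gauge_pair_def gauge_pair_axioms_def s)
qed

end

lemma (in triangular) gaugeI:
  assumes H: "hopf_algebra k H" and A: "equivariant_hopf_galois k K H A"
  shows "gauge k K R A H"
proof -
  have "module k H" using H unfolding hopf_algebra_def k_algebra_def by blast
  moreover have "K_module_algebra k K A" using A unfolding equivariant_hopf_galois_def by blast
  moreover have "linear_map k A (tpa A H) (coact A)"
    using A unfolding equivariant_hopf_galois_def hopf_galois_def comodule_algebra_def algebra_map_def by blast
  then have "linear_map k A (tensor_module k A H) (coact A)" by simp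
  ultimately show ?thesis
    using A triangular_axioms hopf_axioms
    unfolding gauge_def gauge_axioms_def endomorphisms_def endomorphisms_axioms_def equivariant_hopf_galois_def by blast
qed

lemma ground_ring_cring: "ground_ring k ==> cring k"
  by (auto simp: ground_ring_def field_def domain_def)

theorem corollary8p2:
  fixes k :: "'k ring"
    and K :: "('k, 'h) hopf" and \<R> \<F> :: "('k, 'h, 'h) tensor"
    and H :: "('k, 'c) hopf"
    and A :: "('k, 'h, 'c, 'a) comod_kmod"
  assumes "ground_ring k"
    and "triangular_hopf_algebra k K \<R>"
    and "hopf_twist_element k K \<F>"
    and "hopf_algebra k H"
    and "equivariant_hopf_galois k K H A"
  shows "braided_hopf_isomorphic k (twisted_hopf k K \<F>) (twisted_R k K \<R> \<F>)
    (twisted_braided_hopf k K \<F> (universal_enveloping k K \<R> (aut_lie k K H \<R> A)))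
    (universal_enveloping k (twisted_hopf k K \<F>) (twisted_R k K \<R> \<F>)
      (aut_lie k (twisted_hopf k K \<F>) H (twisted_R k K \<R> \<F>) (twisted_algebra k K \<F> A)))"
proof -
  let ?G = "inv_twist k K \<F>"
  have k: "cring k" by (rule ground_ring_cring[OF assms(1)])
  interpret triangular k K \<R> by (rule triangularI[OF assms(2) k])
  interpret twist k K \<F> ?G by (rule twistI[OF assms(3) hopf k])
  interpret triangular_twist k K \<R> \<F> ?G by unfold_locales
  note P = gauge_pairs[OF gaugeI[OF assms(4,5)]]
  have c: "carrier (aut_lie k K H \<R> A) \<subseteq> carrier (hom_module k K A)"
    "carrier (aut_lie k K' H R' (twisted_algebra k K \<F> A)) \<subseteq> carrier (hom_module k K' (twisted_algebra k K \<F> A))"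
    by (auto simp: aut_lie_def aut_carrier_def Let_def kmod.defs)
  show ?thesis
    unfolding twisted_R_eq
    by (rule enveloping_twist_isomorphic[OF gauge_bracket_twist[OF P] gauge_bracket_twist[OF P(2,1)]])
      (use c D_D[OF P] D_D[OF P(2,1)] in blast)+
qed

end
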